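(* Let $k$ be an algebraically closed field, let $p$ be a prime with $\operatorname{char}(k)\neq p$, let $X$ be a projective, irreducible, non-singular curve over $k$ with adele ring $\mathbb{A}_X$, and fix a nontrivial character $\chi:\mathcal{C}_p\to\mu_p\subseteq k^*$. Ramification provides a natural filtration of $\mathbb{H}(\mathbb{A}_X,\mathcal{C}_p)$ by subgroups: $$\mathbb{H}(\mathbb{A}_X,\mathcal{C}_p)\simeq\varinjlim_{\mathfrak{R}}\mathbb{H}(\mathbb{A}_{X,\mathfrak{R}},\mathcal{C}_p)\simeq\varinjlim_{\mathfrak{R}}\{\mathbb{B}\in\mathbb{H}(\mathbb{A}_X,\mathcal{C}_p):\operatorname{Ram}(\mathbb{B})\subseteq\mathfrak{R}\},$$ where $\mathfrak{R}$ runs over the finite sets of closed points of $X$. For a given finite subset $\mathfrak{R}\subseteq X$, $$\#\{\mathbb{B}\in\mathbb{H}(\mathbb{A}_X,\mathcal{C}_p):\operatorname{Ram}(\mathbb{B})\subseteq\mathfrak{R}\}=p^{\#\mathfrak{R}}.$$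
   Context: Closed points of $X$ are written $x\in X$. $A_x$ is the completion of the local ring of $X$ at $x$, $K_x$ its fraction field, $\upsilon_x$ its (normalized discrete) valuation. The adele ring is $\mathbb{A}_X=\{(\alpha_x)_x\in\prod_{x\in X}K_x:\alpha_x\in A_x\text{ for almost all }x\}$, $\mathbb{I}_X=\mathbb{A}_X^*$. For finite $\mathfrak{R}\subset X$: $\mathbb{A}_{X,\mathfrak{R}}=\prod_{x\in\mathfrak{R}}K_x\times\prod_{x\in X\setminus\mathfrak{R}}A_x$. $\mu_p$ is the group of $p$-th roots of unity in $k$. For a commutative ring $R$ and a finite group $G$, a $G$-Galois extension of $R$ is a commutative ring extension $S$ of $R$ with a faithful action of $G$ by $R$-algebra automorphisms such that $S^G=R$ and the map $S\otimes_R S\to\operatorname{Maps}(G,S)$, $s\otimes t\mapsto(g\mapsto s\,g(t))$, is an isomorphism. $\mathbb{H}(R,G)$ denotes the set of $G$-equivariant $R$-algebra isomorphism classes of $G$-Galois extensions of $R$. For $R$ a $k$-algebra and $G=\mathcal{C}_p$ (cyclic of order $p$), it is an abelian group (the Harrison group) under $S_1\cdot S_2=\bigoplus_{\psi}(S_1^\psi\otimes_R S_2^\psi)$, where $\psi$ runs over the characters $\mathcal{C}_p\to\mu_p$, $S^\psi=\{s\in S: g(s)=\psi(g)s\ \forall g\}$, and $g$ acts on the $\psi$-summand by $\psi(g)$. It is functorial in $R$ via $S\mapsto R_2\otimes_{R_1}S$; the transition maps $\mathbb{H}(\mathbb{A}_{X,\mathfrak{R}},\mathcal{C}_p)\to\mathbb{H}(\mathbb{A}_{X,\mathfrak{R}'},\mathcal{C}_p)$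 for $\mathfrak{R}\subseteq\mathfrak{R}'$ and the maps to $\mathbb{H}(\mathbb{A}_X,\mathcal{C}_p)$ come from the ring inclusions. Ramification: every class $\mathbb{B}\in\mathbb{H}(\mathbb{A}_X,\mathcal{C}_p)$ is represented by $\mathbb{A}_X[T]/(T^p-t)$ with action $g(T)=\chi(g)T$ for some $t=(t_x)_x\in\mathbb{I}_X$, unique modulo $\mathbb{I}_X^p$ (known fact). The ramification locus is the finite set $\operatorname{Ram}(\mathbb{B})=\{x\in X:\upsilon_x(t_x)\not\equiv0\bmod p\}$. *)

theory Defs
  imports "HOL-Algebra.Algebra" "HOL-Computational_Algebra.Polynomial"
begin

section \<open>Projective varieties over a field\<close>

text \<open>A point of projective n-space is the set of its homogeneous coordinate vectors; a vector
  is a function on the naturals supported in \<open>{..n}\<close>. Polynomials in the variables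
  \<open>x\<^sub>0, x\<^sub>1, ...\<close> are finitely supported functions on monomials.\<close>

type_synonym 'k ppoint = "(nat \<Rightarrow> 'k) set"
type_synonym 'k mpoly = "(nat \<Rightarrow>\<^sub>0 nat) \<Rightarrow>\<^sub>0 'k"

definition proj_space :: "nat \<Rightarrow> 'k::field ppoint set" where
  "proj_space n =
    {{(\<lambda>i. a * v i) |a. a \<noteq> 0} |v. (\<exists>i. v i \<noteq> 0) \<and> (\<forall>i>n. v i = 0)}"

definition mpoly_eval :: "'k::field mpoly \<Rightarrow> (nat \<Rightarrow> 'k) \<Rightarrow> 'k" where
  "mpoly_eval f v =
    (\<Sum>m\<in>Poly_Mapping.keys f. Poly_Mapping.lookup f m *
       (\<Prod>i\<in>Poly_Mapping.keys m. v i ^ Poly_Mapping.lookup m i))"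

definition homogeneous :: "nat \<Rightarrow> nat \<Rightarrow> 'k::field mpoly \<Rightarrow> bool" where
  "homogeneous n d f \<longleftrightarrow>
    (\<forall>m\<in>Poly_Mapping.keys f. Poly_Mapping.keys m \<subseteq> {..n} \<and>
       (\<Sum>i\<in>Poly_Mapping.keys m. Poly_Mapping.lookup m i) = d)"

definition zariski_closed :: "nat \<Rightarrow> 'k::field ppoint set \<Rightarrow> bool" where
  "zariski_closed n Z \<longleftrightarrow>
    (\<exists>F. (\<forall>f\<in>F. \<exists>d. homogeneous n d f) \<and>
         Z = {x \<in> proj_space n. \<forall>f\<in>F. \<forall>v\<in>x. mpoly_eval f v = 0})"

definition zariski_open_in :: "nat \<Rightarrow> 'k::field ppoint set \<Rightarrow> 'k ppoint set \<Rightarrow> bool" where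
  "zariski_open_in n C U \<longleftrightarrow> (\<exists>Z. zariski_closed n Z \<and> U = C - Z)"

definition irreducible_set :: "nat \<Rightarrow> 'k::field ppoint set \<Rightarrow> bool" where
  "irreducible_set n Z \<longleftrightarrow> Z \<noteq> {} \<and>
    (\<forall>A B. zariski_closed n A \<and> zariski_closed n B \<and> Z \<subseteq> A \<union> B \<longrightarrow> Z \<subseteq> A \<or> Z \<subseteq> B)"

definition irreducible_chain :: "nat \<Rightarrow> 'k::field ppoint set \<Rightarrow> nat \<Rightarrow> bool" where
  "irreducible_chain n C d \<longleftrightarrow>
    (\<exists>Z :: nat \<Rightarrow> 'k ppoint set.
       (\<forall>i\<le>d. zariski_closed n (Z i) \<and> irreducible_set n (Z i) \<and> Z i \<subseteq> C) \<and>
       (\<forall>i<d. Z i \<subset> Z (Suc i)))"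

definition has_dim :: "nat \<Rightarrow> 'k::field ppoint set \<Rightarrow> nat \<Rightarrow> bool" where
  "has_dim n C d \<longleftrightarrow> irreducible_chain n C d \<and> \<not> irreducible_chain n C (Suc d)"

definition regular_on :: "nat \<Rightarrow> 'k::field ppoint set \<Rightarrow> 'k ppoint set \<Rightarrow> ('k ppoint \<Rightarrow> 'k) \<Rightarrow> bool"
  where "regular_on n C U \<phi> \<longleftrightarrow>
    (\<forall>x\<in>U. \<exists>V f g d. zariski_open_in n C V \<and> x \<in> V \<and> V \<subseteq> U \<and>
       homogeneous n d f \<and> homogeneous n d g \<and>
       (\<forall>y\<in>V. \<forall>v\<in>y. mpoly_eval g v \<noteq> 0 \<and> \<phi> y = mpoly_eval f v / mpoly_eval g v))"

section \<open>The local ring of a point, as germs of regular functions\<close>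

type_synonym 'k germ = "('k ppoint set \<times> ('k ppoint \<Rightarrow> 'k)) set"

definition local_functions ::
    "nat \<Rightarrow> 'k::field ppoint set \<Rightarrow> 'k ppoint \<Rightarrow> ('k ppoint set \<times> ('k ppoint \<Rightarrow> 'k)) set" where
  "local_functions n C x = {(U, \<phi>). zariski_open_in n C U \<and> x \<in> U \<and> regular_on n C U \<phi>}"

definition germ_rel where
  "germ_rel n C x =
    {((U, \<phi>), (V, \<psi>)). (U, \<phi>) \<in> local_functions n C x \<and> (V, \<psi>) \<in> local_functions n C x \<and>
       (\<exists>W. zariski_open_in n C W \<and> x \<in> W \<and> W \<subseteq> U \<inter> V \<and> (\<forall>y\<in>W. \<phi> y = \<psi> y))}"

definition const_germ :: "nat \<Rightarrow> 'k::field ppoint set \<Rightarrow> 'k ppoint \<Rightarrow> 'k \<Rightarrow> 'k germ" where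
  "const_germ n C x a = germ_rel n C x `` {(C, \<lambda>_. a)}"

definition local_ring :: "nat \<Rightarrow> 'k::field ppoint set \<Rightarrow> 'k ppoint \<Rightarrow> 'k germ ring" where
  "local_ring n C x =
    \<lparr>carrier = local_functions n C x // germ_rel n C x,
     monoid.mult = (\<lambda>A B. \<Union>(U, \<phi>)\<in>A. \<Union>(V, \<psi>)\<in>B. germ_rel n C x `` {(U \<inter> V, \<lambda>y. \<phi> y * \<psi> y)}),
     one = const_germ n C x 1,
     ring.zero = const_germ n C x 0,
     ring.add = (\<lambda>A B. \<Union>(U, \<phi>)\<in>A. \<Union>(V, \<psi>)\<in>B. germ_rel n C x `` {(U \<inter> V, \<lambda>y. \<phi> y + \<psi> y)})\<rparr>"

text \<open>The maximal ideal, when \<open>R\<close> is a local ring.\<close>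

definition nonunits :: "('a, 'b) ring_scheme \<Rightarrow> 'a set" where
  "nonunits R = carrier R - Units R"

primrec ideal_power :: "('a, 'b) ring_scheme \<Rightarrow> 'a set \<Rightarrow> nat \<Rightarrow> 'a set" where
  "ideal_power R I 0 = carrier R"
| "ideal_power R I (Suc n) = ideal_prod R I (ideal_power R I n)"

text \<open>The cotangent space \<open>m/m\<^sup>2\<close> of \<open>C\<close> at \<open>x\<close> has a basis with \<open>d\<close> elements over the ground
  field: each member of \<open>m\<close> has unique coordinates modulo \<open>m\<^sup>2\<close>.\<close>

definition cotangent_dim :: "nat \<Rightarrow> 'k::field ppoint set \<Rightarrow> 'k ppoint \<Rightarrow> nat \<Rightarrow> bool" where
  "cotangent_dim n C x d \<longleftrightarrow>
    (let L = local_ring n C x; m = nonunits L in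
     \<exists>t :: nat \<Rightarrow> 'k germ. (\<forall>i<d. t i \<in> m) \<and>
       (\<forall>f\<in>m. \<exists>!a. a \<in> {..<d} \<rightarrow>\<^sub>E UNIV \<and>
          f \<ominus>\<^bsub>L\<^esub> finsum L (\<lambda>i. const_germ n C x (a i) \<otimes>\<^bsub>L\<^esub> t i) {..<d} \<in> ideal_power L m 2))"

definition nonsingular_at :: "nat \<Rightarrow> 'k::field ppoint set \<Rightarrow> 'k ppoint \<Rightarrow> bool" where
  "nonsingular_at n C x \<longleftrightarrow> (\<exists>d. has_dim n C d \<and> cotangent_dim n C x d)"

definition smooth_projective_curve :: "nat \<Rightarrow> 'k::field ppoint set \<Rightarrow> bool" where
  "smooth_projective_curve n C \<longleftrightarrow>
    zariski_closed n C \<and> irreducible_set n C \<and> has_dim n C 1 \<and> (\<forall>x\<in>C. nonsingular_at n C x)"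

section \<open>Products, completions, fraction fields, valuations\<close>

definition prod_ring :: "'i set \<Rightarrow> ('i \<Rightarrow> ('a, 'b) ring_scheme) \<Rightarrow> ('i \<Rightarrow> 'a) ring" where
  "prod_ring I R =
    \<lparr>carrier = (\<Pi>\<^sub>E i\<in>I. carrier (R i)),
     monoid.mult = (\<lambda>f g. \<lambda>i\<in>I. f i \<otimes>\<^bsub>R i\<^esub> g i),
     one = (\<lambda>i\<in>I. \<one>\<^bsub>R i\<^esub>),
     ring.zero = (\<lambda>i\<in>I. \<zero>\<^bsub>R i\<^esub>),
     ring.add = (\<lambda>f g. \<lambda>i\<in>I. f i \<oplus>\<^bsub>R i\<^esub> g i)\<rparr>"

text \<open>The inverse limit of the rings \<open>R / I\<^sup>n\<close>. As \<open>I\<^sup>n\<^sup>+\<^sup>1 \<subseteq> I\<^sup>n\<close>, a coset of \<open>I\<^sup>n\<close> is the image of a coset of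
  \<open>I\<^sup>n\<^sup>+\<^sup>1\<close> iff it contains that coset.\<close>

definition completion :: "('a, 'b) ring_scheme \<Rightarrow> 'a set \<Rightarrow> (nat \<Rightarrow> 'a set) ring" where
  "completion R I =
    (let P = prod_ring UNIV (\<lambda>n. R Quot ideal_power R I n)
     in P\<lparr>carrier := {a \<in> carrier P. \<forall>n. a (Suc n) \<subseteq> a n}\<rparr>)"

definition frac_rel :: "('a, 'b) ring_scheme \<Rightarrow> (('a \<times> 'a) \<times> ('a \<times> 'a)) set" where
  "frac_rel R =
    {((a, b), (c, d)). a \<in> carrier R \<and> c \<in> carrier R \<and>
       b \<in> carrier R - {\<zero>\<^bsub>R\<^esub>} \<and> d \<in> carrier R - {\<zero>\<^bsub>R\<^esub>} \<and> a \<otimes>\<^bsub>R\<^esub> d = c \<otimes>\<^bsub>R\<^esub> b}"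

definition fraction :: "('a, 'b) ring_scheme \<Rightarrow> 'a \<Rightarrow> 'a \<Rightarrow> ('a \<times> 'a) set" where
  "fraction R a b = frac_rel R `` {(a, b)}"

definition frac_field :: "('a, 'b) ring_scheme \<Rightarrow> ('a \<times> 'a) set ring" where
  "frac_field R =
    \<lparr>carrier = (carrier R \<times> (carrier R - {\<zero>\<^bsub>R\<^esub>})) // frac_rel R,
     monoid.mult = (\<lambda>y z. \<Union>(a, b)\<in>y. \<Union>(c, d)\<in>z. fraction R (a \<otimes>\<^bsub>R\<^esub> c) (b \<otimes>\<^bsub>R\<^esub> d)),
     one = fraction R \<one>\<^bsub>R\<^esub> \<one>\<^bsub>R\<^esub>,
     ring.zero = fraction R \<zero>\<^bsub>R\<^esub> \<one>\<^bsub>R\<^esub>,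
     ring.add = (\<lambda>y z. \<Union>(a, b)\<in>y. \<Union>(c, d)\<in>z.
              fraction R (a \<otimes>\<^bsub>R\<^esub> d \<oplus>\<^bsub>R\<^esub> c \<otimes>\<^bsub>R\<^esub> b) (b \<otimes>\<^bsub>R\<^esub> d))\<rparr>"

text \<open>The normalized valuation of a discrete valuation ring and of its fraction field, at
  nonzero arguments.\<close>

definition dvr_order :: "('a, 'b) ring_scheme \<Rightarrow> 'a \<Rightarrow> nat" where
  "dvr_order R a = (GREATEST n. a \<in> ideal_power R (nonunits R) n)"

definition frac_val :: "('a, 'b) ring_scheme \<Rightarrow> ('a \<times> 'a) set \<Rightarrow> int" where
  "frac_val R z =
    (THE e. \<exists>a\<in>carrier R - {\<zero>\<^bsub>R\<^esub>}. \<exists>b\<in>carrier R - {\<zero>\<^bsub>R\<^esub>}.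
       z = fraction R a b \<and> e = int (dvr_order R a) - int (dvr_order R b))"

section \<open>Adeles\<close>

type_synonym 'k local_elt = "nat \<Rightarrow> 'k germ set"
type_synonym 'k adele = "'k ppoint \<Rightarrow> ('k local_elt \<times> 'k local_elt) set"

definition A_at :: "nat \<Rightarrow> 'k::field ppoint set \<Rightarrow> 'k ppoint \<Rightarrow> 'k local_elt ring" where
  "A_at n C x = completion (local_ring n C x) (nonunits (local_ring n C x))"

definition K_at :: "nat \<Rightarrow> 'k::field ppoint set \<Rightarrow> 'k ppoint \<Rightarrow> ('k local_elt \<times> 'k local_elt) set ring"
  where "K_at n C x = frac_field (A_at n C x)"

definition integers_at :: "nat \<Rightarrow> 'k::field ppoint set \<Rightarrow> 'k ppoint \<Rightarrow> ('k local_elt \<times> 'k local_elt) set set"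
  where "integers_at n C x = (\<lambda>a. fraction (A_at n C x) a \<one>\<^bsub>A_at n C x\<^esub>) ` carrier (A_at n C x)"

definition val_at :: "nat \<Rightarrow> 'k::field ppoint set \<Rightarrow> 'k ppoint \<Rightarrow> ('k local_elt \<times> 'k local_elt) set \<Rightarrow> int"
  where "val_at n C x = frac_val (A_at n C x)"

definition adele_ring :: "nat \<Rightarrow> 'k::field ppoint set \<Rightarrow> 'k adele ring" where
  "adele_ring n C =
    (prod_ring C (K_at n C))
      \<lparr>carrier := {\<alpha> \<in> carrier (prod_ring C (K_at n C)). finite {x\<in>C. \<alpha> x \<notin> integers_at n C x}}\<rparr>"

definition adele_ring_at :: "nat \<Rightarrow> 'k::field ppoint set \<Rightarrow> 'k ppoint set \<Rightarrow> 'k adele ring" where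
  "adele_ring_at n C S =
    (prod_ring C (K_at n C))
      \<lparr>carrier := {\<alpha> \<in> carrier (prod_ring C (K_at n C)). \<forall>x\<in>C - S. \<alpha> x \<in> integers_at n C x}\<rparr>"

text \<open>The diagonal embedding of the ground field, which makes all these rings algebras over it.\<close>

definition adele_const :: "nat \<Rightarrow> 'k::field ppoint set \<Rightarrow> 'k \<Rightarrow> 'k adele" where
  "adele_const n C a =
    (\<lambda>x\<in>C. let L = local_ring n C x in
       fraction (A_at n C x)
         (\<lambda>i. ideal_power L (nonunits L) i +>\<^bsub>L\<^esub> const_germ n C x a) \<one>\<^bsub>A_at n C x\<^esub>)"

section \<open>Tensor products\<close>

text \<open>The free abelian group on pairs modulo the subgroup generated by the bilinearity relations.\<close>

definition tensor_relations ::
    "'a set \<Rightarrow> ('a, 'm, 'c) module_scheme \<Rightarrow> ('a, 'n, 'd) module_scheme \<Rightarrow> ('m \<times> 'n \<Rightarrow>\<^sub>0 int) set" where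
  "tensor_relations C M N =
     {frag_of (m \<oplus>\<^bsub>M\<^esub> m', n) - frag_of (m, n) - frag_of (m', n) |m m' n.
        m \<in> carrier M \<and> m' \<in> carrier M \<and> n \<in> carrier N} \<union>
     {frag_of (m, n \<oplus>\<^bsub>N\<^esub> n') - frag_of (m, n) - frag_of (m, n') |m n n'.
        m \<in> carrier M \<and> n \<in> carrier N \<and> n' \<in> carrier N} \<union>
     {frag_of (r \<odot>\<^bsub>M\<^esub> m, n) - frag_of (m, r \<odot>\<^bsub>N\<^esub> n) |r m n.
        r \<in> C \<and> m \<in> carrier M \<and> n \<in> carrier N}"

definition tensor_class ::
    "'a set \<Rightarrow> ('a, 'm, 'c) module_scheme \<Rightarrow> ('a, 'n, 'd) module_scheme \<Rightarrow>
     ('m \<times> 'n \<Rightarrow>\<^sub>0 int) \<Rightarrow> ('m \<times> 'n \<Rightarrow>\<^sub>0 int) set" where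
  "tensor_class C M N f =
    (let F = free_Abelian_group (carrier M \<times> carrier N)
     in generate F (tensor_relations C M N) #>\<^bsub>F\<^esub> f)"

definition pure_tensor where
  "pure_tensor C M N m n = tensor_class C M N (frag_of (m, n))"

text \<open>\<open>(m \<otimes> n) (m' \<otimes> n') = m m' \<otimes> n n'\<close>, extended biadditively. The factors may come from different
  tensor products; the product is taken in the tensor product of \<open>M\<close> and \<open>N\<close>.\<close>

definition tensor_mult ::
    "'a set \<Rightarrow> ('a, 'm, 'c) module_scheme \<Rightarrow> ('a, 'n, 'd) module_scheme \<Rightarrow>
     ('m \<times> 'n \<Rightarrow>\<^sub>0 int) set \<Rightarrow> ('m \<times> 'n \<Rightarrow>\<^sub>0 int) set \<Rightarrow> ('m \<times> 'n \<Rightarrow>\<^sub>0 int) set" where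
  "tensor_mult C M N A B =
    (\<Union>f\<in>A. \<Union>g\<in>B. tensor_class C M N
       (frag_extend (\<lambda>(m, n). frag_extend (\<lambda>(m', n'). frag_of (m \<otimes>\<^bsub>M\<^esub> m', n \<otimes>\<^bsub>N\<^esub> n')) g) f))"

definition tensor_ring ::
    "('a, 'b) ring_scheme \<Rightarrow> ('a, 'm, 'c) module_scheme \<Rightarrow> ('a, 'n, 'd) module_scheme \<Rightarrow>
     ('m \<times> 'n \<Rightarrow>\<^sub>0 int) set ring" where
  "tensor_ring R M N =
    \<lparr>carrier = tensor_class (carrier R) M N ` carrier (free_Abelian_group (carrier M \<times> carrier N)),
     monoid.mult = tensor_mult (carrier R) M N,
     one = pure_tensor (carrier R) M N \<one>\<^bsub>M\<^esub> \<one>\<^bsub>N\<^esub>,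
     ring.zero = tensor_class (carrier R) M N 0,
     ring.add = set_mult (free_Abelian_group (carrier M \<times> carrier N))\<rparr>"

text \<open>The additive map on a tensor product into \<open>T\<close> with \<open>m \<otimes> n \<mapsto> \<beta> m n\<close>, for balanced \<open>\<beta>\<close>.\<close>

definition tensor_lift ::
    "('t, 'b) ring_scheme \<Rightarrow> ('m \<Rightarrow> 'n \<Rightarrow> 't) \<Rightarrow> ('m \<times> 'n \<Rightarrow>\<^sub>0 int) set \<Rightarrow> 't" where
  "tensor_lift T \<beta> A =
    the_elem ((\<lambda>f. finsum T (\<lambda>(m, n). add_pow T (Poly_Mapping.lookup f (m, n)) (\<beta> m n))
                 (Poly_Mapping.keys f)) ` A)"

text \<open>The subset \<open>V\<close> of a ring \<open>S\<close> as a module, with scalars acting through \<open>\<iota>\<close>.\<close>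

definition module_via :: "('a \<Rightarrow> 's) \<Rightarrow> ('s, 'c) ring_scheme \<Rightarrow> 's set \<Rightarrow> ('a, 's) module" where
  "module_via \<iota> S V =
    \<lparr>carrier = V, monoid.mult = monoid.mult S, one = \<one>\<^bsub>S\<^esub>, ring.zero = \<zero>\<^bsub>S\<^esub>, ring.add = ring.add S,
     module.smult = (\<lambda>r s. \<iota> r \<otimes>\<^bsub>S\<^esub> s)\<rparr>"

section \<open>Galois extensions of commutative rings\<close>

record ('a, 'g, 's) gext = "'s ring" +
  emb :: "'a \<Rightarrow> 's"
  act :: "'g \<Rightarrow> 's \<Rightarrow> 's"

definition self_module :: "('a, 'g, 's) gext \<Rightarrow> ('a, 's) module" where
  "self_module S = module_via (emb S) S (carrier S)"

definition galois_extension :: "('a, 'b) ring_scheme \<Rightarrow> 'g monoid \<Rightarrow> ('a, 'g, 's) gext \<Rightarrow> bool" where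
  "galois_extension R G S \<longleftrightarrow>
    finite (carrier G) \<and> cring R \<and> cring S \<and>
    emb S \<in> ring_hom R S \<and> inj_on (emb S) (carrier R) \<and>
    faithful_action G (carrier S) (\<lambda>g. restrict (act S g) (carrier S)) \<and>
    (\<forall>g\<in>carrier G. act S g \<in> ring_iso S S \<and> (\<forall>r\<in>carrier R. act S g (emb S r) = emb S r)) \<and>
    {s \<in> carrier S. \<forall>g\<in>carrier G. act S g s = s} = emb S ` carrier R \<and>
    tensor_lift (prod_ring (carrier G) (\<lambda>_. S)) (\<lambda>s t. \<lambda>g\<in>carrier G. s \<otimes>\<^bsub>S\<^esub> act S g t)
      \<in> ring_iso (tensor_ring R (self_module S) (self_module S)) (prod_ring (carrier G) (\<lambda>_. S))"

definition gext_isomorphic ::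
    "('a, 'b) ring_scheme \<Rightarrow> 'g monoid \<Rightarrow> ('a, 'g, 's) gext \<Rightarrow> ('a, 'g, 't) gext \<Rightarrow> bool" where
  "gext_isomorphic R G S T \<longleftrightarrow>
    (\<exists>h \<in> ring_iso S T. (\<forall>r\<in>carrier R. h (emb S r) = emb T r) \<and>
       (\<forall>g\<in>carrier G. \<forall>s\<in>carrier S. h (act S g s) = act T g (h s)))"

text \<open>Isomorphism classes are formed among the extensions whose elements are lists over the base
  ring. This loses nothing: a Galois extension of \<open>R\<close> is finitely generated projective over \<open>R\<close>,
  so its underlying set is in bijection with a set of lists over \<open>R\<close>. The extension \<open>S\<close> whose class
  is taken may live in any type.\<close>

definition gext_class ::
    "('a, 'b) ring_scheme \<Rightarrow> 'g monoid \<Rightarrow> ('a, 'g, 's) gext \<Rightarrow> ('a, 'g, 'a list) gext set" where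
  "gext_class R G S = {T. galois_extension R G T \<and> gext_isomorphic R G S T}"

section \<open>The Harrison group\<close>

definition roots_of_unity_group :: "nat \<Rightarrow> 'k::field monoid" where
  "roots_of_unity_group p = \<lparr>carrier = {z. z ^ p = 1}, monoid.mult = (*), one = 1\<rparr>"

definition characters :: "nat \<Rightarrow> 'g monoid \<Rightarrow> ('g \<Rightarrow> 'k::field) set" where
  "characters p G = hom G (roots_of_unity_group p) \<inter> extensional (carrier G)"

text \<open>Here and below \<open>c\<close> is the structure map of \<open>R\<close> as an algebra over the field \<open>'k\<close>.\<close>

definition eigenmodule ::
    "('k::field \<Rightarrow> 'a) \<Rightarrow> 'g monoid \<Rightarrow> ('a, 'g, 's) gext \<Rightarrow> ('g \<Rightarrow> 'k) \<Rightarrow> ('a, 's) module" where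
  "eigenmodule c G S \<psi> =
    module_via (emb S) S
      {s \<in> carrier S. \<forall>g\<in>carrier G. act S g s = emb S (c (\<psi> g)) \<otimes>\<^bsub>S\<^esub> s}"

definition harrison_product ::
    "nat \<Rightarrow> 'g monoid \<Rightarrow> 'a ring \<Rightarrow> ('k::field \<Rightarrow> 'a) \<Rightarrow> ('a, 'g, 's) gext \<Rightarrow> ('a, 'g, 't) gext \<Rightarrow>
     ('a, 'g, ('g \<Rightarrow> 'k) \<Rightarrow> ('s \<times> 't \<Rightarrow>\<^sub>0 int) set) gext" where
  "harrison_product p G R c S1 S2 =
    (let Ch = characters p G; triv = (\<lambda>g\<in>carrier G. 1);
         E1 = eigenmodule c G S1; E2 = eigenmodule c G S2;
         T = (\<lambda>\<psi>. tensor_ring R (E1 \<psi>) (E2 \<psi>))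
     in \<lparr>carrier = (\<Pi>\<^sub>E \<psi>\<in>Ch. carrier (T \<psi>)),
         monoid.mult = (\<lambda>u v. \<lambda>\<theta>\<in>Ch. finsum (T \<theta>)
            (\<lambda>(\<psi>, \<phi>). tensor_mult (carrier R) (E1 \<theta>) (E2 \<theta>) (u \<psi>) (v \<phi>))
            {(\<psi>, \<phi>) \<in> Ch \<times> Ch. (\<lambda>g\<in>carrier G. \<psi> g * \<phi> g) = \<theta>}),
         one = (\<lambda>\<psi>\<in>Ch. if \<psi> = triv then \<one>\<^bsub>T \<psi>\<^esub> else \<zero>\<^bsub>T \<psi>\<^esub>),
         ring.zero = (\<lambda>\<psi>\<in>Ch. \<zero>\<^bsub>T \<psi>\<^esub>),
         ring.add = (\<lambda>u v. \<lambda>\<psi>\<in>Ch. u \<psi> \<oplus>\<^bsub>T \<psi>\<^esub> v \<psi>),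
         emb = (\<lambda>r. \<lambda>\<psi>\<in>Ch. if \<psi> = triv
            then pure_tensor (carrier R) (E1 \<psi>) (E2 \<psi>) (emb S1 r) \<one>\<^bsub>S2\<^esub> else \<zero>\<^bsub>T \<psi>\<^esub>),
         act = (\<lambda>g u. \<lambda>\<psi>\<in>Ch. tensor_lift (T \<psi>)
            (\<lambda>s t. pure_tensor (carrier R) (E1 \<psi>) (E2 \<psi>) (emb S1 (c (\<psi> g)) \<otimes>\<^bsub>S1\<^esub> s) t) (u \<psi>))\<rparr>)"

text \<open>The neutral element: maps from \<open>G\<close> to \<open>R\<close>, with \<open>G\<close> acting by translation.\<close>

definition trivial_gext :: "'g monoid \<Rightarrow> 'a ring \<Rightarrow> ('a, 'g, 'g \<Rightarrow> 'a) gext" where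
  "trivial_gext G R =
    ring.extend (prod_ring (carrier G) (\<lambda>_. R))
      \<lparr>emb = (\<lambda>r. \<lambda>h\<in>carrier G. r), act = (\<lambda>g f. \<lambda>h\<in>carrier G. f (h \<otimes>\<^bsub>G\<^esub> g))\<rparr>"

definition harrison_group ::
    "nat \<Rightarrow> 'g monoid \<Rightarrow> 'a ring \<Rightarrow> ('k::field \<Rightarrow> 'a) \<Rightarrow> ('a, 'g, 'a list) gext set monoid" where
  "harrison_group p G R c =
    \<lparr>carrier = gext_class R G ` {S :: ('a, 'g, 'a list) gext. galois_extension R G S},
     monoid.mult = (\<lambda>B1 B2. \<Union>S1\<in>B1. \<Union>S2\<in>B2. gext_class R G (harrison_product p G R c S1 S2)),
     one = gext_class R G (trivial_gext G R)\<rparr>"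

text \<open>Base change along a ring homomorphism \<open>j\<close> from \<open>R1\<close> to \<open>R2\<close>.\<close>

definition base_change ::
    "'a ring \<Rightarrow> 'b ring \<Rightarrow> ('a \<Rightarrow> 'b) \<Rightarrow> ('a, 'g, 's) gext \<Rightarrow> ('b, 'g, ('b \<times> 's \<Rightarrow>\<^sub>0 int) set) gext" where
  "base_change R1 R2 j S =
    (let M = module_via j R2 (carrier R2); N = self_module S; T = tensor_ring R1 M N
     in ring.extend T
      \<lparr>emb = (\<lambda>r. pure_tensor (carrier R1) M N r \<one>\<^bsub>S\<^esub>),
       act = (\<lambda>g. tensor_lift T (\<lambda>r s. pure_tensor (carrier R1) M N r (act S g s)))\<rparr>)"

definition harrison_map ::
    "'g monoid \<Rightarrow> 'a ring \<Rightarrow> 'b ring \<Rightarrow> ('a \<Rightarrow> 'b) \<Rightarrow>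
     ('a, 'g, 'a list) gext set \<Rightarrow> ('b, 'g, 'b list) gext set" where
  "harrison_map G R1 R2 j B = (\<Union>S\<in>B. gext_class R2 G (base_change R1 R2 j S))"

text \<open>\<open>R[T]/(T\<^sup>p - t)\<close>, where \<open>g\<close> acts by the substitution \<open>T \<mapsto> \<chi>(g) T\<close>.\<close>

definition kummer_extension ::
    "nat \<Rightarrow> 'a ring \<Rightarrow> ('k::field \<Rightarrow> 'a) \<Rightarrow> ('g \<Rightarrow> 'k) \<Rightarrow> 'a \<Rightarrow> ('a, 'g, (nat \<Rightarrow> 'a) set) gext" where
  "kummer_extension p R c \<chi> t =
    (let P = UP R; const = (\<lambda>r. up_ring.monom P r 0);
         I = PIdl\<^bsub>P\<^esub> (up_ring.monom P \<one>\<^bsub>R\<^esub> p \<ominus>\<^bsub>P\<^esub> const t)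
     in ring.extend (P Quot I)
      \<lparr>emb = (\<lambda>r. I +>\<^bsub>P\<^esub> const r),
       act = (\<lambda>g A. \<Union>f\<in>A. I +>\<^bsub>P\<^esub> eval R P const (up_ring.monom P (c (\<chi> g)) 1) f)\<rparr>)"

section \<open>Direct limits of abelian groups\<close>

definition direct_system ::
    "'i::order set \<Rightarrow> ('i \<Rightarrow> 'h monoid) \<Rightarrow> ('i \<Rightarrow> 'i \<Rightarrow> 'h \<Rightarrow> 'h) \<Rightarrow> bool" where
  "direct_system I H f \<longleftrightarrow>
    (\<forall>i\<in>I. comm_group (H i)) \<and>
    (\<forall>i\<in>I. \<forall>j\<in>I. i \<le> j \<longrightarrow> f i j \<in> hom (H i) (H j)) \<and>
    (\<forall>i\<in>I. \<forall>a\<in>carrier (H i). f i i a = a) \<and>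
    (\<forall>i\<in>I. \<forall>j\<in>I. \<forall>k\<in>I. i \<le> j \<and> j \<le> k \<longrightarrow> (\<forall>a\<in>carrier (H i). f j k (f i j a) = f i k a))"

definition dlim_rel ::
    "'i::order set \<Rightarrow> ('i \<Rightarrow> 'h monoid) \<Rightarrow> ('i \<Rightarrow> 'i \<Rightarrow> 'h \<Rightarrow> 'h) \<Rightarrow> (('i \<times> 'h) \<times> ('i \<times> 'h)) set" where
  "dlim_rel I H f =
    {((i, a), (j, b)). i \<in> I \<and> j \<in> I \<and> a \<in> carrier (H i) \<and> b \<in> carrier (H j) \<and>
       (\<exists>k\<in>I. i \<le> k \<and> j \<le> k \<and> f i k a = f j k b)}"

definition direct_limit ::
    "'i::order set \<Rightarrow> ('i \<Rightarrow> 'h monoid) \<Rightarrow> ('i \<Rightarrow> 'i \<Rightarrow> 'h \<Rightarrow> 'h) \<Rightarrow> ('i \<times> 'h) set monoid" where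
  "direct_limit I H f =
    \<lparr>carrier = (SIGMA i:I. carrier (H i)) // dlim_rel I H f,
     monoid.mult = (\<lambda>A B. \<Union>(i, a)\<in>A. \<Union>(j, b)\<in>B. \<Union>k\<in>{k\<in>I. i \<le> k \<and> j \<le> k}.
        dlim_rel I H f `` {(k, f i k a \<otimes>\<^bsub>H k\<^esub> f j k b)}),
     one = (\<Union>i\<in>I. dlim_rel I H f `` {(i, \<one>\<^bsub>H i\<^esub>)})\<rparr>"

text \<open>The map on a direct limit induced by a compatible family of maps \<open>u i\<close>.\<close>

definition dlim_desc :: "('i \<Rightarrow> 'h \<Rightarrow> 'c) \<Rightarrow> ('i \<times> 'h) set \<Rightarrow> 'c" where
  "dlim_desc u A = the_elem ((\<lambda>(i, a). u i a) ` A)"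

section \<open>The Harrison group of the adeles and ramification\<close>

definition adele_harrison ::
    "nat \<Rightarrow> 'g monoid \<Rightarrow> nat \<Rightarrow> 'k::field ppoint set \<Rightarrow>
     ('k adele, 'g, 'k adele list) gext set monoid" where
  "adele_harrison p G n C = harrison_group p G (adele_ring n C) (adele_const n C)"

definition adele_harrison_at ::
    "nat \<Rightarrow> 'g monoid \<Rightarrow> nat \<Rightarrow> 'k::field ppoint set \<Rightarrow> 'k ppoint set \<Rightarrow>
     ('k adele, 'g, 'k adele list) gext set monoid" where
  "adele_harrison_at p G n C S = harrison_group p G (adele_ring_at n C S) (adele_const n C)"

definition ram ::
    "nat \<Rightarrow> 'g monoid \<Rightarrow> ('g \<Rightarrow> 'k) \<Rightarrow> nat \<Rightarrow> 'k::field ppoint set \<Rightarrow>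
     ('k adele, 'g, 'k adele list) gext set \<Rightarrow> 'k ppoint set" where
  "ram p G \<chi> n C B =
    (let A = adele_ring n C;
         t = (SOME t. t \<in> Units A \<and> B = gext_class A G (kummer_extension p A (adele_const n C) \<chi> t))
     in {x \<in> C. \<not> int p dvd val_at n C x (t x)})"

definition ram_within ::
    "nat \<Rightarrow> 'g monoid \<Rightarrow> ('g \<Rightarrow> 'k) \<Rightarrow> nat \<Rightarrow> 'k::field ppoint set \<Rightarrow> 'k ppoint set \<Rightarrow>
     ('k adele, 'g, 'k adele list) gext set set" where
  "ram_within p G \<chi> n C S = {B \<in> carrier (adele_harrison p G n C). ram p G \<chi> n C B \<subseteq> S}"

end

theory Submission
  imports Defs "HOL-Computational_Algebra.Formal_Laurent_Series"
begin

text \<open>Over a ring of adeles, every partition of unity can be refined by orthogonal idempotents, so each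
  eigenmodule of a \<open>C\<^sub>p\<close>-Galois extension is free of rank one and the extension is \<open>R[T]/(T\<^sup>p - t)\<close>
  for a unit \<open>t\<close> that is unique modulo \<open>p\<close>-th powers. Base change acts on \<open>t\<close> by the ring
  homomorphism, and the Harrison product multiplies the units. At a nonsingular point Nakayama's
  lemma provides a uniformizer, so the completed local ring is \<open>k[[T]]\<close> and adeles are families of
  Laurent series. As \<open>k\<close> is algebraically closed and \<open>p\<close> is invertible in it, a Laurent series is a
  \<open>p\<close>-th power iff its order is divisible by \<open>p\<close>. Thus the class of \<open>t\<close> amounts to the orders
  of its components modulo \<open>p\<close>. The classes unramified outside \<open>S\<close> are those with a representative
  that is a unit at all points outside \<open>S\<close>, and they correspond to the functions from \<open>S\<close> to
  \<open>{0, ..., p - 1}\<close>.\<close>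

section \<open>Tensor products\<close>

text \<open>The groups in the statement are built from models in different types: polynomial
  quotients, quotients of free abelian groups, families indexed by characters, and lists. Each is
  brought to one description, the locale \<open>kummer_extn\<close>: an action with fixed ring
  \<open>R\<close> and an eigenvector \<open>u\<close> with \<open>u^p = t\<close>, a unit. The
  powers of \<open>u\<close> form a basis whose structure constants depend on \<open>t\<close>
  alone, so \<open>t\<close> determines the extension.

  That a Galois extension contains such a \<open>u\<close> rests on Fourier analysis on the cyclic
  group. As \<open>p\<close> is invertible in the field, the extension is the direct sum of its
  eigenspaces, and the Galois isomorphism, evaluated at the indicator function of the identity,
  yields elements of two opposite eigenspaces whose products sum to 1.

  The isomorphisms of limits rest on one fact: equality of classes is a condition on orders modulo
  \<open>p\<close> that does not mention which ring of adeles is used. Hence each map into the group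
  of the full ring is injective, and its image is the set of classes with ramification in the given
  set.\<close>

lemma frag_extend_add_fun:
  "frag_extend (\<lambda>x. a x + b x) f = frag_extend a f + frag_extend b f"
  by (simp add: frag_extend_def frag_cmul_distrib2 sum.distrib)

lemma frag_extend_minus_fun: "frag_extend (\<lambda>x. - a x) f = - frag_extend a f"
proof -
  have "frag_extend a f + frag_extend (\<lambda>x. - a x) f = frag_extend (\<lambda>x. a x + - a x) f"
    by (rule frag_extend_add_fun[symmetric])
  also have "\<dots> = 0" by (rule frag_extend_eq_0) simp
  finally show ?thesis by (metis add_eq_0_iff)
qed

lemma frag_extend_diff_fun:
  "frag_extend (\<lambda>x. a x - b x) f = frag_extend a f - frag_extend b f"
  using frag_extend_add_fun[of a "\<lambda>x. - b x" f] by (simp add: frag_extend_minus_fun)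

lemma tensor_relationsE: assumes x: "x \<in> tensor_relations A M N"
  obtains
      (add_left) m m' n where "m \<in> carrier M" "m' \<in> carrier M" "n \<in> carrier N"
        "x = frag_of (m \<oplus>\<^bsub>M\<^esub> m', n) - frag_of (m, n) - frag_of (m', n)"
    | (add_right) m n n' where "m \<in> carrier M" "n \<in> carrier N" "n' \<in> carrier N"
        "x = frag_of (m, n \<oplus>\<^bsub>N\<^esub> n') - frag_of (m, n) - frag_of (m, n')"
    | (smult) r m n where "r \<in> A" "m \<in> carrier M" "n \<in> carrier N"
        "x = frag_of (r \<odot>\<^bsub>M\<^esub> m, n) - frag_of (m, r \<odot>\<^bsub>N\<^esub> n)"
proof -
  show ?thesis
  using x unfolding tensor_relations_def
  apply (elim UnE CollectE exE conjE)
  subgoal by (rule that(1))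
  subgoal by (rule that(2))
  subgoal by (rule that(3))
  done
qed

text \<open>A setting wide enough for whole extensions, for their eigenmodules, and for a ring
  regarded as a module along a homomorphism from another ring.\<close>

locale tensor_factors =
  fixes R :: "('a, 'b) ring_scheme"
    and M :: "('a, 'm, 'c) module_scheme" and N :: "('a, 'n, 'd) module_scheme"
  assumes abM: "abelian_group M" and abN: "abelian_group N"
    and smultM: "\<lbrakk>r \<in> carrier R; m \<in> carrier M\<rbrakk> \<Longrightarrow> r \<odot>\<^bsub>M\<^esub> m \<in> carrier M"
    and smultN: "\<lbrakk>r \<in> carrier R; n \<in> carrier N\<rbrakk> \<Longrightarrow> r \<odot>\<^bsub>N\<^esub> n \<in> carrier N"
begin

sublocale M: abelian_group M by (rule abM)
sublocale N: abelian_group N by (rule abN)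

abbreviation "FM \<equiv> free_Abelian_group (carrier M \<times> carrier N)"
abbreviation "rel \<equiv> generate FM (tensor_relations (carrier R) M N)"
abbreviation "cls \<equiv> tensor_class (carrier R) M N"
abbreviation "T \<equiv> tensor_ring R M N"
abbreviation "pure \<equiv> pure_tensor (carrier R) M N"
abbreviation "keysin (f :: 'm \<times> 'n \<Rightarrow>\<^sub>0 int) \<equiv> Poly_Mapping.keys f \<subseteq> carrier M \<times> carrier N"

lemma keysin_diff: "keysin f \<Longrightarrow> keysin g \<Longrightarrow> keysin (f - g)"
  using keys_diff[of f g] by auto

lemma keysin_add: "keysin f \<Longrightarrow> keysin g \<Longrightarrow> keysin (f + g)"
  using Poly_Mapping.keys_add[of f g] by auto

lemma relations_carrier: "tensor_relations (carrier R) M N \<subseteq> carrier FM"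
proof
  fix x assume x: "x \<in> tensor_relations (carrier R) M N"
  have k: "keysin (frag_of (m, n))" if "m \<in> carrier M" "n \<in> carrier N" for m n
    using that by simp
  have "keysin x"
    using x
  proof (cases rule: tensor_relationsE)
    case 1: (add_left m m' n)
    show ?thesis unfolding 1(4)
      by (intro keysin_diff k M.add.m_closed) (fact 1)+
  next
    case 2: (add_right m n n')
    show ?thesis unfolding 2(4)
      by (intro keysin_diff k N.add.m_closed) (fact 2)+
  next
    case 3: (smult r m n)
    show ?thesis unfolding 3(4)
      by (intro keysin_diff k smultM smultN) (fact 3)+
  qed
  then show "x \<in> carrier FM" by simp
qed

lemma rel_subgroup: "subgroup rel FM"
  by (rule group.generate_is_subgroup[OF group_free_Abelian_group relations_carrier])

lemma rel_keys: "f \<in> rel \<Longrightarrow> keysin f"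
  using subgroup.mem_carrier[OF rel_subgroup] by auto

lemma rel_zero: "0 \<in> rel"
  using subgroup.one_closed[OF rel_subgroup] by simp

lemma rel_add: "f \<in> rel \<Longrightarrow> g \<in> rel \<Longrightarrow> f + g \<in> rel"
  using subgroup.m_closed[OF rel_subgroup] by simp

lemma rel_minus: "f \<in> rel \<Longrightarrow> - f \<in> rel"
  using subgroup.m_inv_closed[OF rel_subgroup] by (simp add: rel_keys)

lemma rel_diff: "f \<in> rel \<Longrightarrow> g \<in> rel \<Longrightarrow> f - g \<in> rel"
  using rel_add[OF _ rel_minus] by fastforce

lemma rel_incl: "f \<in> tensor_relations (carrier R) M N \<Longrightarrow> f \<in> rel"
  by (rule generate.incl)

lemma rel_induct [consumes 1, case_names zero relation add minus]:
  assumes "f \<in> rel" "P 0" "\<And>h. h \<in> tensor_relations (carrier R) M N \<Longrightarrow> P h"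
    "\<And>h h'. h \<in> rel \<Longrightarrow> h' \<in> rel \<Longrightarrow> P h \<Longrightarrow> P h' \<Longrightarrow> P (h + h')"
    "\<And>h. h \<in> rel \<Longrightarrow> P h \<Longrightarrow> P (- h)"
  shows "P f"
  using assms(1)
proof (induction rule: generate.induct)
  case one then show ?case using assms(2) by simp
next
  case (incl h) then show ?case by (rule assms(3))
next
  case (inv h)
  then have "keysin h" using rel_keys rel_incl by blast
  moreover have "P (- h)" using inv assms(3,5) rel_incl by blast
  ultimately show ?case by simp
next
  case (eng h1 h2) then show ?case using assms(4) by simp
qed

lemma cls_eq: "cls f = (\<lambda>h. h + f) ` rel"
  by (auto simp: tensor_class_def r_coset_def)

lemma cls_self: "f \<in> cls f"
  using rel_zero by (force simp: cls_eq)

lemma cls_eq_iff: "cls f = cls g \<longleftrightarrow> f - g \<in> rel"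
proof
  assume "cls f = cls g"
  then have "f \<in> cls g" using cls_self by auto
  then show "f - g \<in> rel" by (auto simp: cls_eq)
next
  assume *: "f - g \<in> rel"
  have "h + f \<in> (\<lambda>h. h + g) ` rel" if "h \<in> rel" for h
    by (rule image_eqI[of _ _ "h + (f - g)"]) (use * that rel_add in auto)
  moreover have "h + g \<in> (\<lambda>h. h + f) ` rel" if "h \<in> rel" for h
    by (rule image_eqI[of _ _ "h - (f - g)"]) (use * that rel_diff in auto)
  ultimately show "cls f = cls g" by (auto simp: cls_eq)
qed

lemma mem_cls_iff: "g \<in> cls f \<longleftrightarrow> g - f \<in> rel"
  by (force simp: cls_eq)

lemma carrier_T: "carrier T = cls ` {f. keysin f}"
  by (auto simp: tensor_ring_def free_Abelian_group_def)

lemma T_zero: "\<zero>\<^bsub>T\<^esub> = cls 0"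
  by (simp add: tensor_ring_def)

lemma T_one: "\<one>\<^bsub>T\<^esub> = pure \<one>\<^bsub>M\<^esub> \<one>\<^bsub>N\<^esub>"
  by (simp add: tensor_ring_def)

lemma T_add: "cls f \<oplus>\<^bsub>T\<^esub> cls g = cls (f + g)"
proof -
  have "cls f \<oplus>\<^bsub>T\<^esub> cls g = (\<Union>x\<in>cls f. \<Union>y\<in>cls g. {x + y})"
    by (simp add: tensor_ring_def set_mult_def)
  also have "\<dots> = cls (f + g)"
  proof
    show "(\<Union>x\<in>cls f. \<Union>y\<in>cls g. {x + y}) \<subseteq> cls (f + g)"
    proof
      fix h assume "h \<in> (\<Union>x\<in>cls f. \<Union>y\<in>cls g. {x + y})"
      then obtain x y where "x \<in> cls f" "y \<in> cls g" "h = x + y" by blast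
      then have xy: "x - f \<in> rel" "y - g \<in> rel" "h = x + y" unfolding mem_cls_iff .
      have "h - (f + g) = (x - f) + (y - g)" using xy(3) by simp
      then show "h \<in> cls (f + g)" using rel_add[OF xy(1,2)] unfolding mem_cls_iff by metis
    qed
    show "cls (f + g) \<subseteq> (\<Union>x\<in>cls f. \<Union>y\<in>cls g. {x + y})"
    proof
      fix h assume "h \<in> cls (f + g)"
      then have "h - g \<in> cls f" unfolding mem_cls_iff by (metis diff_diff_eq add.commute)
      moreover have "h = (h - g) + g" by simp
      ultimately show "h \<in> (\<Union>x\<in>cls f. \<Union>y\<in>cls g. {x + y})" using cls_self by blast
    qed
  qed
  finally show ?thesis .
qed

lemma pure_closed: "m \<in> carrier M \<Longrightarrow> n \<in> carrier N \<Longrightarrow> pure m n \<in> carrier T"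
  by (auto simp: carrier_T pure_tensor_def intro!: imageI)

lemma ab_T: "abelian_group T"
proof (rule abelian_groupI)
  fix x y z assume xyz: "x \<in> carrier T" "y \<in> carrier T" "z \<in> carrier T"
  then obtain f g h where f: "x = cls f" "keysin f" "y = cls g" "keysin g" "z = cls h" "keysin h"
    by (auto simp: carrier_T)
  show "x \<oplus>\<^bsub>T\<^esub> y \<in> carrier T"
    using f keysin_add[of f g] by (auto simp: T_add carrier_T)
  show "x \<oplus>\<^bsub>T\<^esub> y \<oplus>\<^bsub>T\<^esub> z = x \<oplus>\<^bsub>T\<^esub> (y \<oplus>\<^bsub>T\<^esub> z)" "x \<oplus>\<^bsub>T\<^esub> y = y \<oplus>\<^bsub>T\<^esub> x"
    using f by (simp_all add: T_add ac_simps)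
next
  fix x assume "x \<in> carrier T"
  then obtain f where f: "x = cls f" "keysin f" by (auto simp: carrier_T)
  show "\<zero>\<^bsub>T\<^esub> \<oplus>\<^bsub>T\<^esub> x = x" using f by (simp add: T_zero T_add)
  show "\<exists>y\<in>carrier T. y \<oplus>\<^bsub>T\<^esub> x = \<zero>\<^bsub>T\<^esub>"
    by (rule bexI[of _ "cls (- f)"]) (use f in \<open>auto simp: T_zero T_add carrier_T\<close>)
next
  show "\<zero>\<^bsub>T\<^esub> \<in> carrier T" by (auto simp: T_zero carrier_T)
qed

sublocale T: abelian_group T by (rule ab_T)

lemma tensor_induct [consumes 1, case_names zero pure add]:
  assumes "x \<in> carrier T" and z: "P \<zero>\<^bsub>T\<^esub>"
    and p: "\<And>m n. m \<in> carrier M \<Longrightarrow> n \<in> carrier N \<Longrightarrow> P (pure m n)"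
    and a: "\<And>x y. x \<in> carrier T \<Longrightarrow> y \<in> carrier T \<Longrightarrow> P x \<Longrightarrow> P y \<Longrightarrow> P (x \<oplus>\<^bsub>T\<^esub> y)"
  shows "P x"
proof -
  obtain f where f: "x = cls f" "keysin f" using assms(1) by (auto simp: carrier_T)
  \<comment> \<open>A negated generator is again a pure tensor: the additivity relation at
    \<open>\<zero>, \<zero>\<close> kills \<open>\<zero> \<otimes> n\<close>, and the one at
    \<open>m, \<ominus> m\<close> then gives the claim. So the induction rule needs no case for
    negatives.\<close>
  have neg: "cls (- frag_of (m, n)) = pure (\<ominus>\<^bsub>M\<^esub> m) n" if "m \<in> carrier M" "n \<in> carrier N" for m n
  proof -
    have "frag_of (\<zero>\<^bsub>M\<^esub> \<oplus>\<^bsub>M\<^esub> \<zero>\<^bsub>M\<^esub>, n) - frag_of (\<zero>\<^bsub>M\<^esub>, n) - frag_of (\<zero>\<^bsub>M\<^esub>, n)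
        \<in> tensor_relations (carrier R) M N"
      unfolding tensor_relations_def using that by blast
    then have 0: "- frag_of (\<zero>\<^bsub>M\<^esub>, n) \<in> rel" using rel_incl by fastforce
    have "frag_of (m \<oplus>\<^bsub>M\<^esub> \<ominus>\<^bsub>M\<^esub> m, n) - frag_of (m, n) - frag_of (\<ominus>\<^bsub>M\<^esub> m, n)
        \<in> tensor_relations (carrier R) M N"
      unfolding tensor_relations_def using that M.a_inv_closed by blast
    then have "frag_of (\<zero>\<^bsub>M\<^esub>, n) - frag_of (m, n) - frag_of (\<ominus>\<^bsub>M\<^esub> m, n) \<in> rel"
      using that rel_incl M.r_neg by fastforce
    from rel_add[OF this 0] show ?thesis
      unfolding pure_tensor_def cls_eq_iff
      by (metis (no_types, lifting) add.commute add_diff_cancel_left' diff_add_cancel uminus_add_conv_diff diff_add_eq)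
  qed
  \<comment> \<open>Both signs are carried along because \<open>frag_induction\<close> builds formal
    sums from differences.\<close>
  have "keysin f \<and> P (cls f) \<and> P (cls (- f))"
    using f(2)
  proof (induction f rule: frag_induction)
    case zero then show ?case using z by (simp add: T_zero)
  next
    case (one x)
    then show ?case using p neg by (auto simp: pure_tensor_def)
  next
    case (diff a' b')
    have "cls (a' - b') = cls a' \<oplus>\<^bsub>T\<^esub> cls (- b')" "cls (- (a' - b')) = cls b' \<oplus>\<^bsub>T\<^esub> cls (- a')"
      by (simp_all add: T_add)
    moreover have "cls a' \<in> carrier T" "cls (-b') \<in> carrier T" "cls b' \<in> carrier T" "cls (-a') \<in> carrier T"
      using diff by (auto simp: carrier_T)
    ultimately show ?case using diff a keysin_diff by simp
  qed
  then show ?thesis using f by simp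
qed

lemma pure_add_left:
  assumes "m \<in> carrier M" "m' \<in> carrier M" "n \<in> carrier N"
  shows "pure (m \<oplus>\<^bsub>M\<^esub> m') n = pure m n \<oplus>\<^bsub>T\<^esub> pure m' n"
proof -
  have "frag_of (m \<oplus>\<^bsub>M\<^esub> m', n) - frag_of (m, n) - frag_of (m', n) \<in> rel"
    by (rule rel_incl) (use assms in \<open>auto simp: tensor_relations_def\<close>)
  then show ?thesis unfolding pure_tensor_def T_add cls_eq_iff diff_diff_eq .
qed

lemma pure_add_right:
  assumes "m \<in> carrier M" "n \<in> carrier N" "n' \<in> carrier N"
  shows "pure m (n \<oplus>\<^bsub>N\<^esub> n') = pure m n \<oplus>\<^bsub>T\<^esub> pure m n'"
proof -
  have "frag_of (m, n \<oplus>\<^bsub>N\<^esub> n') - frag_of (m, n) - frag_of (m, n') \<in> rel"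
    by (rule rel_incl) (use assms in \<open>auto simp: tensor_relations_def\<close>)
  then show ?thesis unfolding pure_tensor_def T_add cls_eq_iff diff_diff_eq .
qed

lemma pure_smult:
  assumes "r \<in> carrier R" "m \<in> carrier M" "n \<in> carrier N"
  shows "pure (r \<odot>\<^bsub>M\<^esub> m) n = pure m (r \<odot>\<^bsub>N\<^esub> n)"
proof -
  have "frag_of (r \<odot>\<^bsub>M\<^esub> m, n) - frag_of (m, r \<odot>\<^bsub>N\<^esub> n) \<in> rel"
    by (rule rel_incl) (use assms in \<open>auto simp: tensor_relations_def\<close>)
  then show ?thesis by (simp add: pure_tensor_def cls_eq_iff)
qed

lemma pure_zero_left:
  assumes "n \<in> carrier N" shows "pure \<zero>\<^bsub>M\<^esub> n = \<zero>\<^bsub>T\<^esub>"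
  using pure_add_left[of "\<zero>\<^bsub>M\<^esub>" "\<zero>\<^bsub>M\<^esub>" n] assms pure_closed[of "\<zero>\<^bsub>M\<^esub>" n]
  by (metis M.l_zero M.zero_closed T.add.r_cancel_one')

lemma pure_zero_right:
  assumes "m \<in> carrier M" shows "pure m \<zero>\<^bsub>N\<^esub> = \<zero>\<^bsub>T\<^esub>"
  using pure_add_right[of m "\<zero>\<^bsub>N\<^esub>" "\<zero>\<^bsub>N\<^esub>"] assms pure_closed[of m "\<zero>\<^bsub>N\<^esub>"]
  by (metis N.l_zero N.zero_closed T.add.r_cancel_one')

lemma pure_finsum_right:
  assumes "finite I" "m \<in> carrier M" "b \<in> I \<rightarrow> carrier N"
  shows "pure m (finsum N b I) = finsum T (\<lambda>i. pure m (b i)) I"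
  using assms(1,3)
proof (induction I rule: finite_induct)
  case empty then show ?case using assms pure_zero_right by simp
next
  case (insert x I)
  then have "b x \<in> carrier N" "b \<in> I \<rightarrow> carrier N" "(\<lambda>i. pure m (b i)) \<in> I \<rightarrow> carrier T"
    using assms(2) pure_closed by auto
  then show ?case using insert assms(2) by (simp add: pure_add_right pure_closed)
qed

text \<open>Scalars in the right factor can be moved to the left, so each tensor has a normal form
  with one coefficient from \<open>M\<close> for each spanning element of \<open>N\<close>.\<close>

lemma tensor_span:
  assumes "finite I" "b \<in> I \<rightarrow> carrier N"
    and span: "\<And>n. n \<in> carrier N \<Longrightarrow> \<exists>r\<in>I \<rightarrow> carrier R. n = finsum N (\<lambda>i. r i \<odot>\<^bsub>N\<^esub> b i) I"
    and "z \<in> carrier T"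
  shows "\<exists>m\<in>I \<rightarrow> carrier M. z = finsum T (\<lambda>i. pure (m i) (b i)) I"
  using assms(4)
proof (induction rule: tensor_induct)
  case zero
  have "finsum T (\<lambda>i. pure \<zero>\<^bsub>M\<^esub> (b i)) I = finsum T (\<lambda>i. \<zero>\<^bsub>T\<^esub>) I"
    by (rule T.finsum_cong') (use assms(2) pure_zero_left in auto)
  then show ?case by (intro bexI[of _ "\<lambda>_. \<zero>\<^bsub>M\<^esub>"]) auto
next
  case (pure m n)
  obtain r where r: "r \<in> I \<rightarrow> carrier R" "n = finsum N (\<lambda>i. r i \<odot>\<^bsub>N\<^esub> b i) I"
    using span pure(2) by blast
  have "pure m n = finsum T (\<lambda>i. pure m (r i \<odot>\<^bsub>N\<^esub> b i)) I"
    unfolding r(2) by (rule pure_finsum_right) (use assms(1,2) pure r smultN in auto)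
  also have "\<dots> = finsum T (\<lambda>i. pure (r i \<odot>\<^bsub>M\<^esub> m) (b i)) I"
    by (rule T.finsum_cong')
      (use assms(2) pure r smultM pure_closed pure_smult[symmetric] in \<open>auto simp: Pi_iff\<close>)
  finally show ?case using r pure smultM by (intro bexI[of _ "\<lambda>i. r i \<odot>\<^bsub>M\<^esub> m"]) auto
next
  case (add x y)
  from add.IH(1) obtain m where m0: "m \<in> I \<rightarrow> carrier M" "x = finsum T (\<lambda>i. pure (m i) (b i)) I" ..
  from add.IH(2) obtain m' where m1: "m' \<in> I \<rightarrow> carrier M" "y = finsum T (\<lambda>i. pure (m' i) (b i)) I" ..
  note m = m0 m1
  have "x \<oplus>\<^bsub>T\<^esub> y = finsum T (\<lambda>i. pure (m i) (b i) \<oplus>\<^bsub>T\<^esub> pure (m' i) (b i)) I"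
    unfolding m by (rule T.finsum_addf[symmetric]) (use m assms(2) pure_closed in \<open>auto simp: Pi_iff\<close>)
  also have "\<dots> = finsum T (\<lambda>i. pure (m i \<oplus>\<^bsub>M\<^esub> m' i) (b i)) I"
    by (rule T.finsum_cong') (use m assms(2) pure_closed pure_add_left in \<open>auto simp: Pi_iff\<close>)
  finally show ?case using m by (intro bexI[of _ "\<lambda>i. m i \<oplus>\<^bsub>M\<^esub> m' i"]) auto
qed

text \<open>Serves to extract finitely many elements of a Galois extension from a preimage under the
  Galois map.\<close>

lemma tensor_finite_sum:
  assumes "z \<in> carrier T"
  shows "\<exists>k m n. m \<in> {..<k::nat} \<rightarrow> carrier M \<and> n \<in> {..<k} \<rightarrow> carrier N \<and>
    z = finsum T (\<lambda>i. pure (m i) (n i)) {..<k}"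
  using assms
proof (induction rule: tensor_induct)
  case zero then show ?case by (intro exI[of _ 0]) simp
next
  case (pure m n)
  then show ?case using pure_closed
    by (intro exI[of _ 1] exI[of _ "\<lambda>_. m"] exI[of _ "\<lambda>_. n"]) (auto simp: lessThan_Suc)
next
  case (add x y)
  then obtain k m n k' m' n' where k:
    "m \<in> {..<k::nat} \<rightarrow> carrier M" "n \<in> {..<k} \<rightarrow> carrier N" "x = finsum T (\<lambda>i. pure (m i) (n i)) {..<k}"
    "m' \<in> {..<k'::nat} \<rightarrow> carrier M" "n' \<in> {..<k'} \<rightarrow> carrier N"
    "y = finsum T (\<lambda>i. pure (m' i) (n' i)) {..<k'}" by blast
  define m2 n2 where "m2 i = (if i < k then m i else m' (i - k))"
    and "n2 i = (if i < k then n i else n' (i - k))" for i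
  have U: "{..<k + k'} = {..<k} \<union> (\<lambda>i. i + k) ` {..<k'}"
  proof -
    have "x \<in> (\<lambda>i. i + k) ` {..<k'}" if "k \<le> x" "x < k + k'" for x
      by (rule image_eqI[of _ _ "x - k"]) (use that in auto)
    then show ?thesis by (auto simp: not_less[symmetric])
  qed
  have c: "m2 \<in> {..<k+k'} \<rightarrow> carrier M" "n2 \<in> {..<k+k'} \<rightarrow> carrier N"
    using k by (auto simp: m2_def n2_def Pi_iff)
  have "finsum T (\<lambda>i. pure (m2 i) (n2 i)) {..<k + k'} =
      finsum T (\<lambda>i. pure (m2 i) (n2 i)) {..<k} \<oplus>\<^bsub>T\<^esub> finsum T (\<lambda>i. pure (m2 i) (n2 i)) ((\<lambda>i. i + k) ` {..<k'})"
    unfolding U by (rule T.finsum_Un_disjoint) (use c pure_closed in \<open>auto simp: Pi_iff\<close>)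
  also have "finsum T (\<lambda>i. pure (m2 i) (n2 i)) {..<k} = x"
    unfolding k by (rule T.finsum_cong') (use k pure_closed in \<open>auto simp: m2_def n2_def Pi_iff\<close>)
  also have "finsum T (\<lambda>i. pure (m2 i) (n2 i)) ((\<lambda>i. i + k) ` {..<k'})
      = finsum T (\<lambda>i. pure (m2 (i + k)) (n2 (i + k))) {..<k'}"
    by (rule T.add.finprod_reindex[simplified]) (use c pure_closed in \<open>auto simp: Pi_iff\<close>)
  also have "\<dots> = y"
    unfolding k by (rule T.finsum_cong') (use k pure_closed in \<open>auto simp: m2_def n2_def Pi_iff\<close>)
  finally show ?case using c by (intro exI[of _ "k + k'"] exI[of _ m2] exI[of _ n2]) simp
qed

end

section \<open>Maps out of a tensor product\<close>

locale balanced_map = tensor_factors R M N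
  for R :: "('a, 'b) ring_scheme"
    and M :: "('a, 'm, 'c) module_scheme" and N :: "('a, 'n, 'd) module_scheme" +
  fixes U :: "('u, 'e) ring_scheme" and \<beta> :: "'m \<Rightarrow> 'n \<Rightarrow> 'u"
  assumes abU: "abelian_group U"
    and \<beta>_closed: "\<lbrakk>m \<in> carrier M; n \<in> carrier N\<rbrakk> \<Longrightarrow> \<beta> m n \<in> carrier U"
    and \<beta>_add_left: "\<lbrakk>m \<in> carrier M; m' \<in> carrier M; n \<in> carrier N\<rbrakk> \<Longrightarrow>
      \<beta> (m \<oplus>\<^bsub>M\<^esub> m') n = \<beta> m n \<oplus>\<^bsub>U\<^esub> \<beta> m' n"
    and \<beta>_add_right: "\<lbrakk>m \<in> carrier M; n \<in> carrier N; n' \<in> carrier N\<rbrakk> \<Longrightarrow>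
      \<beta> m (n \<oplus>\<^bsub>N\<^esub> n') = \<beta> m n \<oplus>\<^bsub>U\<^esub> \<beta> m n'"
    and \<beta>_smult: "\<lbrakk>r \<in> carrier R; m \<in> carrier M; n \<in> carrier N\<rbrakk> \<Longrightarrow>
      \<beta> (r \<odot>\<^bsub>M\<^esub> m) n = \<beta> m (r \<odot>\<^bsub>N\<^esub> n)"
begin

sublocale U: abelian_group U by (rule abU)

abbreviation "term (f :: 'm \<times> 'n \<Rightarrow>\<^sub>0 int) x \<equiv> add_pow U (Poly_Mapping.lookup f x) (\<beta> (fst x) (snd x))"
definition "lift0 (f :: 'm \<times> 'n \<Rightarrow>\<^sub>0 int) = finsum U (\<lambda>(m, n). add_pow U (Poly_Mapping.lookup f (m, n)) (\<beta> m n)) (Poly_Mapping.keys f)"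
abbreviation "lift \<equiv> tensor_lift U \<beta>"

lemma term_closed: "x \<in> carrier M \<times> carrier N \<Longrightarrow> term f x \<in> carrier U"
  using \<beta>_closed by auto

text \<open>Summing over a superset of the support makes formal sums with different supports
  comparable term by term.\<close>

lemma lift0_superset:
  assumes "finite K" "Poly_Mapping.keys f \<subseteq> K" "K \<subseteq> carrier M \<times> carrier N"
  shows "lift0 f = finsum U (term f) K"
proof -
  have "term f x = \<zero>\<^bsub>U\<^esub>" if "x \<in> K - Poly_Mapping.keys f" for x
    using that by (simp add: not_in_keys_iff_lookup_eq_zero add_pow_def)
  moreover have "term f \<in> K \<rightarrow> carrier U" using assms(3) term_closed by blast
  ultimately show ?thesis
    unfolding lift0_def using assms(1,2)
    by (intro U.add.finprod_mono_neutral_cong_left) auto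
qed

lemma lift0_closed: "keysin f \<Longrightarrow> lift0 f \<in> carrier U"
  unfolding lift0_def by (rule U.finsum_closed) (use \<beta>_closed in \<open>auto simp: subset_iff\<close>)

lemma lift0_add:
  assumes "keysin f" "keysin g" shows "lift0 (f + g) = lift0 f \<oplus>\<^bsub>U\<^esub> lift0 g"
proof -
  let ?K = "Poly_Mapping.keys f \<union> Poly_Mapping.keys g"
  have K: "?K \<subseteq> carrier M \<times> carrier N" using assms by auto
  have "lift0 (f + g) = finsum U (term (f + g)) ?K"
    by (rule lift0_superset) (use K Poly_Mapping.keys_add[of f g] in auto)
  also have "\<dots> = finsum U (\<lambda>x. term f x \<oplus>\<^bsub>U\<^esub> term g x) ?K"
    by (rule U.finsum_cong')
      (use K term_closed \<beta>_closed in \<open>auto simp: lookup_add U.add.int_pow_mult subset_iff\<close>)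
  also have "\<dots> = finsum U (term f) ?K \<oplus>\<^bsub>U\<^esub> finsum U (term g) ?K"
    by (rule U.finsum_addf) (use K \<beta>_closed in \<open>auto simp: subset_iff\<close>)
  also have "\<dots> = lift0 f \<oplus>\<^bsub>U\<^esub> lift0 g"
    using lift0_superset[of ?K f] lift0_superset[of ?K g] K by simp
  finally show ?thesis .
qed

lemma lift0_zero: "lift0 0 = \<zero>\<^bsub>U\<^esub>" by (simp add: lift0_def)

lemma lift0_pure: "m \<in> carrier M \<Longrightarrow> n \<in> carrier N \<Longrightarrow> lift0 (frag_of (m, n)) = \<beta> m n"
  using \<beta>_closed by (simp add: lift0_def)

lemma lift0_minus: "keysin f \<Longrightarrow> lift0 (- f) = \<ominus>\<^bsub>U\<^esub> lift0 f"
  by (rule U.minus_equality[symmetric]) (use lift0_add[of "-f" f] lift0_closed lift0_zero in auto)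

lemma lift0_diff: "keysin f \<Longrightarrow> keysin g \<Longrightarrow> lift0 (f - g) = lift0 f \<ominus>\<^bsub>U\<^esub> lift0 g"
  using lift0_add[of f "-g"] by (simp add: lift0_minus a_minus_def)

text \<open>Vanishing on the relations makes the value constant on a coset. The definition of
  \<open>tensor_lift\<close> by \<open>the_elem\<close> of an image is meaningful only because of
  this.\<close>

lemma lift0_rel: "f \<in> rel \<Longrightarrow> lift0 f = \<zero>\<^bsub>U\<^esub>"
proof (induction rule: rel_induct)
  case zero then show ?case by (rule lift0_zero)
next
  case (relation h)
  have *: "lift0 (frag_of x - frag_of y - frag_of z) = \<zero>\<^bsub>U\<^esub>"
    if "x \<in> carrier M \<times> carrier N" "y \<in> carrier M \<times> carrier N" "z \<in> carrier M \<times> carrier N"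
      "\<beta> (fst x) (snd x) = \<beta> (fst y) (snd y) \<oplus>\<^bsub>U\<^esub> \<beta> (fst z) (snd z)" for x y z
  proof -
    have c: "\<beta> (fst y) (snd y) \<in> carrier U" "\<beta> (fst z) (snd z) \<in> carrier U"
      using that \<beta>_closed by auto
    have p: "lift0 (frag_of w) = \<beta> (fst w) (snd w)" if "w \<in> carrier M \<times> carrier N" for w
      using lift0_pure[of "fst w" "snd w"] that by auto
    have k: "keysin (frag_of w)" if "w \<in> carrier M \<times> carrier N" for w
      using that by auto
    have "lift0 (frag_of x - (frag_of y + frag_of z)) = lift0 (frag_of x) \<ominus>\<^bsub>U\<^esub> lift0 (frag_of y + frag_of z)"
      by (rule lift0_diff) (use k that keysin_add in blast)+
    also have "lift0 (frag_of y + frag_of z) = lift0 (frag_of y) \<oplus>\<^bsub>U\<^esub> lift0 (frag_of z)"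
      by (rule lift0_add) (use k that in blast)+
    finally show ?thesis
      unfolding p[OF that(1)] p[OF that(2)] p[OF that(3)] that(4) diff_diff_eq
      using c by (simp add: a_minus_def U.r_neg)
  qed
  from relation show ?case
  proof (cases rule: tensor_relationsE)
    case 1: (add_left m m' n)
    show ?thesis unfolding 1(4) by (rule *) (use 1 \<beta>_add_left in simp_all)
  next
    case 2: (add_right m n n')
    show ?thesis unfolding 2(4) by (rule *) (use 2 \<beta>_add_right in simp_all)
  next
    case 3: (smult r m n)
    have "lift0 h = lift0 (frag_of (r \<odot>\<^bsub>M\<^esub> m, n)) \<ominus>\<^bsub>U\<^esub> lift0 (frag_of (m, r \<odot>\<^bsub>N\<^esub> n))"
      unfolding 3(4) by (rule lift0_diff) (use 3 smultM smultN in simp_all)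
    also have "\<dots> = \<beta> (r \<odot>\<^bsub>M\<^esub> m) n \<ominus>\<^bsub>U\<^esub> \<beta> m (r \<odot>\<^bsub>N\<^esub> n)"
      using lift0_pure[OF smultM[OF 3(1,2)] 3(3)] lift0_pure[OF 3(2) smultN[OF 3(1,3)]] by metis
    finally show ?thesis using 3 \<beta>_closed smultN smultM by (simp add: \<beta>_smult a_minus_def U.r_neg)
  qed
next
  case (add h h') then show ?case using rel_keys by (simp add: lift0_add)
next
  case (minus h) then show ?case using rel_keys by (simp add: lift0_minus)
qed

lemma lift_cls: assumes "keysin f" shows "lift (cls f) = lift0 f"
proof -
  have "lift0 (h + f) = lift0 f" if "h \<in> rel" for h
    using that assms lift0_add[of h f] rel_keys lift0_rel lift0_closed by simp
  then have "lift0 ` cls f = {lift0 f}" using rel_zero by (force simp: cls_eq)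
  then show ?thesis by (simp add: tensor_lift_def lift0_def)
qed

lemma lift_closed: "z \<in> carrier T \<Longrightarrow> lift z \<in> carrier U"
  using lift_cls lift0_closed by (auto simp: carrier_T)

lemma lift_add: "z \<in> carrier T \<Longrightarrow> z' \<in> carrier T \<Longrightarrow> lift (z \<oplus>\<^bsub>T\<^esub> z') = lift z \<oplus>\<^bsub>U\<^esub> lift z'"
  using lift_cls lift0_add keysin_add by (auto simp: carrier_T T_add)

lemma lift_zero: "lift \<zero>\<^bsub>T\<^esub> = \<zero>\<^bsub>U\<^esub>"
  by (simp add: T_zero lift_cls lift0_zero)

lemma lift_pure: "m \<in> carrier M \<Longrightarrow> n \<in> carrier N \<Longrightarrow> lift (pure m n) = \<beta> m n"
  by (simp add: pure_tensor_def lift_cls lift0_pure)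

lemma lift_minus: "z \<in> carrier T \<Longrightarrow> lift (\<ominus>\<^bsub>T\<^esub> z) = \<ominus>\<^bsub>U\<^esub> lift z"
  by (rule U.minus_equality[symmetric]) (simp_all add: lift_closed lift_zero T.l_neg flip: lift_add)

lemma lift_finsum:
  assumes "finite I" "z \<in> I \<rightarrow> carrier T"
  shows "lift (finsum T z I) = finsum U (\<lambda>i. lift (z i)) I"
  using assms
proof (induction I rule: finite_induct)
  case empty then show ?case by (simp add: lift_zero)
next
  case (insert x F)
  then show ?case by (simp add: lift_add Pi_iff lift_closed)
qed

text \<open>Both properties are tested on the normal forms of \<open>tensor_span\<close>. If the
  coefficients can be recovered from the image, the kernel is trivial; freeness of the tensor
  product on \<open>b\<close> is thus a consequence and not an input.\<close>

lemma lift_bij_betw: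
  assumes "finite I" "b \<in> I \<rightarrow> carrier N"
    and "\<And>n. n \<in> carrier N \<Longrightarrow> \<exists>r\<in>I \<rightarrow> carrier R. n = finsum N (\<lambda>i. r i \<odot>\<^bsub>N\<^esub> b i) I"
    and inj: "\<And>m. \<lbrakk>m \<in> I \<rightarrow> carrier M; finsum U (\<lambda>i. \<beta> (m i) (b i)) I = \<zero>\<^bsub>U\<^esub>\<rbrakk> \<Longrightarrow> \<forall>i\<in>I. m i = \<zero>\<^bsub>M\<^esub>"
    and surj: "\<And>u. u \<in> carrier U \<Longrightarrow> \<exists>m\<in>I \<rightarrow> carrier M. u = finsum U (\<lambda>i. \<beta> (m i) (b i)) I"
  shows "bij_betw lift (carrier T) (carrier U)"
proof -
  have lf: "lift (finsum T (\<lambda>i. pure (m i) (b i)) I) = finsum U (\<lambda>i. \<beta> (m i) (b i)) I"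
    if "m \<in> I \<rightarrow> carrier M" for m
  proof -
    have "lift (finsum T (\<lambda>i. pure (m i) (b i)) I) = finsum U (\<lambda>i. lift (pure (m i) (b i))) I"
      by (rule lift_finsum) (use that assms pure_closed in \<open>auto simp: Pi_iff\<close>)
    also have "\<dots> = finsum U (\<lambda>i. \<beta> (m i) (b i)) I"
      by (rule U.finsum_cong') (use that assms lift_pure \<beta>_closed in \<open>auto simp: Pi_iff\<close>)
    finally show ?thesis .
  qed
  have ker: "z = \<zero>\<^bsub>T\<^esub>" if z: "z \<in> carrier T" "lift z = \<zero>\<^bsub>U\<^esub>" for z
  proof -
    obtain m where m: "m \<in> I \<rightarrow> carrier M" "z = finsum T (\<lambda>i. pure (m i) (b i)) I"
      using tensor_span[OF assms(1-3) z(1)] by blast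
    have "\<forall>i\<in>I. m i = \<zero>\<^bsub>M\<^esub>"
      by (rule inj[OF m(1)]) (use lf[OF m(1)] z m(2) in simp)
    then have "finsum T (\<lambda>i. pure (m i) (b i)) I = finsum T (\<lambda>i. \<zero>\<^bsub>T\<^esub>) I"
      by (intro T.finsum_cong') (use assms(2) pure_zero_left in auto)
    then show ?thesis using m by simp
  qed
  show ?thesis
  proof (rule bij_betw_imageI)
    show "inj_on lift (carrier T)"
    proof (rule inj_onI)
      fix x y assume xy: "x \<in> carrier T" "y \<in> carrier T" "lift x = lift y"
      then have "lift (x \<ominus>\<^bsub>T\<^esub> y) = \<zero>\<^bsub>U\<^esub>"
        by (simp add: a_minus_def lift_add lift_minus lift_closed U.r_neg)
      then have "x \<ominus>\<^bsub>T\<^esub> y = \<zero>\<^bsub>T\<^esub>" using ker xy(1,2) by simp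
      moreover have "x = (x \<ominus>\<^bsub>T\<^esub> y) \<oplus>\<^bsub>T\<^esub> y"
        using xy(1,2) by (simp add: a_minus_def T.a_assoc T.l_neg)
      ultimately show "x = y" using xy(2) by (metis T.l_zero)
    qed
    have "u \<in> lift ` carrier T" if "u \<in> carrier U" for u
    proof -
      obtain m where m: "m \<in> I \<rightarrow> carrier M" "u = finsum U (\<lambda>i. \<beta> (m i) (b i)) I"
        using surj \<open>u \<in> carrier U\<close> by blast
      moreover have "finsum T (\<lambda>i. pure (m i) (b i)) I \<in> carrier T"
        by (rule T.finsum_closed) (use m assms pure_closed in \<open>auto simp: Pi_iff\<close>)
      ultimately show ?thesis using lf[OF m(1)] m(2) by (intro image_eqI) simp_all
    qed
    then show "lift ` carrier T = carrier U" using lift_closed by blast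
  qed
qed

end

text \<open>Three tensor products instead of one, because eigenmodules multiply from the indices
  \<open>i\<close> and \<open>j\<close> into the index \<open>i + j\<close> modulo \<open>p\<close>.
  The product of an algebra is the case in which all three coincide.\<close>

locale tensor_pairing =
  t1: tensor_factors R M1 N1 + t2: tensor_factors R M2 N2 + t3: tensor_factors R M3 N3
  for R :: "('a, 'b) ring_scheme"
    and M1 M2 M3 :: "('a, 'm, 'c) module_scheme" and N1 N2 :: "('a, 'n, 'd) module_scheme" and N3 :: "('a, 'n, 'd) module_scheme" (structure) +
  assumes multM: "\<lbrakk>m \<in> carrier M1; m' \<in> carrier M2\<rbrakk> \<Longrightarrow> m \<otimes>\<^bsub>M3\<^esub> m' \<in> carrier M3"
    and multM_add_left: "\<lbrakk>m1 \<in> carrier M1; m2 \<in> carrier M1; m' \<in> carrier M2\<rbrakk> \<Longrightarrow>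
      (m1 \<oplus>\<^bsub>M1\<^esub> m2) \<otimes>\<^bsub>M3\<^esub> m' = m1 \<otimes>\<^bsub>M3\<^esub> m' \<oplus>\<^bsub>M3\<^esub> m2 \<otimes>\<^bsub>M3\<^esub> m'"
    and multM_add_right: "\<lbrakk>m \<in> carrier M1; m1 \<in> carrier M2; m2 \<in> carrier M2\<rbrakk> \<Longrightarrow>
      m \<otimes>\<^bsub>M3\<^esub> (m1 \<oplus>\<^bsub>M2\<^esub> m2) = m \<otimes>\<^bsub>M3\<^esub> m1 \<oplus>\<^bsub>M3\<^esub> m \<otimes>\<^bsub>M3\<^esub> m2"
    and multM_smult_left: "\<lbrakk>r \<in> carrier R; m \<in> carrier M1; m' \<in> carrier M2\<rbrakk> \<Longrightarrow>
      (r \<odot>\<^bsub>M1\<^esub> m) \<otimes>\<^bsub>M3\<^esub> m' = r \<odot>\<^bsub>M3\<^esub> (m \<otimes>\<^bsub>M3\<^esub> m')"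
    and multM_smult_right: "\<lbrakk>r \<in> carrier R; m \<in> carrier M1; m' \<in> carrier M2\<rbrakk> \<Longrightarrow>
      m \<otimes>\<^bsub>M3\<^esub> (r \<odot>\<^bsub>M2\<^esub> m') = r \<odot>\<^bsub>M3\<^esub> (m \<otimes>\<^bsub>M3\<^esub> m')"
    and multN: "\<lbrakk>n \<in> carrier N1; n' \<in> carrier N2\<rbrakk> \<Longrightarrow> n \<otimes> n' \<in> carrier N3"
    and multN_add_left: "\<lbrakk>n1 \<in> carrier N1; n2 \<in> carrier N1; n' \<in> carrier N2\<rbrakk> \<Longrightarrow>
      (n1 \<oplus>\<^bsub>N1\<^esub> n2) \<otimes> n' = n1 \<otimes> n' \<oplus> n2 \<otimes> n'"
    and multN_add_right: "\<lbrakk>n \<in> carrier N1; n1 \<in> carrier N2; n2 \<in> carrier N2\<rbrakk> \<Longrightarrow>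
      n \<otimes> (n1 \<oplus>\<^bsub>N2\<^esub> n2) = n \<otimes> n1 \<oplus> n \<otimes> n2"
    and multN_smult_left: "\<lbrakk>r \<in> carrier R; n \<in> carrier N1; n' \<in> carrier N2\<rbrakk> \<Longrightarrow>
      (r \<odot>\<^bsub>N1\<^esub> n) \<otimes> n' = r \<odot> (n \<otimes> n')"
    and multN_smult_right: "\<lbrakk>r \<in> carrier R; n \<in> carrier N1; n' \<in> carrier N2\<rbrakk> \<Longrightarrow>
      n \<otimes> (r \<odot>\<^bsub>N2\<^esub> n') = r \<odot> (n \<otimes> n')"
begin

definition "fprod f g = frag_extend (\<lambda>(m, n). frag_extend (\<lambda>(m', n'). frag_of (m \<otimes>\<^bsub>M3\<^esub> m', n \<otimes> n')) g) f"

abbreviation "tmult \<equiv> tensor_mult (carrier R) M3 N3"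

lemma fprod_pure: "fprod (frag_of (m, n)) (frag_of (m', n')) = frag_of (m \<otimes>\<^bsub>M3\<^esub> m', n \<otimes> n')"
  by (simp add: fprod_def)

lemma fprod_zero_left: "fprod 0 g = 0"
  by (simp add: fprod_def)

lemma fprod_zero_right: "fprod f 0 = 0"
  unfolding fprod_def by (rule frag_extend_eq_0) auto

lemma fprod_diff_left: "fprod (f - f') g = fprod f g - fprod f' g"
  by (simp add: fprod_def frag_extend_diff)

lemma fprod_add_left: "fprod (f + f') g = fprod f g + fprod f' g"
  by (simp add: fprod_def frag_extend_add)

lemma fprod_minus_left: "fprod (- f) g = - fprod f g"
  by (simp add: fprod_def frag_extend_minus)

lemma fprod_add_right: "fprod f (g + g') = fprod f g + fprod f g'"
  unfolding fprod_def frag_extend_add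
  by (simp add: case_prod_unfold frag_extend_add_fun)

lemma fprod_minus_right: "fprod f (- g) = - fprod f g"
  unfolding fprod_def frag_extend_minus
  by (simp add: case_prod_unfold frag_extend_minus_fun)

lemma fprod_diff_right: "fprod f (g - g') = fprod f g - fprod f g'"
  unfolding fprod_def frag_extend_diff
  by (simp add: case_prod_unfold frag_extend_diff_fun)

lemma fprod_keysin: "t1.keysin f \<Longrightarrow> t2.keysin g \<Longrightarrow> t3.keysin (fprod f g)"
proof (induction f rule: frag_induction)
  case zero then show ?case by (simp add: fprod_zero_left)
next
  case (one x)
  from one(2) show ?case
  proof (induction g rule: frag_induction)
    case zero then show ?case by (simp add: fprod_zero_right)
  next
    case (one y)
    then show ?case using \<open>x \<in> carrier M1 \<times> carrier N1\<close> multM multN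
      by (cases x, cases y) (auto simp: fprod_pure)
  next
    case (diff a b) then show ?case by (metis fprod_diff_right t3.keysin_diff)
  qed
next
  case (diff a b) then show ?case by (metis fprod_diff_left t3.keysin_diff)
qed

lemma fprod_rel_left:
  assumes "f \<in> t1.rel" "t2.keysin g" shows "fprod f g \<in> t3.rel"
  using assms(1)
proof (induction rule: t1.rel_induct)
  case zero then show ?case by (simp add: fprod_zero_left t3.rel_zero)
next
  case (relation h)
  from assms(2) show ?case
  proof (induction g rule: frag_induction)
    case zero then show ?case by (simp add: fprod_zero_right t3.rel_zero)
  next
    case (one y)
    obtain m' n' where y: "y = (m', n')" "m' \<in> carrier M2" "n' \<in> carrier N2" using one by auto
    from relation show ?case
    proof (cases rule: tensor_relationsE)
      case *: (add_left m1 m2 n)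
      then have "fprod h (frag_of y) = frag_of (m1 \<otimes>\<^bsub>M3\<^esub> m' \<oplus>\<^bsub>M3\<^esub> m2 \<otimes>\<^bsub>M3\<^esub> m', n \<otimes> n')
          - frag_of (m1 \<otimes>\<^bsub>M3\<^esub> m', n \<otimes> n') - frag_of (m2 \<otimes>\<^bsub>M3\<^esub> m', n \<otimes> n')"
        using y by (simp add: fprod_diff_left fprod_pure multM_add_left)
      moreover have "m1 \<otimes>\<^bsub>M3\<^esub> m' \<in> carrier M3" "m2 \<otimes>\<^bsub>M3\<^esub> m' \<in> carrier M3" "n \<otimes> n' \<in> carrier N3"
        using * y multM multN by auto
      ultimately show ?thesis
        by (intro t3.rel_incl) (unfold tensor_relations_def, blast)
    next
      case *: (add_right m n1 n2)
      then have "fprod h (frag_of y) = frag_of (m \<otimes>\<^bsub>M3\<^esub> m', n1 \<otimes> n' \<oplus> n2 \<otimes> n')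
          - frag_of (m \<otimes>\<^bsub>M3\<^esub> m', n1 \<otimes> n') - frag_of (m \<otimes>\<^bsub>M3\<^esub> m', n2 \<otimes> n')"
        using y by (simp add: fprod_diff_left fprod_pure multN_add_left)
      moreover have "m \<otimes>\<^bsub>M3\<^esub> m' \<in> carrier M3" "n1 \<otimes> n' \<in> carrier N3" "n2 \<otimes> n' \<in> carrier N3"
        using * y multM multN by auto
      ultimately show ?thesis
        by (intro t3.rel_incl) (unfold tensor_relations_def, blast)
    next
      case *: (smult r m n)
      then have "fprod h (frag_of y) = frag_of (r \<odot>\<^bsub>M3\<^esub> (m \<otimes>\<^bsub>M3\<^esub> m'), n \<otimes> n')
          - frag_of (m \<otimes>\<^bsub>M3\<^esub> m', r \<odot> (n \<otimes> n'))"
        using y by (simp add: fprod_diff_left fprod_pure multN_smult_left multM_smult_left)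
      moreover have "m \<otimes>\<^bsub>M3\<^esub> m' \<in> carrier M3" "n \<otimes> n' \<in> carrier N3"
        using * y multM multN by auto
      ultimately show ?thesis using *(1)
        by (intro t3.rel_incl) (unfold tensor_relations_def, blast)
    qed
  next
    case (diff a b) then show ?case by (simp add: fprod_diff_right t3.rel_diff)
  qed
next
  case (add h h') then show ?case by (simp add: fprod_add_left t3.rel_add)
next
  case (minus h) then show ?case by (simp add: fprod_minus_left t3.rel_minus)
qed

lemma fprod_rel_right:
  assumes "g \<in> t2.rel" "t1.keysin f" shows "fprod f g \<in> t3.rel"
  using assms(1)
proof (induction rule: t2.rel_induct)
  case zero then show ?case by (simp add: fprod_zero_right t3.rel_zero)
next
  case (relation h)
  from assms(2) show ?case
  proof (induction f rule: frag_induction)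
    case zero then show ?case by (simp add: fprod_zero_left t3.rel_zero)
  next
    case (one y)
    obtain m' n' where y: "y = (m', n')" "m' \<in> carrier M1" "n' \<in> carrier N1" using one by auto
    from relation show ?case
    proof (cases rule: tensor_relationsE)
      case *: (add_left m1 m2 n)
      then have "fprod (frag_of y) h = frag_of (m' \<otimes>\<^bsub>M3\<^esub> m1 \<oplus>\<^bsub>M3\<^esub> m' \<otimes>\<^bsub>M3\<^esub> m2, n' \<otimes> n)
          - frag_of (m' \<otimes>\<^bsub>M3\<^esub> m1, n' \<otimes> n) - frag_of (m' \<otimes>\<^bsub>M3\<^esub> m2, n' \<otimes> n)"
        using y by (simp add: fprod_diff_right fprod_pure multM_add_right)
      moreover have "m' \<otimes>\<^bsub>M3\<^esub> m1 \<in> carrier M3" "m' \<otimes>\<^bsub>M3\<^esub> m2 \<in> carrier M3" "n' \<otimes> n \<in> carrier N3"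
        using * y multM multN by auto
      ultimately show ?thesis
        by (intro t3.rel_incl) (unfold tensor_relations_def, blast)
    next
      case *: (add_right m n1 n2)
      then have "fprod (frag_of y) h = frag_of (m' \<otimes>\<^bsub>M3\<^esub> m, n' \<otimes> n1 \<oplus> n' \<otimes> n2)
          - frag_of (m' \<otimes>\<^bsub>M3\<^esub> m, n' \<otimes> n1) - frag_of (m' \<otimes>\<^bsub>M3\<^esub> m, n' \<otimes> n2)"
        using y by (simp add: fprod_diff_right fprod_pure multN_add_right)
      moreover have "m' \<otimes>\<^bsub>M3\<^esub> m \<in> carrier M3" "n' \<otimes> n1 \<in> carrier N3" "n' \<otimes> n2 \<in> carrier N3"
        using * y multM multN by auto
      ultimately show ?thesis
        by (intro t3.rel_incl) (unfold tensor_relations_def, blast)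
    next
      case *: (smult r m n)
      then have "fprod (frag_of y) h = frag_of (r \<odot>\<^bsub>M3\<^esub> (m' \<otimes>\<^bsub>M3\<^esub> m), n' \<otimes> n)
          - frag_of (m' \<otimes>\<^bsub>M3\<^esub> m, r \<odot> (n' \<otimes> n))"
        using y by (simp add: fprod_diff_right fprod_pure multN_smult_right multM_smult_right)
      moreover have "m' \<otimes>\<^bsub>M3\<^esub> m \<in> carrier M3" "n' \<otimes> n \<in> carrier N3"
        using * y multM multN by auto
      ultimately show ?thesis using *(1)
        by (intro t3.rel_incl) (unfold tensor_relations_def, blast)
    qed
  next
    case (diff a b) then show ?case by (simp add: fprod_diff_left t3.rel_diff)
  qed
next
  case (add h h') then show ?case by (simp add: fprod_add_right t3.rel_add)
next
  case (minus h) then show ?case by (simp add: fprod_minus_right t3.rel_minus)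
qed

lemma tmult_cls:
  assumes f: "t1.keysin f" and g: "t2.keysin g"
  shows "tmult (t1.cls f) (t2.cls g) = t3.cls (fprod f g)"
proof -
  have "t3.cls (fprod f' g') = t3.cls (fprod f g)" if "f' \<in> t1.cls f" "g' \<in> t2.cls g" for f' g'
  proof -
    have 1: "f' - f \<in> t1.rel" "g' - g \<in> t2.rel"
      using that by (simp_all only: t1.mem_cls_iff t2.mem_cls_iff)
    have "t2.keysin ((g' - g) + g)" by (rule t2.keysin_add) (use 1 g t2.rel_keys in blast)+
    then have "t2.keysin g'" by simp
    \<comment> \<open>Changing the representatives one at a time: f' g' - f g = (f' - f) g' + f (g'
      - g), and each summand is a relation.\<close>
    then have "fprod (f' - f) g' + fprod f (g' - g) \<in> t3.rel"
      using 1 f by (intro t3.rel_add fprod_rel_left fprod_rel_right)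
    moreover have "fprod (f' - f) g' + fprod f (g' - g) = fprod f' g' - fprod f g"
      by (simp add: fprod_diff_left fprod_diff_right)
    ultimately show ?thesis by (simp only: t3.cls_eq_iff)
  qed
  moreover have "t1.cls f \<noteq> {}" "t2.cls g \<noteq> {}" using t1.cls_self t2.cls_self by blast+
  ultimately show ?thesis
    unfolding tensor_mult_def fprod_def[symmetric] by blast
qed

lemma tmult_closed: "x \<in> carrier t1.T \<Longrightarrow> y \<in> carrier t2.T \<Longrightarrow> tmult x y \<in> carrier t3.T"
  using fprod_keysin by (auto simp: t1.carrier_T t2.carrier_T t3.carrier_T tmult_cls)

lemma tmult_pure:
  "\<lbrakk>m \<in> carrier M1; n \<in> carrier N1; m' \<in> carrier M2; n' \<in> carrier N2\<rbrakk> \<Longrightarrow>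
   tmult (t1.pure m n) (t2.pure m' n') = t3.pure (m \<otimes>\<^bsub>M3\<^esub> m') (n \<otimes> n')"
  by (simp add: pure_tensor_def tmult_cls fprod_pure)

lemma tmult_add_left:
  assumes "x \<in> carrier t1.T" "x' \<in> carrier t1.T" "y \<in> carrier t2.T"
  shows "tmult (x \<oplus>\<^bsub>t1.T\<^esub> x') y = tmult x y \<oplus>\<^bsub>t3.T\<^esub> tmult x' y"
  using assms t1.keysin_add
  by (auto simp: t1.carrier_T t2.carrier_T t1.T_add t3.T_add tmult_cls fprod_add_left)

lemma tmult_add_right:
  assumes "x \<in> carrier t1.T" "y \<in> carrier t2.T" "y' \<in> carrier t2.T"
  shows "tmult x (y \<oplus>\<^bsub>t2.T\<^esub> y') = tmult x y \<oplus>\<^bsub>t3.T\<^esub> tmult x y'"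
  using assms t2.keysin_add
  by (auto simp: t1.carrier_T t2.carrier_T t2.T_add t3.T_add tmult_cls fprod_add_right)

lemma tmult_zero_left: "y \<in> carrier t2.T \<Longrightarrow> tmult \<zero>\<^bsub>t1.T\<^esub> y = \<zero>\<^bsub>t3.T\<^esub>"
  by (auto simp: t1.T_zero t3.T_zero t2.carrier_T tmult_cls fprod_zero_left)

lemma tmult_zero_right: "x \<in> carrier t1.T \<Longrightarrow> tmult x \<zero>\<^bsub>t2.T\<^esub> = \<zero>\<^bsub>t3.T\<^esub>"
  by (auto simp: t2.T_zero t3.T_zero t1.carrier_T tmult_cls fprod_zero_right)

end

section \<open>Tensor products of algebras\<close>

locale tensor_algebras = tensor_factors R M N
  for R :: "('a, 'b) ring_scheme"
    and M :: "('a, 'm, 'c) module_scheme" and N :: "('a, 'n, 'd) module_scheme" +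
  assumes crM: "cring M" and crN: "cring N"
    and smultM_assoc: "\<lbrakk>r \<in> carrier R; m \<in> carrier M; m' \<in> carrier M\<rbrakk> \<Longrightarrow>
      (r \<odot>\<^bsub>M\<^esub> m) \<otimes>\<^bsub>M\<^esub> m' = r \<odot>\<^bsub>M\<^esub> (m \<otimes>\<^bsub>M\<^esub> m')"
    and smultN_assoc: "\<lbrakk>r \<in> carrier R; n \<in> carrier N; n' \<in> carrier N\<rbrakk> \<Longrightarrow>
      (r \<odot>\<^bsub>N\<^esub> n) \<otimes>\<^bsub>N\<^esub> n' = r \<odot>\<^bsub>N\<^esub> (n \<otimes>\<^bsub>N\<^esub> n')"
begin

sublocale crM: cring M by (rule crM)
sublocale crN: cring N by (rule crN)

sublocale pairing: tensor_pairing R M M M N N N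
proof (unfold_locales, goal_cases)
  case (1 m m') then show ?case by simp
next
  case (2 m1 m2 m') then show ?case by (simp add: crM.l_distr)
next
  case (3 m m1 m2) then show ?case by (simp add: crM.r_distr)
next
  case (4 r m m') then show ?case by (rule smultM_assoc)
next
  case (5 r m m') then show ?case by (metis smultM_assoc crM.m_comm smultM)
next
  case (6 m m') then show ?case by simp
next
  case (7 m1 m2 m') then show ?case by (simp add: crN.l_distr)
next
  case (8 m m1 m2) then show ?case by (simp add: crN.r_distr)
next
  case (9 r m m') then show ?case by (rule smultN_assoc)
next
  case (10 r m m') then show ?case by (metis smultN_assoc crN.m_comm smultN)
qed

lemma T_mult: "monoid.mult T = pairing.tmult"
  by (simp add: tensor_ring_def)

lemma T_mult_pure: "\<lbrakk>m \<in> carrier M; n \<in> carrier N; m' \<in> carrier M; n' \<in> carrier N\<rbrakk> \<Longrightarrow>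
   pure m n \<otimes>\<^bsub>T\<^esub> pure m' n' = pure (m \<otimes>\<^bsub>M\<^esub> m') (n \<otimes>\<^bsub>N\<^esub> n')"
  unfolding T_mult by (rule pairing.tmult_pure)

lemma cring_T: "cring T"
proof -
  note cl = pairing.tmult_closed and al = pairing.tmult_add_left and ar = pairing.tmult_add_right
  note z = pairing.tmult_zero_left pairing.tmult_zero_right
  have comm: "pairing.tmult x y = pairing.tmult y x" if "x \<in> carrier T" "y \<in> carrier T" for x y
    using that(1)
  proof (induction rule: tensor_induct)
    case zero then show ?case using that by (simp add: z)
  next
    case (pure m n)
    from that(2) show ?case
    proof (induction rule: tensor_induct)
      case zero then show ?case using pure by (simp add: z pure_closed)
    next
      case (pure m' n') then show ?case using \<open>m \<in> carrier M\<close> \<open>n \<in> carrier N\<close>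
        by (simp add: pairing.tmult_pure crM.m_comm crN.m_comm)
    next
      case (add y y') then show ?case using pure by (simp add: al ar pure_closed)
    qed
  next
    case (add x x') then show ?case using that by (simp add: al ar)
  qed
  have assoc: "pairing.tmult (pairing.tmult x y) w = pairing.tmult x (pairing.tmult y w)"
    if "x \<in> carrier T" "y \<in> carrier T" "w \<in> carrier T" for x y w
    using that(1)
  proof (induction rule: tensor_induct)
    case zero then show ?case using that by (simp add: z cl)
  next
    case p1: (pure m n)
    from that(2) show ?case
    proof (induction rule: tensor_induct)
      case zero then show ?case using p1 that by (simp add: z cl pure_closed)
    next
      case p2: (pure m' n')
      from that(3) show ?case
      proof (induction rule: tensor_induct)
        case zero then show ?case using p1 p2 by (simp add: z cl pure_closed)
      next
        case p3: (pure m'' n'') then show ?case using p1 p2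
          by (simp add: pairing.tmult_pure crM.m_assoc crN.m_assoc)
      next
        case (add y y') then show ?case using p1 p2 by (simp add: al ar cl pure_closed)
      qed
    next
      case (add y y') then show ?case using p1 that by (simp add: al ar cl pure_closed)
    qed
  next
    case (add x x') then show ?case using that by (simp add: al ar cl)
  qed
  have one: "pairing.tmult \<one>\<^bsub>T\<^esub> x = x" if "x \<in> carrier T" for x
    using that
  proof (induction rule: tensor_induct)
    case zero then show ?case by (simp add: z pure_closed T_one)
  next
    case (pure m n) then show ?case by (simp add: T_one pairing.tmult_pure)
  next
    case (add x x') then show ?case by (simp add: T_one ar pure_closed)
  qed
  have onec: "\<one>\<^bsub>T\<^esub> \<in> carrier T" by (simp add: T_one pure_closed)
  show ?thesis
  proof (rule cringI)
    show "abelian_group T" by (rule ab_T)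
    show "comm_monoid T"
      by (rule comm_monoidI) (simp_all add: T_mult cl assoc one onec, rule comm)
    fix x y w assume "x \<in> carrier T" "y \<in> carrier T" "w \<in> carrier T"
    then show "(x \<oplus>\<^bsub>T\<^esub> y) \<otimes>\<^bsub>T\<^esub> w = x \<otimes>\<^bsub>T\<^esub> w \<oplus>\<^bsub>T\<^esub> y \<otimes>\<^bsub>T\<^esub> w"
      unfolding T_mult by (rule al)
  qed
qed

end

section \<open>Finite sums\<close>

lemma (in abelian_monoid) finsum_commute:
  assumes "finite A" "finite B" "\<And>a b. a \<in> A \<Longrightarrow> b \<in> B \<Longrightarrow> f a b \<in> carrier G"
  shows "(\<Oplus>a\<in>A. \<Oplus>b\<in>B. f a b) = (\<Oplus>b\<in>B. \<Oplus>a\<in>A. f a b)"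
  using assms(1,3)
proof (induction A rule: finite_induct)
  case empty then show ?case by simp
next
  case (insert x A)
  have "(\<Oplus>b\<in>B. \<Oplus>a\<in>insert x A. f a b) = (\<Oplus>b\<in>B. f x b \<oplus> (\<Oplus>a\<in>A. f a b))"
    by (rule finsum_cong') (use insert in \<open>auto intro!: finsum_closed\<close>)
  also have "\<dots> = (\<Oplus>b\<in>B. f x b) \<oplus> (\<Oplus>b\<in>B. \<Oplus>a\<in>A. f a b)"
    by (rule finsum_addf) (use insert in \<open>auto intro!: finsum_closed\<close>)
  also have "\<dots> = (\<Oplus>b\<in>B. f x b) \<oplus> (\<Oplus>a\<in>A. \<Oplus>b\<in>B. f a b)"
    using insert by simp
  also have "\<dots> = (\<Oplus>a\<in>insert x A. \<Oplus>b\<in>B. f a b)"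
    using insert by (subst finsum_insert) (auto intro!: finsum_closed)
  finally show ?case ..
qed

lemma (in abelian_monoid) finsum_cartesian:
  assumes "finite A" "finite B" "\<And>a b. a \<in> A \<Longrightarrow> b \<in> B \<Longrightarrow> f (a, b) \<in> carrier G"
  shows "finsum G f (A \<times> B) = (\<Oplus>a\<in>A. \<Oplus>b\<in>B. f (a, b))"
  using assms(1,3)
proof (induction A rule: finite_induct)
  case empty then show ?case by simp
next
  case (insert x A)
  have I: "insert x A \<times> B = Pair x ` B \<union> A \<times> B" by auto
  have "finsum G f (insert x A \<times> B) = finsum G f (Pair x ` B) \<oplus> finsum G f (A \<times> B)"
    unfolding I by (rule finsum_Un_disjoint) (use insert assms(2) in auto)
  also have "finsum G f (Pair x ` B) = (\<Oplus>b\<in>B. f (x, b))"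
    by (rule finsum_reindex) (use insert in \<open>auto simp: inj_on_def\<close>)
  finally show ?case using insert by (subst finsum_insert) (auto intro!: finsum_closed)
qed

text \<open>Stated for plain additive maps, since it is applied to projections and to evaluation at
  an index as well as to embeddings.\<close>

lemma additive_finsum:
  assumes "abelian_monoid A" "abelian_monoid B" "finite I" "f \<in> I \<rightarrow> carrier A"
    and "\<And>x. x \<in> carrier A \<Longrightarrow> h x \<in> carrier B" "h \<zero>\<^bsub>A\<^esub> = \<zero>\<^bsub>B\<^esub>"
    and "\<And>x y. \<lbrakk>x \<in> carrier A; y \<in> carrier A\<rbrakk> \<Longrightarrow> h (x \<oplus>\<^bsub>A\<^esub> y) = h x \<oplus>\<^bsub>B\<^esub> h y"
  shows "h (finsum A f I) = finsum B (\<lambda>i. h (f i)) I"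
  using assms(3,4)
proof (induction I rule: finite_induct)
  case empty
  then show ?case
    by (simp add: abelian_monoid.finsum_empty[OF assms(1)] abelian_monoid.finsum_empty[OF assms(2)] assms)
next
  case (insert x I)
  then have "f x \<in> carrier A" "f \<in> I \<rightarrow> carrier A" "(\<lambda>i. h (f i)) \<in> I \<rightarrow> carrier B" using assms(5) by auto
  then show ?case using insert
    by (simp add: abelian_monoid.finsum_insert[OF assms(1)] abelian_monoid.finsum_insert[OF assms(2)]
        assms(5,7) abelian_monoid.finsum_closed[OF assms(1)])
qed

section \<open>Characters of a cyclic group of prime order\<close>

locale prime_character =
  fixes G :: "'g monoid" and p :: nat and \<chi> :: "'g \<Rightarrow> 'k::field"
  assumes prime_p: "Factorial_Ring.prime p" and char_k: "CHAR('k) \<noteq> p"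
    and group_G: "group G" and cyclic_G: "cyclic_group G" and order_G: "Coset.order G = p"
    and \<chi>_char: "\<chi> \<in> characters p G" and \<chi>_nontriv: "\<exists>g\<in>carrier G. \<chi> g \<noteq> 1"
begin

sublocale G: group G by (rule group_G)

lemma p_pos: "0 < p" using prime_p by (simp add: prime_gt_0_nat)

lemma p_gt_1: "1 < p" using prime_gt_1_nat[OF prime_p] by simp

text \<open>The characteristic would divide the prime \<open>p\<close>, so it would be
  \<open>p\<close> or 1, and characteristic 1 means \<open>1 = 0\<close>.\<close>

lemma of_nat_p: "(of_nat p :: 'k) \<noteq> 0"
proof
  assume "(of_nat p :: 'k) = 0"
  then have "CHAR('k) dvd p" by (simp add: of_nat_eq_0_iff_char_dvd)
  then have "CHAR('k) = 1" using prime_p char_k by (auto simp: prime_nat_iff)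
  then show False using of_nat_CHAR[where 'a = 'k] by simp
qed

lemma finite_G: "finite (carrier G)"
  using order_G p_pos by (metis Coset.order_def card.infinite less_irrefl)

lemma char_hom: "\<psi> \<in> characters p G \<Longrightarrow> g \<in> carrier G \<Longrightarrow> h \<in> carrier G \<Longrightarrow> \<psi> (g \<otimes>\<^bsub>G\<^esub> h) = \<psi> g * \<psi> h"
  by (auto simp: characters_def roots_of_unity_group_def hom_def)

lemma char_pow_p: "\<psi> \<in> characters p G \<Longrightarrow> g \<in> carrier G \<Longrightarrow> \<psi> g ^ p = 1"
  by (auto simp: characters_def roots_of_unity_group_def hom_def)

lemma char_nonzero: "\<psi> \<in> characters p G \<Longrightarrow> g \<in> carrier G \<Longrightarrow> \<psi> g \<noteq> 0"
  using char_pow_p[of \<psi> g] p_pos by (auto simp: zero_power)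

lemma char_one: "\<psi> \<in> characters p G \<Longrightarrow> \<psi> \<one>\<^bsub>G\<^esub> = 1"
  using char_hom[of \<psi> "\<one>\<^bsub>G\<^esub>" "\<one>\<^bsub>G\<^esub>"] char_nonzero[of \<psi> "\<one>\<^bsub>G\<^esub>"] by simp

lemma char_pow: "\<psi> \<in> characters p G \<Longrightarrow> g \<in> carrier G \<Longrightarrow> \<psi> (g [^]\<^bsub>G\<^esub> (n::nat)) = \<psi> g ^ n"
  by (induction n) (simp_all add: char_one char_hom)

lemma char_ext: "\<psi> \<in> characters p G \<Longrightarrow> \<phi> \<in> characters p G \<Longrightarrow>
    (\<And>g. g \<in> carrier G \<Longrightarrow> \<psi> g = \<phi> g) \<Longrightarrow> \<psi> = \<phi>"
  by (auto simp: characters_def intro: extensionalityI)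

lemma charI:
  assumes "\<And>g h. g \<in> carrier G \<Longrightarrow> h \<in> carrier G \<Longrightarrow> \<psi> (g \<otimes>\<^bsub>G\<^esub> h) = \<psi> g * \<psi> h"
    "\<And>g. g \<in> carrier G \<Longrightarrow> \<psi> g ^ p = 1"
  shows "restrict \<psi> (carrier G) \<in> characters p G"
  using assms by (auto simp: characters_def roots_of_unity_group_def hom_def)

definition "chi_pow i = (\<lambda>g\<in>carrier G. \<chi> g ^ i)"

lemma chi_pow_char: "chi_pow i \<in> characters p G"
  unfolding chi_pow_def
proof (rule charI)
  fix g assume "g \<in> carrier G"
  then have "(\<chi> g ^ p) ^ i = 1" using char_pow_p[OF \<chi>_char] by simp
  then show "(\<chi> g ^ i) ^ p = 1" by (simp add: power_mult[symmetric] mult.commute)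
qed (simp add: char_hom[OF \<chi>_char] power_mult_distrib)

lemma chi_pow_mod: "chi_pow (i mod p) = chi_pow i"
proof -
  have "\<chi> g ^ i = \<chi> g ^ (i mod p)" if "g \<in> carrier G" for g
  proof -
    have "\<chi> g ^ i = (\<chi> g ^ p) ^ (i div p) * \<chi> g ^ (i mod p)"
      by (simp add: power_mult[symmetric] power_add[symmetric])
    then show ?thesis using char_pow_p[OF \<chi>_char that] by simp
  qed
  then show ?thesis by (auto simp: chi_pow_def restrict_def)
qed

lemma chi_pow_mult: "(\<lambda>g\<in>carrier G. chi_pow i g * chi_pow j g) = chi_pow (i + j)"
  by (auto simp: chi_pow_def power_add restrict_def)

lemma chi_pow_0: "chi_pow 0 = (\<lambda>g\<in>carrier G. 1)"
  by (simp add: chi_pow_def)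

text \<open>A nontrivial character of a cyclic group of order \<open>p\<close> sends a generator to
  a \<open>p\<close>-th root of unity other than 1, which has exact order \<open>p\<close>; every
  element other than the identity is a power of the generator with exponent prime to
  \<open>p\<close>.\<close>

lemma chi_pow_eq_1:
  assumes "g \<in> carrier G" "g \<noteq> \<one>\<^bsub>G\<^esub>" "\<chi> g ^ i = 1" shows "p dvd i"
proof -
  obtain g0 where g0: "g0 \<in> carrier G" "carrier G = range (\<lambda>n::int. g0 [^]\<^bsub>G\<^esub> n)"
    using cyclic_G G.cyclic_group by blast
  have nat: "\<exists>n<p. h = g0 [^]\<^bsub>G\<^esub> n" if "h \<in> carrier G" for h
  proof -
    from that have "h \<in> range (\<lambda>n::int. g0 [^]\<^bsub>G\<^esub> n)" unfolding g0(2)[symmetric] .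
    then obtain n :: int where n: "h = g0 [^]\<^bsub>G\<^esub> n" by (elim rangeE)
    have pp: "g0 [^]\<^bsub>G\<^esub> int p = \<one>\<^bsub>G\<^esub>"
      using G.pow_order_eq_1[OF g0(1)] order_G by (simp add: int_pow_int)
    have "g0 [^]\<^bsub>G\<^esub> n = g0 [^]\<^bsub>G\<^esub> (int p * (n div int p) + n mod int p)" by simp
    also have "\<dots> = (g0 [^]\<^bsub>G\<^esub> int p) [^]\<^bsub>G\<^esub> (n div int p) \<otimes>\<^bsub>G\<^esub> g0 [^]\<^bsub>G\<^esub> (n mod int p)"
      using g0 by (simp only: G.int_pow_mult G.int_pow_pow)
    also have "\<dots> = g0 [^]\<^bsub>G\<^esub> (n mod int p)" using pp g0 by simp
    also have "\<dots> = g0 [^]\<^bsub>G\<^esub> nat (n mod int p)"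
      using p_pos by (metis int_nat_eq int_pow_int of_nat_0_less_iff pos_mod_sign)
    finally show ?thesis using n p_pos
      by (intro exI[of _ "nat (n mod int p)"]) (auto simp: nat_less_iff)
  qed
  define z where "z = \<chi> g0"
  have zp: "z ^ p = 1" using char_pow_p[OF \<chi>_char g0(1)] by (simp add: z_def)
  have z1: "z \<noteq> 1"
  proof
    assume "z = 1"
    then have "\<chi> h = 1" if "h \<in> carrier G" for h
      using nat[OF that] char_pow[OF \<chi>_char g0(1)] by (auto simp: z_def)
    then show False using \<chi>_nontriv by blast
  qed
  \<comment> \<open>Together with \<open>z^p = 1\<close>, a Bezout relation
    \<open>n x = p y + 1\<close> would give \<open>z = 1\<close>.\<close>
  have dvd: "p dvd n" if "z ^ n = 1" for n
  proof (rule ccontr)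
    assume "\<not> p dvd n"
    then have "coprime p n" using prime_p prime_imp_coprime by blast
    moreover have "n \<noteq> 0" using \<open>\<not> p dvd n\<close> by (metis dvd_0_right)
    ultimately obtain x y where "n * x = p * y + 1"
      using bezout_add_strong_nat[of n p] by (metis coprime_common_divisor_nat coprime_commute nat_dvd_1_iff_1)
    then have "(z ^ n) ^ x = (z ^ p) ^ y * z" by (metis power_add power_mult power_one_right)
    then show False using that zp z1 by simp
  qed
  obtain n where n: "n < p" "g = g0 [^]\<^bsub>G\<^esub> n" using nat assms(1) by blast
  then have "n \<noteq> 0" using assms(2) by (intro notI) simp
  then have "\<not> p dvd n" using n by (auto dest: dvd_imp_le)
  moreover have "z ^ (n * i) = 1"
    using assms(3) n g0 by (simp add: char_pow[OF \<chi>_char] z_def power_mult)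
  ultimately show ?thesis using dvd prime_p by (metis prime_dvd_mult_iff)
qed

lemma ex_nontrivial: "\<exists>g\<in>carrier G. g \<noteq> \<one>\<^bsub>G\<^esub>"
  using \<chi>_nontriv char_one[OF \<chi>_char] by metis

lemma chi_inj: "g \<in> carrier G \<Longrightarrow> h \<in> carrier G \<Longrightarrow> \<chi> g = \<chi> h \<Longrightarrow> g = h"
proof (rule ccontr)
  assume *: "g \<in> carrier G" "h \<in> carrier G" "\<chi> g = \<chi> h" "g \<noteq> h"
  have "\<chi> (inv\<^bsub>G\<^esub> g \<otimes>\<^bsub>G\<^esub> h) = \<chi> (inv\<^bsub>G\<^esub> g \<otimes>\<^bsub>G\<^esub> g)"
    using * by (simp only: char_hom[OF \<chi>_char] G.inv_closed)
  then have "\<chi> (inv\<^bsub>G\<^esub> g \<otimes>\<^bsub>G\<^esub> h) ^ 1 = 1" using * by (simp add: char_one[OF \<chi>_char])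
  moreover have "inv\<^bsub>G\<^esub> g \<otimes>\<^bsub>G\<^esub> h \<noteq> \<one>\<^bsub>G\<^esub>"
    using * by (metis G.inv_equality G.inv_inv G.inv_closed)
  ultimately have "p dvd 1" using chi_pow_eq_1[of "inv\<^bsub>G\<^esub> g \<otimes>\<^bsub>G\<^esub> h" 1] * by simp
  then show False using p_gt_1 by simp
qed

text \<open>A geometric sum in the \<open>p\<close>-th root of unity
  \<open>\<chi> h / \<chi> g\<close>, which equals 1 only for \<open>g = h\<close> because
  \<open>\<chi>\<close> is injective.\<close>

lemma orthogonality_powers:
  assumes "g \<in> carrier G" "h \<in> carrier G"
  shows "(\<Sum>i<p. \<chi> h ^ i * inverse (\<chi> g) ^ i) = (if g = h then of_nat p else 0)"
proof -
  have "(\<Sum>i<p. \<chi> h ^ i * inverse (\<chi> g) ^ i) = (\<Sum>i<p. (\<chi> h / \<chi> g) ^ i)"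
    by (simp add: power_divide field_simps power_inverse)
  also have "\<dots> = (if g = h then of_nat p else 0)"
  proof (cases "g = h")
    case True then show ?thesis using assms char_nonzero[OF \<chi>_char] by simp
  next
    case False
    then have "\<chi> h / \<chi> g \<noteq> 1" using assms chi_inj char_nonzero[OF \<chi>_char] by fastforce
    moreover have "(\<chi> h / \<chi> g) ^ p = 1" using assms char_pow_p[OF \<chi>_char] by (simp add: power_divide)
    ultimately show ?thesis using False by (simp add: geometric_sum)
  qed
  finally show ?thesis .
qed

text \<open>Translating the summation variable by some \<open>h\<close> multiplies the sum by its
  summand at \<open>h\<close>. For \<open>i \<noteq> j\<close> that summand differs from 1, so the
  sum vanishes.\<close>

lemma orthogonality_group:
  assumes "i < p" "j < p"
  shows "(\<Sum>g\<in>carrier G. \<chi> g ^ i * inverse (\<chi> g) ^ j) = (if i = j then of_nat p else 0)"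
proof (cases "i = j")
  case True
  have "\<chi> g ^ i * inverse (\<chi> g) ^ i = 1" if "g \<in> carrier G" for g
    using char_nonzero[OF \<chi>_char that] by (simp add: power_mult_distrib[symmetric])
  then show ?thesis using True order_G by (simp add: Coset.order_def)
next
  case False
  obtain h where h: "h \<in> carrier G" "h \<noteq> \<one>\<^bsub>G\<^esub>" using ex_nontrivial by blast
  let ?f = "\<lambda>g. \<chi> g ^ i * inverse (\<chi> g) ^ j"
  have nz: "\<chi> h \<noteq> 0" using h char_nonzero[OF \<chi>_char] by blast
  have "?f h \<noteq> 1"
  proof
    assume "?f h = 1"
    then have e: "\<chi> h ^ i = \<chi> h ^ j" using nz by (simp add: power_inverse field_simps)
    have "\<chi> h ^ (max i j - min i j) = 1"
      using e nz by (auto simp: max_def min_def power_diff)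
    then have "p dvd max i j - min i j" using chi_pow_eq_1 h by blast
    then show False using assms False by (auto simp: max_def min_def dest!: dvd_imp_le split: if_splits)
  qed
  have "(\<Sum>g\<in>carrier G. ?f g) = (\<Sum>g\<in>carrier G. ?f (h \<otimes>\<^bsub>G\<^esub> g))"
    by (rule sum.reindex_bij_witness[of _ "\<lambda>g. h \<otimes>\<^bsub>G\<^esub> g" "\<lambda>g. inv\<^bsub>G\<^esub> h \<otimes>\<^bsub>G\<^esub> g"])
      (use h in \<open>auto simp: G.m_assoc[symmetric]\<close>)
  also have "\<dots> = (\<Sum>g\<in>carrier G. ?f h * ?f g)"
    by (rule sum.cong) (use h in \<open>auto simp: char_hom[OF \<chi>_char] power_mult_distrib\<close>)
  also have "\<dots> = ?f h * (\<Sum>g\<in>carrier G. ?f g)" by (simp only: sum_distrib_left)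
  finally have "(\<Sum>g\<in>carrier G. ?f g) * (?f h - 1) = 0" by (simp add: algebra_simps)
  then show ?thesis using \<open>?f h \<noteq> 1\<close> False by simp
qed

lemma chi_pow_inj: "i < p \<Longrightarrow> j < p \<Longrightarrow> chi_pow i = chi_pow j \<Longrightarrow> i = j"
proof (rule ccontr)
  assume *: "i < p" "j < p" "chi_pow i = chi_pow j" "i \<noteq> j"
  have "\<chi> g ^ i = \<chi> g ^ j" if "g \<in> carrier G" for g
    using fun_cong[OF *(3), of g] that by (simp add: chi_pow_def)
  then have "(\<Sum>g\<in>carrier G. \<chi> g ^ i * inverse (\<chi> g) ^ j) = (\<Sum>g\<in>carrier G. \<chi> g ^ j * inverse (\<chi> g) ^ j)"
    by (intro sum.cong) simp_all
  then show False using * orthogonality_group of_nat_p by simp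
qed

text \<open>A character different from all powers of \<open>\<chi>\<close> would be orthogonal to
  each of them by the translation argument. Adding up these relations, the orthogonality over powers
  isolates the value at the identity and leaves \<open>p = 0\<close> in the field.\<close>

lemma characters_eq: "characters p G = chi_pow ` {..<p}"
proof
  show "chi_pow ` {..<p} \<subseteq> characters p G" using chi_pow_char by blast
  show "characters p G \<subseteq> chi_pow ` {..<p}"
  proof (rule subsetI, rule ccontr)
    fix \<psi> assume \<psi>: "\<psi> \<in> characters p G" and no: "\<psi> \<notin> chi_pow ` {..<p}"
    have z: "(\<Sum>g\<in>carrier G. \<psi> g * inverse (\<chi> g) ^ j) = 0" if j: "j < p" for j
    proof -
      let ?f = "\<lambda>g. \<psi> g * inverse (\<chi> g) ^ j"
      obtain h where h: "h \<in> carrier G" "\<psi> h \<noteq> \<chi> h ^ j"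
        using no j char_ext[OF \<psi> chi_pow_char, of j] by (auto simp: chi_pow_def)
      have "?f h \<noteq> 1"
        using h char_nonzero[OF \<chi>_char h(1)] by (auto simp: power_inverse field_simps)
      have "(\<Sum>g\<in>carrier G. ?f g) = (\<Sum>g\<in>carrier G. ?f (h \<otimes>\<^bsub>G\<^esub> g))"
        by (rule sum.reindex_bij_witness[of _ "\<lambda>g. h \<otimes>\<^bsub>G\<^esub> g" "\<lambda>g. inv\<^bsub>G\<^esub> h \<otimes>\<^bsub>G\<^esub> g"])
          (use h in \<open>auto simp: G.m_assoc[symmetric]\<close>)
      also have "\<dots> = (\<Sum>g\<in>carrier G. ?f h * ?f g)"
        by (rule sum.cong) (use h in \<open>auto simp: char_hom[OF \<chi>_char] char_hom[OF \<psi>] power_mult_distrib\<close>)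
      also have "\<dots> = ?f h * (\<Sum>g\<in>carrier G. ?f g)" by (simp only: sum_distrib_left)
      finally have "(\<Sum>g\<in>carrier G. ?f g) * (?f h - 1) = 0" by (simp add: algebra_simps)
      then show ?thesis using \<open>?f h \<noteq> 1\<close> by simp
    qed
    have "0 = (\<Sum>j<p. \<Sum>g\<in>carrier G. \<psi> g * inverse (\<chi> g) ^ j)" using z by simp
    also have "\<dots> = (\<Sum>g\<in>carrier G. \<psi> g * (\<Sum>j<p. \<chi> \<one>\<^bsub>G\<^esub> ^ j * inverse (\<chi> g) ^ j))"
      by (subst sum.swap) (simp add: sum_distrib_left char_one[OF \<chi>_char])
    also have "\<dots> = (\<Sum>g\<in>carrier G. if g = \<one>\<^bsub>G\<^esub> then of_nat p else 0)"
      by (rule sum.cong) (auto simp: orthogonality_powers char_one[OF \<psi>])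
    also have "\<dots> = of_nat p" using finite_G by simp
    finally show False using of_nat_p by simp
  qed
qed

end

section \<open>Extensions with a cyclic group action\<close>

locale kummer_base = prime_character G p \<chi>
  for G :: "'g monoid" and p :: nat and \<chi> :: "'g \<Rightarrow> 'k::field" +
  fixes R :: "'a ring" (structure) and c :: "'k \<Rightarrow> 'a"
  assumes crR: "cring R" and R_nontrivial: "\<one> \<noteq> \<zero>"
    and c_closed: "c a \<in> carrier R" and c_one: "c 1 = \<one>"
    and c_add: "c (a + b) = c a \<oplus> c b" and c_mult: "c (a * b) = c a \<otimes> c b"
begin
sublocale R: cring R by (rule crR)
end

text \<open>The condition on the fixed ring is added only in \<open>act_extn\<close>: for the
  polynomial model it is derived from a computation of traces, which already needs the
  action.\<close>

locale action_extn = kummer_base G p \<chi> R c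
  for G :: "'g monoid" and p :: nat and \<chi> :: "'g \<Rightarrow> 'k::field" and R :: "'a ring" and c :: "'k \<Rightarrow> 'a" +
  fixes S :: "('a, 'g, 's) gext" (structure)
  assumes crS: "cring S" and emb_hom: "emb S \<in> ring_hom R S" and emb_inj: "inj_on (emb S) (carrier R)"
    and act_hom: "g \<in> carrier G \<Longrightarrow> act S g \<in> ring_hom S S"
    and act_emb: "\<lbrakk>g \<in> carrier G; r \<in> carrier R\<rbrakk> \<Longrightarrow> act S g (emb S r) = emb S r"
    and act_one: "s \<in> carrier S \<Longrightarrow> act S \<one>\<^bsub>G\<^esub> s = s"
    and act_comp: "\<lbrakk>g \<in> carrier G; h \<in> carrier G; s \<in> carrier S\<rbrakk> \<Longrightarrow>
      act S (g \<otimes>\<^bsub>G\<^esub> h) s = act S g (act S h s)"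
begin

sublocale S: cring S by (rule crS)
sublocale E: ring_hom_cring R S "emb S"
  by (rule ring_hom_cringI) (rule crR crS emb_hom)+

definition "\<kappa> a = emb S (c a)"

lemma \<kappa>_closed [simp]: "\<kappa> a \<in> carrier S" by (simp add: \<kappa>_def c_closed)
lemma \<kappa>_one [simp]: "\<kappa> 1 = \<one>" by (simp add: \<kappa>_def c_one)
lemma \<kappa>_add: "\<kappa> (a + b) = \<kappa> a \<oplus> \<kappa> b" by (simp add: \<kappa>_def c_add c_closed)
lemma \<kappa>_mult: "\<kappa> (a * b) = \<kappa> a \<otimes> \<kappa> b" by (simp add: \<kappa>_def c_mult c_closed)
lemma \<kappa>_zero [simp]: "\<kappa> 0 = \<zero>"
  using \<kappa>_add[of 0 0] by (simp add: S.add.r_cancel_one')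
lemma \<kappa>_pow: "\<kappa> (a ^ n) = \<kappa> a [^] n"
  by (induction n) (simp_all add: \<kappa>_mult S.nat_pow_Suc S.m_comm)
lemma \<kappa>_sum: "finite I \<Longrightarrow> \<kappa> (sum f I) = (\<Oplus>i\<in>I. \<kappa> (f i))"
  by (induction I rule: finite_induct) (simp_all add: \<kappa>_add)

lemma act_closed [simp]: "g \<in> carrier G \<Longrightarrow> s \<in> carrier S \<Longrightarrow> act S g s \<in> carrier S"
  using act_hom by (metis ring_hom_closed)
lemma act_mult: "g \<in> carrier G \<Longrightarrow> s \<in> carrier S \<Longrightarrow> s' \<in> carrier S \<Longrightarrow>
   act S g (s \<otimes> s') = act S g s \<otimes> act S g s'"
  using act_hom by (metis ring_hom_mult)
lemma act_add: "g \<in> carrier G \<Longrightarrow> s \<in> carrier S \<Longrightarrow> s' \<in> carrier S \<Longrightarrow>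
   act S g (s \<oplus> s') = act S g s \<oplus> act S g s'"
  using act_hom by (metis ring_hom_add)
lemma act_1: "g \<in> carrier G \<Longrightarrow> act S g \<one> = \<one>"
  using act_hom by (metis ring_hom_one)
lemma act_0: "g \<in> carrier G \<Longrightarrow> act S g \<zero> = \<zero>"
  using act_add[of g "\<zero>" "\<zero>"] by (simp add: S.add.r_cancel_one')
lemma act_\<kappa>: "g \<in> carrier G \<Longrightarrow> act S g (\<kappa> a) = \<kappa> a"
  by (simp add: \<kappa>_def act_emb c_closed)
lemma act_pow: "g \<in> carrier G \<Longrightarrow> s \<in> carrier S \<Longrightarrow> act S g (s [^] (n::nat)) = act S g s [^] n"
  by (induction n) (simp_all add: act_1 act_mult)
lemma act_finsum: "\<lbrakk>g \<in> carrier G; finite I; f \<in> I \<rightarrow> carrier S\<rbrakk> \<Longrightarrow>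
   act S g (finsum S f I) = (\<Oplus>i\<in>I. act S g (f i))"
  by (rule additive_finsum) (auto simp: S.abelian_monoid_axioms act_0 act_add)

lemma image_translation:
  assumes h: "h \<in> carrier G" shows "(\<lambda>g. h \<otimes>\<^bsub>G\<^esub> g) ` carrier G = carrier G"
proof -
  have "g \<in> (\<lambda>g. h \<otimes>\<^bsub>G\<^esub> g) ` carrier G" if "g \<in> carrier G" for g
    by (rule image_eqI[of _ _ "inv\<^bsub>G\<^esub> h \<otimes>\<^bsub>G\<^esub> g"]) (use h that in \<open>auto simp: G.m_assoc[symmetric]\<close>)
  then show ?thesis using h by auto
qed

definition "trace s = (\<Oplus>g\<in>carrier G. act S g s)"

lemma trace_closed: "s \<in> carrier S \<Longrightarrow> trace s \<in> carrier S"
  unfolding trace_def by (rule S.finsum_closed) auto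

lemma trace_add: "s \<in> carrier S \<Longrightarrow> s' \<in> carrier S \<Longrightarrow> trace (s \<oplus> s') = trace s \<oplus> trace s'"
proof -
  assume s: "s \<in> carrier S" "s' \<in> carrier S"
  have "trace (s \<oplus> s') = (\<Oplus>g\<in>carrier G. act S g s \<oplus> act S g s')"
    unfolding trace_def by (rule S.finsum_cong') (use s in \<open>auto simp: act_add\<close>)
  also have "\<dots> = trace s \<oplus> trace s'"
    unfolding trace_def by (rule S.finsum_addf) (use s in auto)
  finally show ?thesis .
qed

lemma trace_zero: "trace \<zero> = \<zero>"
  using trace_add[of "\<zero>" "\<zero>"] trace_closed by (simp add: S.add.r_cancel_one')

text \<open>Each group element scales \<open>w\<close> by a character value, so the trace multiplies
  \<open>w\<close> by a character sum, which is \<open>p\<close> or 0.\<close>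

lemma eigenvector_trace:
  assumes w: "w \<in> carrier S" "\<And>g. g \<in> carrier G \<Longrightarrow> act S g w = \<kappa> (\<chi> g ^ i) \<otimes> w"
  shows "trace w = (if p dvd i then \<kappa> (of_nat p) \<otimes> w else \<zero>)"
proof -
  \<comment> \<open>Character sums are known for exponents below \<open>p\<close>, so
    \<open>i\<close> is reduced first; the trivial factor with exponent 0 gives the sum the shape of
    \<open>orthogonality_group\<close>.\<close>
  have "\<chi> g ^ i = \<chi> g ^ (i mod p) * inverse (\<chi> g) ^ 0" if "g \<in> carrier G" for g
    using fun_cong[OF chi_pow_mod, of i g] that by (simp add: chi_pow_def)
  then have "(\<Sum>g\<in>carrier G. \<chi> g ^ i) = (\<Sum>g\<in>carrier G. \<chi> g ^ (i mod p) * inverse (\<chi> g) ^ 0)"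
    by (intro sum.cong) auto
  also have "\<dots> = (if p dvd i then of_nat p else 0)"
    using orthogonality_group[of "i mod p" 0] p_pos by (simp add: dvd_eq_mod_eq_0)
  finally have sum: "(\<Sum>g\<in>carrier G. \<chi> g ^ i) = (if p dvd i then of_nat p else 0)" .
  have "trace w = (\<Oplus>g\<in>carrier G. \<kappa> (\<chi> g ^ i) \<otimes> w)"
    unfolding trace_def by (rule S.finsum_cong') (use w in auto)
  also have "\<dots> = (\<Oplus>g\<in>carrier G. \<kappa> (\<chi> g ^ i)) \<otimes> w"
    by (rule S.finsum_ldistr[symmetric]) (use w finite_G in auto)
  also have "\<dots> = \<kappa> (\<Sum>g\<in>carrier G. \<chi> g ^ i) \<otimes> w" by (simp add: \<kappa>_sum finite_G)
  finally show ?thesis using w(1) by (simp add: sum)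
qed

text \<open>On a fixed element the trace is multiplication by \<open>p\<close>, which can be undone
  by a constant.\<close>

lemma fixed_trace:
  assumes s: "s \<in> carrier S" "\<And>g. g \<in> carrier G \<Longrightarrow> act S g s = s"
    and tr: "trace s \<in> emb S ` carrier R"
  shows "s \<in> emb S ` carrier R"
proof -
  obtain r where r: "r \<in> carrier R" "trace s = emb S r" using tr by auto
  have "\<kappa> (of_nat p) \<otimes> s = emb S r"
    using eigenvector_trace[of s 0] s r by simp
  then have "\<kappa> (1 / of_nat p) \<otimes> (\<kappa> (of_nat p) \<otimes> s) = emb S (c (1 / of_nat p) \<otimes>\<^bsub>R\<^esub> r)"
    using r by (simp add: \<kappa>_def c_closed)
  moreover have "\<kappa> (1 / of_nat p) \<otimes> (\<kappa> (of_nat p) \<otimes> s) = s"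
    using s(1) of_nat_p by (simp add: S.m_assoc[symmetric] \<kappa>_mult[symmetric])
  ultimately show ?thesis using r c_closed by (metis R.m_closed image_eqI)
qed

end

locale act_extn = action_extn G p \<chi> R c S
  for G :: "'g monoid" and p :: nat and \<chi> :: "'g \<Rightarrow> 'k::field" and R :: "'a ring" and c :: "'k \<Rightarrow> 'a"
    and S :: "('a, 'g, 's) gext" (structure) +
  assumes fixed_emb: "\<lbrakk>s \<in> carrier S; \<And>g. g \<in> carrier G \<Longrightarrow> act S g s = s\<rbrakk> \<Longrightarrow> s \<in> emb S ` carrier R"
begin

text \<open>The index is a natural number and not a residue, so that multiplication simply adds
  indices; \<open>eigen_p\<close> and \<open>eigen_mod\<close> express the periodicity.\<close>

definition "eigen i = {s \<in> carrier S. \<forall>g\<in>carrier G. act S g s = \<kappa> (\<chi> g ^ i) \<otimes> s}"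

lemma eigen_closed: "s \<in> eigen i \<Longrightarrow> s \<in> carrier S" by (simp add: eigen_def)

lemma eigen_0: "eigen 0 = emb S ` carrier R"
proof
  show "eigen 0 \<subseteq> emb S ` carrier R" using fixed_emb by (auto simp: eigen_def)
  show "emb S ` carrier R \<subseteq> eigen 0" using act_emb by (auto simp: eigen_def)
qed

lemma eigen_mult:
  assumes "s \<in> eigen i" "s' \<in> eigen j" shows "s \<otimes> s' \<in> eigen (i + j)"
proof -
  have "act S g (s \<otimes> s') = \<kappa> (\<chi> g ^ (i + j)) \<otimes> (s \<otimes> s')" if "g \<in> carrier G" for g
  proof -
    have "act S g (s \<otimes> s') = (\<kappa> (\<chi> g ^ i) \<otimes> s) \<otimes> (\<kappa> (\<chi> g ^ j) \<otimes> s')"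
      using assms that by (simp add: act_mult eigen_def)
    also have "\<dots> = (\<kappa> (\<chi> g ^ i) \<otimes> \<kappa> (\<chi> g ^ j)) \<otimes> (s \<otimes> s')"
      using assms by (simp add: eigen_def S.m_ac)
    finally show ?thesis by (simp add: power_add \<kappa>_mult)
  qed
  then show ?thesis using assms by (simp add: eigen_def)
qed

lemma eigen_p: "eigen p = eigen 0"
  using char_pow_p[OF \<chi>_char] by (auto simp: eigen_def)

lemma emb_eigen: "r \<in> carrier R \<Longrightarrow> emb S r \<in> eigen 0" by (simp add: eigen_0)

text \<open>The discrete Fourier transform on the group, normalized by \<open>1/p\<close> so that no
  factor appears in the inversion formula.\<close>

definition "ft F i = (\<Oplus>g\<in>carrier G. \<kappa> (inverse (\<chi> g) ^ i / of_nat p) \<otimes> F g)"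

lemma ft_closed: "F \<in> carrier G \<rightarrow> carrier S \<Longrightarrow> ft F i \<in> carrier S"
  unfolding ft_def by (rule S.finsum_closed) (auto simp: Pi_iff)

lemma fourier_inversion:
  assumes F: "F \<in> carrier G \<rightarrow> carrier S" and h: "h \<in> carrier G"
  shows "(\<Oplus>i\<in>{..<p}. \<kappa> (\<chi> h ^ i) \<otimes> ft F i) = F h"
proof -
  have cl: "\<And>g. g \<in> carrier G \<Longrightarrow> F g \<in> carrier S" using F by auto
  have "(\<Oplus>i\<in>{..<p}. \<kappa> (\<chi> h ^ i) \<otimes> ft F i) =
     (\<Oplus>i\<in>{..<p}. \<Oplus>g\<in>carrier G. \<kappa> (\<chi> h ^ i) \<otimes> (\<kappa> (inverse (\<chi> g) ^ i / of_nat p) \<otimes> F g))"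
    unfolding ft_def
    by (intro S.finsum_cong' S.finsum_rdistr refl S.finsum_closed) (auto simp: finite_G cl)
  also have "\<dots> = (\<Oplus>g\<in>carrier G. \<Oplus>i\<in>{..<p}. \<kappa> (\<chi> h ^ i) \<otimes> (\<kappa> (inverse (\<chi> g) ^ i / of_nat p) \<otimes> F g))"
    by (rule S.finsum_commute) (auto simp: finite_G cl)
  also have "\<dots> = (\<Oplus>g\<in>carrier G. if h = g then F g else \<zero>)"
  proof (rule S.finsum_cong', rule refl)
    show "(\<lambda>g. if h = g then F g else \<zero>) \<in> carrier G \<rightarrow> carrier S" using cl by auto
    fix g assume g: "g \<in> carrier G"
    have "(\<Oplus>i\<in>{..<p}. \<kappa> (\<chi> h ^ i) \<otimes> (\<kappa> (inverse (\<chi> g) ^ i / of_nat p) \<otimes> F g))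
       = (\<Oplus>i\<in>{..<p}. \<kappa> (\<chi> h ^ i * inverse (\<chi> g) ^ i / of_nat p) \<otimes> F g)"
      by (rule S.finsum_cong') (auto simp: cl[OF g] S.m_assoc[symmetric] \<kappa>_mult[symmetric])
    also have "\<dots> = (\<Oplus>i\<in>{..<p}. \<kappa> (\<chi> h ^ i * inverse (\<chi> g) ^ i / of_nat p)) \<otimes> F g"
      by (rule S.finsum_ldistr[symmetric]) (auto simp: cl[OF g])
    also have "\<dots> = \<kappa> ((\<Sum>i<p. \<chi> h ^ i * inverse (\<chi> g) ^ i) / of_nat p) \<otimes> F g"
      by (simp add: \<kappa>_sum[symmetric] sum_divide_distrib)
    also have "\<dots> = (if h = g then F g else \<zero>)"
      using orthogonality_powers[OF g h] cl[OF g] of_nat_p by auto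
    finally show "(\<Oplus>i\<in>{..<p}. \<kappa> (\<chi> h ^ i) \<otimes> (\<kappa> (inverse (\<chi> g) ^ i / of_nat p) \<otimes> F g))
       = (if h = g then F g else \<zero>)" .
  qed
  also have "\<dots> = F h"
    by (rule S.finsum_singleton) (use h finite_G F in auto)
  finally show ?thesis .
qed

lemma fourier_coefficient:
  assumes x: "x \<in> {..<p} \<rightarrow> carrier S" and j: "j < p"
  shows "ft (\<lambda>g. \<Oplus>i\<in>{..<p}. \<kappa> (\<chi> g ^ i) \<otimes> x i) j = x j"
proof -
  have cl: "\<And>i. i < p \<Longrightarrow> x i \<in> carrier S" using x by auto
  have "ft (\<lambda>g. \<Oplus>i\<in>{..<p}. \<kappa> (\<chi> g ^ i) \<otimes> x i) j =
     (\<Oplus>g\<in>carrier G. \<Oplus>i\<in>{..<p}. \<kappa> (inverse (\<chi> g) ^ j / of_nat p) \<otimes> (\<kappa> (\<chi> g ^ i) \<otimes> x i))"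
    unfolding ft_def
    by (intro S.finsum_cong' S.finsum_rdistr refl S.finsum_closed) (auto simp: cl)
  also have "\<dots> = (\<Oplus>i\<in>{..<p}. \<Oplus>g\<in>carrier G. \<kappa> (inverse (\<chi> g) ^ j / of_nat p) \<otimes> (\<kappa> (\<chi> g ^ i) \<otimes> x i))"
    by (rule S.finsum_commute) (auto simp: finite_G cl)
  also have "\<dots> = (\<Oplus>i\<in>{..<p}. if j = i then x i else \<zero>)"
  proof (rule S.finsum_cong', rule refl)
    show "(\<lambda>i. if j = i then x i else \<zero>) \<in> {..<p} \<rightarrow> carrier S" using cl by auto
    fix i assume i: "i \<in> {..<p}"
    have "(\<Oplus>g\<in>carrier G. \<kappa> (inverse (\<chi> g) ^ j / of_nat p) \<otimes> (\<kappa> (\<chi> g ^ i) \<otimes> x i))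
       = (\<Oplus>g\<in>carrier G. \<kappa> (\<chi> g ^ i * inverse (\<chi> g) ^ j / of_nat p) \<otimes> x i)"
      by (rule S.finsum_cong') (use cl i in \<open>auto simp: S.m_assoc[symmetric] \<kappa>_mult[symmetric] mult.commute\<close>)
    also have "\<dots> = (\<Oplus>g\<in>carrier G. \<kappa> (\<chi> g ^ i * inverse (\<chi> g) ^ j / of_nat p)) \<otimes> x i"
      by (rule S.finsum_ldistr[symmetric]) (use finite_G cl i in auto)
    also have "\<dots> = \<kappa> ((\<Sum>g\<in>carrier G. \<chi> g ^ i * inverse (\<chi> g) ^ j) / of_nat p) \<otimes> x i"
      by (simp add: \<kappa>_sum[symmetric] sum_divide_distrib finite_G)
    also have "\<dots> = (if j = i then x i else \<zero>)"
      using orthogonality_group[of i j] i j cl of_nat_p by auto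
    finally show "(\<Oplus>g\<in>carrier G. \<kappa> (inverse (\<chi> g) ^ j / of_nat p) \<otimes> (\<kappa> (\<chi> g ^ i) \<otimes> x i))
       = (if j = i then x i else \<zero>)" .
  qed
  also have "\<dots> = x j"
    by (rule S.finsum_singleton) (use j x in auto)
  finally show ?thesis .
qed

text \<open>The Fourier transform of the orbit of \<open>s\<close> is the projection to the
  eigenspace of index \<open>i\<close>.\<close>

definition "proj i s = ft (\<lambda>g. act S g s) i"

lemma proj_closed [simp]: "s \<in> carrier S \<Longrightarrow> proj i s \<in> carrier S"
  unfolding proj_def by (rule ft_closed) auto

lemma proj_eigen: assumes s: "s \<in> carrier S" shows "proj i s \<in> eigen i"
proof -
  have "act S h (proj i s) = \<kappa> (\<chi> h ^ i) \<otimes> proj i s" if h: "h \<in> carrier G" for h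
  proof -
    have "act S h (proj i s) = (\<Oplus>g\<in>carrier G. act S h (\<kappa> (inverse (\<chi> g) ^ i / of_nat p) \<otimes> act S g s))"
      unfolding proj_def ft_def by (rule act_finsum) (use h finite_G s in auto)
    \<comment> \<open>Everything is rewritten in terms of \<open>h g\<close>: the factor
      \<open>\<chi> h ^ i\<close> compensates the shift of the weight, and translation by
      \<open>h\<close> then permutes the summands.\<close>
    also have "\<dots> = (\<Oplus>g\<in>carrier G. \<kappa> (\<chi> h ^ i) \<otimes> (\<kappa> (inverse (\<chi> (h \<otimes>\<^bsub>G\<^esub> g)) ^ i / of_nat p) \<otimes> act S (h \<otimes>\<^bsub>G\<^esub> g) s))"
    proof (rule S.finsum_cong', rule refl)
      show "(\<lambda>g. \<kappa> (\<chi> h ^ i) \<otimes> (\<kappa> (inverse (\<chi> (h \<otimes>\<^bsub>G\<^esub> g)) ^ i / of_nat p) \<otimes> act S (h \<otimes>\<^bsub>G\<^esub> g) s))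
        \<in> carrier G \<rightarrow> carrier S" using h s by auto
      fix g assume g: "g \<in> carrier G"
      have e: "inverse (\<chi> g) ^ i / of_nat p = \<chi> h ^ i * (inverse (\<chi> (h \<otimes>\<^bsub>G\<^esub> g)) ^ i / of_nat p)"
        using h g char_nonzero[OF \<chi>_char] by (simp add: char_hom[OF \<chi>_char] power_inverse power_mult_distrib)
      have "act S h (\<kappa> (inverse (\<chi> g) ^ i / of_nat p) \<otimes> act S g s) = \<kappa> (inverse (\<chi> g) ^ i / of_nat p) \<otimes> act S (h \<otimes>\<^bsub>G\<^esub> g) s"
        using h g s by (simp add: act_mult act_\<kappa> act_comp)
      also have "\<dots> = \<kappa> (\<chi> h ^ i) \<otimes> (\<kappa> (inverse (\<chi> (h \<otimes>\<^bsub>G\<^esub> g)) ^ i / of_nat p) \<otimes> act S (h \<otimes>\<^bsub>G\<^esub> g) s)"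
        unfolding e \<kappa>_mult using h g s by (simp add: S.m_assoc)
      finally show "act S h (\<kappa> (inverse (\<chi> g) ^ i / of_nat p) \<otimes> act S g s)
        = \<kappa> (\<chi> h ^ i) \<otimes> (\<kappa> (inverse (\<chi> (h \<otimes>\<^bsub>G\<^esub> g)) ^ i / of_nat p) \<otimes> act S (h \<otimes>\<^bsub>G\<^esub> g) s)" .
    qed
    also have "\<dots> = \<kappa> (\<chi> h ^ i) \<otimes> (\<Oplus>g\<in>carrier G. \<kappa> (inverse (\<chi> (h \<otimes>\<^bsub>G\<^esub> g)) ^ i / of_nat p) \<otimes> act S (h \<otimes>\<^bsub>G\<^esub> g) s)"
      by (rule S.finsum_rdistr[symmetric]) (use h s finite_G in auto)
    also have "(\<Oplus>g\<in>carrier G. \<kappa> (inverse (\<chi> (h \<otimes>\<^bsub>G\<^esub> g)) ^ i / of_nat p) \<otimes> act S (h \<otimes>\<^bsub>G\<^esub> g) s) =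
       (\<Oplus>g\<in>(\<lambda>g. h \<otimes>\<^bsub>G\<^esub> g) ` carrier G. \<kappa> (inverse (\<chi> g) ^ i / of_nat p) \<otimes> act S g s)"
      by (rule S.finsum_reindex[symmetric]) (use h s in \<open>auto simp: inj_on_def\<close>)
    finally show ?thesis unfolding image_translation[OF h] proj_def ft_def .
  qed
  then show ?thesis using s by (simp add: eigen_def)
qed

lemma proj_sum: assumes s: "s \<in> carrier S" shows "(\<Oplus>i\<in>{..<p}. proj i s) = s"
proof -
  have "(\<Oplus>i\<in>{..<p}. proj i s) = (\<Oplus>i\<in>{..<p}. \<kappa> (\<chi> \<one>\<^bsub>G\<^esub> ^ i) \<otimes> proj i s)"
    by (rule S.finsum_cong') (use s in \<open>auto simp: char_one[OF \<chi>_char]\<close>)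
  also have "\<dots> = s"
    unfolding proj_def by (subst fourier_inversion) (use s act_one in auto)
  finally show ?thesis .
qed

text \<open>The sum of the eigenspaces is direct: as \<open>g\<close> varies, its action turns the
  sum into a Fourier series with coefficients \<open>x i\<close>, and these are unique.\<close>

lemma proj_eigen_sum:
  assumes x: "\<And>i. i < p \<Longrightarrow> x i \<in> eigen i" and j: "j < p"
  shows "proj j (\<Oplus>i\<in>{..<p}. x i) = x j"
proof -
  have cl: "\<And>i. i < p \<Longrightarrow> x i \<in> carrier S" using x eigen_closed by blast
  have a: "act S g (\<Oplus>i\<in>{..<p}. x i) = (\<Oplus>i\<in>{..<p}. \<kappa> (\<chi> g ^ i) \<otimes> x i)"
    if "g \<in> carrier G" for g
  proof -
    have "act S g (\<Oplus>i\<in>{..<p}. x i) = (\<Oplus>i\<in>{..<p}. act S g (x i))"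
      by (rule act_finsum) (use that cl in auto)
    also have "\<dots> = (\<Oplus>i\<in>{..<p}. \<kappa> (\<chi> g ^ i) \<otimes> x i)"
      by (rule S.finsum_cong') (use that x cl in \<open>auto simp: eigen_def\<close>)
    finally show ?thesis .
  qed
  have "proj j (\<Oplus>i\<in>{..<p}. x i) = ft (\<lambda>g. \<Oplus>i\<in>{..<p}. \<kappa> (\<chi> g ^ i) \<otimes> x i) j"
    unfolding proj_def ft_def
    by (rule S.finsum_cong') (use a cl in \<open>auto intro!: S.finsum_closed\<close>)
  also have "\<dots> = x j" by (rule fourier_coefficient) (use cl j in auto)
  finally show ?thesis .
qed

lemma ft_add:
  assumes "F \<in> carrier G \<rightarrow> carrier S" "F' \<in> carrier G \<rightarrow> carrier S"
  shows "ft (\<lambda>g. F g \<oplus> F' g) i = ft F i \<oplus> ft F' i"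
proof -
  have "ft (\<lambda>g. F g \<oplus> F' g) i = (\<Oplus>g\<in>carrier G. \<kappa> (inverse (\<chi> g) ^ i / of_nat p) \<otimes> F g
     \<oplus> \<kappa> (inverse (\<chi> g) ^ i / of_nat p) \<otimes> F' g)"
    unfolding ft_def by (rule S.finsum_cong') (use assms in \<open>auto simp: Pi_iff S.r_distr\<close>)
  also have "\<dots> = ft F i \<oplus> ft F' i"
    unfolding ft_def by (rule S.finsum_addf) (use assms in \<open>auto simp: Pi_iff\<close>)
  finally show ?thesis .
qed

lemma proj_add: "s \<in> carrier S \<Longrightarrow> s' \<in> carrier S \<Longrightarrow> proj i (s \<oplus> s') = proj i s \<oplus> proj i s'"
proof -
  assume s: "s \<in> carrier S" "s' \<in> carrier S"
  have "proj i (s \<oplus> s') = ft (\<lambda>g. act S g s \<oplus> act S g s') i"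
    unfolding proj_def ft_def by (rule S.finsum_cong') (use s in \<open>auto simp: act_add\<close>)
  also have "\<dots> = proj i s \<oplus> proj i s'" unfolding proj_def by (rule ft_add) (use s in auto)
  finally show ?thesis .
qed

text \<open>Since \<open>i + j = p\<close>, the factor by which \<open>g\<close> scales
  \<open>b\<close> equals the weight in the projector of index \<open>i\<close>; absorbing it leaves
  the plain average over the group.\<close>

lemma proj_eigen_mult:
  assumes b: "b \<in> eigen j" and s: "s \<in> carrier S" and ij: "i + j = p"
  shows "proj i s \<otimes> b = proj 0 (s \<otimes> b)"
proof -
  have bc: "b \<in> carrier S" using b eigen_closed by blast
  have "proj i s \<otimes> b = (\<Oplus>g\<in>carrier G. (\<kappa> (inverse (\<chi> g) ^ i / of_nat p) \<otimes> act S g s) \<otimes> b)"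
    unfolding proj_def ft_def by (rule S.finsum_ldistr) (use finite_G s bc in auto)
  also have "\<dots> = (\<Oplus>g\<in>carrier G. \<kappa> (inverse (\<chi> g) ^ 0 / of_nat p) \<otimes> act S g (s \<otimes> b))"
  proof (rule S.finsum_cong', rule refl)
    show "(\<lambda>g. \<kappa> (inverse (\<chi> g) ^ 0 / of_nat p) \<otimes> act S g (s \<otimes> b)) \<in> carrier G \<rightarrow> carrier S"
      using s bc by auto
    fix g assume g: "g \<in> carrier G"
    have "\<chi> g ^ i * \<chi> g ^ j = 1" using char_pow_p[OF \<chi>_char g] by (simp add: power_add[symmetric] ij)
    then have e: "inverse (\<chi> g) ^ i / of_nat p = 1 / of_nat p * \<chi> g ^ j"
      by (simp add: power_inverse inverse_unique)
    have "act S g (s \<otimes> b) = act S g s \<otimes> (\<kappa> (\<chi> g ^ j) \<otimes> b)"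
      using g s bc b by (simp add: act_mult eigen_def)
    then show "(\<kappa> (inverse (\<chi> g) ^ i / of_nat p) \<otimes> act S g s) \<otimes> b
       = \<kappa> (inverse (\<chi> g) ^ 0 / of_nat p) \<otimes> act S g (s \<otimes> b)"
      unfolding e \<kappa>_mult using g s bc by (simp add: S.m_ac)
  qed
  finally show ?thesis unfolding proj_def ft_def .
qed

end

section \<open>Submodules and products\<close>

lemma module_via_simps [simp]:
  "carrier (module_via \<iota> S V) = V" "monoid.mult (module_via \<iota> S V) = monoid.mult S"
  "monoid.one (module_via \<iota> S V) = monoid.one S" "ring.zero (module_via \<iota> S V) = ring.zero S"
  "ring.add (module_via \<iota> S V) = ring.add S" "module.smult (module_via \<iota> S V) = (\<lambda>r s. \<iota> r \<otimes>\<^bsub>S\<^esub> s)"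
  by (simp_all add: module_via_def)

lemma abelian_group_module_via:
  assumes "abelian_group S" "V \<subseteq> carrier S" "\<zero>\<^bsub>S\<^esub> \<in> V"
    and "\<And>x y. x \<in> V \<Longrightarrow> y \<in> V \<Longrightarrow> x \<oplus>\<^bsub>S\<^esub> y \<in> V" "\<And>x. x \<in> V \<Longrightarrow> \<ominus>\<^bsub>S\<^esub> x \<in> V"
  shows "abelian_group (module_via \<iota> S V)"
proof -
  interpret S: abelian_group S by fact
  show ?thesis
  proof (rule abelian_groupI, goal_cases)
    case (6 x)
    then show ?case using assms by (intro bexI[of _ "\<ominus>\<^bsub>S\<^esub> x"]) (auto simp: S.l_neg)
  qed (use assms in \<open>auto simp: S.a_ac subset_iff\<close>)
qed

lemma finsum_module_via:
  assumes "abelian_group S" "abelian_group (module_via \<iota> S V)" "V \<subseteq> carrier S" "finite I" "f \<in> I \<rightarrow> V"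
  shows "finsum (module_via \<iota> S V) f I = finsum S f I"
  using additive_finsum[of "module_via \<iota> S V" S I f "\<lambda>x. x"] assms
  by (auto simp: abelian_group.axioms)

lemma self_module_eq: "self_module S = module_via (emb S) S (carrier S)"
  by (simp add: self_module_def)

lemma cring_module_via:
  assumes "cring S" shows "cring (module_via \<iota> S (carrier S))"
proof -
  interpret S: cring S by fact
  show ?thesis
    by (rule cringI)
      (auto intro!: abelian_group_module_via comm_monoidI simp: S.abelian_group_axioms S.m_ac,
        simp add: S.r_distr S.m_comm)
qed

lemma prod_ring_simps [simp]:
  "carrier (prod_ring I R) = (\<Pi>\<^sub>E i\<in>I. carrier (R i))"
  "f \<otimes>\<^bsub>prod_ring I R\<^esub> g = (\<lambda>i\<in>I. f i \<otimes>\<^bsub>R i\<^esub> g i)"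
  "f \<oplus>\<^bsub>prod_ring I R\<^esub> g = (\<lambda>i\<in>I. f i \<oplus>\<^bsub>R i\<^esub> g i)"
  "\<one>\<^bsub>prod_ring I R\<^esub> = (\<lambda>i\<in>I. \<one>\<^bsub>R i\<^esub>)" "\<zero>\<^bsub>prod_ring I R\<^esub> = (\<lambda>i\<in>I. \<zero>\<^bsub>R i\<^esub>)"
  by (simp_all add: prod_ring_def)

lemma cring_prod_ring:
  assumes "\<And>i. i \<in> I \<Longrightarrow> cring (R i)"
  shows "cring (prod_ring I R)"
proof (rule cringI)
  have cr: "abelian_group (R i)" "comm_monoid (R i)" "monoid (R i)" if "i \<in> I" for i
    using assms[OF that] by (auto simp: cring_def ring_def comm_monoid_def)
  have l: "\<And>i x y z. \<lbrakk>i \<in> I; x \<in> carrier (R i); y \<in> carrier (R i); z \<in> carrier (R i)\<rbrakk> \<Longrightarrow>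
     (x \<oplus>\<^bsub>R i\<^esub> y) \<otimes>\<^bsub>R i\<^esub> z = x \<otimes>\<^bsub>R i\<^esub> z \<oplus>\<^bsub>R i\<^esub> y \<otimes>\<^bsub>R i\<^esub> z"
    using assms by (meson cring.axioms(1) ring.ring_simprules(13))
  show "abelian_group (prod_ring I R)"
  proof (rule abelian_groupI, goal_cases)
    case (6 x)
    have "(\<lambda>i\<in>I. \<ominus>\<^bsub>R i\<^esub> x i) \<in> carrier (prod_ring I R)"
      using 6 cr(1) by (auto simp: PiE_iff intro: abelian_group.a_inv_closed)
    moreover have "(\<lambda>i\<in>I. \<ominus>\<^bsub>R i\<^esub> x i) \<oplus>\<^bsub>prod_ring I R\<^esub> x = \<zero>\<^bsub>prod_ring I R\<^esub>"
      using 6 cr(1) by (auto simp: PiE_iff abelian_group.l_neg restrict_def)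
    ultimately show ?case by blast
  next
    case (1 x y) then show ?case using cr(1)
      by (auto simp: PiE_iff intro: abelian_monoid.a_closed abelian_group.axioms)
  next
    case 2 then show ?case using cr(1)
      by (auto simp: PiE_iff intro: abelian_monoid.zero_closed abelian_group.axioms)
  next
    case (3 x y z) then show ?case using cr(1)
      by (auto simp: PiE_iff restrict_def abelian_monoid.a_assoc[OF abelian_group.axioms(1)])
  next
    case (4 x y) then show ?case using cr(1)
      by (auto simp: PiE_iff restrict_def abelian_monoid.a_comm[OF abelian_group.axioms(1)])
  next
    case (5 x) then show ?case using cr(1)
      by (auto simp: PiE_iff restrict_def extensional_def abelian_monoid.l_zero[OF abelian_group.axioms(1)])
  qed
  show "comm_monoid (prod_ring I R)"
  proof (rule comm_monoidI, goal_cases)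
    case (1 x y) then show ?case using cr(3) by (auto simp: PiE_iff intro: monoid.m_closed)
  next
    case 2 then show ?case using cr(3) by (auto simp: PiE_iff intro: monoid.one_closed)
  next
    case (3 x y z) then show ?case using cr(3) by (auto simp: PiE_iff restrict_def monoid.m_assoc)
  next
    case (4 x) then show ?case using cr(3) by (auto simp: PiE_iff restrict_def extensional_def monoid.l_one)
  next
    case (5 x y) then show ?case using cr(2) by (auto simp: PiE_iff restrict_def comm_monoid.m_comm)
  qed
  fix x y z assume "x \<in> carrier (prod_ring I R)" "y \<in> carrier (prod_ring I R)" "z \<in> carrier (prod_ring I R)"
  then show "(x \<oplus>\<^bsub>prod_ring I R\<^esub> y) \<otimes>\<^bsub>prod_ring I R\<^esub> z
     = x \<otimes>\<^bsub>prod_ring I R\<^esub> z \<oplus>\<^bsub>prod_ring I R\<^esub> y \<otimes>\<^bsub>prod_ring I R\<^esub> z"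
    using l by (auto simp: PiE_iff restrict_def)
qed

lemma finsum_prod_ring:
  assumes "\<And>i. i \<in> I \<Longrightarrow> cring (R i)" "finite J" "f \<in> J \<rightarrow> carrier (prod_ring I R)" "i \<in> I"
  shows "finsum (prod_ring I R) f J i = finsum (R i) (\<lambda>j. f j i) J"
proof (rule additive_finsum[where h = "\<lambda>f. f i"])
  interpret P: cring "prod_ring I R" by (rule cring_prod_ring) (rule assms(1))
  interpret Ri: cring "R i" by (rule assms(1)) fact
  show "abelian_monoid (prod_ring I R)" by (rule P.abelian_monoid_axioms)
  show "abelian_monoid (R i)" by (rule Ri.abelian_monoid_axioms)
qed (use assms in \<open>auto simp: PiE_iff\<close>)

section \<open>Kummer extensions\<close>

text \<open>The coefficients of a product of two polynomials of degree below \<open>p\<close> modulo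
  \<open>T^p - t\<close>: passing degree \<open>p\<close> costs a factor \<open>t\<close>.\<close>

definition (in kummer_base) conv :: "'a \<Rightarrow> (nat \<Rightarrow> 'a) \<Rightarrow> (nat \<Rightarrow> 'a) \<Rightarrow> nat \<Rightarrow> 'a" where
  "conv t r q l = finsum R (\<lambda>(i, j). if i + j < p then r i \<otimes> q j else t \<otimes> (r i \<otimes> q j))
     {(i, j). i < p \<and> j < p \<and> (i + j) mod p = l}"

text \<open>A description of \<open>R[T]/(T^p - t)\<close> that is independent of any model, with
  \<open>u\<close> in the role of \<open>T\<close>. Every construction of an extension below is
  recognized through it.\<close>

locale kummer_extn = act_extn G p \<chi> R c S
  for G :: "'g monoid" and p :: nat and \<chi> :: "'g \<Rightarrow> 'k::field" and R :: "'a ring" and c :: "'k \<Rightarrow> 'a"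
    and S :: "('a, 'g, 's) gext" (structure) +
  fixes u t
  assumes u_closed [simp]: "u \<in> carrier S"
    and act_u: "g \<in> carrier G \<Longrightarrow> act S g u = emb S (c (\<chi> g)) \<otimes> u"
    and u_pow: "u [^] p = emb S t" and t_unit: "t \<in> Units R"
begin

lemma t_closed [simp]: "t \<in> carrier R" using t_unit by (rule R.Units_closed)

lemma u_unit: "u \<in> Units S"
proof -
  let ?v = "u [^] (p - 1) \<otimes> emb S (inv\<^bsub>R\<^esub> t)"
  have "u \<otimes> ?v = (u [^] (p - 1) \<otimes> u) \<otimes> emb S (inv\<^bsub>R\<^esub> t)"
    using t_unit by (simp add: S.m_ac)
  also have "u [^] (p - 1) \<otimes> u = emb S t"
    using p_pos u_pow by (metis S.nat_pow_Suc Suc_pred' One_nat_def)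
  also have "emb S t \<otimes> emb S (inv\<^bsub>R\<^esub> t) = \<one>"
    using t_unit by (simp flip: E.hom_mult)
  finally have "u \<otimes> ?v = \<one>" .
  moreover have vc: "?v \<in> carrier S" using t_unit by simp
  ultimately show ?thesis
    unfolding Units_def using S.m_comm[OF vc u_closed] u_closed by auto
qed

lemma u_eigen: "u [^] i \<in> eigen i"
proof -
  have "act S g (u [^] i) = \<kappa> (\<chi> g ^ i) \<otimes> u [^] i" if "g \<in> carrier G" for g
    using that by (simp add: act_pow act_u \<kappa>_pow S.nat_pow_distrib flip: \<kappa>_def)
  then show ?thesis by (simp add: eigen_def)
qed

lemma emb_u_eigen: "r \<in> carrier R \<Longrightarrow> emb S r \<otimes> u [^] i \<in> eigen i"
  using eigen_mult[OF emb_eigen u_eigen, of r i] by simp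

text \<open>Multiplication by \<open>u^(p - i)\<close> moves an eigenvector of index
  \<open>i\<close> into the fixed ring; multiplying by \<open>u^i\<close> and dividing by
  \<open>t\<close> brings it back.\<close>

lemma eigen_coef:
  assumes "i < p" "s \<in> eigen i" shows "\<exists>r\<in>carrier R. s = emb S r \<otimes> u [^] i"
proof -
  have s: "s \<in> carrier S" using assms(2) by (rule eigen_closed)
  have "s \<otimes> u [^] (p - i) \<in> eigen 0"
    using eigen_mult[OF assms(2) u_eigen[of "p - i"]] assms(1) by (simp add: eigen_p)
  then obtain r where r: "r \<in> carrier R" "s \<otimes> u [^] (p - i) = emb S r"
    by (auto simp: eigen_0)
  have "emb S (r \<otimes>\<^bsub>R\<^esub> inv\<^bsub>R\<^esub> t) \<otimes> u [^] i
      = (s \<otimes> emb S (inv\<^bsub>R\<^esub> t)) \<otimes> (u [^] (p - i) \<otimes> u [^] i)"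
    using r s t_unit by (simp add: r(2)[symmetric] S.m_ac)
  also have "u [^] (p - i) \<otimes> u [^] i = emb S t"
    using assms(1) u_pow by (simp add: S.nat_pow_mult)
  also have "(s \<otimes> emb S (inv\<^bsub>R\<^esub> t)) \<otimes> emb S t = s \<otimes> emb S (inv\<^bsub>R\<^esub> t \<otimes>\<^bsub>R\<^esub> t)"
    using s t_unit by (simp add: S.m_assoc del: R.Units_l_inv)
  also have "\<dots> = s" using s t_unit by simp
  finally show ?thesis using r t_unit by (intro bexI[of _ "r \<otimes>\<^bsub>R\<^esub> inv\<^bsub>R\<^esub> t"]) auto
qed

lemma emb_u_inj:
  assumes "r \<in> carrier R" "r' \<in> carrier R" "emb S r \<otimes> u [^] (i::nat) = emb S r' \<otimes> u [^] i"
  shows "r = r'"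
proof -
  have u: "u [^] i \<in> Units S" using u_unit by (rule S.Units_pow_closed)
  have "u [^] i \<otimes> emb S r = u [^] i \<otimes> emb S r'"
    using assms by (simp add: S.m_comm)
  then have "emb S r = emb S r'" using u assms by (simp add: S.Units_l_cancel)
  then show ?thesis using emb_inj assms by (auto dest: inj_onD)
qed

definition "coef i s = (THE r. r \<in> carrier R \<and> proj i s = emb S r \<otimes> u [^] i)"

lemma coef:
  assumes "i < p" "s \<in> carrier S"
  shows "coef i s \<in> carrier R \<and> proj i s = emb S (coef i s) \<otimes> u [^] i"
  unfolding coef_def
proof (rule theI')
  show "\<exists>!r. r \<in> carrier R \<and> proj i s = emb S r \<otimes> u [^] i"
    using eigen_coef[OF assms(1) proj_eigen[OF assms(2)]] emb_u_inj by (metis (no_types, lifting))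
qed

lemma coef_closed [simp]: "i < p \<Longrightarrow> s \<in> carrier S \<Longrightarrow> coef i s \<in> carrier R"
  using coef by blast

definition "lin r = (\<Oplus>i\<in>{..<p}. emb S (r i) \<otimes> u [^] i)"

lemma lin_closed [simp]: "r \<in> {..<p} \<rightarrow> carrier R \<Longrightarrow> lin r \<in> carrier S"
  unfolding lin_def by (rule S.finsum_closed) (auto simp: Pi_iff)

lemma lin_cong: "(\<And>i. i < p \<Longrightarrow> r i = q i) \<Longrightarrow> q \<in> {..<p} \<rightarrow> carrier R \<Longrightarrow> lin r = lin q"
  unfolding lin_def by (rule S.finsum_cong') (auto simp: Pi_iff)

lemma lin_coef: assumes "s \<in> carrier S" shows "lin (\<lambda>i. coef i s) = s"
proof -
  have "lin (\<lambda>i. coef i s) = (\<Oplus>i\<in>{..<p}. proj i s)"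
    unfolding lin_def by (rule S.finsum_cong') (use coef assms in auto)
  then show ?thesis using proj_sum assms by simp
qed

lemma coef_lin: assumes "r \<in> {..<p} \<rightarrow> carrier R" "j < p" shows "coef j (lin r) = r j"
proof -
  have "proj j (lin r) = emb S (r j) \<otimes> u [^] j"
    unfolding lin_def by (rule proj_eigen_sum) (use assms emb_u_eigen in auto)
  then have "emb S (coef j (lin r)) \<otimes> u [^] j = emb S (r j) \<otimes> u [^] j"
    using coef[OF assms(2) lin_closed[OF assms(1)]] by simp
  then show ?thesis using emb_u_inj assms by (auto simp: Pi_iff)
qed

lemma coef_eq: "s = lin r \<Longrightarrow> r \<in> {..<p} \<rightarrow> carrier R \<Longrightarrow> j < p \<Longrightarrow> coef j s = r j"
  using coef_lin by simp

lemma lin_add: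
  assumes "r \<in> {..<p} \<rightarrow> carrier R" "q \<in> {..<p} \<rightarrow> carrier R"
  shows "lin (\<lambda>i. r i \<oplus>\<^bsub>R\<^esub> q i) = lin r \<oplus> lin q"
proof -
  have "lin (\<lambda>i. r i \<oplus>\<^bsub>R\<^esub> q i) = (\<Oplus>i\<in>{..<p}. emb S (r i) \<otimes> u [^] i \<oplus> emb S (q i) \<otimes> u [^] i)"
    unfolding lin_def by (rule S.finsum_cong') (use assms in \<open>auto simp: Pi_iff S.l_distr\<close>)
  also have "\<dots> = lin r \<oplus> lin q"
    unfolding lin_def by (rule S.finsum_addf) (use assms in \<open>auto simp: Pi_iff\<close>)
  finally show ?thesis .
qed

lemma lin_smult:
  assumes "r \<in> {..<p} \<rightarrow> carrier R" "a \<in> carrier R"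
  shows "lin (\<lambda>i. a \<otimes>\<^bsub>R\<^esub> r i) = emb S a \<otimes> lin r"
proof -
  have "lin (\<lambda>i. a \<otimes>\<^bsub>R\<^esub> r i) = (\<Oplus>i\<in>{..<p}. emb S a \<otimes> (emb S (r i) \<otimes> u [^] i))"
    unfolding lin_def by (rule S.finsum_cong') (use assms in \<open>auto simp: Pi_iff S.m_assoc\<close>)
  also have "\<dots> = emb S a \<otimes> lin r"
    unfolding lin_def by (rule S.finsum_rdistr[symmetric]) (use assms in \<open>auto simp: Pi_iff\<close>)
  finally show ?thesis .
qed

lemma lin_single:
  assumes "a \<in> carrier R" "i < p"
  shows "lin (\<lambda>j. if i = j then a else \<zero>\<^bsub>R\<^esub>) = emb S a \<otimes> u [^] i"
proof -
  have "lin (\<lambda>j. if i = j then a else \<zero>\<^bsub>R\<^esub>) = (\<Oplus>j\<in>{..<p}. if i = j then emb S a \<otimes> u [^] j else \<zero>)"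
    unfolding lin_def by (rule S.finsum_cong') (use assms in auto)
  also have "\<dots> = emb S a \<otimes> u [^] i"
    by (rule S.finsum_singleton) (use assms in auto)
  finally show ?thesis .
qed

lemma coef_add: "i < p \<Longrightarrow> s \<in> carrier S \<Longrightarrow> s' \<in> carrier S \<Longrightarrow> coef i (s \<oplus> s') = coef i s \<oplus>\<^bsub>R\<^esub> coef i s'"
  by (rule coef_eq) (auto simp: lin_add lin_coef)

lemma coef_smult: "i < p \<Longrightarrow> s \<in> carrier S \<Longrightarrow> a \<in> carrier R \<Longrightarrow> coef i (emb S a \<otimes> s) = a \<otimes>\<^bsub>R\<^esub> coef i s"
  by (rule coef_eq) (auto simp: lin_smult lin_coef)

lemma coef_single: "i < p \<Longrightarrow> j < p \<Longrightarrow> a \<in> carrier R \<Longrightarrow>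
    coef j (emb S a \<otimes> u [^] i) = (if i = j then a else \<zero>\<^bsub>R\<^esub>)"
  by (rule coef_eq) (auto simp: lin_single)

lemma coef_emb: "j < p \<Longrightarrow> a \<in> carrier R \<Longrightarrow> coef j (emb S a) = (if 0 = j then a else \<zero>\<^bsub>R\<^esub>)"
  using coef_single[of 0 j a] p_pos by simp

lemma coef_zero: "j < p \<Longrightarrow> coef j \<zero> = \<zero>\<^bsub>R\<^esub>"
  using coef_emb[of j "\<zero>\<^bsub>R\<^esub>"] by simp

lemma coef_eqI: "s \<in> carrier S \<Longrightarrow> s' \<in> carrier S \<Longrightarrow> (\<And>i. i < p \<Longrightarrow> coef i s = coef i s') \<Longrightarrow> s = s'"
  using lin_coef lin_cong[of "\<lambda>i. coef i s" "\<lambda>i. coef i s'"] by fastforce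

lemma u_mult:
  assumes "i < p" "j < p"
  shows "u [^] i \<otimes> u [^] j =
    emb S (if i + j < p then \<one>\<^bsub>R\<^esub> else t) \<otimes> u [^] ((i + j) mod p)"
proof (cases "i + j < p")
  case True then show ?thesis by (simp add: S.nat_pow_mult)
next
  case False
  then have "(i + j) mod p = i + j - p" using assms by (simp add: le_mod_geq)
  moreover have "u [^] (i + j) = emb S t \<otimes> u [^] (i + j - p)"
    using False by (simp add: u_pow[symmetric] S.nat_pow_mult)
  ultimately show ?thesis using False by (simp add: S.nat_pow_mult)
qed

lemma conv_closed:
  "r \<in> {..<p} \<rightarrow> carrier R \<Longrightarrow> q \<in> {..<p} \<rightarrow> carrier R \<Longrightarrow> conv t r q l \<in> carrier R"
  unfolding conv_def by (rule R.finsum_closed) (auto simp: Pi_iff)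

lemma lin_mult:
  assumes r: "r \<in> {..<p} \<rightarrow> carrier R" and q: "q \<in> {..<p} \<rightarrow> carrier R"
  shows "lin r \<otimes> lin q = lin (conv t r q)"
proof -
  define w where "w = (\<lambda>(i, j). if i + j < p then r i \<otimes>\<^bsub>R\<^esub> q j else t \<otimes>\<^bsub>R\<^esub> (r i \<otimes>\<^bsub>R\<^esub> q j))"
  define z where "z = (\<lambda>(i, j). emb S (w (i, j)) \<otimes> u [^] ((i + j) mod p))"
  define D where "D l = {(i, j). i < p \<and> j < p \<and> (i + j) mod p = l}" for l
  have rc: "\<And>i. i < p \<Longrightarrow> r i \<in> carrier R" and qc: "\<And>i. i < p \<Longrightarrow> q i \<in> carrier R" using r q by auto
  have wc: "w (i, j) \<in> carrier R" if "i < p" "j < p" for i j using that rc qc by (simp add: w_def)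
  have zc: "z (i, j) \<in> carrier S" if "i < p" "j < p" for i j using that wc by (simp add: z_def)
  have UD: "(\<Union>l\<in>{..<p}. D l) = {..<p} \<times> {..<p}" using p_pos by (auto simp: D_def)
  have fD: "finite (D l)" for l by (rule finite_subset[of _ "{..<p} \<times> {..<p}"]) (auto simp: D_def)
  have "lin r \<otimes> lin q = (\<Oplus>i\<in>{..<p}. (emb S (r i) \<otimes> u [^] i) \<otimes> lin q)"
    unfolding lin_def[of r] by (rule S.finsum_ldistr) (use rc q in auto)
  also have "\<dots> = (\<Oplus>i\<in>{..<p}. \<Oplus>j\<in>{..<p}. z (i, j))"
  proof (rule S.finsum_cong', rule refl)
    show "(\<lambda>i. \<Oplus>j\<in>{..<p}. z (i, j)) \<in> {..<p} \<rightarrow> carrier S" using zc by (auto intro!: S.finsum_closed)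
    fix i assume i: "i \<in> {..<p}"
    have "(emb S (r i) \<otimes> u [^] i) \<otimes> lin q
       = (\<Oplus>j\<in>{..<p}. (emb S (r i) \<otimes> u [^] i) \<otimes> (emb S (q j) \<otimes> u [^] j))"
      unfolding lin_def by (rule S.finsum_rdistr) (use rc qc i in auto)
    also have "\<dots> = (\<Oplus>j\<in>{..<p}. z (i, j))"
    proof (rule S.finsum_cong', rule refl)
      show "(\<lambda>j. z (i, j)) \<in> {..<p} \<rightarrow> carrier S" using zc i by auto
      fix j assume j: "j \<in> {..<p}"
      have "(emb S (r i) \<otimes> u [^] i) \<otimes> (emb S (q j) \<otimes> u [^] j)
         = (emb S (r i) \<otimes> emb S (q j)) \<otimes> (u [^] i \<otimes> u [^] j)"
        using i j rc qc by (simp add: S.m_ac)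
      also have "\<dots> = z (i, j)"
        using i j rc qc by (simp add: u_mult z_def w_def S.m_ac)
      finally show "(emb S (r i) \<otimes> u [^] i) \<otimes> (emb S (q j) \<otimes> u [^] j) = z (i, j)" .
    qed
    finally show "(emb S (r i) \<otimes> u [^] i) \<otimes> lin q = (\<Oplus>j\<in>{..<p}. z (i, j))" .
  qed
  also have "\<dots> = finsum S z ({..<p} \<times> {..<p})"
    by (rule S.finsum_cartesian[symmetric]) (use zc in auto)
  \<comment> \<open>The double sum is regrouped by the residue of \<open>i + j\<close>, which is the
    exponent of \<open>u\<close> after reduction.\<close>
  also have "\<dots> = finsum S z (\<Union>l\<in>{..<p}. D l)" by (simp only: UD)
  also have "\<dots> = (\<Oplus>l\<in>{..<p}. finsum S z (D l))"
    by (rule S.add.finprod_UN_disjoint) (use fD zc in \<open>auto simp: D_def pairwise_def disjnt_def\<close>)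
  also have "\<dots> = (\<Oplus>l\<in>{..<p}. emb S (conv t r q l) \<otimes> u [^] l)"
  proof (rule S.finsum_cong', rule refl)
    show "(\<lambda>l. emb S (conv t r q l) \<otimes> u [^] l) \<in> {..<p} \<rightarrow> carrier S"
      using conv_closed[OF r q] by auto
    fix l assume "l \<in> {..<p}"
    have "emb S (conv t r q l) = (\<Oplus>x\<in>D l. emb S (w x))"
      unfolding conv_def w_def[symmetric] D_def[symmetric]
      by (subst E.hom_finsum) (use wc in \<open>auto simp: D_def o_def\<close>)
    then have "emb S (conv t r q l) \<otimes> u [^] l = (\<Oplus>x\<in>D l. emb S (w x) \<otimes> u [^] l)"
      using S.finsum_ldistr[OF fD, of "u [^] l" "\<lambda>x. emb S (w x)" l] wc by (auto simp: D_def)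
    also have "\<dots> = finsum S z (D l)"
      by (rule S.finsum_cong') (use wc zc in \<open>auto simp: D_def z_def\<close>)
    finally show "finsum S z (D l) = emb S (conv t r q l) \<otimes> u [^] l" by simp
  qed
  finally show ?thesis unfolding lin_def .
qed

lemma coef_mult:
  assumes "s \<in> carrier S" "s' \<in> carrier S" "l < p"
  shows "coef l (s \<otimes> s') = conv t (\<lambda>i. coef i s) (\<lambda>i. coef i s') l"
proof (rule coef_eq)
  show "s \<otimes> s' = lin (conv t (\<lambda>i. coef i s) (\<lambda>i. coef i s'))"
    using lin_mult[of "\<lambda>i. coef i s" "\<lambda>i. coef i s'"] assms by (simp add: lin_coef)
qed (use assms conv_closed in auto)

end

lemma (in act_extn) \<kappa>_inj: assumes "\<kappa> a \<otimes> s = \<kappa> b \<otimes> s" "s \<in> Units S" shows "a = b"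
proof (rule ccontr)
  assume "a \<noteq> b"
  have sc: "s \<in> carrier S" using assms(2) by (rule S.Units_closed)
  have "s \<otimes> \<kappa> a = s \<otimes> \<kappa> b" using assms sc by (simp add: S.m_comm)
  then have e: "\<kappa> a = \<kappa> b" using assms(2) by (simp add: S.Units_l_cancel)
  have "\<kappa> (a - b) = \<kappa> (a + - b)" by simp
  also have "\<dots> = \<kappa> (b + - b)" unfolding \<kappa>_add e ..
  also have "\<dots> = \<zero>" by simp
  \<comment> \<open>A nonzero difference is invertible in the field, so if its image vanished, 1
    would be 0 in the base ring.\<close>
  finally have "\<kappa> (inverse (a - b) * (a - b)) = \<zero>" unfolding \<kappa>_mult by simp
  then have "emb S \<one>\<^bsub>R\<^esub> = emb S \<zero>\<^bsub>R\<^esub>" using \<open>a \<noteq> b\<close> by simp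
  from inj_onD[OF emb_inj this] show False using R_nontrivial by simp
qed

section \<open>Kummer extensions are Galois\<close>

context kummer_extn
begin

abbreviation "MM \<equiv> self_module S"

lemma cring_MM: "cring MM" unfolding self_module_eq by (rule cring_module_via) (rule crS)

lemma tensor_algebras_self: "tensor_algebras R MM MM"
proof -
  have "abelian_group MM" using cring_MM by (simp add: cring_def ring_def)
  then have "tensor_factors R MM MM"
    by (intro tensor_factors.intro) (simp_all add: self_module_eq)
  then show ?thesis
    by (intro tensor_algebras.intro tensor_algebras_axioms.intro cring_MM)
      (simp_all add: self_module_eq S.m_assoc)
qed

lemma finsum_MM: "finite I \<Longrightarrow> f \<in> I \<rightarrow> carrier S \<Longrightarrow> finsum MM f I = finsum S f I"
  using cring_MM unfolding self_module_eq
  by (intro finsum_module_via) (auto simp: S.abelian_group_axioms cring_def ring_def)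

lemma cring_maps: "cring (prod_ring (carrier G) (\<lambda>_. S))"
  by (rule cring_prod_ring) (rule crS)

abbreviation "gmap \<equiv> (\<lambda>s t. \<lambda>g\<in>carrier G. s \<otimes> act S g t)"

lemma balanced_gmap: "balanced_map R MM MM (prod_ring (carrier G) (\<lambda>_. S)) gmap"
proof -
  interpret T: tensor_algebras R MM MM by (rule tensor_algebras_self)
  interpret U: cring "prod_ring (carrier G) (\<lambda>_. S)" by (rule cring_maps)
  show ?thesis
    by (intro balanced_map.intro balanced_map_axioms.intro T.tensor_factors_axioms U.abelian_group_axioms)
      (auto simp: self_module_eq PiE_iff S.l_distr S.r_distr act_add act_mult act_emb S.m_ac restrict_def extensional_def)
qed

text \<open>On a tensor in normal form, the sum of \<open>m i\<close> tensor \<open>u^i\<close>, the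
  Galois map is the Fourier series with coefficients \<open>m i\<close> times \<open>u^i\<close>.
  Fourier inversion recovers these products, and \<open>u^i\<close> is a unit, so the coefficients
  exist and are unique.\<close>

lemma gmap_iso: "tensor_lift (prod_ring (carrier G) (\<lambda>_. S)) gmap
  \<in> ring_iso (tensor_ring R MM MM) (prod_ring (carrier G) (\<lambda>_. S))"
proof -
  interpret T: tensor_algebras R MM MM by (rule tensor_algebras_self)
  interpret U: cring "prod_ring (carrier G) (\<lambda>_. S)" by (rule cring_maps)
  interpret B: balanced_map R MM MM "prod_ring (carrier G) (\<lambda>_. S)" gmap by (rule balanced_gmap)
  let ?U = "prod_ring (carrier G) (\<lambda>_. S)"
  have MMc [simp]: "carrier MM = carrier S" by (simp add: self_module_eq)
  have MMm [simp]: "monoid.mult MM = monoid.mult S" "monoid.one MM = monoid.one S" "ring.zero MM = ring.zero S"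
    by (simp_all add: self_module_eq)
  have sumg: "finsum ?U (\<lambda>i. gmap (m i) (u [^] i)) {..<p} g
      = (\<Oplus>i\<in>{..<p}. \<kappa> (\<chi> g ^ i) \<otimes> (m i \<otimes> u [^] i))"
    if "m \<in> {..<p} \<rightarrow> carrier S" "g \<in> carrier G" for m g
  proof -
    have "finsum ?U (\<lambda>i. gmap (m i) (u [^] i)) {..<p} g = (\<Oplus>i\<in>{..<p}. gmap (m i) (u [^] i) g)"
      by (rule finsum_prod_ring) (use that crS in \<open>auto simp: Pi_iff\<close>)
    also have "\<dots> = (\<Oplus>i\<in>{..<p}. \<kappa> (\<chi> g ^ i) \<otimes> (m i \<otimes> u [^] i))"
      by (rule S.finsum_cong') (use that u_eigen in \<open>auto simp: Pi_iff eigen_def S.m_ac\<close>)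
    finally show ?thesis .
  qed
  have bij: "bij_betw B.lift (carrier T.T) (carrier ?U)"
  proof (rule B.lift_bij_betw[of "{..<p}" "\<lambda>i. u [^] i"])
    fix n assume n: "n \<in> carrier MM"
    have "n = finsum MM (\<lambda>i. coef i n \<odot>\<^bsub>MM\<^esub> u [^] i) {..<p}"
      using n lin_coef[of n] by (subst finsum_MM) (auto simp: self_module_eq lin_def)
    then show "\<exists>r\<in>{..<p} \<rightarrow> carrier R. n = finsum MM (\<lambda>i. r i \<odot>\<^bsub>MM\<^esub> u [^] i) {..<p}"
      using n by (intro bexI[of _ "\<lambda>i. coef i n"]) auto
  next
    fix m assume m: "m \<in> {..<p} \<rightarrow> carrier MM" and z: "finsum ?U (\<lambda>i. gmap (m i) (u [^] i)) {..<p} = \<zero>\<^bsub>?U\<^esub>"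
    have m': "m \<in> {..<p} \<rightarrow> carrier S" using m by simp
    have 0: "(\<Oplus>i\<in>{..<p}. \<kappa> (\<chi> g ^ i) \<otimes> (m i \<otimes> u [^] i)) = \<zero>" if "g \<in> carrier G" for g
      using sumg[OF m' that] fun_cong[OF z, of g] that by simp
    have "m j = \<zero>" if j: "j < p" for j
    proof -
      have mj: "m j \<in> carrier S" using m' j by auto
      have "m j \<otimes> u [^] j = ft (\<lambda>g. \<Oplus>i\<in>{..<p}. \<kappa> (\<chi> g ^ i) \<otimes> (m i \<otimes> u [^] i)) j"
        by (rule fourier_coefficient[symmetric]) (use m' j in \<open>auto simp: Pi_iff\<close>)
      also have "\<dots> = (\<Oplus>g\<in>carrier G. \<zero>)"
        unfolding ft_def by (rule S.finsum_cong') (use 0 in auto)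
      finally have "u [^] j \<otimes> m j = u [^] j \<otimes> \<zero>" using mj by (simp add: S.m_comm)
      moreover have "u [^] j \<in> Units S" using u_unit by (rule S.Units_pow_closed)
      ultimately show ?thesis using mj by (simp add: S.Units_l_cancel del: S.r_null)
    qed
    then show "\<forall>i\<in>{..<p}. m i = \<zero>\<^bsub>MM\<^esub>" by simp
  next
    fix F assume F: "F \<in> carrier ?U"
    have F': "F \<in> carrier G \<rightarrow> carrier S" using F by auto
    define m where "m i = ft F i \<otimes> inv\<^bsub>S\<^esub> (u [^] i)" for i :: nat
    have ui: "u [^] i \<in> Units S" for i :: nat using u_unit by (rule S.Units_pow_closed)
    have mc: "m i \<in> carrier S" for i using ui ft_closed[OF F'] by (simp add: m_def)
    have mu: "m i \<otimes> u [^] i = ft F i" for i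
      using ui ft_closed[OF F'] by (simp add: m_def S.m_assoc)
    have "F g = finsum ?U (\<lambda>i. gmap (m i) (u [^] i)) {..<p} g" if "g \<in> carrier G" for g
      using fourier_inversion[OF F' that] sumg[OF _ that, of m] mc by (simp add: mu)
    moreover have "finsum ?U (\<lambda>i. gmap (m i) (u [^] i)) {..<p} \<in> carrier ?U"
      by (rule U.finsum_closed) (use mc in \<open>auto simp: PiE_iff\<close>)
    ultimately have "F = finsum ?U (\<lambda>i. gmap (m i) (u [^] i)) {..<p}"
      using F by (intro extensionalityI[of _ "carrier G"]) (auto simp: PiE_iff)
    then show "\<exists>m\<in>{..<p} \<rightarrow> carrier MM. F = finsum ?U (\<lambda>i. gmap (m i) (u [^] i)) {..<p}"
      using mc by (intro bexI[of _ m]) auto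
  qed auto
  have mult: "B.lift (x \<otimes>\<^bsub>T.T\<^esub> y) = B.lift x \<otimes>\<^bsub>?U\<^esub> B.lift y" if x: "x \<in> carrier T.T" and y: "y \<in> carrier T.T" for x y
  proof -
    interpret TT: cring T.T by (rule T.cring_T)
    show ?thesis using x
    proof (induction rule: T.tensor_induct)
      case zero
      have "B.lift \<zero>\<^bsub>T.T\<^esub> \<otimes>\<^bsub>?U\<^esub> B.lift y = \<zero>\<^bsub>?U\<^esub>"
        unfolding B.lift_zero by (rule U.l_null) (rule B.lift_closed[OF y])
      then show ?case using y TT.l_null B.lift_zero by metis
    next
      case p1: (pure m n)
      from y show ?case
      proof (induction rule: T.tensor_induct)
        case zero
        have "B.lift (T.pure m n) \<otimes>\<^bsub>?U\<^esub> B.lift \<zero>\<^bsub>T.T\<^esub> = \<zero>\<^bsub>?U\<^esub>"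
          unfolding B.lift_zero by (rule U.r_null) (rule B.lift_closed[OF T.pure_closed[OF p1]])
        then show ?case using TT.r_null[OF T.pure_closed[OF p1]] B.lift_zero by metis
      next
        case p2: (pure m' n')
        have "B.lift (T.pure m n \<otimes>\<^bsub>T.T\<^esub> T.pure m' n') = gmap (m \<otimes> m') (n \<otimes> n')"
          using p1 p2 by (simp only: T.T_mult_pure MMm) (rule B.lift_pure, simp_all)
        also have "\<dots> = gmap m n \<otimes>\<^bsub>?U\<^esub> gmap m' n'"
          using p1 p2 by (auto simp: act_mult S.m_ac restrict_def)
        finally show ?case using p1 p2 by (simp only: B.lift_pure)
      next
        case (add y y')
        have "B.lift (T.pure m n \<otimes>\<^bsub>T.T\<^esub> (y \<oplus>\<^bsub>T.T\<^esub> y')) =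
           B.lift (T.pure m n \<otimes>\<^bsub>T.T\<^esub> y) \<oplus>\<^bsub>?U\<^esub> B.lift (T.pure m n \<otimes>\<^bsub>T.T\<^esub> y')"
          using add p1 by (simp only: TT.r_distr T.pure_closed B.lift_add TT.m_closed)
        also have "\<dots> = B.lift (T.pure m n) \<otimes>\<^bsub>?U\<^esub> (B.lift y \<oplus>\<^bsub>?U\<^esub> B.lift y')"
          using add p1 by (simp only: U.r_distr B.lift_closed T.pure_closed)
        finally show ?case using add by (simp only: B.lift_add)
      qed
    next
      case (add x x')
      have "B.lift ((x \<oplus>\<^bsub>T.T\<^esub> x') \<otimes>\<^bsub>T.T\<^esub> y) = B.lift (x \<otimes>\<^bsub>T.T\<^esub> y) \<oplus>\<^bsub>?U\<^esub> B.lift (x' \<otimes>\<^bsub>T.T\<^esub> y)"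
        using add y by (simp only: TT.l_distr B.lift_add TT.m_closed)
      also have "\<dots> = (B.lift x \<oplus>\<^bsub>?U\<^esub> B.lift x') \<otimes>\<^bsub>?U\<^esub> B.lift y"
        using add y by (simp only: U.l_distr B.lift_closed)
      finally show ?case using add by (simp only: B.lift_add)
    qed
  qed
  have "B.lift \<one>\<^bsub>T.T\<^esub> = \<one>\<^bsub>?U\<^esub>"
    unfolding T.T_one by (subst B.lift_pure) (auto simp: act_1 restrict_def)
  then have "B.lift \<in> ring_hom T.T ?U"
    by (intro ring_hom_memI B.lift_closed B.lift_add mult)
  then show ?thesis using bij by (simp only: ring_iso_def mem_Collect_eq)
qed

lemma act_bij: assumes g: "g \<in> carrier G" shows "bij_betw (act S g) (carrier S) (carrier S)"
proof (rule bij_betwI[of _ _ _ "act S (inv\<^bsub>G\<^esub> g)"])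
  fix s assume s: "s \<in> carrier S"
  show "act S (inv\<^bsub>G\<^esub> g) (act S g s) = s" "act S g (act S (inv\<^bsub>G\<^esub> g) s) = s"
    using act_comp[of "inv\<^bsub>G\<^esub> g" g s] act_comp[of g "inv\<^bsub>G\<^esub> g" s] g s act_one by simp_all
qed (use g in auto)

lemma galois: "galois_extension R G S"
  unfolding galois_extension_def
proof (intro conjI ballI)
  show "finite (carrier G)" by (rule finite_G)
  show "cring R" by (rule crR)
  show "cring S" by (rule crS)
  show "emb S \<in> ring_hom R S" by (rule emb_hom)
  show "inj_on (emb S) (carrier R)" by (rule emb_inj)
  let ?\<phi> = "\<lambda>g. restrict (act S g) (carrier S)"
  have Bij: "?\<phi> g \<in> Bij (carrier S)" if "g \<in> carrier G" for g
    using act_bij[OF that] by (simp add: Bij_def)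
  show "faithful_action G (carrier S) ?\<phi>"
  proof (intro faithful_action.intro group_action.intro group_hom.intro group_hom_axioms.intro
      faithful_action_axioms.intro)
    show "group G" by (rule group_G)
    show "group (BijGroup (carrier S))" by (rule group_BijGroup)
    show "?\<phi> \<in> hom G (BijGroup (carrier S))"
    proof (rule homI)
      fix g h assume gh: "g \<in> carrier G" "h \<in> carrier G"
      then show "?\<phi> (g \<otimes>\<^bsub>G\<^esub> h) = ?\<phi> g \<otimes>\<^bsub>BijGroup (carrier S)\<^esub> ?\<phi> h"
        using Bij by (auto simp: BijGroup_def compose_def act_comp restrict_def)
    qed (use Bij in \<open>simp add: BijGroup_def\<close>)
    show "inj_on ?\<phi> (carrier G)"
    proof (rule inj_onI)
      fix g h assume gh: "g \<in> carrier G" "h \<in> carrier G" "?\<phi> g = ?\<phi> h"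
      \<comment> \<open>Faithfulness is visible on \<open>u\<close> alone: it is a unit scaled by
        \<open>\<chi>\<close>, and \<open>\<chi>\<close> is injective.\<close>
      then have "act S g u = act S h u" by (metis restrict_apply' u_closed)
      then have "\<kappa> (\<chi> g) \<otimes> u = \<kappa> (\<chi> h) \<otimes> u" using gh by (simp add: act_u \<kappa>_def)
      then have "\<chi> g = \<chi> h" by (rule \<kappa>_inj) (rule u_unit)
      then show "g = h" using chi_inj gh by blast
    qed
  qed
  show "{s \<in> carrier S. \<forall>g\<in>carrier G. act S g s = s} = emb S ` carrier R"
    using fixed_emb act_emb by auto
  show "tensor_lift (prod_ring (carrier G) (\<lambda>_. S)) gmap
    \<in> ring_iso (tensor_ring R (self_module S) (self_module S)) (prod_ring (carrier G) (\<lambda>_. S))"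
    by (rule gmap_iso)
next
  fix g assume "g \<in> carrier G"
  then show "act S g \<in> ring_iso S S" using act_hom act_bij by (simp add: ring_iso_def)
next
  fix g r assume "g \<in> carrier G" "r \<in> carrier R"
  then show "act S g (emb S r) = emb S r" by (rule act_emb)
qed

end

lemma (in act_extn) eigen_add:
  assumes "s \<in> eigen i" "s' \<in> eigen i" shows "s \<oplus> s' \<in> eigen i"
  using assms by (simp add: eigen_def act_add S.r_distr)

lemma (in act_extn) eigen_zero: "\<zero> \<in> eigen i"
  by (simp add: eigen_def act_0)

lemma (in act_extn) eigen_finsum:
  assumes "finite I" "\<And>j. j \<in> I \<Longrightarrow> f j \<in> eigen i" shows "finsum S f I \<in> eigen i"
  using assms
proof (induction I rule: finite_induct)
  case empty then show ?case by (simp add: eigen_zero)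
next
  case (insert x I)
  then have "f \<in> I \<rightarrow> carrier S" "f x \<in> carrier S" using eigen_closed by auto
  then show ?case using insert by (simp add: eigen_add)
qed

lemma (in act_extn) eigen_pow: assumes "s \<in> eigen i" shows "s [^] (n::nat) \<in> eigen (i * n)"
proof (induction n)
  case 0 then show ?case using emb_eigen[of "\<one>\<^bsub>R\<^esub>"] by simp
next
  case (Suc n) then show ?case using eigen_mult[OF Suc assms] by (simp add: add.commute)
qed

lemma (in act_extn) eigen_mult_p: "eigen (i * p) = eigen 0"
proof -
  have "\<chi> g ^ (i * p) = 1" if "g \<in> carrier G" for g
    using char_pow_p[OF \<chi>_char that] by (simp add: mult.commute[of i] power_mult)
  then show ?thesis by (auto simp: eigen_def)
qed

lemma (in act_extn) proj_0_fixed: assumes "s \<in> eigen 0" shows "proj 0 s = s"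
proof -
  have sc: "s \<in> carrier S" using assms by (rule eigen_closed)
  have "(\<Oplus>i\<in>{..<p}. if 0 = i then s else \<zero>) = s"
    by (rule S.finsum_singleton[of 0 "{..<p}" "\<lambda>_. s"]) (use sc p_pos in auto)
  moreover have "proj 0 (\<Oplus>i\<in>{..<p}. if 0 = i then s else \<zero>) = (if 0 = (0::nat) then s else \<zero>)"
    by (rule proj_eigen_sum) (use assms eigen_zero p_pos in auto)
  ultimately show ?thesis by simp
qed

lemma (in act_extn) proj_zero: "proj i \<zero> = \<zero>"
  using proj_add[of "\<zero>" "\<zero>" i] by (simp add: S.add.r_cancel_one')

lemma (in act_extn) emb_eqD: "emb S r = emb S r' \<Longrightarrow> r \<in> carrier R \<Longrightarrow> r' \<in> carrier R \<Longrightarrow> r = r'"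
  using emb_inj by (rule inj_onD)

section \<open>Kummer extensions up to isomorphism\<close>

context kummer_extn
begin

lemma act_lin:
  assumes g: "g \<in> carrier G" and r: "r \<in> {..<p} \<rightarrow> carrier R"
  shows "act S g (lin r) = lin (\<lambda>i. c (\<chi> g ^ i) \<otimes>\<^bsub>R\<^esub> r i)"
proof -
  have rc: "\<And>i. i < p \<Longrightarrow> r i \<in> carrier R" using r by auto
  have "act S g (lin r) = (\<Oplus>i\<in>{..<p}. act S g (emb S (r i) \<otimes> u [^] i))"
    unfolding lin_def by (rule act_finsum) (use g rc in auto)
  also have "\<dots> = (\<Oplus>i\<in>{..<p}. emb S (c (\<chi> g ^ i) \<otimes>\<^bsub>R\<^esub> r i) \<otimes> u [^] i)"
  proof (rule S.finsum_cong', rule refl)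
    fix i assume "i \<in> {..<p}"
    then have i: "r i \<in> carrier R" using rc by auto
    have "act S g (emb S (r i) \<otimes> u [^] i) = \<kappa> (\<chi> g ^ i) \<otimes> (emb S (r i) \<otimes> u [^] i)"
      using emb_u_eigen[OF i, of i] g by (simp add: eigen_def)
    then show "act S g (emb S (r i) \<otimes> u [^] i) = emb S (c (\<chi> g ^ i) \<otimes>\<^bsub>R\<^esub> r i) \<otimes> u [^] i"
      using i by (simp add: \<kappa>_def c_closed S.m_assoc)
  qed (use rc c_closed in auto)
  finally show ?thesis unfolding lin_def .
qed

lemma coef_act:
  assumes "g \<in> carrier G" "s \<in> carrier S" "i < p"
  shows "coef i (act S g s) = c (\<chi> g ^ i) \<otimes>\<^bsub>R\<^esub> coef i s"
proof (rule coef_eq)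
  show "act S g s = lin (\<lambda>i. c (\<chi> g ^ i) \<otimes>\<^bsub>R\<^esub> coef i s)"
    using act_lin[OF assms(1), of "\<lambda>i. coef i s"] assms by (simp add: lin_coef)
qed (use assms c_closed in auto)

text \<open>Replacing the generator \<open>u\<close> by \<open>r u\<close> multiplies the parameter
  by \<open>r^p\<close>. By \<open>iso_unit\<close> no other parameters occur for isomorphic
  extensions.\<close>

lemma rescale:
  assumes r: "r \<in> Units R"
  shows "kummer_extn G p \<chi> R c S (emb S r \<otimes> u) (r [^]\<^bsub>R\<^esub> p \<otimes>\<^bsub>R\<^esub> t)"
proof (intro kummer_extn.intro act_extn_axioms kummer_extn_axioms.intro, goal_cases)
  case 1 then show ?case using R.Units_closed[OF r] by simp
next
  case (2 g) then show ?case using R.Units_closed[OF r] by (simp add: act_mult act_emb act_u c_closed S.m_ac)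
next
  case 3 then show ?case using R.Units_closed[OF r] u_pow by (simp add: S.nat_pow_distrib)
next
  case 4 then show ?case using r t_unit by (simp add: R.Units_pow_closed)
qed

text \<open>An equivariant isomorphism sends \<open>u\<close> to an eigenvector of index 1, hence to
  \<open>r u'\<close>. Comparing \<open>p\<close>-th powers relates the parameters, and
  \<open>r\<close> is a unit because it divides the unit \<open>t\<close>.\<close>

lemma iso_unit:
  assumes "kummer_extn G p \<chi> R c S' u' t'" "gext_isomorphic R G S S'"
  shows "\<exists>r\<in>Units R. t = r [^]\<^bsub>R\<^esub> p \<otimes>\<^bsub>R\<^esub> t'"
proof -
  interpret B: kummer_extn G p \<chi> R c S' u' t' by fact
  obtain h where h: "h \<in> ring_iso S S'" "\<And>r. r \<in> carrier R \<Longrightarrow> h (emb S r) = emb S' r"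
    "\<And>g s. g \<in> carrier G \<Longrightarrow> s \<in> carrier S \<Longrightarrow> h (act S g s) = act S' g (h s)"
    using assms(2) unfolding gext_isomorphic_def by auto
  have hh: "h \<in> ring_hom S S'" using h(1) by (simp add: ring_iso_def)
  interpret h: ring_hom_cring S S' h by (rule ring_hom_cringI) (rule crS B.crS hh)+
  have "h u \<in> B.eigen 1"
    using h act_u by (simp add: B.eigen_def B.\<kappa>_def c_closed flip: h(3))
  then obtain r where r: "r \<in> carrier R" "h u = emb S' r \<otimes>\<^bsub>S'\<^esub> u' [^]\<^bsub>S'\<^esub> (1::nat)"
    using B.eigen_coef[OF p_gt_1] by blast
  have "emb S' t = h (u [^] p)" using h(2) u_pow by simp
  also have "\<dots> = (emb S' r \<otimes>\<^bsub>S'\<^esub> u') [^]\<^bsub>S'\<^esub> p" using r by simp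
  also have "\<dots> = emb S' (r [^]\<^bsub>R\<^esub> p \<otimes>\<^bsub>R\<^esub> t')"
    using r B.u_pow by (simp add: B.S.nat_pow_distrib)
  finally have t: "t = r [^]\<^bsub>R\<^esub> p \<otimes>\<^bsub>R\<^esub> t'"
    by (rule B.emb_eqD) (use r in auto)
  have "r \<otimes>\<^bsub>R\<^esub> (r [^]\<^bsub>R\<^esub> (p - 1) \<otimes>\<^bsub>R\<^esub> t' \<otimes>\<^bsub>R\<^esub> inv\<^bsub>R\<^esub> t) = (r [^]\<^bsub>R\<^esub> (p - 1) \<otimes>\<^bsub>R\<^esub> r) \<otimes>\<^bsub>R\<^esub> t' \<otimes>\<^bsub>R\<^esub> inv\<^bsub>R\<^esub> t"
    using r t_unit by (simp add: R.m_ac)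
  also have "r [^]\<^bsub>R\<^esub> (p - 1) \<otimes>\<^bsub>R\<^esub> r = r [^]\<^bsub>R\<^esub> p"
    using p_pos by (metis R.nat_pow_Suc Suc_pred' One_nat_def)
  also have "r [^]\<^bsub>R\<^esub> p \<otimes>\<^bsub>R\<^esub> t' \<otimes>\<^bsub>R\<^esub> inv\<^bsub>R\<^esub> t = \<one>\<^bsub>R\<^esub>" using t t_unit R.Units_r_inv by metis
  finally have 1: "r \<otimes>\<^bsub>R\<^esub> (r [^]\<^bsub>R\<^esub> (p - 1) \<otimes>\<^bsub>R\<^esub> t' \<otimes>\<^bsub>R\<^esub> inv\<^bsub>R\<^esub> t) = \<one>\<^bsub>R\<^esub>" .
  have c: "r [^]\<^bsub>R\<^esub> (p - 1) \<otimes>\<^bsub>R\<^esub> t' \<otimes>\<^bsub>R\<^esub> inv\<^bsub>R\<^esub> t \<in> carrier R" using r t_unit by simp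
  have "r \<in> Units R" unfolding Units_def using 1 R.m_comm[OF r(1) c] c r(1) by auto
  then show ?thesis using t by blast
qed

text \<open>In coordinates with respect to the powers of the generator, product, embedding and
  action depend only on the base ring and \<open>t\<close>; so matching coordinates is an
  isomorphism.\<close>

lemma iso_same:
  assumes "kummer_extn G p \<chi> R c S' u' t"
  shows "gext_isomorphic R G S S'"
proof -
  interpret B: kummer_extn G p \<chi> R c S' u' t by fact
  define h where "h s = B.lin (\<lambda>i. coef i s)" for s
  have hc: "h s \<in> carrier S'" if "s \<in> carrier S" for s using that by (simp add: h_def)
  have ch: "B.coef i (h s) = coef i s" if "s \<in> carrier S" "i < p" for s i
    unfolding h_def by (rule B.coef_lin) (use that in auto)
  note eqI = B.coef_eqI
  have hom: "h \<in> ring_hom S S'"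
  proof (rule ring_hom_memI)
    fix x y assume xy: "x \<in> carrier S" "y \<in> carrier S"
    show "h (x \<otimes> y) = h x \<otimes>\<^bsub>S'\<^esub> h y"
    proof (rule eqI)
      fix i assume i: "i < p"
      have "B.coef i (h x \<otimes>\<^bsub>S'\<^esub> h y) = conv t (\<lambda>i. B.coef i (h x)) (\<lambda>i. B.coef i (h y)) i"
        by (rule B.coef_mult) (use xy hc i in auto)
      also have "\<dots> = conv t (\<lambda>i. coef i x) (\<lambda>i. coef i y) i"
        unfolding conv_def by (rule R.finsum_cong') (use xy ch in auto)
      finally show "B.coef i (h (x \<otimes> y)) = B.coef i (h x \<otimes>\<^bsub>S'\<^esub> h y)"
        using xy i by (simp add: ch coef_mult)
    qed (use xy hc in auto)
    show "h (x \<oplus> y) = h x \<oplus>\<^bsub>S'\<^esub> h y"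
      by (rule eqI) (use xy hc ch in \<open>auto simp: B.coef_add coef_add\<close>)
  next
    show "h \<one> = \<one>\<^bsub>S'\<^esub>"
    proof (rule eqI)
      fix i assume "i < p"
      then show "B.coef i (h \<one>) = B.coef i \<one>\<^bsub>S'\<^esub>"
        using ch[of "\<one>" i] coef_emb[of i "\<one>\<^bsub>R\<^esub>"] B.coef_emb[of i "\<one>\<^bsub>R\<^esub>"] by simp
    qed (use hc in auto)
  qed (rule hc)
  have "bij_betw h (carrier S) (carrier S')"
  proof (rule bij_betwI[of _ _ _ "\<lambda>s. lin (\<lambda>i. B.coef i s)"])
    fix s assume s: "s \<in> carrier S"
    show "lin (\<lambda>i. B.coef i (h s)) = s"
      using lin_cong[of "\<lambda>i. B.coef i (h s)" "\<lambda>i. coef i s"] s ch lin_coef by auto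
  next
    fix s assume s: "s \<in> carrier S'"
    have "coef i (lin (\<lambda>i. B.coef i s)) = B.coef i s" if "i < p" for i
      by (rule coef_lin) (use that s in auto)
    then show "h (lin (\<lambda>i. B.coef i s)) = s"
      unfolding h_def using B.lin_cong[of "\<lambda>i. coef i (lin (\<lambda>i. B.coef i s))" "\<lambda>i. B.coef i s"] s B.lin_coef by auto
  qed (use hc in auto)
  moreover have "h (emb S r) = emb S' r" if "r \<in> carrier R" for r
    by (rule eqI) (use that hc ch in \<open>auto simp: coef_emb B.coef_emb\<close>)
  moreover have "h (act S g s) = act S' g (h s)" if "g \<in> carrier G" "s \<in> carrier S" for g s
    by (rule eqI) (use that hc ch in \<open>auto simp: coef_act B.coef_act\<close>)
  ultimately show ?thesis
    unfolding gext_isomorphic_def ring_iso_def using hom by blast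
qed

text \<open>\<open>P\<close> is not assumed to be a ring. A bijection compatible with the operations
  pulls back the ring laws, the action and the fixed ring at once, which spares a direct check for
  models such as the Harrison product.\<close>

lemma transport:
  fixes P :: "('a, 'g, 'q) gext"
  assumes H: "bij_betw H (carrier P) (carrier S)"
    and cl: "\<And>x y. \<lbrakk>x \<in> carrier P; y \<in> carrier P\<rbrakk> \<Longrightarrow> x \<otimes>\<^bsub>P\<^esub> y \<in> carrier P"
      "\<And>x y. \<lbrakk>x \<in> carrier P; y \<in> carrier P\<rbrakk> \<Longrightarrow> x \<oplus>\<^bsub>P\<^esub> y \<in> carrier P"
      "\<one>\<^bsub>P\<^esub> \<in> carrier P" "\<zero>\<^bsub>P\<^esub> \<in> carrier P"
      "\<And>r. r \<in> carrier R \<Longrightarrow> emb P r \<in> carrier P"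
      "\<And>g x. \<lbrakk>g \<in> carrier G; x \<in> carrier P\<rbrakk> \<Longrightarrow> act P g x \<in> carrier P"
    and h: "\<And>x y. \<lbrakk>x \<in> carrier P; y \<in> carrier P\<rbrakk> \<Longrightarrow> H (x \<otimes>\<^bsub>P\<^esub> y) = H x \<otimes> H y"
      "\<And>x y. \<lbrakk>x \<in> carrier P; y \<in> carrier P\<rbrakk> \<Longrightarrow> H (x \<oplus>\<^bsub>P\<^esub> y) = H x \<oplus> H y"
      "H \<one>\<^bsub>P\<^esub> = \<one>" "H \<zero>\<^bsub>P\<^esub> = \<zero>"
      "\<And>r. r \<in> carrier R \<Longrightarrow> H (emb P r) = emb S r"
      "\<And>g x. \<lbrakk>g \<in> carrier G; x \<in> carrier P\<rbrakk> \<Longrightarrow> H (act P g x) = act S g (H x)"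
  shows "kummer_extn G p \<chi> R c P (inv_into (carrier P) H u) t"
proof -
  have Hc [simp]: "H x \<in> carrier S" if "x \<in> carrier P" for x using H that by (auto dest: bij_betwE)
  have inj: "x = y" if "H x = H y" "x \<in> carrier P" "y \<in> carrier P" for x y
    using H that by (auto simp: bij_betw_def dest: inj_onD)
  have surj: "\<exists>x\<in>carrier P. H x = s" if "s \<in> carrier S" for s
    using H that unfolding bij_betw_def by (metis imageE)
  let ?v = "inv_into (carrier P) H u"
  have v: "?v \<in> carrier P" "H ?v = u"
    using H u_closed by (auto simp: bij_betw_def inv_into_into f_inv_into_f)
  have crP: "cring P"
  proof (rule cringI)
    show "abelian_group P"
    proof (rule abelian_groupI, goal_cases)
      case (6 x)
      obtain y where y: "y \<in> carrier P" "H y = \<ominus> H x" using surj 6 by (meson Hc S.a_inv_closed)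
      then have "y \<oplus>\<^bsub>P\<^esub> x = \<zero>\<^bsub>P\<^esub>" by (intro inj) (use 6 cl h in \<open>auto simp: S.l_neg\<close>)
      then show ?case using y by blast
    next
      case (3 x y z) then show ?case by (intro inj) (simp_all add: cl h S.a_assoc)
    next
      case (4 x y) then show ?case by (intro inj) (simp_all add: cl h S.a_comm)
    next
      case (5 x) then show ?case by (intro inj) (simp_all add: cl h)
    qed (use cl in auto)
    show "comm_monoid P"
    proof (rule comm_monoidI, goal_cases)
      case (3 x y z) then show ?case by (intro inj) (simp_all add: cl h S.m_assoc)
    next
      case (4 x) then show ?case by (intro inj) (simp_all add: cl h)
    next
      case (5 x y) then show ?case by (intro inj) (simp_all add: cl h S.m_comm)
    qed (use cl in auto)
    fix x y z assume "x \<in> carrier P" "y \<in> carrier P" "z \<in> carrier P"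
    then show "(x \<oplus>\<^bsub>P\<^esub> y) \<otimes>\<^bsub>P\<^esub> z = x \<otimes>\<^bsub>P\<^esub> z \<oplus>\<^bsub>P\<^esub> y \<otimes>\<^bsub>P\<^esub> z"
      by (intro inj) (simp_all add: cl h S.l_distr)
  qed
  interpret P: cring P by (rule crP)
  have Hpow: "H (x [^]\<^bsub>P\<^esub> (n::nat)) = H x [^] n" if "x \<in> carrier P" for x n
    using that by (induction n) (simp_all add: h)
  show ?thesis
  proof (intro kummer_extn.intro act_extn.intro action_extn.intro action_extn_axioms.intro act_extn_axioms.intro kummer_extn_axioms.intro kummer_base_axioms crP)
    show "emb P \<in> ring_hom R P"
      by (rule ring_hom_memI) (auto intro!: inj simp: cl h)
    show "inj_on (emb P) (carrier R)"
    proof (rule inj_onI)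
      fix x y assume xy: "x \<in> carrier R" "y \<in> carrier R" "emb P x = emb P y"
      then have "emb S x = emb S y" using h(5) by metis
      then show "x = y" by (rule emb_eqD) fact+
    qed
    fix g assume g: "g \<in> carrier G"
    show "act P g \<in> ring_hom P P"
      by (rule ring_hom_memI) (use g in \<open>auto intro!: inj simp: cl h act_mult act_add act_1\<close>)
    show "act P g ?v = emb P (c (\<chi> g)) \<otimes>\<^bsub>P\<^esub> ?v"
      by (rule inj) (use g v c_closed in \<open>auto simp: cl h act_u\<close>)
    show "act P g (emb P r) = emb P r" if "r \<in> carrier R" for r
      by (rule inj) (use g that in \<open>auto simp: cl h act_emb\<close>)
    show "act P (g \<otimes>\<^bsub>G\<^esub> g') s = act P g (act P g' s)" if "g' \<in> carrier G" "s \<in> carrier P" for g' s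
      by (rule inj) (use g that in \<open>auto simp: cl h act_comp\<close>)
  next
    show "act P \<one>\<^bsub>G\<^esub> s = s" if "s \<in> carrier P" for s
      by (rule inj) (use that in \<open>auto simp: cl h act_one\<close>)
    show "s \<in> emb P ` carrier R" if s: "s \<in> carrier P" "\<And>g. g \<in> carrier G \<Longrightarrow> act P g s = s" for s
    proof -
      have "H s \<in> emb S ` carrier R" by (rule fixed_emb) (use s h(6) in \<open>auto simp flip: h(6)\<close>)
      then obtain r where r: "r \<in> carrier R" "H s = emb S r" by auto
      then have "s = emb P r" by (intro inj) (use s in \<open>auto simp: cl h\<close>)
      then show ?thesis using r by blast
    qed
    show "?v \<in> carrier P" by (rule v)
    show "?v [^]\<^bsub>P\<^esub> p = emb P t" by (rule inj) (use v in \<open>auto simp: Hpow cl h u_pow\<close>)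
    show "t \<in> Units R" by (rule t_unit)
  qed
qed

text \<open>The members of a class in the Harrison group are extensions whose elements are lists
  over the base ring; here an element is encoded by its \<open>p\<close> coefficients.\<close>

lemma list_model: "\<exists>(P :: ('a, 'g, 'a list) gext) v. kummer_extn G p \<chi> R c P v t"
proof -
  define L where "L s = map (\<lambda>i. coef i s) [0..<p]" for s
  have injL: "inj_on L (carrier S)"
  proof (rule inj_onI)
    fix x y assume *: "x \<in> carrier S" "y \<in> carrier S" "L x = L y"
    have "coef i x = coef i y" if "i < p" for i
      using *(3) that by (auto simp: L_def map_eq_conv)
    then show "x = y" using coef_eqI * by blast
  qed
  define H where "H = inv_into (carrier S) L"
  have HL [simp]: "H (L s) = s" if "s \<in> carrier S" for s
    unfolding H_def using injL that by (rule inv_into_f_f)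
  define P :: "('a, 'g, 'a list) gext" where "P =
    \<lparr>carrier = L ` carrier S, monoid.mult = (\<lambda>x y. L (H x \<otimes> H y)), one = L \<one>,
     ring.zero = L \<zero>, ring.add = (\<lambda>x y. L (H x \<oplus> H y)),
     emb = (\<lambda>r. L (emb S r)), act = (\<lambda>g x. L (act S g (H x)))\<rparr>"
  have "bij_betw H (carrier P) (carrier S)"
    by (rule bij_betwI[of _ _ _ L]) (auto simp: P_def)
  then have "kummer_extn G p \<chi> R c P (inv_into (carrier P) H u) t"
    by (rule transport) (auto simp: P_def)
  then show ?thesis by blast
qed

end

text \<open>The condition on \<open>R\<close> makes the eigenmodules of every Galois extension free: local generators of
  an eigenmodule are glued along the idempotents \<open>e i\<close>.\<close>

locale kummer_ring = kummer_base G p \<chi> R c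
  for G :: "'g monoid" and p :: nat and \<chi> :: "'g \<Rightarrow> 'k::field" and R :: "'a ring" (structure) and c :: "'k \<Rightarrow> 'a" +
  assumes partition_of_unity:
    "\<lbrakk>a \<in> {..<n::nat} \<rightarrow> carrier R; finsum R a {..<n} = \<one>\<^bsub>R\<^esub>\<rbrakk> \<Longrightarrow>
      \<exists>e d. e \<in> {..<n} \<rightarrow> carrier R \<and> d \<in> {..<n} \<rightarrow> carrier R \<and> finsum R e {..<n} = \<one>\<^bsub>R\<^esub> \<and>
        (\<forall>i<n. a i \<otimes>\<^bsub>R\<^esub> d i = e i \<and> e i \<otimes>\<^bsub>R\<^esub> e i = e i) \<and> (\<forall>i<n. \<forall>j<n. i \<noteq> j \<longrightarrow> e i \<otimes>\<^bsub>R\<^esub> e j = \<zero>\<^bsub>R\<^esub>)"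

section \<open>Galois extensions are Kummer extensions\<close>

lemma (in kummer_base) galois_imp_act_extn:
  fixes S :: "('a, 'g, 's) gext"
  assumes "galois_extension R G S"
  shows "act_extn G p \<chi> R c S"
proof -
  note ga = assms[unfolded galois_extension_def]
  interpret F: faithful_action G "carrier S" "\<lambda>g. restrict (act S g) (carrier S)" using ga by blast
  have Bij: "restrict (act S g) (carrier S) \<in> Bij (carrier S)" if "g \<in> carrier G" for g
    using F.bij_prop0[OF that] by (simp add: Bij_def)
  have cl: "act S g s \<in> carrier S" if "g \<in> carrier G" "s \<in> carrier S" for g s
    using Bij[OF that(1)] that by (auto simp: Bij_def bij_betw_def)
  show ?thesis
  proof (intro act_extn.intro action_extn.intro action_extn_axioms.intro act_extn_axioms.intro kummer_base_axioms)
    fix g h s assume *: "g \<in> carrier G" "h \<in> carrier G" "s \<in> carrier S"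
    have "restrict (act S (g \<otimes>\<^bsub>G\<^esub> h)) (carrier S) = compose (carrier S) (restrict (act S g) (carrier S)) (restrict (act S h) (carrier S))"
      using group_hom.hom_mult[OF F.group_hom *(1,2)] Bij * by (simp add: BijGroup_def)
    from fun_cong[OF this, of s] show "act S (g \<otimes>\<^bsub>G\<^esub> h) s = act S g (act S h s)"
      using * cl by (simp add: compose_def)
  next
    fix s assume s: "s \<in> carrier S"
    have "restrict (act S \<one>\<^bsub>G\<^esub>) (carrier S) = (\<lambda>x\<in>carrier S. x)"
      using group_hom.hom_one[OF F.group_hom] by (simp add: BijGroup_def)
    from fun_cong[OF this, of s] show "act S \<one>\<^bsub>G\<^esub> s = s" using s by simp
  next
    fix s assume "s \<in> carrier S" "\<And>g. g \<in> carrier G \<Longrightarrow> act S g s = s"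
    then show "s \<in> emb S ` carrier R" using ga by blast
  qed (use ga in \<open>auto simp: ring_iso_def\<close>)
qed

text \<open>A preimage of the indicator function of the identity under the Galois map gives finite
  families with sum of \<open>m i\<close> times \<open>g (n i)\<close> equal to 1 for the identity
  and 0 for other \<open>g\<close>. Their eigencomponents of opposite index have products summing to
  1, which makes the eigenmodule of \<open>\<chi>\<close> invertible; the partition by idempotents
  then glues its local generators to a global unit.\<close>

lemma (in kummer_ring) galois_imp_kummer:
  fixes S :: "('a, 'g, 's) gext"
  assumes gal: "galois_extension R G S"
  shows "\<exists>u t. kummer_extn G p \<chi> R c S u t"
proof -
  note ga = gal[unfolded galois_extension_def]
  interpret A: act_extn G p \<chi> R c S by (rule galois_imp_act_extn) fact
  let ?M = "self_module S" and ?U = "prod_ring (carrier G) (\<lambda>_. S)"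
  let ?gm = "\<lambda>s t. \<lambda>g\<in>carrier G. s \<otimes>\<^bsub>S\<^esub> act S g t"
  have crM: "cring ?M" unfolding self_module_eq by (rule cring_module_via) (rule A.crS)
  have Mc [simp]: "carrier ?M = carrier S" by (simp add: self_module_eq)
  have crU: "cring ?U" by (rule cring_prod_ring) (rule A.crS)
  interpret U: cring ?U by (rule crU)
  have tf: "tensor_factors R ?M ?M"
    by (intro tensor_factors.intro) (use crM in \<open>simp_all add: self_module_eq cring_def ring_def\<close>)
  interpret B: balanced_map R ?M ?M ?U ?gm
    by (intro balanced_map.intro balanced_map_axioms.intro tf U.abelian_group_axioms)
      (auto simp: self_module_eq PiE_iff A.S.l_distr A.S.r_distr A.act_add A.act_mult A.act_emb A.S.m_ac restrict_def extensional_def)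
  have surj: "B.lift ` carrier B.T = carrier ?U" using ga by (simp add: ring_iso_def bij_betw_def)
  let ?\<delta> = "\<lambda>g\<in>carrier G. if g = \<one>\<^bsub>G\<^esub> then \<one>\<^bsub>S\<^esub> else \<zero>\<^bsub>S\<^esub>"
  have "?\<delta> \<in> carrier ?U" by auto
  then have "?\<delta> \<in> B.lift ` carrier B.T" unfolding surj .
  then obtain z where z: "z \<in> carrier B.T" "?\<delta> = B.lift z" by (elim imageE) (rule that)
  obtain k m n where mn: "m \<in> {..<k::nat} \<rightarrow> carrier S" "n \<in> {..<k} \<rightarrow> carrier S"
    "z = finsum B.T (\<lambda>i. B.pure (m i) (n i)) {..<k}"
    using B.tensor_finite_sum[OF z(1)] by auto
  have mc: "\<And>i. i < k \<Longrightarrow> m i \<in> carrier S" and nc: "\<And>i. i < k \<Longrightarrow> n i \<in> carrier S" using mn by auto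
  have eq: "(\<Oplus>\<^bsub>S\<^esub>i\<in>{..<k}. m i \<otimes>\<^bsub>S\<^esub> act S g (n i)) = (if g = \<one>\<^bsub>G\<^esub> then \<one>\<^bsub>S\<^esub> else \<zero>\<^bsub>S\<^esub>)"
    if g: "g \<in> carrier G" for g
  proof -
    have "B.lift z = finsum ?U (\<lambda>i. B.lift (B.pure (m i) (n i))) {..<k}"
      unfolding mn(3) by (rule B.lift_finsum) (use mc nc B.pure_closed in auto)
    also have "\<dots> = finsum ?U (\<lambda>i. ?gm (m i) (n i)) {..<k}"
      by (rule U.finsum_cong') (use mc nc B.lift_pure in \<open>auto simp: PiE_iff\<close>)
    finally have "?\<delta> g = finsum ?U (\<lambda>i. ?gm (m i) (n i)) {..<k} g" using z(2) by simp
    also have "\<dots> = (\<Oplus>\<^bsub>S\<^esub>i\<in>{..<k}. ?gm (m i) (n i) g)"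
      by (rule finsum_prod_ring) (use mc nc g A.crS in \<open>auto simp: PiE_iff\<close>)
    also have "\<dots> = (\<Oplus>\<^bsub>S\<^esub>i\<in>{..<k}. m i \<otimes>\<^bsub>S\<^esub> act S g (n i))"
      by (rule A.S.finsum_cong') (use mc nc g in auto)
    finally show ?thesis using g by simp
  qed
  \<comment> \<open>The indices 1 and \<open>p - 1\<close> belong to \<open>\<chi>\<close> and its
    inverse. The factor \<open>p\<close> in \<open>a\<close> cancels the \<open>1/p\<close>
    contained in the Fourier coefficients.\<close>
  define b where "b i = A.proj 1 (n i)" for i
  define a where "a i = A.\<kappa> (of_nat p) \<otimes>\<^bsub>S\<^esub> A.proj (p - 1) (m i)" for i
  have bc: "b i \<in> carrier S" if "i < k" for i using nc[OF that] by (simp add: b_def)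
  have ac: "a i \<in> carrier S" if "i < k" for i using mc[OF that] by (simp add: a_def)
  have be: "b i \<in> A.eigen 1" if "i < k" for i unfolding b_def by (rule A.proj_eigen) (rule nc[OF that])
  have ae: "a i \<in> A.eigen (p - 1)" if "i < k" for i
    unfolding a_def using A.eigen_mult[OF A.emb_eigen A.proj_eigen[OF mc[OF that]], of "c (of_nat p)" "p - 1"]
    by (simp add: A.\<kappa>_def c_closed)
  \<comment> \<open>After exchanging the sums only the term of the identity survives, with its
    weight \<open>1/p\<close>.\<close>
  have mb: "(\<Oplus>\<^bsub>S\<^esub>i\<in>{..<k}. m i \<otimes>\<^bsub>S\<^esub> b i) = A.\<kappa> (1 / of_nat p)"
  proof -
    let ?w = "\<lambda>g. A.\<kappa> (inverse (\<chi> g) ^ 1 / of_nat p)"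
    have "(\<Oplus>\<^bsub>S\<^esub>i\<in>{..<k}. m i \<otimes>\<^bsub>S\<^esub> b i) = (\<Oplus>\<^bsub>S\<^esub>i\<in>{..<k}. \<Oplus>\<^bsub>S\<^esub>g\<in>carrier G. m i \<otimes>\<^bsub>S\<^esub> (?w g \<otimes>\<^bsub>S\<^esub> act S g (n i)))"
      unfolding b_def A.proj_def A.ft_def
      by (intro A.S.finsum_cong' A.S.finsum_rdistr refl A.S.finsum_closed) (use mc nc finite_G in auto)
    also have "\<dots> = (\<Oplus>\<^bsub>S\<^esub>g\<in>carrier G. \<Oplus>\<^bsub>S\<^esub>i\<in>{..<k}. m i \<otimes>\<^bsub>S\<^esub> (?w g \<otimes>\<^bsub>S\<^esub> act S g (n i)))"
      by (rule A.S.finsum_commute) (use mc nc finite_G in auto)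
    also have "\<dots> = (\<Oplus>\<^bsub>S\<^esub>g\<in>carrier G. if \<one>\<^bsub>G\<^esub> = g then A.\<kappa> (1 / of_nat p) else \<zero>\<^bsub>S\<^esub>)"
    proof (rule A.S.finsum_cong', rule refl)
      fix g assume g: "g \<in> carrier G"
      have "(\<Oplus>\<^bsub>S\<^esub>i\<in>{..<k}. m i \<otimes>\<^bsub>S\<^esub> (?w g \<otimes>\<^bsub>S\<^esub> act S g (n i))) = (\<Oplus>\<^bsub>S\<^esub>i\<in>{..<k}. ?w g \<otimes>\<^bsub>S\<^esub> (m i \<otimes>\<^bsub>S\<^esub> act S g (n i)))"
        by (rule A.S.finsum_cong') (use mc nc g in \<open>auto simp: A.S.m_lcomm\<close>)
      also have "\<dots> = ?w g \<otimes>\<^bsub>S\<^esub> (\<Oplus>\<^bsub>S\<^esub>i\<in>{..<k}. m i \<otimes>\<^bsub>S\<^esub> act S g (n i))"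
        by (rule A.S.finsum_rdistr[symmetric]) (use mc nc g in auto)
      finally show "(\<Oplus>\<^bsub>S\<^esub>i\<in>{..<k}. m i \<otimes>\<^bsub>S\<^esub> (?w g \<otimes>\<^bsub>S\<^esub> act S g (n i))) = (if \<one>\<^bsub>G\<^esub> = g then A.\<kappa> (1 / of_nat p) else \<zero>\<^bsub>S\<^esub>)"
        using eq[OF g] by (auto simp: char_one[OF \<chi>_char])
    qed auto
    also have "\<dots> = A.\<kappa> (1 / of_nat p)"
      by (rule A.S.finsum_singleton) (use finite_G in auto)
    finally show ?thesis .
  qed
  have ab: "(\<Oplus>\<^bsub>S\<^esub>i\<in>{..<k}. a i \<otimes>\<^bsub>S\<^esub> b i) = \<one>\<^bsub>S\<^esub>"
  proof -
    \<comment> \<open>A constant is fixed by the projection to index 0. Distributed over the sum,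
      that projection turns \<open>m i\<close> into its component of index \<open>p - 1\<close> by
      \<open>proj_eigen_mult\<close>.\<close>
    have "A.\<kappa> (1 / of_nat p) = A.proj 0 (\<Oplus>\<^bsub>S\<^esub>i\<in>{..<k}. m i \<otimes>\<^bsub>S\<^esub> b i)"
      unfolding mb by (rule A.proj_0_fixed[symmetric]) (simp add: A.\<kappa>_def A.emb_eigen c_closed)
    also have "\<dots> = (\<Oplus>\<^bsub>S\<^esub>i\<in>{..<k}. A.proj 0 (m i \<otimes>\<^bsub>S\<^esub> b i))"
      by (rule additive_finsum) (use mc bc in \<open>auto simp: A.S.abelian_monoid_axioms A.proj_zero A.proj_add\<close>)
    also have "\<dots> = (\<Oplus>\<^bsub>S\<^esub>i\<in>{..<k}. A.proj (p - 1) (m i) \<otimes>\<^bsub>S\<^esub> b i)"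
      by (rule A.S.finsum_cong') (use mc bc be A.proj_eigen_mult[of _ 1 _ "p - 1"] p_pos in auto)
    finally have "A.\<kappa> (of_nat p * (1 / of_nat p)) = A.\<kappa> (of_nat p) \<otimes>\<^bsub>S\<^esub> (\<Oplus>\<^bsub>S\<^esub>i\<in>{..<k}. A.proj (p - 1) (m i) \<otimes>\<^bsub>S\<^esub> b i)"
      by (simp only: A.\<kappa>_mult)
    also have "\<dots> = (\<Oplus>\<^bsub>S\<^esub>i\<in>{..<k}. A.\<kappa> (of_nat p) \<otimes>\<^bsub>S\<^esub> (A.proj (p - 1) (m i) \<otimes>\<^bsub>S\<^esub> b i))"
      by (rule A.S.finsum_rdistr) (use mc bc in auto)
    also have "\<dots> = (\<Oplus>\<^bsub>S\<^esub>i\<in>{..<k}. a i \<otimes>\<^bsub>S\<^esub> b i)"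
      by (rule A.S.finsum_cong') (use mc bc in \<open>auto simp: a_def A.S.m_assoc\<close>)
    finally show ?thesis using of_nat_p by simp
  qed
  \<comment> \<open>The indices add up to \<open>p\<close>, so the products lie in the base ring,
    where the partition of unity can be refined.\<close>
  have "\<exists>\<alpha>. \<forall>i<k. \<alpha> i \<in> carrier R \<and> a i \<otimes>\<^bsub>S\<^esub> b i = emb S (\<alpha> i)"
  proof -
    have "\<exists>r. r \<in> carrier R \<and> a i \<otimes>\<^bsub>S\<^esub> b i = emb S r" if "i < k" for i
      using A.eigen_mult[OF ae[OF that] be[OF that]] p_pos by (auto simp: A.eigen_p A.eigen_0)
    then show ?thesis by metis
  qed
  then obtain \<alpha> where \<alpha>: "\<And>i. i < k \<Longrightarrow> \<alpha> i \<in> carrier R" "\<And>i. i < k \<Longrightarrow> a i \<otimes>\<^bsub>S\<^esub> b i = emb S (\<alpha> i)"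
    by blast
  have "emb S (finsum R \<alpha> {..<k}) = (\<Oplus>\<^bsub>S\<^esub>i\<in>{..<k}. emb S (\<alpha> i))"
    by (rule additive_finsum) (use \<alpha> in \<open>auto simp: A.S.abelian_monoid_axioms R.abelian_monoid_axioms\<close>)
  also have "\<dots> = (\<Oplus>\<^bsub>S\<^esub>i\<in>{..<k}. a i \<otimes>\<^bsub>S\<^esub> b i)"
    by (rule A.S.finsum_cong') (use \<alpha> ac bc in auto)
  finally have "emb S (finsum R \<alpha> {..<k}) = emb S \<one>" using ab by simp
  then have "finsum R \<alpha> {..<k} = \<one>"
    by (rule A.emb_eqD) (use \<alpha> in \<open>auto intro!: R.finsum_closed\<close>)
  then obtain e d where ed: "e \<in> {..<k} \<rightarrow> carrier R" "d \<in> {..<k} \<rightarrow> carrier R" "finsum R e {..<k} = \<one>"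
    "\<And>i. i < k \<Longrightarrow> \<alpha> i \<otimes> d i = e i" "\<And>i. i < k \<Longrightarrow> e i \<otimes> e i = e i"
    "\<And>i j. \<lbrakk>i < k; j < k; i \<noteq> j\<rbrakk> \<Longrightarrow> e i \<otimes> e j = \<zero>"
    using partition_of_unity[of \<alpha> k] \<alpha> by auto
  have ec: "\<And>i. i < k \<Longrightarrow> e i \<in> carrier R" and dc: "\<And>i. i < k \<Longrightarrow> d i \<in> carrier R" using ed by auto
  \<comment> \<open>On the factor of the ring cut out by \<open>e i\<close> the element
    \<open>\<alpha> i\<close> is invertible with inverse \<open>d i\<close>, so \<open>b i\<close>
    generates the eigenmodule there and \<open>d i\<close> times \<open>a i\<close> is its inverse.
    \<open>u\<close> glues the generators, \<open>v\<close> the inverses; mixed terms vanish by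
    orthogonality of the idempotents.\<close>
  define u where "u = (\<Oplus>\<^bsub>S\<^esub>i\<in>{..<k}. emb S (e i) \<otimes>\<^bsub>S\<^esub> b i)"
  define v where "v = (\<Oplus>\<^bsub>S\<^esub>i\<in>{..<k}. emb S (d i \<otimes> e i) \<otimes>\<^bsub>S\<^esub> a i)"
  have ue: "u \<in> A.eigen 1"
    unfolding u_def using A.eigen_mult[OF A.emb_eigen be] ec by (intro A.eigen_finsum) auto
  have "emb S (d i \<otimes> e i) \<otimes>\<^bsub>S\<^esub> a i \<in> A.eigen (p - 1)" if "i < k" for i
    using A.eigen_mult[OF A.emb_eigen ae[OF that], of "d i \<otimes> e i"] ec dc that
    by (simp del: A.E.hom_mult)
  then have ve: "v \<in> A.eigen (p - 1)"
    unfolding v_def by (intro A.eigen_finsum) auto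
  note uc = A.eigen_closed[OF ue] and vc = A.eigen_closed[OF ve]
  have uv: "u \<otimes>\<^bsub>S\<^esub> v = \<one>\<^bsub>S\<^esub>"
  proof -
    have "u \<otimes>\<^bsub>S\<^esub> v = (\<Oplus>\<^bsub>S\<^esub>i\<in>{..<k}. (emb S (e i) \<otimes>\<^bsub>S\<^esub> b i) \<otimes>\<^bsub>S\<^esub> v)"
      unfolding u_def by (rule A.S.finsum_ldistr) (use ec bc vc in auto)
    also have "\<dots> = (\<Oplus>\<^bsub>S\<^esub>i\<in>{..<k}. emb S (e i))"
    proof (rule A.S.finsum_cong', rule refl)
      fix i assume "i \<in> {..<k}"
      then have i: "i < k" by simp
      have "(emb S (e i) \<otimes>\<^bsub>S\<^esub> b i) \<otimes>\<^bsub>S\<^esub> v = (\<Oplus>\<^bsub>S\<^esub>j\<in>{..<k}. (emb S (e i) \<otimes>\<^bsub>S\<^esub> b i) \<otimes>\<^bsub>S\<^esub> (emb S (d j \<otimes> e j) \<otimes>\<^bsub>S\<^esub> a j))"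
        unfolding v_def by (rule A.S.finsum_rdistr) (use ec bc dc ac i in auto)
      also have "\<dots> = (\<Oplus>\<^bsub>S\<^esub>j\<in>{..<k}. if i = j then emb S (e j) else \<zero>\<^bsub>S\<^esub>)"
      proof (rule A.S.finsum_cong', rule refl)
        fix j assume "j \<in> {..<k}"
        then have j: "j < k" by simp
        have "(emb S (e i) \<otimes>\<^bsub>S\<^esub> b i) \<otimes>\<^bsub>S\<^esub> (emb S (d j \<otimes> e j) \<otimes>\<^bsub>S\<^esub> a j)
           = emb S ((e i \<otimes> e j) \<otimes> d j) \<otimes>\<^bsub>S\<^esub> (a j \<otimes>\<^bsub>S\<^esub> b i)"
          using i j ec dc bc ac by (simp add: A.S.m_ac)
        also have "\<dots> = (if i = j then emb S (e j) else \<zero>\<^bsub>S\<^esub>)"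
        proof (cases "i = j")
          case True
          have "emb S ((e i \<otimes> e i) \<otimes> d i) \<otimes>\<^bsub>S\<^esub> (a i \<otimes>\<^bsub>S\<^esub> b i) = emb S (e i \<otimes> (\<alpha> i \<otimes> d i))"
          proof -
            have "emb S ((e i \<otimes> e i) \<otimes> d i) \<otimes>\<^bsub>S\<^esub> (a i \<otimes>\<^bsub>S\<^esub> b i) = emb S ((e i \<otimes> d i) \<otimes> \<alpha> i)"
              using i ec dc \<alpha> by (simp only: ed(5)[OF i] A.E.hom_mult R.m_closed)
            also have "(e i \<otimes> d i) \<otimes> \<alpha> i = e i \<otimes> (\<alpha> i \<otimes> d i)"
              using i ec dc \<alpha> by (simp add: R.m_ac)
            finally show ?thesis .
          qed
          then show ?thesis using True i ed by simp
        next
          case False then show ?thesis using i j ed(6)[OF i j] ac bc dc by simp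
        qed
        finally show "(emb S (e i) \<otimes>\<^bsub>S\<^esub> b i) \<otimes>\<^bsub>S\<^esub> (emb S (d j \<otimes> e j) \<otimes>\<^bsub>S\<^esub> a j)
          = (if i = j then emb S (e j) else \<zero>\<^bsub>S\<^esub>)" .
      qed (use ec in auto)
      also have "\<dots> = emb S (e i)" by (rule A.S.finsum_singleton) (use i ec in auto)
      finally show "(emb S (e i) \<otimes>\<^bsub>S\<^esub> b i) \<otimes>\<^bsub>S\<^esub> v = emb S (e i)" .
    qed (use ec in auto)
    also have "\<dots> = emb S (finsum R e {..<k})"
      by (rule additive_finsum[symmetric]) (use ec in \<open>auto simp: A.S.abelian_monoid_axioms R.abelian_monoid_axioms\<close>)
    finally show ?thesis using ed by simp
  qed
  obtain t where t: "t \<in> carrier R" "u [^]\<^bsub>S\<^esub> p = emb S t"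
    using A.eigen_pow[OF ue, of p] A.eigen_mult_p[of 1] by (auto simp: A.eigen_0)
  obtain t' where t': "t' \<in> carrier R" "v [^]\<^bsub>S\<^esub> p = emb S t'"
    using A.eigen_pow[OF ve, of p] A.eigen_mult_p[of "p - 1"] by (auto simp: A.eigen_0)
  have "emb S (t \<otimes> t') = (u \<otimes>\<^bsub>S\<^esub> v) [^]\<^bsub>S\<^esub> p"
    using t t' uc vc by (simp add: A.S.nat_pow_distrib)
  then have "emb S (t \<otimes> t') = emb S \<one>" using uv by simp
  then have "t \<otimes> t' = \<one>" by (rule A.emb_eqD) (use t t' in auto)
  then have tu: "t \<in> Units R" unfolding Units_def using t t' R.m_comm[of t t'] by auto
  have "kummer_extn G p \<chi> R c S u t"
    by (intro kummer_extn.intro kummer_extn_axioms.intro A.act_extn_axioms)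
      (use uc ue t tu in \<open>auto simp: A.eigen_def A.\<kappa>_def\<close>)
  then show ?thesis by blast
qed

text \<open>An extension record carries extra fields, hence has another type than its underlying
  ring; the ring laws see only the carrier and the operations.\<close>

lemma cring_record_cong:
  assumes "cring A" "carrier B = carrier A" "monoid.mult B = monoid.mult A" "monoid.one B = monoid.one A"
    "ring.zero B = ring.zero A" "ring.add B = ring.add A"
  shows "cring B"
proof -
  interpret A: cring A by fact
  show ?thesis
  proof (rule cringI)
    show "abelian_group B"
    proof (rule abelian_groupI)
      fix x assume "x \<in> carrier B"
      then show "\<exists>y\<in>carrier B. y \<oplus>\<^bsub>B\<^esub> x = \<zero>\<^bsub>B\<^esub>"
        using assms by (intro bexI[of _ "\<ominus>\<^bsub>A\<^esub> x"]) (auto simp: A.l_neg)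
    qed (use assms in \<open>auto simp: A.a_ac\<close>)
    show "comm_monoid B" by (rule comm_monoidI) (use assms in \<open>auto simp: A.m_ac\<close>)
  qed (use assms in \<open>auto simp: A.l_distr\<close>)
qed

lemma extend_simps [simp]:
  "carrier (ring.extend A B) = carrier A" "monoid.mult (ring.extend A B) = monoid.mult A"
  "monoid.one (ring.extend A B) = monoid.one A" "ring.zero (ring.extend A B) = ring.zero A"
  "ring.add (ring.extend A B) = ring.add A"
  by (simp_all add: ring.extend_def)

section \<open>The trivial extension\<close>

text \<open>As a function on the group, \<open>\<chi>\<close> is an eigenvector for translation with
  \<open>p\<close>-th power 1, so the neutral element of the Harrison group has parameter 1.\<close>

lemma (in kummer_base) trivial_kummer:
  "kummer_extn G p \<chi> R c (trivial_gext G R) (\<lambda>h\<in>carrier G. c (\<chi> h)) \<one>"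
proof -
  let ?S = "trivial_gext G R" and ?P = "prod_ring (carrier G) (\<lambda>_. R)"
  have sm: "carrier ?S = carrier ?P" "monoid.mult ?S = monoid.mult ?P"
    "monoid.one ?S = monoid.one ?P" "ring.zero ?S = ring.zero ?P" "ring.add ?S = ring.add ?P"
    by (simp_all add: trivial_gext_def)
  have em: "emb ?S = (\<lambda>r. \<lambda>h\<in>carrier G. r)" and ac: "act ?S = (\<lambda>g f. \<lambda>h\<in>carrier G. f (h \<otimes>\<^bsub>G\<^esub> g))"
    by (simp_all add: trivial_gext_def ring.extend_def)
  have crP: "cring ?P" by (rule cring_prod_ring) (rule crR)
  have crS: "cring ?S" by (rule cring_record_cong[OF crP sm])
  interpret S: cring ?S by (rule crS)
  have powS: "(x [^]\<^bsub>?S\<^esub> (n::nat)) h = x h [^] n" if "x \<in> carrier ?S" "h \<in> carrier G" for x n h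
    using that by (induction n) (simp_all add: sm)
  have cpow: "c a [^] n = c (a ^ n)" for a and n :: nat
    by (induction n) (simp_all add: c_one c_mult R.m_comm c_closed)
  let ?u = "\<lambda>h\<in>carrier G. c (\<chi> h)"
  have uS: "?u \<in> carrier ?S" by (simp add: sm c_closed)
  show ?thesis
  proof (intro kummer_extn.intro act_extn.intro action_extn.intro action_extn_axioms.intro act_extn_axioms.intro
      kummer_extn_axioms.intro kummer_base_axioms crS)
    show "emb ?S \<in> ring_hom R ?S"
      by (rule ring_hom_memI) (auto simp: sm em restrict_def)
    show "inj_on (emb ?S) (carrier R)"
    proof (rule inj_onI)
      fix x y assume "emb ?S x = emb ?S y"
      from fun_cong[OF this, of "\<one>\<^bsub>G\<^esub>"] show "x = y" by (simp add: em)
    qed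
    fix g assume g: "g \<in> carrier G"
    show "act ?S g \<in> ring_hom ?S ?S"
      by (rule ring_hom_memI) (use g in \<open>auto simp: sm ac PiE_iff restrict_def extensional_def\<close>)
    show "act ?S g (emb ?S r) = emb ?S r" for r
      using g by (auto simp: ac em restrict_def)
    show "act ?S (g \<otimes>\<^bsub>G\<^esub> g') s = act ?S g (act ?S g' s)" if "g' \<in> carrier G" for g' s
      using g that by (auto simp: ac restrict_def G.m_assoc)
    show "act ?S g ?u = emb ?S (c (\<chi> g)) \<otimes>\<^bsub>?S\<^esub> ?u"
      using g by (auto simp: ac em sm restrict_def char_hom[OF \<chi>_char] c_mult c_closed R.m_comm)
  next
    show "act ?S \<one>\<^bsub>G\<^esub> s = s" if "s \<in> carrier ?S" for s
      using that by (auto simp: ac sm PiE_iff extensional_def restrict_def)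
    show "s \<in> emb ?S ` carrier R" if s: "s \<in> carrier ?S" "\<And>g. g \<in> carrier G \<Longrightarrow> act ?S g s = s" for s
    proof -
      have e: "s g = s \<one>\<^bsub>G\<^esub>" if "g \<in> carrier G" for g
        using fun_cong[OF s(2)[OF that], of "\<one>\<^bsub>G\<^esub>"] that by (simp add: ac)
      have "s = emb ?S (s \<one>\<^bsub>G\<^esub>)"
      proof (rule extensionalityI[of _ "carrier G"])
        fix g assume "g \<in> carrier G"
        then show "s g = emb ?S (s \<one>\<^bsub>G\<^esub>) g" using e[of g] by (simp add: em)
      qed (use s(1) in \<open>auto simp: em sm PiE_iff\<close>)
      then show ?thesis using s(1) by (auto simp: sm PiE_iff)
    qed
    show "?u \<in> carrier ?S" by (rule uS)
    have "?u [^]\<^bsub>?S\<^esub> p \<in> carrier ?S" using uS by (rule S.nat_pow_closed)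
    moreover have "(?u [^]\<^bsub>?S\<^esub> p) h = \<one>" if "h \<in> carrier G" for h
      using powS[OF uS that, of p] that char_pow_p[OF \<chi>_char that] by (simp add: cpow c_one)
    ultimately show "?u [^]\<^bsub>?S\<^esub> p = emb ?S \<one>"
      by (intro extensionalityI[of _ "carrier G"]) (auto simp: sm em PiE_iff)
  qed simp
qed

section \<open>Polynomial models\<close>

text \<open>Two points carry the weight. The base ring embeds because a nonzero multiple of the
  monic polynomial \<open>T^p - t\<close> is not constant, and the fixed ring is no larger because
  all traces lie in the base ring.\<close>

lemma (in kummer_base) kummer_extension_kummer:
  assumes t: "t \<in> Units R"
  shows "\<exists>u. kummer_extn G p \<chi> R c (kummer_extension p R c \<chi> t) u t"
proof -
  define PP where "PP = UP R"
  interpret U: UP_cring R PP by unfold_locales (rule PP_def[THEN eq_reflection])+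
  let ?m = "up_ring.monom PP"
  define f0 where "f0 = ?m \<one> p \<ominus>\<^bsub>PP\<^esub> ?m t 0"
  define I where "I = PIdl\<^bsub>PP\<^esub> f0"
  let ?S = "kummer_extension p R c \<chi> t" and ?Q = "PP Quot I"
  have tc: "t \<in> carrier R" using t by (rule R.Units_closed)
  have f0c: "f0 \<in> carrier PP" using tc by (simp add: f0_def)
  have idI: "ideal I PP" unfolding I_def by (rule U.cgenideal_ideal) (rule f0c)
  interpret I: ideal I PP by (rule idI)
  interpret Q: cring ?Q by (rule I.quotient_is_cring) (rule U.UP_cring)
  define q where "q f = I +>\<^bsub>PP\<^esub> f" for f
  interpret q: ring_hom_cring PP ?Q q
    using I.rcos_ring_hom_cring[OF U.UP_cring] unfolding q_def .
  have qsurj: "\<exists>f\<in>carrier PP. z = q f" if "z \<in> carrier ?Q" for z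
    using that by (auto simp: FactRing_def A_RCOSETS_def RCOSETS_def q_def a_r_coset_def)
  have q_eq: "q f = q g \<longleftrightarrow> f \<ominus>\<^bsub>PP\<^esub> g \<in> I" if "f \<in> carrier PP" "g \<in> carrier PP" for f g
    unfolding q_def using U.quotient_eq_iff_same_a_r_cos[OF idI] that by metis
  define \<sigma> where "\<sigma> g = eval R PP (\<lambda>r. ?m r 0) (?m (c (\<chi> g)) 1)" for g
  interpret h: UP_pre_univ_prop R PP "\<lambda>r. ?m r 0" PP
    by (intro UP_pre_univ_prop.intro ring_hom_cringI crR U.UP_cring U.const_ring_hom U.UP_cring_axioms) (rule PP_def[THEN eq_reflection])
  have mc: "?m (c a) 1 \<in> carrier PP" for a by (simp add: c_closed)
  have \<sigma>hom: "\<sigma> g \<in> ring_hom PP PP" for g unfolding \<sigma>_def by (rule h.eval_ring_hom) (rule mc)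
  interpret \<sigma>: ring_hom_cring PP PP "\<sigma> g" for g by (rule ring_hom_cringI) (rule U.UP_cring \<sigma>hom)+
  have cpow: "c a [^] n = c (a ^ n)" for a and n :: nat
    by (induction n) (simp_all add: c_one c_mult R.m_comm c_closed)
  have \<sigma>m: "\<sigma> g (?m r n) = ?m (r \<otimes> c (\<chi> g ^ n)) n" if "r \<in> carrier R" for g r n
  proof -
    have "\<sigma> g (?m r n) = ?m r 0 \<otimes>\<^bsub>PP\<^esub> ?m (c (\<chi> g)) 1 [^]\<^bsub>PP\<^esub> n"
      unfolding \<sigma>_def using that mc by (rule h.eval_monom)
    also have "?m (c (\<chi> g)) 1 [^]\<^bsub>PP\<^esub> n = ?m (c (\<chi> g ^ n)) n"
      by (simp add: U.monom_pow c_closed cpow)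
    also have "?m r 0 \<otimes>\<^bsub>PP\<^esub> ?m (c (\<chi> g ^ n)) n = ?m (r \<otimes> c (\<chi> g ^ n)) (0 + n)"
      by (rule U.monom_mult[symmetric]) (use that c_closed in auto)
    finally show ?thesis by simp
  qed
  \<comment> \<open>As \<open>\<chi> g ^ p = 1\<close>, the substitution fixes
    \<open>T^p - t\<close> and therefore preserves the ideal.\<close>
  have \<sigma>f0: "\<sigma> g f0 = f0" if "g \<in> carrier G" for g
    using tc char_pow_p[OF \<chi>_char that] by (simp add: f0_def a_minus_def \<sigma>m c_one)
  have \<sigma>I: "\<sigma> g f \<in> I" if g: "g \<in> carrier G" and fI: "f \<in> I" for g f
  proof -
    obtain w where w: "w \<in> carrier PP" "f = w \<otimes>\<^bsub>PP\<^esub> f0"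
      using fI unfolding I_def cgenideal_def by blast
    then have "\<sigma> g f = \<sigma> g w \<otimes>\<^bsub>PP\<^esub> f0" using f0c \<sigma>f0[OF g] by simp
    moreover have "\<sigma> g w \<in> carrier PP" using w by simp
    ultimately show ?thesis unfolding I_def cgenideal_def by blast
  qed
  have qc: "q f \<in> carrier ?Q" if "f \<in> carrier PP" for f using that by simp
  have sm: "carrier ?S = carrier ?Q" "monoid.mult ?S = monoid.mult ?Q"
    "monoid.one ?S = monoid.one ?Q" "ring.zero ?S = ring.zero ?Q" "ring.add ?S = ring.add ?Q"
    by (simp_all add: kummer_extension_def Let_def PP_def I_def f0_def)
  note sm [simp]
  have powS [simp]: "x [^]\<^bsub>?S\<^esub> (n::nat) = x [^]\<^bsub>?Q\<^esub> n" for x n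
    by (simp add: nat_pow_def)
  have qsurjS: "\<exists>f\<in>carrier PP. z = q f" if "z \<in> carrier ?S" for z
    using that qsurj by simp
  have em: "emb ?S r = q (?m r 0)" for r
    by (simp add: kummer_extension_def Let_def PP_def I_def f0_def q_def ring.extend_def)
  have ac0: "act ?S g z = (\<Union>f\<in>z. q (\<sigma> g f))" for g z
    by (simp add: kummer_extension_def Let_def PP_def I_def f0_def q_def \<sigma>_def ring.extend_def)
  \<comment> \<open>The action is defined by a union over a whole coset; all representatives
    contribute the same coset.\<close>
  have ac: "act ?S g (q f) = q (\<sigma> g f)" if g: "g \<in> carrier G" and f: "f \<in> carrier PP" for g f
  proof -
    have "q (\<sigma> g h) = q (\<sigma> g f)" if h: "h \<in> q f" for h
    proof -
      obtain i where i: "i \<in> I" "h = i \<oplus>\<^bsub>PP\<^esub> f"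
        using h by (auto simp: q_def a_r_coset_def r_coset_def)
      have ic: "i \<in> carrier PP" using i by (simp add: I.Icarr)
      have "\<sigma> g h \<ominus>\<^bsub>PP\<^esub> \<sigma> g f = \<sigma> g i" using i ic f by (simp add: a_minus_def U.P.a_assoc U.P.r_neg)
      then show ?thesis using q_eq[of "\<sigma> g h" "\<sigma> g f"] \<sigma>I[OF g i(1)] ic f i by simp
    qed
    moreover have "f \<in> q f" unfolding q_def using f by (rule I.a_rcos_self)
    ultimately show ?thesis unfolding ac0 by blast
  qed
  have crS: "cring ?S" by (rule cring_record_cong[OF Q.is_cring sm])
  interpret S: cring ?S by (rule crS)
  have T1: "?m \<one> 1 \<in> carrier PP" by simp
  let ?u = "q (?m \<one> 1)"
  have qhom: "q \<in> ring_hom PP ?S"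
    by (rule ring_hom_memI) (simp_all add: sm)
  interpret qS: ring_hom_cring PP ?S q by (rule ring_hom_cringI) (rule U.UP_cring crS qhom)+
  have upow: "?u [^]\<^bsub>?S\<^esub> n = q (?m \<one> n)" for n :: nat
    by (subst qS.hom_pow[symmetric]) (simp_all add: U.monom_pow)
  have qf0: "q (?m \<one> p) = q (?m t 0)"
    using q_eq[of "?m \<one> p" "?m t 0"] tc U.cgenideal_self[OF f0c] by (simp add: f0_def I_def)
  have pre: "action_extn G p \<chi> R c ?S"
  proof (intro action_extn.intro action_extn_axioms.intro kummer_base_axioms crS)
    show "emb ?S \<in> ring_hom R ?S"
    proof (rule ring_hom_memI)
      fix x y assume xy: "x \<in> carrier R" "y \<in> carrier R"
      show "emb ?S x \<in> carrier ?S" using xy by (simp add: em)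
      show "emb ?S (x \<oplus> y) = emb ?S x \<oplus>\<^bsub>?S\<^esub> emb ?S y"
        unfolding em using xy by simp
      have "?m (x \<otimes> y) (0 + 0) = ?m x 0 \<otimes>\<^bsub>PP\<^esub> ?m y 0" by (rule U.monom_mult) (use xy in auto)
      then show "emb ?S (x \<otimes> y) = emb ?S x \<otimes>\<^bsub>?S\<^esub> emb ?S y"
        unfolding em using xy by simp
    next
      show "emb ?S \<one> = \<one>\<^bsub>?S\<^esub>" by (simp add: em)
    qed
    show "inj_on (emb ?S) (carrier R)"
    proof (rule inj_onI)
      fix x y assume xy: "x \<in> carrier R" "y \<in> carrier R" "emb ?S x = emb ?S y"
      then have "?m x 0 \<ominus>\<^bsub>PP\<^esub> ?m y 0 \<in> I" using q_eq by (simp add: em)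
      then obtain w where w: "w \<in> carrier PP" "?m x 0 \<ominus>\<^bsub>PP\<^esub> ?m y 0 = w \<otimes>\<^bsub>PP\<^esub> f0"
        unfolding I_def cgenideal_def by blast
      \<comment> \<open>\<open>f0\<close> is monic of degree \<open>p\<close>, so above the degree
        of \<open>w\<close> only its leading monomial contributes.\<close>
      have lead: "up_ring.coeff PP (w \<otimes>\<^bsub>PP\<^esub> f0) (n + p) = up_ring.coeff PP w n" if "\<And>j. n < j \<Longrightarrow> up_ring.coeff PP w j = \<zero>" for n
      proof -
        have 1: "up_ring.coeff PP (w \<otimes>\<^bsub>PP\<^esub> ?m \<one> p) (n + p) = up_ring.coeff PP w n"
          using U.coeff_monom_mult[of "\<one>" w p n] w(1) by (simp add: U.P.m_comm)
        have 2: "up_ring.coeff PP (w \<otimes>\<^bsub>PP\<^esub> ?m t 0) (n + p) = \<zero>"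
          using U.coeff_monom_mult[of t w 0 "n + p"] w(1) tc that[of "n + p"] p_pos by (simp add: U.P.m_comm)
        have "w \<otimes>\<^bsub>PP\<^esub> f0 = w \<otimes>\<^bsub>PP\<^esub> ?m \<one> p \<ominus>\<^bsub>PP\<^esub> w \<otimes>\<^bsub>PP\<^esub> ?m t 0"
          using w(1) tc by (simp add: f0_def a_minus_def U.P.r_distr U.P.r_minus)
        then have "up_ring.coeff PP (w \<otimes>\<^bsub>PP\<^esub> f0) (n + p) = up_ring.coeff PP w n \<ominus> \<zero>"
          using w(1) tc 1 2 by simp
        then show ?thesis using w(1) by (simp add: a_minus_def)
      qed
      have c0: "up_ring.coeff PP (w \<otimes>\<^bsub>PP\<^esub> f0) j = \<zero>" if "0 < j" for j
        using that xy unfolding w(2)[symmetric] by (simp add: a_minus_def)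
      \<comment> \<open>Downward induction from the degree: once all higher coefficients of
        \<open>w\<close> vanish, coefficient \<open>n\<close> equals coefficient
        \<open>n + p\<close> of the product, which is a constant polynomial.\<close>
      have "up_ring.coeff PP w n = \<zero>" for n
      proof (induction "deg R w + 1 - n" arbitrary: n rule: less_induct)
        case less
        show ?case
        proof (cases "deg R w < n")
          case True then show ?thesis using w(1) by (simp add: U.deg_aboveD)
        next
          case False
          have "up_ring.coeff PP w j = \<zero>" if "n < j" for j by (rule less) (use that False in auto)
          then show ?thesis using lead[of n] c0[of "n + p"] p_pos by simp
        qed
      qed
      then have "w = \<zero>\<^bsub>PP\<^esub>" using w(1) by (intro U.up_eqI) auto
      then have "?m x 0 \<ominus>\<^bsub>PP\<^esub> ?m y 0 = \<zero>\<^bsub>PP\<^esub>" using w(2) f0c by simp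
      then have "up_ring.coeff PP (?m x 0 \<ominus>\<^bsub>PP\<^esub> ?m y 0) 0 = up_ring.coeff PP \<zero>\<^bsub>PP\<^esub> 0" by simp
      then have "x \<ominus> y = \<zero>" using xy by simp
      then show "x = y" using xy by simp
    qed
    fix g assume g: "g \<in> carrier G"
    show "act ?S g \<in> ring_hom ?S ?S"
    proof (rule ring_hom_memI)
      fix x y assume xyS: "x \<in> carrier ?S" "y \<in> carrier ?S"
      obtain a b where "a \<in> carrier PP" "x = q a" "b \<in> carrier PP" "y = q b"
        using qsurjS[OF xyS(1)] qsurjS[OF xyS(2)] by blast
      note ab = this(1,3,2,4)
      show "act ?S g x \<in> carrier ?S" using ab g by (simp add: ac sm)
      show "act ?S g (x \<otimes>\<^bsub>?S\<^esub> y) = act ?S g x \<otimes>\<^bsub>?S\<^esub> act ?S g y"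
        using ac[OF g, of "a \<otimes>\<^bsub>PP\<^esub> b"] ac[OF g ab(1)] ac[OF g ab(2)] ab by simp
      show "act ?S g (x \<oplus>\<^bsub>?S\<^esub> y) = act ?S g x \<oplus>\<^bsub>?S\<^esub> act ?S g y"
        using ac[OF g, of "a \<oplus>\<^bsub>PP\<^esub> b"] ac[OF g ab(1)] ac[OF g ab(2)] ab by simp
    next
      show "act ?S g \<one>\<^bsub>?S\<^esub> = \<one>\<^bsub>?S\<^esub>"
        using ac[OF g, of "\<one>\<^bsub>PP\<^esub>"] by (simp add: qS.hom_one)
    qed
    show "act ?S g (emb ?S r) = emb ?S r" if "r \<in> carrier R" for r
      using that g by (simp add: em ac \<sigma>m c_one)
    show "act ?S (g \<otimes>\<^bsub>G\<^esub> g') s = act ?S g (act ?S g' s)" if g': "g' \<in> carrier G" and s: "s \<in> carrier ?S" for g' s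
    proof -
      obtain f where f: "f \<in> carrier PP" "s = q f" using qsurjS[OF s] by (elim bexE)
      \<comment> \<open>Homomorphisms out of a polynomial ring agree if they agree on constants and
        on the variable.\<close>
      have "\<sigma> (g \<otimes>\<^bsub>G\<^esub> g') f = (\<sigma> g \<circ> \<sigma> g') f"
      proof (rule h.UP_hom_unique[where s = "\<sigma> (g \<otimes>\<^bsub>G\<^esub> g') (?m \<one> (Suc 0))"
            and Phi = "\<sigma> (g \<otimes>\<^bsub>G\<^esub> g')" and Psi = "\<sigma> g \<circ> \<sigma> g'"])
        show "ring_hom_cring PP PP (\<sigma> (g \<otimes>\<^bsub>G\<^esub> g'))" by (rule \<sigma>.ring_hom_cring_axioms)
        show "ring_hom_cring PP PP (\<sigma> g \<circ> \<sigma> g')"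
          by (rule ring_hom_cringI[OF U.UP_cring U.UP_cring]) (rule ring_hom_trans[OF \<sigma>hom \<sigma>hom])
        show "(\<sigma> g \<circ> \<sigma> g') (?m \<one> (Suc 0)) = \<sigma> (g \<otimes>\<^bsub>G\<^esub> g') (?m \<one> (Suc 0))"
          using g g' by (simp add: \<sigma>m c_closed char_hom[OF \<chi>_char] c_mult R.m_comm)
      qed (use f in \<open>auto simp: \<sigma>m c_one c_closed\<close>)
      then show ?thesis using f g g' by (simp add: ac)
    qed
  next
    show "act ?S \<one>\<^bsub>G\<^esub> s = s" if s: "s \<in> carrier ?S" for s
    proof -
      obtain f where f: "f \<in> carrier PP" "s = q f" using qsurjS[OF s] by (elim bexE)
      have "\<sigma> \<one>\<^bsub>G\<^esub> f = (\<lambda>x. x) f"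
      proof (rule h.UP_hom_unique[where s = "?m \<one> (Suc 0)"
            and Phi = "\<sigma> \<one>\<^bsub>G\<^esub>" and Psi = "\<lambda>x. x"])
        show "ring_hom_cring PP PP (\<sigma> \<one>\<^bsub>G\<^esub>)" by (rule \<sigma>.ring_hom_cring_axioms)
        show "ring_hom_cring PP PP (\<lambda>x. x)"
          by (rule ring_hom_cringI[OF U.UP_cring U.UP_cring]) (auto intro: ring_hom_memI)
        show "\<sigma> \<one>\<^bsub>G\<^esub> (?m \<one> (Suc 0)) = ?m \<one> (Suc 0)"
          by (simp add: \<sigma>m char_one[OF \<chi>_char] c_one)
      qed (use f in \<open>auto simp: \<sigma>m c_one\<close>)
      then show ?thesis using f by (simp add: ac)
    qed
  qed
  interpret A: action_extn G p \<chi> R c ?S by (rule pre)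
  \<comment> \<open>A monomial of degree \<open>n\<close> is an eigenvector of index
    \<open>n\<close>. Its trace vanishes unless \<open>p\<close> divides \<open>n\<close>, and then
    the monomial is, in the quotient, its coefficient times a power of \<open>t\<close>.\<close>
  have tr_monom: "A.trace (q (?m r n)) \<in> emb ?S ` carrier R" if r: "r \<in> carrier R" for r n
  proof -
    have "act ?S g (q (?m r n)) = A.\<kappa> (\<chi> g ^ n) \<otimes>\<^bsub>?S\<^esub> q (?m r n)" if g: "g \<in> carrier G" for g
    proof -
      have "?m (c (\<chi> g ^ n) \<otimes> r) (0 + n) = ?m (c (\<chi> g ^ n)) 0 \<otimes>\<^bsub>PP\<^esub> ?m r n"
        by (rule U.monom_mult) (use r c_closed in auto)
      then show ?thesis using g r by (simp add: ac \<sigma>m A.\<kappa>_def em R.m_comm c_closed)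
    qed
    then have tr: "A.trace (q (?m r n)) = (if p dvd n then A.\<kappa> (of_nat p) \<otimes>\<^bsub>?S\<^esub> q (?m r n) else \<zero>\<^bsub>?S\<^esub>)"
      by (intro A.eigenvector_trace) (use r in auto)
    show ?thesis
    proof (cases "p dvd n")
      case False
      then show ?thesis using tr A.E.hom_zero by (metis R.zero_closed image_eqI)
    next
      case True
      then obtain k where k: "n = p * k" by blast
      have "q (?m r n) = q (?m r 0) \<otimes>\<^bsub>?S\<^esub> q (?m \<one> p) [^]\<^bsub>?S\<^esub> k"
      proof -
        have "?m (r \<otimes> \<one>) (0 + n) = ?m r 0 \<otimes>\<^bsub>PP\<^esub> ?m \<one> n"
          by (rule U.monom_mult) (use r in auto)
        moreover have "?m \<one> n = ?m \<one> p [^]\<^bsub>PP\<^esub> k" by (simp add: U.monom_pow k)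
        ultimately have "?m r n = ?m r 0 \<otimes>\<^bsub>PP\<^esub> ?m \<one> p [^]\<^bsub>PP\<^esub> k" using r by simp
        then show ?thesis using r by simp
      qed
      also have "\<dots> = emb ?S (r \<otimes> t [^] k)"
        unfolding qf0 using r tc by (simp add: em[symmetric])
      finally have "A.trace (q (?m r n)) = emb ?S (c (of_nat p) \<otimes> (r \<otimes> t [^] k))"
        using tr True r tc by (simp add: A.\<kappa>_def c_closed)
      then show ?thesis using r tc c_closed by blast
    qed
  qed
  have tr: "A.trace (q f) \<in> emb ?S ` carrier R" if f: "f \<in> carrier PP" for f
  proof -
    have fin: "A.trace (q (finsum PP (\<lambda>i. ?m (up_ring.coeff PP f i) i) J)) \<in> emb ?S ` carrier R" if "finite J" for J
      using that
    proof (induction J rule: finite_induct)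
      case empty
      have "A.trace (q (finsum PP (\<lambda>i. ?m (up_ring.coeff PP f i) i) {})) = emb ?S \<zero>"
        using A.trace_zero A.E.hom_zero by simp
      then show ?case by blast
    next
      case (insert x J)
      let ?a = "?m (up_ring.coeff PP f x) x" and ?b = "finsum PP (\<lambda>i. ?m (up_ring.coeff PP f i) i) J"
      have ab: "?a \<in> carrier PP" "?b \<in> carrier PP" using f by (auto intro!: U.P.finsum_closed)
      have "finsum PP (\<lambda>i. ?m (up_ring.coeff PP f i) i) (insert x J) = ?a \<oplus>\<^bsub>PP\<^esub> ?b"
        using insert f by simp
      then have "A.trace (q (finsum PP (\<lambda>i. ?m (up_ring.coeff PP f i) i) (insert x J))) = A.trace (q ?a) \<oplus>\<^bsub>?S\<^esub> A.trace (q ?b)"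
        using ab A.trace_add[of "q ?a" "q ?b"] by simp
      moreover obtain r1 r2 where r12: "r1 \<in> carrier R" "A.trace (q ?a) = emb ?S r1" "r2 \<in> carrier R" "A.trace (q ?b) = emb ?S r2"
        using tr_monom[of "up_ring.coeff PP f x" x] insert f by auto
      ultimately have "A.trace (q (finsum PP (\<lambda>i. ?m (up_ring.coeff PP f i) i) (insert x J))) = emb ?S (r1 \<oplus> r2)"
        using A.E.hom_add[OF r12(1,3)] by simp
      then show ?case using r12 by blast
    qed
    show ?thesis using fin[of "{..deg R f}"] U.up_repr[OF f] by simp
  qed
  have "kummer_extn G p \<chi> R c ?S ?u t"
  proof (intro kummer_extn.intro act_extn.intro pre act_extn_axioms.intro kummer_extn_axioms.intro t)
    fix s assume s: "s \<in> carrier ?S" "\<And>g. g \<in> carrier G \<Longrightarrow> act ?S g s = s"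
    obtain f where f: "f \<in> carrier PP" "s = q f" using qsurjS[OF s(1)] by (elim bexE)
    show "s \<in> emb ?S ` carrier R" by (rule A.fixed_trace[OF s]) (use tr f in auto)
  next
    show "?u \<in> carrier ?S" by simp
    show "?u [^]\<^bsub>?S\<^esub> p = emb ?S t" by (simp only: upow em qf0)
  next
    fix g assume g: "g \<in> carrier G"
    have "?m (c (\<chi> g) \<otimes> \<one>) (0 + 1) = ?m (c (\<chi> g)) 0 \<otimes>\<^bsub>PP\<^esub> ?m \<one> 1"
      by (rule U.monom_mult) (use c_closed in auto)
    then show "act ?S g ?u = emb ?S (c (\<chi> g)) \<otimes>\<^bsub>?S\<^esub> ?u"
      using g by (simp add: ac \<sigma>m em c_closed)
  qed
  then show ?thesis by blast
qed

section \<open>Base change of Kummer extensions\<close>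

context kummer_extn
begin

text \<open>The extension is free on the powers of \<open>u\<close>, so its base change is free on
  their images, and these multiply as in the polynomial model with parameter
  \<open>j t\<close>.\<close>

lemma base_change_kummer:
  fixes R2 :: "'b ring" and c2 :: "'k \<Rightarrow> 'b"
  assumes base2: "kummer_base G p \<chi> R2 c2" and j: "j \<in> ring_hom R R2" and jc: "\<And>a. j (c a) = c2 a"
  shows "\<exists>v. kummer_extn G p \<chi> R2 c2 (base_change R R2 j S) v (j t)"
proof -
  interpret B2: kummer_base G p \<chi> R2 c2 by (rule base2)
  interpret j: ring_hom_cring R R2 j by (rule ring_hom_cringI) (rule crR B2.crR j)+
  have jt: "j t \<in> Units R2"
  proof -
    have "j t \<otimes>\<^bsub>R2\<^esub> j (inv\<^bsub>R\<^esub> t) = \<one>\<^bsub>R2\<^esub>" "j (inv\<^bsub>R\<^esub> t) \<otimes>\<^bsub>R2\<^esub> j t = \<one>\<^bsub>R2\<^esub>"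
      using t_unit by (simp_all flip: j.hom_mult)
    moreover have "j t \<in> carrier R2" "j (inv\<^bsub>R\<^esub> t) \<in> carrier R2" using t_unit by simp_all
    ultimately show ?thesis unfolding Units_def by blast
  qed
  define K where "K = kummer_extension p R2 c2 \<chi> (j t)"
  obtain w where "kummer_extn G p \<chi> R2 c2 K w (j t)"
    using B2.kummer_extension_kummer[OF jt] unfolding K_def by blast
  then interpret K: kummer_extn G p \<chi> R2 c2 K w "j t" .
  define M where "M = module_via j R2 (carrier R2)"
  have Ms: "carrier M = carrier R2" "monoid.mult M = monoid.mult R2" "monoid.one M = \<one>\<^bsub>R2\<^esub>"
    "ring.zero M = \<zero>\<^bsub>R2\<^esub>" "ring.add M = ring.add R2" "module.smult M = (\<lambda>r s. j r \<otimes>\<^bsub>R2\<^esub> s)"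
    by (simp_all add: M_def)
  define N where "N = self_module S"
  have Ns: "carrier N = carrier S" "monoid.mult N = monoid.mult S" "monoid.one N = \<one>"
    "ring.zero N = \<zero>" "ring.add N = ring.add S" "module.smult N = (\<lambda>r s. emb S r \<otimes> s)"
    by (simp_all add: N_def self_module_eq)
  have crM: "cring M" unfolding M_def by (rule cring_module_via) (rule B2.crR)
  have crN: "cring N" unfolding N_def by (rule cring_MM)
  have abM: "abelian_group M" using crM by (simp add: cring_def ring_def)
  have abN: "abelian_group N" using crN by (simp add: cring_def ring_def)
  interpret TA: tensor_algebras R M N
    by (intro tensor_algebras.intro tensor_factors.intro tensor_algebras_axioms.intro abM abN crM crN)
      (simp_all add: Ms Ns B2.R.m_assoc S.m_assoc)
  interpret T: cring TA.T by (rule TA.cring_T)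
  \<comment> \<open>Applying \<open>j\<close> to coefficients gives a ring homomorphism from
    \<open>S\<close> to the model. Combined with the structure map of the model it yields a balanced
    map, whose lift is the required isomorphism.\<close>
  define jl where "jl s = K.lin (\<lambda>i. j (coef i s))" for s
  have jcoef: "(\<lambda>i. j (coef i s)) \<in> {..<p} \<rightarrow> carrier R2" if "s \<in> carrier S" for s using that by auto
  have jl_closed: "jl s \<in> carrier K" if "s \<in> carrier S" for s
    unfolding jl_def by (rule K.lin_closed[OF jcoef[OF that]])
  have jl_add: "jl (s \<oplus> s') = jl s \<oplus>\<^bsub>K\<^esub> jl s'" if "s \<in> carrier S" "s' \<in> carrier S" for s s'
    unfolding jl_def K.lin_add[OF jcoef[OF that(1)] jcoef[OF that(2)], symmetric]
    by (rule K.lin_cong) (use that in \<open>auto simp: coef_add\<close>)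
  have jl_smult: "jl (emb S r \<otimes> s) = emb K (j r) \<otimes>\<^bsub>K\<^esub> jl s" if "r \<in> carrier R" "s \<in> carrier S" for r s
    unfolding jl_def K.lin_smult[OF jcoef[OF that(2)] j.hom_closed[OF that(1)], symmetric]
    by (rule K.lin_cong) (use that in \<open>auto simp: coef_smult\<close>)
  have jl_mult: "jl (s \<otimes> s') = jl s \<otimes>\<^bsub>K\<^esub> jl s'" if s: "s \<in> carrier S" "s' \<in> carrier S" for s s'
    unfolding jl_def K.lin_mult[OF jcoef[OF s(1)] jcoef[OF s(2)]]
  proof (rule K.lin_cong)
    fix l assume l: "l < p"
    show "j (coef l (s \<otimes> s')) = B2.conv (j t) (\<lambda>i. j (coef i s)) (\<lambda>i. j (coef i s')) l"
      unfolding coef_mult[OF s l] conv_def B2.conv_def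
      by (subst j.hom_finsum, (use s in force), rule B2.R.finsum_cong') (use s in \<open>auto split: if_splits\<close>)
  next
    show "B2.conv (j t) (\<lambda>i. j (coef i s)) (\<lambda>i. j (coef i s')) \<in> {..<p} \<rightarrow> carrier R2"
      using K.conv_closed[OF jcoef[OF s(1)] jcoef[OF s(2)]] by blast
  qed
  have jl_single: "jl (u [^] i) = w [^]\<^bsub>K\<^esub> i" if "i < p" for i
  proof -
    have "coef l (u [^] i) = (if i = l then \<one>\<^bsub>R\<^esub> else \<zero>\<^bsub>R\<^esub>)" if "l < p" for l
      using coef_single[of i l "\<one>\<^bsub>R\<^esub>"] \<open>i < p\<close> that by simp
    then have "jl (u [^] i) = K.lin (\<lambda>l. if i = l then \<one>\<^bsub>R2\<^esub> else \<zero>\<^bsub>R2\<^esub>)"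
      unfolding jl_def by (intro K.lin_cong) auto
    then show ?thesis using K.lin_single[of "\<one>\<^bsub>R2\<^esub>" i] that by simp
  qed
  have jl_one: "jl \<one> = \<one>\<^bsub>K\<^esub>" using jl_single[of 0] p_pos by simp
  have jl_act: "jl (act S g s) = act K g (jl s)" if g: "g \<in> carrier G" and s: "s \<in> carrier S" for g s
    unfolding jl_def K.act_lin[OF g jcoef[OF s]]
    by (rule K.lin_cong) (use g s in \<open>auto simp: coef_act c_closed B2.c_closed jc\<close>)
  define \<beta> where "\<beta> r s = emb K r \<otimes>\<^bsub>K\<^esub> jl s" for r s
  interpret H: balanced_map R M N K \<beta>
    by unfold_locales
      (simp_all add: Ms Ns \<beta>_def jl_closed jl_add jl_smult K.S.l_distr K.S.r_distr K.S.m_assoc K.S.m_comm K.S.m_lcomm)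
  define P where "P = base_change R R2 j S"
  have Ps: "carrier P = carrier TA.T" "monoid.mult P = monoid.mult TA.T" "\<one>\<^bsub>P\<^esub> = \<one>\<^bsub>TA.T\<^esub>" "\<zero>\<^bsub>P\<^esub> = \<zero>\<^bsub>TA.T\<^esub>"
    "ring.add P = ring.add TA.T" "emb P r = TA.pure r \<one>"
    "act P g = tensor_lift TA.T (\<lambda>r s. TA.pure r (act S g s))" for r g
    by (simp_all add: P_def base_change_def Let_def M_def N_def ring.defs)
  have bij: "bij_betw H.lift (carrier TA.T) (carrier K)"
  proof (rule H.lift_bij_betw[of "{..<p}" "\<lambda>i. u [^] i"])
    show "\<exists>r\<in>{..<p} \<rightarrow> carrier R. s = finsum N (\<lambda>i. r i \<odot>\<^bsub>N\<^esub> u [^] i) {..<p}" if "s \<in> carrier N" for s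
    proof (rule bexI)
      have s: "s \<in> carrier S" using that by (simp add: Ns)
      have "finsum N (\<lambda>i. coef i s \<odot>\<^bsub>N\<^esub> u [^] i) {..<p} = lin (\<lambda>i. coef i s)"
        unfolding lin_def N_def using s by (subst finsum_MM) (auto simp: self_module_eq)
      then show "s = finsum N (\<lambda>i. coef i s \<odot>\<^bsub>N\<^esub> u [^] i) {..<p}" using lin_coef[OF s] by simp
      show "(\<lambda>i. coef i s) \<in> {..<p} \<rightarrow> carrier R" using s by auto
    qed
    have lin: "finsum K (\<lambda>i. \<beta> (m i) (u [^] i)) {..<p} = K.lin m" if "m \<in> {..<p} \<rightarrow> carrier M" for m
      unfolding K.lin_def using that by (intro K.S.finsum_cong') (auto simp: \<beta>_def jl_single Ms Pi_iff)
    show "\<forall>i\<in>{..<p}. m i = \<zero>\<^bsub>M\<^esub>"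
      if m: "m \<in> {..<p} \<rightarrow> carrier M" and z: "finsum K (\<lambda>i. \<beta> (m i) (u [^] i)) {..<p} = \<zero>\<^bsub>K\<^esub>" for m
    proof
      fix i assume "i \<in> {..<p}"
      then have i: "i < p" by simp
      have "m i = K.coef i (K.lin m)" using m i by (simp add: K.coef_lin Ms)
      also have "\<dots> = \<zero>\<^bsub>M\<^esub>" using z i unfolding lin[OF m] by (simp add: K.coef_zero Ms)
      finally show "m i = \<zero>\<^bsub>M\<^esub>" .
    qed
    show "\<exists>m\<in>{..<p} \<rightarrow> carrier M. y = finsum K (\<lambda>i. \<beta> (m i) (u [^] i)) {..<p}" if y: "y \<in> carrier K" for y
    proof (rule bexI)
      show m: "(\<lambda>i. K.coef i y) \<in> {..<p} \<rightarrow> carrier M" using y by (auto simp: Ms)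
      show "y = finsum K (\<lambda>i. \<beta> (K.coef i y) (u [^] i)) {..<p}"
        using lin[OF m] K.lin_coef[OF y] by simp
    qed
  qed (auto simp: Ns)
  have mult: "H.lift (x \<otimes>\<^bsub>TA.T\<^esub> y) = H.lift x \<otimes>\<^bsub>K\<^esub> H.lift y"
    if x: "x \<in> carrier TA.T" and y: "y \<in> carrier TA.T" for x y
    using x
  proof (induction x rule: TA.tensor_induct)
    case zero then show ?case using y by (simp add: H.lift_zero H.lift_closed)
  next
    case (add x x')
    then show ?case using y by (simp add: T.l_distr H.lift_add H.lift_closed K.S.l_distr)
  next
    case (pure m s)
    note ms = pure
    show ?case using y
    proof (induction y rule: TA.tensor_induct)
      case zero then show ?case using TA.pure_closed[OF ms] by (simp add: H.lift_zero H.lift_closed)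
    next
      case (add x x')
      then show ?case using TA.pure_closed[OF ms] by (simp add: T.r_distr H.lift_add H.lift_closed K.S.r_distr)
    next
      case (pure m' s')
      have "H.lift (TA.pure m s \<otimes>\<^bsub>TA.T\<^esub> TA.pure m' s') = \<beta> (m \<otimes>\<^bsub>R2\<^esub> m') (s \<otimes> s')"
        using ms pure unfolding TA.T_mult_pure[OF ms pure] by (subst H.lift_pure) (simp_all add: Ms Ns)
      also have "\<dots> = \<beta> m s \<otimes>\<^bsub>K\<^esub> \<beta> m' s'"
        using ms pure by (simp add: Ms Ns \<beta>_def jl_mult jl_closed K.S.m_ac)
      finally show ?case using ms pure by (simp add: H.lift_pure)
    qed
  qed
  have actT: "act P g x \<in> carrier TA.T \<and> H.lift (act P g x) = act K g (H.lift x)"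
    if g: "g \<in> carrier G" and x: "x \<in> carrier TA.T" for g x
  proof -
    \<comment> \<open>The action on the base change is itself a lift from pairs; it can be evaluated
      on pure tensors only after the inducing map is known to be balanced.\<close>
    interpret A: balanced_map R M N TA.T "\<lambda>r s. TA.pure r (act S g s)"
    proof unfold_locales
      show "TA.pure (r \<odot>\<^bsub>M\<^esub> m) (act S g s) = TA.pure m (act S g (r \<odot>\<^bsub>N\<^esub> s))"
        if "r \<in> carrier R" "m \<in> carrier M" "s \<in> carrier N" for r m s
        using TA.pure_smult[of r m "act S g s"] that g by (simp add: Ns act_mult act_emb)
    qed (use g TA.pure_add_left TA.pure_add_right TA.pure_closed in \<open>auto simp: Ns act_add\<close>)
    have c: "A.lift x \<in> carrier TA.T" by (rule A.lift_closed) (rule x)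
    have "H.lift (A.lift x) = act K g (H.lift x)"
      using x
    proof (induction x rule: TA.tensor_induct)
      case zero then show ?case using g by (simp add: A.lift_zero H.lift_zero K.act_0)
    next
      case (add x x')
      then show ?case using g by (simp add: A.lift_add H.lift_add A.lift_closed H.lift_closed K.act_add)
    next
      case (pure m s)
      then have ms: "m \<in> carrier R2" "s \<in> carrier S" by (simp_all add: Ms Ns)
      have "H.lift (A.lift (TA.pure m s)) = \<beta> m (act S g s)"
        using pure g by (simp add: A.lift_pure) (subst H.lift_pure, simp_all add: Ns)
      moreover have "H.lift (TA.pure m s) = \<beta> m s" by (rule H.lift_pure) (rule pure)+
      moreover have "act K g (\<beta> m s) = \<beta> m (act S g s)"
        using ms g by (simp add: \<beta>_def jl_act K.act_mult K.act_emb jl_closed)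
      ultimately show ?case by (simp only:)
    qed
    then show ?thesis using c by (simp add: Ps)
  qed
  have "kummer_extn G p \<chi> R2 c2 P (inv_into (carrier P) H.lift w) (j t)"
  proof (rule K.transport)
    show "bij_betw H.lift (carrier P) (carrier K)" using bij by (simp add: Ps)
    show "H.lift (emb P r) = emb K r" if "r \<in> carrier R2" for r
      unfolding Ps using that by (subst H.lift_pure) (simp_all add: Ms Ns \<beta>_def jl_one)
    show "H.lift \<one>\<^bsub>P\<^esub> = \<one>\<^bsub>K\<^esub>"
      unfolding Ps TA.T_one by (subst H.lift_pure) (simp_all add: Ms Ns \<beta>_def jl_one)
    show "emb P r \<in> carrier P" if "r \<in> carrier R2" for r
      unfolding Ps using that by (intro TA.pure_closed) (simp_all add: Ms Ns)
    show "act P g x \<in> carrier P" if "g \<in> carrier G" "x \<in> carrier P" for g x using actT that by (simp add: Ps(1))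
    show "H.lift (act P g x) = act K g (H.lift x)" if "g \<in> carrier G" "x \<in> carrier P" for g x
      using actT that by (simp add: Ps(1))
  qed (simp_all add: Ps mult H.lift_add H.lift_zero)
  then show ?thesis unfolding P_def by blast
qed

end

section \<open>The Harrison product of Kummer extensions\<close>

lemma (in act_extn) eigen_mod: "eigen (i mod p) = eigen i"
proof -
  have "\<chi> g ^ (i mod p) = \<chi> g ^ i" if "g \<in> carrier G" for g
    using fun_cong[OF chi_pow_mod[of i], of g] that by (simp add: chi_pow_def)
  then show ?thesis by (simp add: eigen_def cong: conj_cong)
qed

lemma (in act_extn) eigenmodule_chi_pow: "eigenmodule c G S (chi_pow i) = module_via (emb S) S (eigen i)"
  unfolding eigenmodule_def eigen_def \<kappa>_def chi_pow_def by (simp cong: conj_cong)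

lemma (in act_extn) eigen_smult: "r \<in> carrier R \<Longrightarrow> s \<in> eigen i \<Longrightarrow> emb S r \<otimes> s \<in> eigen i"
  using eigen_mult[OF emb_eigen, of r s i] by simp

lemma (in act_extn) abelian_group_eigen: "abelian_group (module_via (emb S) S (eigen i))"
proof (rule abelian_group_module_via)
  show "abelian_group S" by (rule S.abelian_group_axioms)
  fix x assume x: "x \<in> eigen i"
  have "\<ominus> x = emb S (\<ominus>\<^bsub>R\<^esub> \<one>\<^bsub>R\<^esub>) \<otimes> x" using eigen_closed[OF x] by (simp add: S.l_minus)
  then show "\<ominus> x \<in> eigen i" using eigen_smult[OF _ x, of "\<ominus>\<^bsub>R\<^esub> \<one>\<^bsub>R\<^esub>"] by simp
qed (auto simp: eigen_closed eigen_zero eigen_add)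

locale kummer_pair = K1: kummer_extn G p \<chi> R c S1 u1 t1 + K2: kummer_extn G p \<chi> R c S2 u2 t2
  for G :: "'g monoid" and p :: nat and \<chi> :: "'g \<Rightarrow> 'k::field" and R :: "'a ring" (structure) and c :: "'k \<Rightarrow> 'a"
    and S1 :: "('a, 'g, 's) gext" and u1 t1 and S2 :: "('a, 'g, 't) gext" and u2 t2
begin

definition "M i = module_via (emb S1) S1 (K1.eigen i)"
definition "N i = module_via (emb S2) S2 (K2.eigen i)"

lemma M_simps: "carrier (M i) = K1.eigen i" "monoid.mult (M i) = monoid.mult S1" "monoid.one (M i) = \<one>\<^bsub>S1\<^esub>"
  "ring.zero (M i) = \<zero>\<^bsub>S1\<^esub>" "ring.add (M i) = ring.add S1" "module.smult (M i) = (\<lambda>r s. emb S1 r \<otimes>\<^bsub>S1\<^esub> s)"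
  by (simp_all add: M_def)

lemma N_simps: "carrier (N i) = K2.eigen i" "monoid.mult (N i) = monoid.mult S2" "monoid.one (N i) = \<one>\<^bsub>S2\<^esub>"
  "ring.zero (N i) = \<zero>\<^bsub>S2\<^esub>" "ring.add (N i) = ring.add S2" "module.smult (N i) = (\<lambda>r s. emb S2 r \<otimes>\<^bsub>S2\<^esub> s)"
  by (simp_all add: N_def)

lemma factors: "tensor_factors R (M i) (N i)"
  by (intro tensor_factors.intro)
    (simp_all add: M_simps N_simps K1.eigen_smult K2.eigen_smult, simp_all add: M_def N_def K1.abelian_group_eigen K2.abelian_group_eigen)

sublocale T: tensor_factors R "M i" "N i" for i by (rule factors)

lemma pairing: assumes "(i + j) mod p = l" shows "tensor_pairing R (M i) (M j) (M l) (N i) (N j) (N l)"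
proof -
  have e: "K1.eigen (i + j) = K1.eigen l" "K2.eigen (i + j) = K2.eigen l"
    using K1.eigen_mod[of "i + j"] K2.eigen_mod[of "i + j"] assms by simp_all
  show ?thesis
    by (intro tensor_pairing.intro tensor_pairing_axioms.intro factors)
      (auto simp: M_simps N_simps e(1)[symmetric] e(2)[symmetric] K1.eigen_closed K2.eigen_closed
        K1.eigen_mult K2.eigen_mult K1.S.l_distr K1.S.r_distr K2.S.l_distr K2.S.r_distr
        K1.S.m_assoc K2.S.m_assoc K1.S.m_lcomm K2.S.m_lcomm)
qed

text \<open>The component of index \<open>i\<close> of the Harrison product is free of rank one on
  the tensor of \<open>u1^i\<close> and \<open>u2^i\<close>. \<open>E\<close> forms a multiple of
  this generator and \<open>lam\<close> reads off the scalar.\<close>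

definition "E i r = T.pure i (emb S1 r \<otimes>\<^bsub>S1\<^esub> u1 [^]\<^bsub>S1\<^esub> i) (u2 [^]\<^bsub>S2\<^esub> i)"

abbreviation "lam i \<equiv> tensor_lift R (\<lambda>a b. K1.coef i a \<otimes> K2.coef i b)"

lemma balanced_lam: "i < p \<Longrightarrow> balanced_map R (M i) (N i) R (\<lambda>a b. K1.coef i a \<otimes> K2.coef i b)"
  by (intro balanced_map.intro factors balanced_map_axioms.intro K1.R.abelian_group_axioms)
    (simp_all add: M_simps N_simps K1.eigen_closed K2.eigen_closed K1.coef_add K2.coef_add K1.coef_smult K2.coef_smult
      K1.R.l_distr K1.R.r_distr K1.R.m_assoc K1.R.m_lcomm)

lemma E_closed: "r \<in> carrier R \<Longrightarrow> E i r \<in> carrier (T.T i)"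
  unfolding E_def by (rule T.pure_closed) (simp_all add: M_simps N_simps K1.emb_u_eigen K2.u_eigen)

lemma lam_E: "i < p \<Longrightarrow> r \<in> carrier R \<Longrightarrow> lam i (E i r) = r"
  unfolding E_def using balanced_map.lift_pure[OF balanced_lam, of i "emb S1 r \<otimes>\<^bsub>S1\<^esub> u1 [^]\<^bsub>S1\<^esub> i" "u2 [^]\<^bsub>S2\<^esub> i"]
    K2.coef_single[of i i "\<one>"]
  by (simp add: M_simps N_simps K1.emb_u_eigen K2.u_eigen K1.coef_single)

lemma E_add: assumes "r \<in> carrier R" "q \<in> carrier R" shows "E i (r \<oplus> q) = E i r \<oplus>\<^bsub>T.T i\<^esub> E i q"
  unfolding E_def
  using assms T.pure_add_left[of "emb S1 r \<otimes>\<^bsub>S1\<^esub> u1 [^]\<^bsub>S1\<^esub> i" i "emb S1 q \<otimes>\<^bsub>S1\<^esub> u1 [^]\<^bsub>S1\<^esub> i" "u2 [^]\<^bsub>S2\<^esub> i"]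
  by (simp add: M_simps N_simps K1.emb_u_eigen K2.u_eigen K1.S.l_distr)

lemma E_smult_u: "r \<in> carrier R \<Longrightarrow> q \<in> carrier R \<Longrightarrow>
    T.pure i (emb S1 r \<otimes>\<^bsub>S1\<^esub> u1 [^]\<^bsub>S1\<^esub> i) (emb S2 q \<otimes>\<^bsub>S2\<^esub> u2 [^]\<^bsub>S2\<^esub> i) = E i (r \<otimes> q)"
  unfolding E_def using T.pure_smult[of q "emb S1 r \<otimes>\<^bsub>S1\<^esub> u1 [^]\<^bsub>S1\<^esub> i" i "u2 [^]\<^bsub>S2\<^esub> i"]
  by (simp add: M_simps N_simps K1.emb_u_eigen K2.u_eigen K1.S.m_ac)

lemma lam_closed: "i < p \<Longrightarrow> z \<in> carrier (T.T i) \<Longrightarrow> lam i z \<in> carrier R"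
  by (rule balanced_map.lift_closed[OF balanced_lam])

lemma lam_add: "i < p \<Longrightarrow> z \<in> carrier (T.T i) \<Longrightarrow> z' \<in> carrier (T.T i) \<Longrightarrow>
    lam i (z \<oplus>\<^bsub>T.T i\<^esub> z') = lam i z \<oplus> lam i z'"
  by (rule balanced_map.lift_add[OF balanced_lam])

lemma lam_zero: "i < p \<Longrightarrow> lam i \<zero>\<^bsub>T.T i\<^esub> = \<zero>"
  by (rule balanced_map.lift_zero[OF balanced_lam])

lemma E_zero: "E i \<zero> = \<zero>\<^bsub>T.T i\<^esub>"
  unfolding E_def using T.pure_zero_left[of "u2 [^]\<^bsub>S2\<^esub> i" i] by (simp add: M_simps N_simps K2.u_eigen)

lemma E_lam: assumes i: "i < p" and z: "z \<in> carrier (T.T i)" shows "E i (lam i z) = z"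
  using z
proof (induction z rule: T.tensor_induct)
  case zero then show ?case using i by (simp add: lam_zero E_zero)
next
  case (add x y) then show ?case using i by (simp add: lam_add E_add lam_closed)
next
  case (pure m n)
  obtain r where r: "r \<in> carrier R" "m = emb S1 r \<otimes>\<^bsub>S1\<^esub> u1 [^]\<^bsub>S1\<^esub> i"
    using K1.eigen_coef[OF i] pure by (auto simp: M_simps)
  obtain q where q: "q \<in> carrier R" "n = emb S2 q \<otimes>\<^bsub>S2\<^esub> u2 [^]\<^bsub>S2\<^esub> i"
    using K2.eigen_coef[OF i] pure by (auto simp: N_simps)
  have "T.pure i m n = E i (r \<otimes> q)" unfolding r(2) q(2) by (rule E_smult_u) (rule r q)+
  then show ?case using i r q by (simp add: lam_E)
qed

text \<open>When the exponents pass \<open>p\<close>, both tensor factors wrap around at the same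
  time, one contributing \<open>t1\<close> and the other \<open>t2\<close>. This is the reason why
  parameters multiply.\<close>

lemma lam_tmult:
  assumes i: "i < p" and j: "j < p" and l: "(i + j) mod p = l" and x: "x \<in> carrier (T.T i)" and y: "y \<in> carrier (T.T j)"
  shows "tensor_mult (carrier R) (M l) (N l) x y \<in> carrier (T.T l) \<and>
    lam l (tensor_mult (carrier R) (M l) (N l) x y) =
    (if i + j < p then lam i x \<otimes> lam j y else (t1 \<otimes> t2) \<otimes> (lam i x \<otimes> lam j y))"
proof -
  interpret pr: tensor_pairing R "M i" "M j" "M l" "N i" "N j" "N l" by (rule pairing) (rule l)
  have lp: "l < p" using l K1.p_pos by auto
  define a b where "a = lam i x" and "b = lam j y"
  have ab: "a \<in> carrier R" "b \<in> carrier R" using i j x y by (simp_all add: a_def b_def lam_closed)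
  let ?w1 = "if i + j < p then \<one> else t1" and ?w2 = "if i + j < p then \<one> else t2"
  have w: "?w1 \<in> carrier R" "?w2 \<in> carrier R" by auto
  have xy: "x = E i a" "y = E j b" using i j x y by (simp_all add: E_lam a_def b_def)
  have "tensor_mult (carrier R) (M l) (N l) x y =
      T.pure l ((emb S1 a \<otimes>\<^bsub>S1\<^esub> u1 [^]\<^bsub>S1\<^esub> i) \<otimes>\<^bsub>S1\<^esub> (emb S1 b \<otimes>\<^bsub>S1\<^esub> u1 [^]\<^bsub>S1\<^esub> j)) (u2 [^]\<^bsub>S2\<^esub> i \<otimes>\<^bsub>S2\<^esub> u2 [^]\<^bsub>S2\<^esub> j)"
    unfolding xy E_def using ab
    by (subst pr.tmult_pure) (simp_all add: M_simps N_simps K1.emb_u_eigen K2.u_eigen)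
  also have "(emb S1 a \<otimes>\<^bsub>S1\<^esub> u1 [^]\<^bsub>S1\<^esub> i) \<otimes>\<^bsub>S1\<^esub> (emb S1 b \<otimes>\<^bsub>S1\<^esub> u1 [^]\<^bsub>S1\<^esub> j) =
      emb S1 (a \<otimes> b \<otimes> ?w1) \<otimes>\<^bsub>S1\<^esub> u1 [^]\<^bsub>S1\<^esub> l"
  proof -
    have "(emb S1 a \<otimes>\<^bsub>S1\<^esub> u1 [^]\<^bsub>S1\<^esub> i) \<otimes>\<^bsub>S1\<^esub> (emb S1 b \<otimes>\<^bsub>S1\<^esub> u1 [^]\<^bsub>S1\<^esub> j) =
        (emb S1 a \<otimes>\<^bsub>S1\<^esub> emb S1 b) \<otimes>\<^bsub>S1\<^esub> (u1 [^]\<^bsub>S1\<^esub> i \<otimes>\<^bsub>S1\<^esub> u1 [^]\<^bsub>S1\<^esub> j)"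
      using ab by (simp add: K1.S.m_ac)
    also have "\<dots> = (emb S1 a \<otimes>\<^bsub>S1\<^esub> emb S1 b) \<otimes>\<^bsub>S1\<^esub> (emb S1 ?w1 \<otimes>\<^bsub>S1\<^esub> u1 [^]\<^bsub>S1\<^esub> l)"
      unfolding K1.u_mult[OF i j] l ..
    also have "\<dots> = emb S1 (a \<otimes> b \<otimes> ?w1) \<otimes>\<^bsub>S1\<^esub> u1 [^]\<^bsub>S1\<^esub> l"
      using ab w(1) by (simp only: K1.E.hom_mult K1.R.m_closed K1.S.m_assoc K1.E.hom_closed K1.S.nat_pow_closed K1.u_closed K1.S.m_closed)
    finally show ?thesis .
  qed
  also have "u2 [^]\<^bsub>S2\<^esub> i \<otimes>\<^bsub>S2\<^esub> u2 [^]\<^bsub>S2\<^esub> j = emb S2 ?w2 \<otimes>\<^bsub>S2\<^esub> u2 [^]\<^bsub>S2\<^esub> l"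
    unfolding K2.u_mult[OF i j] l ..
  also have "T.pure l (emb S1 (a \<otimes> b \<otimes> ?w1) \<otimes>\<^bsub>S1\<^esub> u1 [^]\<^bsub>S1\<^esub> l) (emb S2 ?w2 \<otimes>\<^bsub>S2\<^esub> u2 [^]\<^bsub>S2\<^esub> l) =
      E l (a \<otimes> b \<otimes> ?w1 \<otimes> ?w2)"
    by (rule E_smult_u) (use ab w in \<open>simp_all only: K1.R.m_closed\<close>)
  finally have e: "tensor_mult (carrier R) (M l) (N l) x y = E l (a \<otimes> b \<otimes> ?w1 \<otimes> ?w2)" .
  have cl: "a \<otimes> b \<otimes> ?w1 \<otimes> ?w2 \<in> carrier R" using ab w by (simp only: K1.R.m_closed)
  have v: "a \<otimes> b \<otimes> ?w1 \<otimes> ?w2 =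
      (if i + j < p then a \<otimes> b else (t1 \<otimes> t2) \<otimes> (a \<otimes> b))"
    using ab by (simp add: K1.R.m_ac)
  show ?thesis unfolding e lam_E[OF lp cl] using E_closed[OF cl] v by (simp add: a_def b_def)
qed

abbreviation "Ch :: ('g \<Rightarrow> 'k) set \<equiv> characters p G"
abbreviation "idx \<equiv> the_inv_into {..<p} K1.chi_pow"
abbreviation "W \<equiv> harrison_product p G R c S1 S2"

lemma idx: "i < p \<Longrightarrow> idx (K1.chi_pow i) = i"
  by (rule the_inv_into_f_f) (auto intro!: inj_onI K1.chi_pow_inj)

lemma Ch_E: assumes "\<psi> \<in> Ch" obtains i where "i < p" "\<psi> = K1.chi_pow i"
  using assms unfolding K1.characters_eq by blast

lemma chi_pow_triv: "i < p \<Longrightarrow> K1.chi_pow i = (\<lambda>g\<in>carrier G. 1) \<longleftrightarrow> i = 0"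
  using K1.chi_pow_inj[of i 0] K1.p_pos by (auto simp: K1.chi_pow_0[symmetric])

lemma eigenmodules:
  "eigenmodule c G S1 (K1.chi_pow i) = M i" "eigenmodule c G S2 (K1.chi_pow i) = N i"
  by (simp_all add: M_def N_def K1.eigenmodule_chi_pow K2.eigenmodule_chi_pow)

lemma carrier_W: "x \<in> carrier W \<longleftrightarrow> x \<in> extensional Ch \<and> (\<forall>i<p. x (K1.chi_pow i) \<in> carrier (T.T i))"
proof -
  have "x \<in> carrier W \<longleftrightarrow> x \<in> extensional Ch \<and> (\<forall>\<psi>\<in>Ch. x \<psi> \<in> carrier (tensor_ring R (eigenmodule c G S1 \<psi>) (eigenmodule c G S2 \<psi>)))"
    unfolding harrison_product_def Let_def by (simp add: PiE_iff conj_commute)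
  also have "\<dots> \<longleftrightarrow> x \<in> extensional Ch \<and> (\<forall>i<p. x (K1.chi_pow i) \<in> carrier (T.T i))"
    unfolding K1.characters_eq by (auto simp: eigenmodules)
  finally show ?thesis .
qed

lemma W_ext:
  "x \<otimes>\<^bsub>W\<^esub> y \<in> extensional Ch" "x \<oplus>\<^bsub>W\<^esub> y \<in> extensional Ch" "\<one>\<^bsub>W\<^esub> \<in> extensional Ch" "\<zero>\<^bsub>W\<^esub> \<in> extensional Ch"
  "emb W r \<in> extensional Ch" "act W g x \<in> extensional Ch"
  by (simp_all add: harrison_product_def Let_def)

lemma W_mult: assumes "l < p"
  shows "(x \<otimes>\<^bsub>W\<^esub> y) (K1.chi_pow l) = finsum (T.T l)
    (\<lambda>(\<psi>, \<phi>). tensor_mult (carrier R) (M l) (N l) (x \<psi>) (y \<phi>))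
    {(\<psi>, \<phi>) \<in> Ch \<times> Ch. (\<lambda>g\<in>carrier G. \<psi> g * \<phi> g) = K1.chi_pow l}"
  using K1.chi_pow_char[of l] by (simp add: harrison_product_def Let_def eigenmodules)

lemma W_simps: assumes "i < p"
  shows "(x \<oplus>\<^bsub>W\<^esub> y) (K1.chi_pow i) = x (K1.chi_pow i) \<oplus>\<^bsub>T.T i\<^esub> y (K1.chi_pow i)"
    "\<one>\<^bsub>W\<^esub> (K1.chi_pow i) = (if i = 0 then \<one>\<^bsub>T.T i\<^esub> else \<zero>\<^bsub>T.T i\<^esub>)"
    "\<zero>\<^bsub>W\<^esub> (K1.chi_pow i) = \<zero>\<^bsub>T.T i\<^esub>"
    "emb W r (K1.chi_pow i) = (if i = 0 then T.pure i (emb S1 r) \<one>\<^bsub>S2\<^esub> else \<zero>\<^bsub>T.T i\<^esub>)"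
    "act W g x (K1.chi_pow i) = tensor_lift (T.T i)
       (\<lambda>s t. T.pure i (emb S1 (c (K1.chi_pow i g)) \<otimes>\<^bsub>S1\<^esub> s) t) (x (K1.chi_pow i))"
  using K1.chi_pow_char[of i] by (simp_all add: harrison_product_def Let_def eigenmodules chi_pow_triv[OF assms])

text \<open>Turns the sum over pairs of characters with given product into the sum over pairs of
  exponents with given residue that occurs in \<open>conv\<close>.\<close>

lemma product_index:
  assumes "l < p"
  shows "bij_betw (\<lambda>(i, j). (K1.chi_pow i, K1.chi_pow j)) {(i, j). i < p \<and> j < p \<and> (i + j) mod p = l}
    {(\<psi>, \<phi>) \<in> Ch \<times> Ch. (\<lambda>g\<in>carrier G. \<psi> g * \<phi> g) = K1.chi_pow l}"
proof (rule bij_betw_imageI)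
  show "inj_on (\<lambda>(i, j). (K1.chi_pow i, K1.chi_pow j)) {(i, j). i < p \<and> j < p \<and> (i + j) mod p = l}"
    by (rule inj_onI) (auto dest: K1.chi_pow_inj)
  have "K1.chi_pow (i + j) = K1.chi_pow l \<longleftrightarrow> (i + j) mod p = l" for i j
    using K1.chi_pow_mod[of "i + j"] K1.chi_pow_inj[of "(i + j) mod p" l] assms K1.p_pos by auto
  then show "(\<lambda>(i, j). (K1.chi_pow i, K1.chi_pow j)) ` {(i, j). i < p \<and> j < p \<and> (i + j) mod p = l} =
      {(\<psi>, \<phi>) \<in> Ch \<times> Ch. (\<lambda>g\<in>carrier G. \<psi> g * \<phi> g) = K1.chi_pow l}"
    unfolding K1.characters_eq by (auto simp: K1.chi_pow_mult image_iff)
qed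

definition "co x i = lam i (x (K1.chi_pow i))"

lemma co_closed: "x \<in> carrier W \<Longrightarrow> co x \<in> {..<p} \<rightarrow> carrier R"
  by (auto simp: co_def carrier_W lam_closed)

lemma co_eqI:
  assumes "x \<in> carrier W" "y \<in> carrier W" "\<And>i. i < p \<Longrightarrow> co x i = co y i" shows "x = y"
proof (rule extensionalityI)
  show "x \<in> extensional Ch" "y \<in> extensional Ch" using assms by (simp_all add: carrier_W)
  fix \<psi> assume "\<psi> \<in> Ch"
  then obtain i where i: "i < p" "\<psi> = K1.chi_pow i" by (rule Ch_E)
  have "E i (co z i) = z \<psi>" if "z \<in> carrier W" for z
    unfolding co_def i(2) using i(1) by (rule E_lam) (use that i(1) carrier_W in blast)
  then show "x \<psi> = y \<psi>" using assms(1,2) assms(3)[OF i(1)] by metis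
qed

lemma co_surj: assumes "r \<in> {..<p} \<rightarrow> carrier R" shows "\<exists>x\<in>carrier W. \<forall>i<p. co x i = r i"
proof (rule bexI)
  let ?x = "\<lambda>\<psi>\<in>Ch. E (idx \<psi>) (r (idx \<psi>))"
  have x: "?x (K1.chi_pow i) = E i (r i)" if "i < p" for i using that by (simp add: K1.chi_pow_char idx)
  show "?x \<in> carrier W" unfolding carrier_W using assms by (auto simp: x E_closed Pi_iff simp del: restrict_apply)
  show "\<forall>i<p. co ?x i = r i" using assms by (auto simp: co_def x lam_E Pi_iff simp del: restrict_apply)
qed

text \<open>In coordinates the product of the graded components becomes the convolution of the
  polynomial model with parameter \<open>t1 \<otimes> t2\<close>.\<close>

lemma W_mult_closed_co:
  assumes x: "x \<in> carrier W" and y: "y \<in> carrier W"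
  shows "x \<otimes>\<^bsub>W\<^esub> y \<in> carrier W \<and> (\<forall>l<p. co (x \<otimes>\<^bsub>W\<^esub> y) l = K1.conv (t1 \<otimes> t2) (co x) (co y) l)"
proof -
  have "(x \<otimes>\<^bsub>W\<^esub> y) (K1.chi_pow l) \<in> carrier (T.T l) \<and> co (x \<otimes>\<^bsub>W\<^esub> y) l = K1.conv (t1 \<otimes> t2) (co x) (co y) l"
    if l: "l < p" for l
  proof -
    let ?I = "{(i, j). i < p \<and> j < p \<and> (i + j) mod p = l}"
    let ?f = "\<lambda>(i, j). tensor_mult (carrier R) (M l) (N l) (x (K1.chi_pow i)) (y (K1.chi_pow j))"
    have fin: "finite ?I" by (rule finite_subset[of _ "{..<p} \<times> {..<p}"]) auto
    have tm: "?f ij \<in> carrier (T.T l) \<and> lam l (?f ij) = (case ij of (i, j) \<Rightarrow>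
        if i + j < p then co x i \<otimes> co y j else (t1 \<otimes> t2) \<otimes> (co x i \<otimes> co y j))" if ij: "ij \<in> ?I" for ij
    proof -
      obtain i j where ij': "ij = (i, j)" "i < p" "j < p" "(i + j) mod p = l" using ij by blast
      have "x (K1.chi_pow i) \<in> carrier (T.T i)" "y (K1.chi_pow j) \<in> carrier (T.T j)"
        using x y ij' by (simp_all add: carrier_W)
      from lam_tmult[OF ij'(2-4) this] show ?thesis unfolding ij'(1) co_def by simp
    qed
    have fc: "?f \<in> ?I \<rightarrow> carrier (T.T l)" by (rule Pi_I) (use tm in blast)
    have pr: "(x \<otimes>\<^bsub>W\<^esub> y) (K1.chi_pow l) = finsum (T.T l) ?f ?I"
    proof -
      let ?h = "\<lambda>(i, j). (K1.chi_pow i, K1.chi_pow j)"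
      let ?g = "\<lambda>(\<psi>, \<phi>). tensor_mult (carrier R) (M l) (N l) (x \<psi>) (y \<phi>)"
      note b = product_index[OF l]
      have "finsum (T.T l) ?g (?h ` ?I) = finsum (T.T l) (\<lambda>ij. ?g (?h ij)) ?I"
      proof (rule T.T.finsum_reindex)
        show "?g \<in> ?h ` ?I \<rightarrow> carrier (T.T l)"
        \<comment> \<open>Membership of the summands in the right tensor product is known only for
          pairs of the form \<open>chi_pow i, chi_pow j\<close>, so each pair in the image is first
          traced back to its exponents.\<close>
        proof
          fix \<psi>\<phi> assume "\<psi>\<phi> \<in> ?h ` ?I"
          then obtain ij where ij: "ij \<in> ?I" "\<psi>\<phi> = ?h ij" by blast
          then have "?g \<psi>\<phi> = ?f ij" by (cases ij) simp
          then show "?g \<psi>\<phi> \<in> carrier (T.T l)" using tm[OF ij(1)] by (simp only:)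
        qed
        show "inj_on ?h ?I" using b by (rule bij_betw_imp_inj_on)
      qed
      moreover have "(\<lambda>ij. ?g (?h ij)) = ?f" by (auto simp: fun_eq_iff)
      ultimately show ?thesis unfolding W_mult[OF l] bij_betw_imp_surj_on[OF b, symmetric] by simp
    qed
    have "co (x \<otimes>\<^bsub>W\<^esub> y) l = lam l (finsum (T.T l) ?f ?I)" unfolding co_def pr ..
    also have "\<dots> = finsum R (\<lambda>ij. lam l (?f ij)) ?I"
      by (rule balanced_map.lift_finsum[OF balanced_lam[OF l] fin fc])
    also have "\<dots> = K1.conv (t1 \<otimes> t2) (co x) (co y) l"
      unfolding K1.conv_def
    proof (rule K1.R.finsum_cong'[OF refl])
      have "co x i \<in> carrier R" "co y i \<in> carrier R" if "i < p" for i
        using that co_closed[OF x] co_closed[OF y] by (simp_all add: Pi_iff)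
      then show "(\<lambda>(i, j). if i + j < p then co x i \<otimes> co y j else (t1 \<otimes> t2) \<otimes> (co x i \<otimes> co y j))
          \<in> ?I \<rightarrow> carrier R" by (intro Pi_I) (auto split: if_splits)
    qed (use tm in blast)
    finally show ?thesis unfolding pr using T.T.finsum_closed[OF fc] by simp
  qed
  then show ?thesis by (simp add: carrier_W W_ext)
qed

lemma act_T:
  assumes i: "i < p" and g: "g \<in> carrier G" and z: "z \<in> carrier (T.T i)"
  shows "tensor_lift (T.T i) (\<lambda>s t. T.pure i (emb S1 (c (K1.chi_pow i g)) \<otimes>\<^bsub>S1\<^esub> s) t) z
    = E i (c (\<chi> g ^ i) \<otimes> lam i z)"
proof -
  have cg: "K1.chi_pow i g = \<chi> g ^ i" using g by (simp add: K1.chi_pow_def)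
  let ?k = "emb S1 (c (\<chi> g ^ i))"
  have kc: "?k \<in> carrier S1" by (simp add: K1.c_closed)
  interpret A: balanced_map R "M i" "N i" "T.T i" "\<lambda>s t. T.pure i (?k \<otimes>\<^bsub>S1\<^esub> s) t"
  proof (intro balanced_map.intro factors balanced_map_axioms.intro T.T.abelian_group_axioms)
    show "T.pure i (?k \<otimes>\<^bsub>S1\<^esub> (r \<odot>\<^bsub>M i\<^esub> m)) n = T.pure i (?k \<otimes>\<^bsub>S1\<^esub> m) (r \<odot>\<^bsub>N i\<^esub> n)"
      if "r \<in> carrier R" "m \<in> carrier (M i)" "n \<in> carrier (N i)" for r m n
    proof -
      have "?k \<otimes>\<^bsub>S1\<^esub> (r \<odot>\<^bsub>M i\<^esub> m) = r \<odot>\<^bsub>M i\<^esub> (?k \<otimes>\<^bsub>S1\<^esub> m)"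
        using that kc by (simp add: M_simps K1.eigen_closed K1.S.m_lcomm)
      moreover have "?k \<otimes>\<^bsub>S1\<^esub> m \<in> carrier (M i)" using that by (simp add: M_simps K1.eigen_smult K1.c_closed)
      ultimately show ?thesis using T.pure_smult[of r "?k \<otimes>\<^bsub>S1\<^esub> m" i n] that by simp
    qed
  next
    show "T.pure i (?k \<otimes>\<^bsub>S1\<^esub> (m \<oplus>\<^bsub>M i\<^esub> m')) n = T.pure i (?k \<otimes>\<^bsub>S1\<^esub> m) n \<oplus>\<^bsub>T.T i\<^esub> T.pure i (?k \<otimes>\<^bsub>S1\<^esub> m') n"
      if "m \<in> carrier (M i)" "m' \<in> carrier (M i)" "n \<in> carrier (N i)" for m m' n
      using that T.pure_add_left[of "?k \<otimes>\<^bsub>S1\<^esub> m" i "?k \<otimes>\<^bsub>S1\<^esub> m'" n] kc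
      by (simp add: M_simps K1.eigen_smult K1.c_closed K1.S.r_distr K1.eigen_closed)
  next
    show "T.pure i (?k \<otimes>\<^bsub>S1\<^esub> m) (n \<oplus>\<^bsub>N i\<^esub> n') = T.pure i (?k \<otimes>\<^bsub>S1\<^esub> m) n \<oplus>\<^bsub>T.T i\<^esub> T.pure i (?k \<otimes>\<^bsub>S1\<^esub> m) n'"
      if "m \<in> carrier (M i)" "n \<in> carrier (N i)" "n' \<in> carrier (N i)" for m n n'
      using that T.pure_add_right[of "?k \<otimes>\<^bsub>S1\<^esub> m" i n n'] by (simp add: M_simps K1.eigen_smult K1.c_closed)
  next
    show "T.pure i (?k \<otimes>\<^bsub>S1\<^esub> m) n \<in> carrier (T.T i)" if "m \<in> carrier (M i)" "n \<in> carrier (N i)" for m n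
      using that by (intro T.pure_closed) (simp_all add: M_simps K1.eigen_smult K1.c_closed)
  qed
  define r where "r = lam i z"
  have r: "r \<in> carrier R" "z = E i r" using i z by (simp_all add: r_def lam_closed E_lam)
  have "A.lift (E i r) = T.pure i (?k \<otimes>\<^bsub>S1\<^esub> (emb S1 r \<otimes>\<^bsub>S1\<^esub> u1 [^]\<^bsub>S1\<^esub> i)) (u2 [^]\<^bsub>S2\<^esub> i)"
    unfolding E_def by (rule A.lift_pure) (simp_all add: M_simps N_simps K1.emb_u_eigen K2.u_eigen r)
  also have "\<dots> = E i (c (\<chi> g ^ i) \<otimes> r)"
    unfolding E_def using r by (simp add: K1.S.m_assoc K1.c_closed)
  finally show ?thesis unfolding cg r_def[symmetric] r(2)[symmetric] by (simp add: r_def)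
qed

text \<open>The coordinates \<open>co\<close> form a bijection to the polynomial model that respects
  all operations, so \<open>transport\<close> applies; in particular the ring laws of the Harrison
  product come from the model.\<close>

lemma harrison_product_kummer: "\<exists>v. kummer_extn G p \<chi> R c W v (t1 \<otimes> t2)"
proof -
  have t: "t1 \<otimes> t2 \<in> Units R" by (rule K1.R.Units_m_closed[OF K1.t_unit K2.t_unit])
  define K where "K = kummer_extension p R c \<chi> (t1 \<otimes> t2)"
  obtain w where "kummer_extn G p \<chi> R c K w (t1 \<otimes> t2)"
    using K1.kummer_extension_kummer[OF t] unfolding K_def by blast
  then interpret K: kummer_extn G p \<chi> R c K w "t1 \<otimes> t2" .
  define H where "H x = K.lin (co x)" for x
  have coef_H: "K.coef i (H x) = co x i" if "x \<in> carrier W" "i < p" for x i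
    unfolding H_def using co_closed[OF that(1)] that(2) by (rule K.coef_lin)
  have add: "x \<oplus>\<^bsub>W\<^esub> y \<in> carrier W" "co (x \<oplus>\<^bsub>W\<^esub> y) i = co x i \<oplus> co y i"
    if "x \<in> carrier W" "y \<in> carrier W" "i < p" for x y i
    using that by (simp_all add: carrier_W W_ext W_simps co_def lam_add)
  have one_l: "\<one>\<^bsub>T.T 0\<^esub> = E 0 \<one>" by (simp add: T.T_one E_def M_simps N_simps)
  have emb_l: "T.pure 0 (emb S1 r) \<one>\<^bsub>S2\<^esub> = E 0 r" if "r \<in> carrier R" for r using that by (simp add: E_def)
  have one: "\<one>\<^bsub>W\<^esub> \<in> carrier W" "co \<one>\<^bsub>W\<^esub> i = (if 0 = i then \<one> else \<zero>)" if "i < p" for i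
    using that E_closed[of "\<one>" 0] by (auto simp: carrier_W W_ext W_simps co_def lam_zero one_l lam_E)
  have emb: "emb W r \<in> carrier W" "co (emb W r) i = (if 0 = i then r else \<zero>)" if "r \<in> carrier R" "i < p" for r i
    using that E_closed[of r 0] by (auto simp: carrier_W W_ext W_simps co_def lam_zero emb_l lam_E)
  have act: "act W g x \<in> carrier W" "co (act W g x) i = c (\<chi> g ^ i) \<otimes> co x i"
    if "g \<in> carrier G" "x \<in> carrier W" "i < p" for g x i
    using that by (auto simp: carrier_W W_ext W_simps co_def act_T lam_E E_closed lam_closed K1.c_closed)
  have "kummer_extn G p \<chi> R c W (inv_into (carrier W) H w) (t1 \<otimes> t2)"
  proof (rule K.transport)
    show "bij_betw H (carrier W) (carrier K)"
    proof (rule bij_betw_imageI)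
      show "inj_on H (carrier W)"
      proof (rule inj_onI, rule co_eqI)
        fix x y i assume "x \<in> carrier W" "y \<in> carrier W" "H x = H y" "i < p"
        then show "co x i = co y i" using coef_H[of x i] coef_H[of y i] by simp
      qed
      show "H ` carrier W = carrier K"
      proof (intro equalityI subsetI)
        fix y assume y: "y \<in> carrier K"
        then have c: "(\<lambda>i. K.coef i y) \<in> {..<p} \<rightarrow> carrier R" by auto
        then obtain x where x: "x \<in> carrier W" "\<forall>i<p. co x i = K.coef i y" using co_surj by blast
        then have "H x = y" unfolding H_def using K.lin_coef[OF y] K.lin_cong[of "co x" "\<lambda>i. K.coef i y"] c by simp
        then show "y \<in> H ` carrier W" using x by blast
      qed (auto simp: H_def intro!: K.lin_closed co_closed)
    qed
    show "H (x \<otimes>\<^bsub>W\<^esub> y) = H x \<otimes>\<^bsub>K\<^esub> H y" if "x \<in> carrier W" "y \<in> carrier W" for x y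
      unfolding H_def K.lin_mult[OF co_closed[OF that(1)] co_closed[OF that(2)]]
      by (rule K.lin_cong)
        (use W_mult_closed_co[OF that] K.conv_closed[OF co_closed[OF that(1)] co_closed[OF that(2)]] in auto)
    show "H (x \<oplus>\<^bsub>W\<^esub> y) = H x \<oplus>\<^bsub>K\<^esub> H y" if "x \<in> carrier W" "y \<in> carrier W" for x y
      unfolding H_def K.lin_add[OF co_closed[OF that(1)] co_closed[OF that(2)], symmetric]
      by (rule K.lin_cong) (use add[OF that] co_closed[OF that(1)] co_closed[OF that(2)] in \<open>auto simp: Pi_iff\<close>)
    have lin0: "K.lin (\<lambda>j. if 0 = j then r else \<zero>) = emb K r" if "r \<in> carrier R" for r
      using K.lin_single[OF that, of 0] K1.p_pos that by simp
    show "H (emb W r) = emb K r" if r: "r \<in> carrier R" for r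
      unfolding lin0[OF r, symmetric] H_def by (rule K.lin_cong) (use emb r in auto)
    show "H \<one>\<^bsub>W\<^esub> = \<one>\<^bsub>K\<^esub>"
    proof -
      have "H \<one>\<^bsub>W\<^esub> = K.lin (\<lambda>j. if 0 = j then \<one> else \<zero>)"
        unfolding H_def by (rule K.lin_cong) (use one in auto)
      then show ?thesis using lin0[of "\<one>"] by simp
    qed
    show "H \<zero>\<^bsub>W\<^esub> = \<zero>\<^bsub>K\<^esub>"
    proof -
      have "H \<zero>\<^bsub>W\<^esub> = K.lin (\<lambda>j. if 0 = j then \<zero> else \<zero>)"
        unfolding H_def by (rule K.lin_cong) (auto simp: co_def W_simps lam_zero)
      then show ?thesis using lin0[of "\<zero>"] by simp
    qed
    show "H (act W g x) = act K g (H x)" if "g \<in> carrier G" "x \<in> carrier W" for g x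
      unfolding H_def K.act_lin[OF that(1) co_closed[OF that(2)]]
      by (rule K.lin_cong) (use act[OF that] co_closed[OF that(2)] in \<open>auto simp: Pi_iff K1.c_closed\<close>)
    show "\<zero>\<^bsub>W\<^esub> \<in> carrier W" by (simp add: carrier_W W_ext W_simps)
    show "x \<otimes>\<^bsub>W\<^esub> y \<in> carrier W" if "x \<in> carrier W" "y \<in> carrier W" for x y
      using W_mult_closed_co[OF that] by (rule conjunct1)
    show "x \<oplus>\<^bsub>W\<^esub> y \<in> carrier W" if "x \<in> carrier W" "y \<in> carrier W" for x y
      using that K1.p_pos by (rule add(1))
    show "\<one>\<^bsub>W\<^esub> \<in> carrier W" using K1.p_pos by (rule one(1))
    show "emb W r \<in> carrier W" if "r \<in> carrier R" for r using that K1.p_pos by (rule emb(1))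
    show "act W g x \<in> carrier W" if "g \<in> carrier G" "x \<in> carrier W" for g x
      using that K1.p_pos by (rule act(1))
  qed
  then show ?thesis by blast
qed

end

section \<open>Kummer classification of the Harrison group\<close>

context kummer_ring
begin

text \<open>Described by the existence of a generator and not by isomorphism with a chosen
  extension, so that membership can be tested without picking a representative.\<close>

definition kummer_class :: "'a \<Rightarrow> ('a, 'g, 'a list) gext set" where
  "kummer_class t = {T. \<exists>v. kummer_extn G p \<chi> R c T v t}"

abbreviation "hgroup \<equiv> harrison_group p G R c"

text \<open>An extension isomorphic to \<open>S\<close> has a parameter differing from
  \<open>t\<close> by a \<open>p\<close>-th power, and rescaling its generator removes the
  difference.\<close>

lemma gext_class_kummer:
  assumes "kummer_extn G p \<chi> R c S u t" shows "gext_class R G S = kummer_class t"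
proof -
  interpret S: kummer_extn G p \<chi> R c S u t by (rule assms)
  show ?thesis
  proof (intro equalityI subsetI)
    fix T assume "T \<in> gext_class R G S"
    then have T: "galois_extension R G T" "gext_isomorphic R G S T" by (simp_all add: gext_class_def)
    obtain v t' where v: "kummer_extn G p \<chi> R c T v t'" using galois_imp_kummer[OF T(1)] by blast
    obtain r where "r \<in> Units R" "t = r [^] p \<otimes> t'" using S.iso_unit[OF v T(2)] by blast
    then show "T \<in> kummer_class t" using kummer_extn.rescale[OF v] unfolding kummer_class_def by blast
  next
    fix T assume "T \<in> kummer_class t"
    then obtain v where v: "kummer_extn G p \<chi> R c T v t" unfolding kummer_class_def by blast
    show "T \<in> gext_class R G S"
      unfolding gext_class_def using kummer_extn.galois[OF v] S.iso_same[OF v] by blast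
  qed
qed

lemma gext_class_kummer_extension:
  assumes "t \<in> Units R" shows "gext_class R G (kummer_extension p R c \<chi> t) = kummer_class t"
proof -
  obtain u where "kummer_extn G p \<chi> R c (kummer_extension p R c \<chi> t) u t"
    using kummer_extension_kummer[OF assms] by blast
  then show ?thesis by (rule gext_class_kummer)
qed

lemma kummer_class_nonempty: assumes "t \<in> Units R" shows "\<exists>T v. T \<in> kummer_class t \<and> kummer_extn G p \<chi> R c T v t"
proof -
  obtain u where u: "kummer_extn G p \<chi> R c (kummer_extension p R c \<chi> t) u t"
    using kummer_extension_kummer[OF assms] by blast
  obtain T :: "('a, 'g, 'a list) gext" and v where "kummer_extn G p \<chi> R c T v t"
    using kummer_extn.list_model[OF u] by blast
  then show ?thesis unfolding kummer_class_def by blast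
qed

lemma kummer_class_eq_iff:
  assumes t: "t \<in> Units R" and t': "t' \<in> Units R"
  shows "kummer_class t = kummer_class t' \<longleftrightarrow> (\<exists>r\<in>Units R. t = r [^] p \<otimes> t')"
proof
  assume e: "kummer_class t = kummer_class t'"
  obtain T v where T: "T \<in> kummer_class t" "kummer_extn G p \<chi> R c T v t" using kummer_class_nonempty[OF t] by blast
  obtain v' where v': "kummer_extn G p \<chi> R c T v' t'" using T(1) e unfolding kummer_class_def by blast
  show "\<exists>r\<in>Units R. t = r [^] p \<otimes> t'"
    by (rule kummer_extn.iso_unit[OF T(2) v']) (rule kummer_extn.iso_same[OF T(2) T(2)])
next
  \<comment> \<open>One inclusion for every unit \<open>r\<close> suffices: the reverse inclusion is
    the same statement for the inverse of \<open>r\<close>.\<close>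
  have sub: "kummer_class t' \<subseteq> kummer_class (r [^] p \<otimes> t')" if "r \<in> Units R" for r t'
  proof
    fix T assume "T \<in> kummer_class t'"
    then obtain v where "kummer_extn G p \<chi> R c T v t'" unfolding kummer_class_def by blast
    from kummer_extn.rescale[OF this that] show "T \<in> kummer_class (r [^] p \<otimes> t')"
      unfolding kummer_class_def by blast
  qed
  assume "\<exists>r\<in>Units R. t = r [^] p \<otimes> t'"
  then obtain r where r: "r \<in> Units R" "t = r [^] p \<otimes> t'" by blast
  have c: "r \<in> carrier R" "inv\<^bsub>R\<^esub> r \<in> carrier R" "t' \<in> carrier R" using r(1) t' by (simp_all add: R.Units_closed)
  have "(inv\<^bsub>R\<^esub> r) [^] p \<otimes> t = (inv\<^bsub>R\<^esub> r \<otimes> r) [^] p \<otimes> t'"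
    using c by (simp add: r(2) R.nat_pow_distrib R.m_assoc)
  also have "\<dots> = t'" using r(1) c by simp
  finally have "t' = (inv\<^bsub>R\<^esub> r) [^] p \<otimes> t" ..
  then show "kummer_class t = kummer_class t'"
    using sub[of "inv\<^bsub>R\<^esub> r" t] sub[OF r(1), of t'] r by auto
qed

lemma carrier_hgroup: "carrier hgroup = kummer_class ` Units R"
proof (intro equalityI subsetI)
  fix B assume "B \<in> carrier hgroup"
  then obtain S :: "('a, 'g, 'a list) gext" where S: "galois_extension R G S" "B = gext_class R G S"
    by (auto simp: harrison_group_def)
  obtain u t where u: "kummer_extn G p \<chi> R c S u t" using galois_imp_kummer[OF S(1)] by blast
  then show "B \<in> kummer_class ` Units R"
    using gext_class_kummer[OF u] kummer_extn.t_unit[OF u] S(2) by blast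
next
  fix B assume "B \<in> kummer_class ` Units R"
  then obtain t where t: "t \<in> Units R" "B = kummer_class t" by blast
  obtain T v where T: "kummer_extn G p \<chi> R c T v t" "T \<in> kummer_class t" using kummer_class_nonempty[OF t(1)] by blast
  then have "B = gext_class R G T" "galois_extension R G T"
    using gext_class_kummer[OF T(1)] kummer_extn.galois[OF T(1)] t(2) by simp_all
  then show "B \<in> carrier hgroup" by (auto simp: harrison_group_def)
qed

text \<open>The product of classes is a union over all pairs of representatives; each pair gives the
  same class, and there is at least one pair.\<close>

lemma hgroup_mult:
  assumes t: "t1 \<in> Units R" "t2 \<in> Units R"
  shows "kummer_class t1 \<otimes>\<^bsub>hgroup\<^esub> kummer_class t2 = kummer_class (t1 \<otimes> t2)"
proof -
  have all: "gext_class R G (harrison_product p G R c S1 S2) = kummer_class (t1 \<otimes> t2)"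
    if S: "S1 \<in> kummer_class t1" "S2 \<in> kummer_class t2" for S1 S2
  proof -
    obtain u1 where u1: "kummer_extn G p \<chi> R c S1 u1 t1" using S(1) unfolding kummer_class_def by blast
    obtain u2 where u2: "kummer_extn G p \<chi> R c S2 u2 t2" using S(2) unfolding kummer_class_def by blast
    interpret kummer_pair G p \<chi> R c S1 u1 t1 S2 u2 t2 by (rule kummer_pair.intro[OF u1 u2])
    obtain v where "kummer_extn G p \<chi> R c (harrison_product p G R c S1 S2) v (t1 \<otimes> t2)"
      using harrison_product_kummer by blast
    then show ?thesis by (rule gext_class_kummer)
  qed
  obtain S1 S2 where "S1 \<in> kummer_class t1" "S2 \<in> kummer_class t2"
    using kummer_class_nonempty[OF t(1)] kummer_class_nonempty[OF t(2)] by blast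
  then show ?thesis unfolding harrison_group_def using all by auto
qed

lemma hgroup_one: "\<one>\<^bsub>hgroup\<^esub> = kummer_class \<one>"
  using gext_class_kummer[OF trivial_kummer] by (simp add: harrison_group_def)

text \<open>The laws are inherited from the unit group through the multiplicative surjection
  \<open>kummer_class\<close>.\<close>

lemma comm_group_hgroup: "comm_group hgroup"
proof (rule comm_groupI)
  show "\<exists>y\<in>carrier hgroup. y \<otimes>\<^bsub>hgroup\<^esub> x = \<one>\<^bsub>hgroup\<^esub>" if x: "x \<in> carrier hgroup" for x
  proof -
    obtain t where t: "t \<in> Units R" "x = kummer_class t" using x unfolding carrier_hgroup by blast
    have "kummer_class (inv\<^bsub>R\<^esub> t) \<otimes>\<^bsub>hgroup\<^esub> x = \<one>\<^bsub>hgroup\<^esub>"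
      using t hgroup_mult[of "inv\<^bsub>R\<^esub> t" t] by (simp add: hgroup_one)
    then show ?thesis unfolding carrier_hgroup using t(1) by blast
  qed
  fix x y assume "x \<in> carrier hgroup" "y \<in> carrier hgroup"
  then obtain t t' where t: "t \<in> Units R" "x = kummer_class t" "t' \<in> Units R" "y = kummer_class t'"
    unfolding carrier_hgroup by blast
  show "x \<otimes>\<^bsub>hgroup\<^esub> y \<in> carrier hgroup" using t by (simp add: hgroup_mult carrier_hgroup)
  show "x \<otimes>\<^bsub>hgroup\<^esub> y = y \<otimes>\<^bsub>hgroup\<^esub> x" using t by (simp add: hgroup_mult R.m_comm R.Units_closed)
  fix z assume "z \<in> carrier hgroup"
  then obtain t'' where t'': "t'' \<in> Units R" "z = kummer_class t''" unfolding carrier_hgroup by blast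
  show "x \<otimes>\<^bsub>hgroup\<^esub> y \<otimes>\<^bsub>hgroup\<^esub> z = x \<otimes>\<^bsub>hgroup\<^esub> (y \<otimes>\<^bsub>hgroup\<^esub> z)"
    using t t'' by (simp add: hgroup_mult R.m_assoc R.Units_closed)
next
  show "\<one>\<^bsub>hgroup\<^esub> \<in> carrier hgroup" by (simp add: hgroup_one carrier_hgroup)
  fix x assume "x \<in> carrier hgroup"
  then obtain t where t: "t \<in> Units R" "x = kummer_class t" unfolding carrier_hgroup by blast
  then show "\<one>\<^bsub>hgroup\<^esub> \<otimes>\<^bsub>hgroup\<^esub> x = x" using hgroup_mult[of "\<one>" t] by (simp add: hgroup_one R.Units_closed)
qed

text \<open>Base change acts on parameters by the ring homomorphism, for every representative in the
  same way.\<close>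

lemma harrison_map_kummer:
  fixes R2 :: "'b ring" and c2 :: "'k \<Rightarrow> 'b"
  assumes "kummer_ring G p \<chi> R2 c2" and j: "j \<in> ring_hom R R2" "\<And>a. j (c a) = c2 a" and t: "t \<in> Units R"
  shows "harrison_map G R R2 j (kummer_class t) = kummer_ring.kummer_class G p \<chi> R2 c2 (j t)"
proof -
  interpret R2: kummer_ring G p \<chi> R2 c2 by (rule assms(1))
  have all: "gext_class R2 G (base_change R R2 j S) = R2.kummer_class (j t)" if S: "S \<in> kummer_class t" for S
  proof -
    obtain u where u: "kummer_extn G p \<chi> R c S u t" using S unfolding kummer_class_def by blast
    obtain v where "kummer_extn G p \<chi> R2 c2 (base_change R R2 j S) v (j t)"
      using kummer_extn.base_change_kummer[OF u R2.kummer_base_axioms j] by blast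
    then show ?thesis by (rule R2.gext_class_kummer)
  qed
  obtain S where "S \<in> kummer_class t" using kummer_class_nonempty[OF t] by blast
  then show ?thesis unfolding harrison_map_def using all by auto
qed

end

section \<open>Direct limits of abelian groups\<close>

locale directed_system =
  fixes I :: "'i::order set" and H :: "'i \<Rightarrow> 'h monoid" and f :: "'i \<Rightarrow> 'i \<Rightarrow> 'h \<Rightarrow> 'h"
  assumes system: "direct_system I H f"
    and directed: "\<lbrakk>i \<in> I; j \<in> I\<rbrakk> \<Longrightarrow> \<exists>k\<in>I. i \<le> k \<and> j \<le> k"
begin

abbreviation "L \<equiv> direct_limit I H f"
definition "cl i a = dlim_rel I H f `` {(i, a)}"

lemma f_closed: "\<lbrakk>i \<in> I; j \<in> I; i \<le> j; a \<in> carrier (H i)\<rbrakk> \<Longrightarrow> f i j a \<in> carrier (H j)"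
  using system unfolding direct_system_def hom_def by blast

lemma f_mult: "\<lbrakk>i \<in> I; j \<in> I; i \<le> j; a \<in> carrier (H i); b \<in> carrier (H i)\<rbrakk> \<Longrightarrow>
    f i j (a \<otimes>\<^bsub>H i\<^esub> b) = f i j a \<otimes>\<^bsub>H j\<^esub> f i j b"
  using system unfolding direct_system_def hom_def by blast

lemma f_id: "\<lbrakk>i \<in> I; a \<in> carrier (H i)\<rbrakk> \<Longrightarrow> f i i a = a"
  using system unfolding direct_system_def by blast

lemma f_comp: "\<lbrakk>i \<in> I; j \<in> I; k \<in> I; i \<le> j; j \<le> k; a \<in> carrier (H i)\<rbrakk> \<Longrightarrow> f j k (f i j a) = f i k a"
  using system unfolding direct_system_def by blast

lemma H_mult_closed: "\<lbrakk>i \<in> I; a \<in> carrier (H i); b \<in> carrier (H i)\<rbrakk> \<Longrightarrow> a \<otimes>\<^bsub>H i\<^esub> b \<in> carrier (H i)"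
  using system unfolding direct_system_def
  by (meson comm_group.axioms(1) comm_monoid.axioms(1) monoid.m_closed)

lemma rel_iff: "((i, a), (j, b)) \<in> dlim_rel I H f \<longleftrightarrow> i \<in> I \<and> j \<in> I \<and> a \<in> carrier (H i) \<and> b \<in> carrier (H j) \<and>
    (\<exists>k\<in>I. i \<le> k \<and> j \<le> k \<and> f i k a = f j k b)"
  by (simp add: dlim_rel_def)

lemma rel_push: assumes "i \<in> I" "k \<in> I" "i \<le> k" "a \<in> carrier (H i)" shows "((i, a), (k, f i k a)) \<in> dlim_rel I H f"
proof -
  have "f i k a = f k k (f i k a)" using assms f_closed f_id by simp
  then show ?thesis unfolding rel_iff using assms f_closed by blast
qed

lemma equiv_rel: "equiv (SIGMA i:I. carrier (H i)) (dlim_rel I H f)"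
proof (rule equivI)
  show "dlim_rel I H f \<subseteq> (SIGMA i:I. carrier (H i)) \<times> (SIGMA i:I. carrier (H i))" by (auto simp: dlim_rel_def)
  show "refl_on (SIGMA i:I. carrier (H i)) (dlim_rel I H f)"
    by (rule refl_onI) (auto simp: rel_iff)
  show "sym (dlim_rel I H f)" by (rule symI) (fastforce simp: dlim_rel_def)
  show "trans (dlim_rel I H f)"
  proof (rule transI)
    fix x y z assume "(x, y) \<in> dlim_rel I H f" "(y, z) \<in> dlim_rel I H f"
    moreover obtain i a j b k d where x: "x = (i, a)" "y = (j, b)" "z = (k, d)" by (cases x, cases y, cases z)
    ultimately have c: "i \<in> I" "j \<in> I" "k \<in> I" "a \<in> carrier (H i)" "b \<in> carrier (H j)" "d \<in> carrier (H k)"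
      and "\<exists>m\<in>I. i \<le> m \<and> j \<le> m \<and> f i m a = f j m b" "\<exists>m\<in>I. j \<le> m \<and> k \<le> m \<and> f j m b = f k m d"
      by (simp_all add: rel_iff)
    then obtain m m' where m: "m \<in> I" "i \<le> m" "j \<le> m" "f i m a = f j m b" "m' \<in> I" "j \<le> m'" "k \<le> m'" "f j m' b = f k m' d"
      by blast
    obtain q where q: "q \<in> I" "m \<le> q" "m' \<le> q" using directed m by blast
    have "f i q a = f m q (f i m a)" using c m(1,2) q by (simp add: f_comp)
    also have "\<dots> = f j q b" unfolding m(4) using c m(1,3) q by (simp add: f_comp)
    also have "\<dots> = f m' q (f j m' b)" using c m(5,6) q by (simp add: f_comp)
    also have "\<dots> = f k q d" unfolding m(8) using c m(5,7) q by (simp add: f_comp)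
    finally have e: "f i q a = f k q d" .
    have "i \<le> q" "k \<le> q" using m q by (meson order_trans)+
    then show "(x, z) \<in> dlim_rel I H f" unfolding x rel_iff using e c q(1) by blast
  qed
qed

lemma cl_eq_iff: "\<lbrakk>i \<in> I; a \<in> carrier (H i); j \<in> I; b \<in> carrier (H j)\<rbrakk> \<Longrightarrow>
    cl i a = cl j b \<longleftrightarrow> ((i, a), (j, b)) \<in> dlim_rel I H f"
  unfolding cl_def by (rule eq_equiv_class_iff[OF equiv_rel]) auto

lemma carrier_L: "carrier L = {cl i a |i a. i \<in> I \<and> a \<in> carrier (H i)}"
  unfolding direct_limit_def cl_def quotient_def by auto

lemma mem_cl: "x \<in> cl i a \<longleftrightarrow> ((i, a), x) \<in> dlim_rel I H f"
  by (simp add: cl_def)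

lemma cl_self: "\<lbrakk>i \<in> I; a \<in> carrier (H i)\<rbrakk> \<Longrightarrow> (i, a) \<in> cl i a"
  unfolding mem_cl rel_iff by blast

text \<open>The product is defined as a union over all representatives and all common bounds. Any
  two choices become equal at an index above everything involved, so the union is a single
  class.\<close>

lemma mult_cl:
  assumes i: "i \<in> I" "a \<in> carrier (H i)" and j: "j \<in> I" "b \<in> carrier (H j)" and k: "k \<in> I" "i \<le> k" "j \<le> k"
  shows "cl i a \<otimes>\<^bsub>L\<^esub> cl j b = cl k (f i k a \<otimes>\<^bsub>H k\<^esub> f j k b)"
proof -
  let ?ab = "f i k a \<otimes>\<^bsub>H k\<^esub> f j k b"
  have abc: "?ab \<in> carrier (H k)" using i j k by (simp add: f_closed H_mult_closed)
  have all: "cl k' (f i' k' a' \<otimes>\<^bsub>H k'\<^esub> f j' k' b') = cl k ?ab"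
    if ia: "(i', a') \<in> cl i a" and jb: "(j', b') \<in> cl j b" and k': "k' \<in> I" "i' \<le> k'" "j' \<le> k'" for i' a' j' b' k'
  proof -
    from ia have i': "i' \<in> I" "a' \<in> carrier (H i')" and "\<exists>m\<in>I. i \<le> m \<and> i' \<le> m \<and> f i m a = f i' m a'"
      by (simp_all add: mem_cl rel_iff)
    then obtain m where m: "m \<in> I" "i \<le> m" "i' \<le> m" "f i m a = f i' m a'" by blast
    from jb have j': "j' \<in> I" "b' \<in> carrier (H j')" and "\<exists>m\<in>I. j \<le> m \<and> j' \<le> m \<and> f j m b = f j' m b'"
      by (simp_all add: mem_cl rel_iff)
    then obtain m' where m': "m' \<in> I" "j \<le> m'" "j' \<le> m'" "f j m' b = f j' m' b'" by blast
    obtain q1 where q1: "q1 \<in> I" "m \<le> q1" "m' \<le> q1" using directed m m' by blast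
    obtain q2 where q2: "q2 \<in> I" "k \<le> q2" "k' \<le> q2" using directed k k' by blast
    obtain q where q': "q \<in> I" "q1 \<le> q" "q2 \<le> q" using directed q1 q2 by blast
    then have q: "q \<in> I" "m \<le> q" "m' \<le> q" "k \<le> q" "k' \<le> q" using q1 q2 by (meson order_trans)+
    have 1: "f i' q a' = f i q a"
    proof -
      have "f i' q a' = f m q (f i' m a')" using m(1,3) q i' by (simp add: f_comp)
      also have "\<dots> = f i q a" unfolding m(4)[symmetric] using m(1,2) q i by (simp add: f_comp)
      finally show ?thesis .
    qed
    have 2: "f j' q b' = f j q b"
    proof -
      have "f j' q b' = f m' q (f j' m' b')" using m'(1,3) q j' by (simp add: f_comp)
      also have "\<dots> = f j q b" unfolding m'(4)[symmetric] using m'(1,2) q j by (simp add: f_comp)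
      finally show ?thesis .
    qed
    have "f k' q (f i' k' a' \<otimes>\<^bsub>H k'\<^esub> f j' k' b') = f i' q a' \<otimes>\<^bsub>H q\<^esub> f j' q b'"
      using i' j' k' q by (simp add: f_mult f_closed f_comp)
    also have "\<dots> = f k q ?ab" unfolding 1 2 using i j k q by (simp add: f_mult f_closed f_comp)
    finally have e: "f k' q (f i' k' a' \<otimes>\<^bsub>H k'\<^esub> f j' k' b') = f k q ?ab" .
    have c: "f i' k' a' \<otimes>\<^bsub>H k'\<^esub> f j' k' b' \<in> carrier (H k')" using i' j' k' by (simp add: f_closed H_mult_closed)
    show ?thesis unfolding cl_eq_iff[OF k'(1) c k(1) abc] rel_iff using c abc e q k(1) k'(1) by blast
  qed
  have "cl i a \<otimes>\<^bsub>L\<^esub> cl j b = (\<Union>(i', a')\<in>cl i a. \<Union>(j', b')\<in>cl j b. \<Union>k'\<in>{k'\<in>I. i' \<le> k' \<and> j' \<le> k'}.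
      cl k' (f i' k' a' \<otimes>\<^bsub>H k'\<^esub> f j' k' b'))"
    by (simp add: direct_limit_def cl_def)
  also have "\<dots> = cl k ?ab"
  proof (intro equalityI subsetI)
    fix x assume "x \<in> (\<Union>(i', a')\<in>cl i a. \<Union>(j', b')\<in>cl j b. \<Union>k'\<in>{k'\<in>I. i' \<le> k' \<and> j' \<le> k'}.
      cl k' (f i' k' a' \<otimes>\<^bsub>H k'\<^esub> f j' k' b'))"
    then obtain i' a' j' b' k' where "(i', a') \<in> cl i a" "(j', b') \<in> cl j b" "k' \<in> I" "i' \<le> k'" "j' \<le> k'"
      "x \<in> cl k' (f i' k' a' \<otimes>\<^bsub>H k'\<^esub> f j' k' b')" by blast
    then show "x \<in> cl k ?ab" using all by blast
  next
    fix x assume "x \<in> cl k ?ab"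
    then show "x \<in> (\<Union>(i', a')\<in>cl i a. \<Union>(j', b')\<in>cl j b. \<Union>k'\<in>{k'\<in>I. i' \<le> k' \<and> j' \<le> k'}.
      cl k' (f i' k' a' \<otimes>\<^bsub>H k'\<^esub> f j' k' b'))" using cl_self[OF i] cl_self[OF j] k by blast
  qed
  finally show ?thesis .
qed

lemma desc_cl:
  assumes u: "\<And>i j a. \<lbrakk>i \<in> I; j \<in> I; i \<le> j; a \<in> carrier (H i)\<rbrakk> \<Longrightarrow> u j (f i j a) = u i a"
    and i: "i \<in> I" "a \<in> carrier (H i)"
  shows "dlim_desc u (cl i a) = u i a"
proof -
  have all: "u j b = u i a" if jb: "(j, b) \<in> cl i a" for j b
  proof -
    from jb have j: "j \<in> I" "b \<in> carrier (H j)" and "\<exists>k\<in>I. i \<le> k \<and> j \<le> k \<and> f i k a = f j k b"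
      by (simp_all add: mem_cl rel_iff)
    then obtain k where "k \<in> I" "i \<le> k" "j \<le> k" "f i k a = f j k b" by blast
    then show ?thesis using u[of i k a] u[of j k b] i j by simp
  qed
  have "(\<lambda>(i, a). u i a) ` cl i a = {u i a}"
  proof (intro equalityI subsetI)
    fix y assume "y \<in> (\<lambda>(i, a). u i a) ` cl i a"
    then obtain j b where "(j, b) \<in> cl i a" "y = u j b" by auto
    then show "y \<in> {u i a}" using all by simp
  next
    fix y assume "y \<in> {u i a}"
    then show "y \<in> (\<lambda>(i, a). u i a) ` cl i a" using cl_self[OF i] by (intro image_eqI[of _ _ "(i, a)"]) auto
  qed
  then show ?thesis by (simp add: dlim_desc_def)
qed

lemma cl_closed: "i \<in> I \<Longrightarrow> a \<in> carrier (H i) \<Longrightarrow> cl i a \<in> carrier L"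
  unfolding carrier_L by blast

text \<open>Any two elements of the limit have representatives at one common index, so injectivity
  at each level and multiplicativity at each level pass to the limit.\<close>

lemma desc_iso:
  assumes u: "\<And>i j a. \<lbrakk>i \<in> I; j \<in> I; i \<le> j; a \<in> carrier (H i)\<rbrakk> \<Longrightarrow> u j (f i j a) = u i a"
    and hom: "\<And>i. i \<in> I \<Longrightarrow> u i \<in> hom (H i) K"
    and inj: "\<And>i. i \<in> I \<Longrightarrow> inj_on (u i) (carrier (H i))"
    and surj: "\<And>y. y \<in> carrier K \<Longrightarrow> \<exists>i\<in>I. \<exists>a\<in>carrier (H i). y = u i a"
  shows "dlim_desc u \<in> iso L K"
proof -
  have d: "dlim_desc u (cl i a) = u i a" if "i \<in> I" "a \<in> carrier (H i)" for i a
    using u that by (rule desc_cl)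
  have repr: "\<exists>k\<in>I. \<exists>a\<in>carrier (H k). \<exists>b\<in>carrier (H k). x = cl k a \<and> y = cl k b"
    if xy: "x \<in> carrier L" "y \<in> carrier L" for x y
  proof -
    obtain i a j b where ij: "i \<in> I" "a \<in> carrier (H i)" "x = cl i a" "j \<in> I" "b \<in> carrier (H j)" "y = cl j b"
      using xy unfolding carrier_L by blast
    obtain k where k: "k \<in> I" "i \<le> k" "j \<le> k" using directed ij by blast
    have "cl i a = cl k (f i k a)" "cl j b = cl k (f j k b)"
      using ij k by (simp_all add: cl_eq_iff f_closed rel_push)
    then show ?thesis using ij k f_closed by blast
  qed
  show ?thesis
  proof (rule isoI)
    show "dlim_desc u \<in> hom L K"
    proof (rule homI)
      fix x assume "x \<in> carrier L"
      then obtain i a where "i \<in> I" "a \<in> carrier (H i)" "x = cl i a" unfolding carrier_L by blast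
      then show "dlim_desc u x \<in> carrier K" using hom[of i] by (auto simp: d hom_def)
    next
      fix x y assume "x \<in> carrier L" "y \<in> carrier L"
      then obtain k a b where k: "k \<in> I" "a \<in> carrier (H k)" "b \<in> carrier (H k)" "x = cl k a" "y = cl k b"
        using repr by blast
      then have "x \<otimes>\<^bsub>L\<^esub> y = cl k (a \<otimes>\<^bsub>H k\<^esub> b)" using mult_cl[of k a k b k] by (simp add: f_id)
      then show "dlim_desc u (x \<otimes>\<^bsub>L\<^esub> y) = dlim_desc u x \<otimes>\<^bsub>K\<^esub> dlim_desc u y"
        using k hom[of k] by (simp add: d H_mult_closed hom_def)
    qed
    show "bij_betw (dlim_desc u) (carrier L) (carrier K)"
    proof (rule bij_betw_imageI)
      show "inj_on (dlim_desc u) (carrier L)"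
      proof (rule inj_onI)
        fix x y assume xy: "x \<in> carrier L" "y \<in> carrier L" and e: "dlim_desc u x = dlim_desc u y"
        obtain k a b where k: "k \<in> I" "a \<in> carrier (H k)" "b \<in> carrier (H k)" "x = cl k a" "y = cl k b"
          using repr[OF xy] by blast
        then have "u k a = u k b" using e by (simp add: d)
        then show "x = y" using inj_onD[OF inj] k by blast
      qed
      show "dlim_desc u ` carrier L = carrier K"
      proof (intro equalityI subsetI)
        fix y assume "y \<in> dlim_desc u ` carrier L"
        then obtain i a where "i \<in> I" "a \<in> carrier (H i)" "y = u i a" unfolding carrier_L using d by auto
        then show "y \<in> carrier K" using hom[of i] by (auto simp: hom_def)
      next
        fix y assume "y \<in> carrier K"
        then obtain i a where "i \<in> I" "a \<in> carrier (H i)" "y = u i a" using surj by blast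
        then show "y \<in> dlim_desc u ` carrier L" using cl_closed[of i a] d[of i a] by (metis image_eqI)
      qed
    qed
  qed
qed

end

section \<open>Homogeneous polynomials on projective space\<close>

definition monom_eval :: "(nat \<Rightarrow>\<^sub>0 nat) \<Rightarrow> (nat \<Rightarrow> 'k::field) \<Rightarrow> 'k" where
  "monom_eval m v = (\<Prod>i\<in>Poly_Mapping.keys m. v i ^ Poly_Mapping.lookup m i)"

definition monom_degree :: "(nat \<Rightarrow>\<^sub>0 nat) \<Rightarrow> nat" where
  "monom_degree m = (\<Sum>i\<in>Poly_Mapping.keys m. Poly_Mapping.lookup m i)"

lemma monom_eval_superset:
  "finite K \<Longrightarrow> Poly_Mapping.keys m \<subseteq> K \<Longrightarrow> monom_eval m v = (\<Prod>i\<in>K. v i ^ Poly_Mapping.lookup m i)"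
  unfolding monom_eval_def by (rule prod.mono_neutral_left) (auto simp: in_keys_iff)

lemma monom_degree_superset:
  "finite K \<Longrightarrow> Poly_Mapping.keys m \<subseteq> K \<Longrightarrow> monom_degree m = (\<Sum>i\<in>K. Poly_Mapping.lookup m i)"
  unfolding monom_degree_def by (rule sum.mono_neutral_left) (auto simp: in_keys_iff)

lemma monom_eval_add: "monom_eval (m + m') v = monom_eval m v * monom_eval m' v"
proof -
  let ?K = "Poly_Mapping.keys m \<union> Poly_Mapping.keys m'"
  have "monom_eval (m + m') v = (\<Prod>i\<in>?K. v i ^ Poly_Mapping.lookup (m + m') i)"
    by (rule monom_eval_superset) (auto dest: subsetD[OF Poly_Mapping.keys_add])
  also have "\<dots> = (\<Prod>i\<in>?K. v i ^ Poly_Mapping.lookup m i) * (\<Prod>i\<in>?K. v i ^ Poly_Mapping.lookup m' i)"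
    by (simp add: lookup_add power_add prod.distrib)
  also have "\<dots> = monom_eval m v * monom_eval m' v"
    using monom_eval_superset[of ?K m v] monom_eval_superset[of ?K m' v] by simp
  finally show ?thesis .
qed

lemma monom_degree_add: "monom_degree (m + m') = monom_degree m + monom_degree m'"
proof -
  let ?K = "Poly_Mapping.keys m \<union> Poly_Mapping.keys m'"
  have "monom_degree (m + m') = (\<Sum>i\<in>?K. Poly_Mapping.lookup (m + m') i)"
    by (rule monom_degree_superset) (auto dest: subsetD[OF Poly_Mapping.keys_add])
  also have "\<dots> = (\<Sum>i\<in>?K. Poly_Mapping.lookup m i) + (\<Sum>i\<in>?K. Poly_Mapping.lookup m' i)"
    by (simp add: lookup_add sum.distrib)
  also have "\<dots> = monom_degree m + monom_degree m'"
    using monom_degree_superset[of ?K m] monom_degree_superset[of ?K m'] by simp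
  finally show ?thesis .
qed

lemma mpoly_eval_eq: "mpoly_eval f v = (\<Sum>m\<in>Poly_Mapping.keys f. Poly_Mapping.lookup f m * monom_eval m v)"
  by (simp add: mpoly_eval_def monom_eval_def)

lemma mpoly_eval_superset:
  "finite K \<Longrightarrow> Poly_Mapping.keys f \<subseteq> K \<Longrightarrow>
    mpoly_eval f v = (\<Sum>m\<in>K. Poly_Mapping.lookup f m * monom_eval m v)"
  unfolding mpoly_eval_eq by (rule sum.mono_neutral_left) (auto simp: in_keys_iff)

lemma mpoly_eval_add: "mpoly_eval (f + g) v = mpoly_eval f v + mpoly_eval g v"
proof -
  let ?K = "Poly_Mapping.keys f \<union> Poly_Mapping.keys g"
  have "mpoly_eval (f + g) v = (\<Sum>m\<in>?K. Poly_Mapping.lookup (f + g) m * monom_eval m v)"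
    by (rule mpoly_eval_superset) (auto dest: subsetD[OF Poly_Mapping.keys_add])
  also have "\<dots> = (\<Sum>m\<in>?K. Poly_Mapping.lookup f m * monom_eval m v) + (\<Sum>m\<in>?K. Poly_Mapping.lookup g m * monom_eval m v)"
    by (simp add: lookup_add distrib_right sum.distrib)
  also have "\<dots> = mpoly_eval f v + mpoly_eval g v"
    using mpoly_eval_superset[of ?K f v] mpoly_eval_superset[of ?K g v] by simp
  finally show ?thesis .
qed

lemma mpoly_eval_0: "mpoly_eval 0 v = 0"
  by (simp add: mpoly_eval_def)

lemma mpoly_eval_sum: "finite I \<Longrightarrow> mpoly_eval (sum f I) v = (\<Sum>i\<in>I. mpoly_eval (f i) v)"
  by (induction I rule: finite_induct) (simp_all add: mpoly_eval_0 mpoly_eval_add)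

lemma mpoly_eval_single: "mpoly_eval (Poly_Mapping.single m a) v = a * monom_eval m v"
  by (cases "a = 0") (simp_all add: mpoly_eval_eq mpoly_eval_0)

lemma poly_mapping_sum_single:
  fixes f :: "'a \<Rightarrow>\<^sub>0 'b::comm_monoid_add"
  shows "f = (\<Sum>m\<in>Poly_Mapping.keys f. Poly_Mapping.single m (Poly_Mapping.lookup f m))"
proof (rule poly_mapping_eqI)
  fix k
  have "Poly_Mapping.lookup (\<Sum>m\<in>Poly_Mapping.keys f. Poly_Mapping.single m (Poly_Mapping.lookup f m)) k
      = (\<Sum>m\<in>Poly_Mapping.keys f. if m = k then Poly_Mapping.lookup f m else 0)"
    by (simp add: lookup_sum lookup_single when_def)
  also have "\<dots> = Poly_Mapping.lookup f k"
    by (simp add: sum.delta in_keys_iff)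
  finally show "Poly_Mapping.lookup f k = Poly_Mapping.lookup
    (\<Sum>m\<in>Poly_Mapping.keys f. Poly_Mapping.single m (Poly_Mapping.lookup f m)) k" by simp
qed

lemma mpoly_eval_mult: "mpoly_eval (f * g) v = mpoly_eval f v * mpoly_eval g v"
proof -
  let ?s = "\<lambda>h m. Poly_Mapping.single m (Poly_Mapping.lookup h m)"
  have "f * g = (\<Sum>m\<in>Poly_Mapping.keys f. ?s f m) * (\<Sum>m'\<in>Poly_Mapping.keys g. ?s g m')"
    using poly_mapping_sum_single[of f] poly_mapping_sum_single[of g] by simp
  also have "\<dots> = (\<Sum>m\<in>Poly_Mapping.keys f. \<Sum>m'\<in>Poly_Mapping.keys g. ?s f m * ?s g m')"
    by (rule sum_product)
  finally have "mpoly_eval (f * g) v = (\<Sum>m\<in>Poly_Mapping.keys f. \<Sum>m'\<in>Poly_Mapping.keys g. mpoly_eval (?s f m * ?s g m') v)"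
    by (simp add: mpoly_eval_sum)
  also have "\<dots> = (\<Sum>m\<in>Poly_Mapping.keys f. \<Sum>m'\<in>Poly_Mapping.keys g.
      (Poly_Mapping.lookup f m * monom_eval m v) * (Poly_Mapping.lookup g m' * monom_eval m' v))"
    by (simp only: mult_single mpoly_eval_single monom_eval_add mult.assoc mult.left_commute)
  also have "\<dots> = mpoly_eval f v * mpoly_eval g v"
    unfolding mpoly_eval_eq by (rule sum_product[symmetric])
  finally show ?thesis .
qed

lemma homogeneous_iff: "homogeneous n d f \<longleftrightarrow>
  (\<forall>m\<in>Poly_Mapping.keys f. Poly_Mapping.keys m \<subseteq> {..n} \<and> monom_degree m = d)"
  by (simp add: homogeneous_def monom_degree_def)

lemma homogeneous_mult:
  assumes "homogeneous n d f" "homogeneous n e g" shows "homogeneous n (d + e) (f * g)"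
  unfolding homogeneous_iff
proof
  fix m assume "m \<in> Poly_Mapping.keys (f * g)"
  then obtain a b where "m = a + b" "a \<in> Poly_Mapping.keys f" "b \<in> Poly_Mapping.keys g"
    using keys_mult[of f g] by blast
  moreover from this have "Poly_Mapping.keys a \<subseteq> {..n}" "Poly_Mapping.keys b \<subseteq> {..n}"
    using assms by (auto simp: homogeneous_iff)
  ultimately show "Poly_Mapping.keys m \<subseteq> {..n} \<and> monom_degree m = d + e"
    using assms Poly_Mapping.keys_add[of a b] by (fastforce simp: homogeneous_iff monom_degree_add)
qed

lemma homogeneous_add:
  assumes "homogeneous n d f" "homogeneous n d g" shows "homogeneous n d (f + g)"
  using assms Poly_Mapping.keys_add[of f g] by (auto simp: homogeneous_iff)

lemma homogeneous_const: "homogeneous n 0 (Poly_Mapping.single 0 a)"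
  by (cases "a = 0") (auto simp: homogeneous_iff monom_degree_def)

definition mvar :: "nat \<Rightarrow> 'k::field mpoly" where
  "mvar i = Poly_Mapping.single (Poly_Mapping.single i 1) 1"

lemma mpoly_eval_mvar: "mpoly_eval (mvar i) v = v i"
  by (simp add: mvar_def mpoly_eval_single monom_eval_def)

lemma homogeneous_mvar: "i \<le> n \<Longrightarrow> homogeneous n 1 (mvar i)"
  by (simp add: homogeneous_iff mvar_def monom_degree_def)

lemma mpoly_eval_const: "mpoly_eval (Poly_Mapping.single 0 a) v = a"
  by (simp add: mpoly_eval_single monom_eval_def)

lemma mpoly_eval_one: "mpoly_eval 1 v = 1"
  using mpoly_eval_const[of 1 v] by simp

lemma homogeneous_one: "homogeneous n 0 1"
  using homogeneous_const[of n 1] by simp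

lemma mpoly_eval_scale:
  assumes "homogeneous n d f" shows "mpoly_eval f (\<lambda>i. a * v i) = a ^ d * mpoly_eval f v"
proof -
  have "monom_eval m (\<lambda>i. a * v i) = a ^ d * monom_eval m v" if "m \<in> Poly_Mapping.keys f" for m
    using assms that
    by (auto simp: homogeneous_iff monom_eval_def monom_degree_def power_mult_distrib prod.distrib power_sum)
  then show ?thesis unfolding mpoly_eval_eq sum_distrib_left
    by (intro sum.cong) (auto simp: mult_ac)
qed

lemma proj_pointE:
  assumes "x \<in> proj_space n"
  obtains v where "v \<in> x" "\<exists>i\<le>n. v i \<noteq> 0" "\<And>w. w \<in> x \<Longrightarrow> \<exists>a. a \<noteq> 0 \<and> w = (\<lambda>i. a * v i)"
proof -
  obtain v where v: "x = {(\<lambda>i. a * v i) |a. a \<noteq> 0}" "\<exists>i. v i \<noteq> 0" "\<forall>i>n. v i = 0"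
    using assms by (auto simp: proj_space_def)
  have "v \<in> x" unfolding v by (rule CollectI) (rule exI[of _ 1], simp)
  moreover have "\<exists>i\<le>n. v i \<noteq> 0" using v by (meson not_le)
  ultimately show ?thesis using that[of v] v(1) by blast
qed

lemma proj_point_scale:
  assumes "x \<in> proj_space n" "v \<in> x" "w \<in> x"
  shows "\<exists>a. a \<noteq> 0 \<and> w = (\<lambda>i. a * v i)"
proof -
  obtain u where u: "\<And>w. w \<in> x \<Longrightarrow> \<exists>a. a \<noteq> 0 \<and> w = (\<lambda>i. a * u i)"
    using proj_pointE[OF assms(1)] by metis
  obtain a b where "a \<noteq> 0" "v = (\<lambda>i. a * u i)" "b \<noteq> 0" "w = (\<lambda>i. b * u i)" using u assms by metis
  then show ?thesis by (intro exI[of _ "b / a"]) auto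
qed

lemma homogeneous_nonvanishing:
  assumes "x \<in> proj_space n" "v \<in> x" "w \<in> x" "homogeneous m d f" "mpoly_eval f v \<noteq> 0"
  shows "mpoly_eval f w \<noteq> 0"
proof -
  obtain a where "a \<noteq> 0" "w = (\<lambda>i. a * v i)" using proj_point_scale[OF assms(1-3)] by blast
  then show ?thesis using mpoly_eval_scale[OF assms(4), of a v] assms(5) by simp
qed

lemma homogeneous_quotient_eq:
  assumes "x \<in> proj_space n" "v \<in> x" "w \<in> x" "homogeneous m d f" "homogeneous m d g"
  shows "mpoly_eval f w / mpoly_eval g w = mpoly_eval f v / mpoly_eval g v"
proof -
  obtain a where "a \<noteq> 0" "w = (\<lambda>i. a * v i)" using proj_point_scale[OF assms(1-3)] by blast
  then show ?thesis using mpoly_eval_scale[OF assms(4), of a v] mpoly_eval_scale[OF assms(5), of a v] by simp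
qed

lemma zariski_closed_empty: "zariski_closed n {}"
proof -
  have "x = {}" if "x \<in> proj_space n" "\<forall>v\<in>x. mpoly_eval 1 v = 0" for x :: "'k::field ppoint"
    using that by (auto simp: mpoly_eval_one)
  moreover have "{} \<notin> proj_space n" by (auto elim!: proj_pointE)
  ultimately show ?thesis
    unfolding zariski_closed_def
    by (intro exI[of _ "{1}"]) (auto intro: homogeneous_one)
qed

text \<open>The union is cut out by products of equations. Non-vanishing of two equations may be
  witnessed by different coordinate vectors of the same point; homogeneity moves both witnesses to
  one vector.\<close>

lemma zariski_closed_Un:
  assumes "zariski_closed n Z" "zariski_closed n Z'" shows "zariski_closed n (Z \<union> Z')"
proof -
  obtain F where F: "\<forall>f\<in>F. \<exists>d. homogeneous n d f" "Z = {x \<in> proj_space n. \<forall>f\<in>F. \<forall>v\<in>x. mpoly_eval f v = 0}"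
    using assms(1) unfolding zariski_closed_def by blast
  obtain F' where F': "\<forall>f\<in>F'. \<exists>d. homogeneous n d f" "Z' = {x \<in> proj_space n. \<forall>f\<in>F'. \<forall>v\<in>x. mpoly_eval f v = 0}"
    using assms(2) unfolding zariski_closed_def by blast
  let ?H = "(\<lambda>(f, g). f * g) ` (F \<times> F')"
  have "\<forall>f\<in>?H. \<exists>d. homogeneous n d f" using F(1) F'(1) homogeneous_mult by fastforce
  moreover have "Z \<union> Z' = {x \<in> proj_space n. \<forall>f\<in>?H. \<forall>v\<in>x. mpoly_eval f v = 0}"
  proof (intro equalityI subsetI)
    fix x assume "x \<in> Z \<union> Z'"
    then show "x \<in> {x \<in> proj_space n. \<forall>f\<in>?H. \<forall>v\<in>x. mpoly_eval f v = 0}"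
      unfolding F(2) F'(2) by (auto simp: mpoly_eval_mult)
  next
    fix x assume x: "x \<in> {x \<in> proj_space n. \<forall>f\<in>?H. \<forall>v\<in>x. mpoly_eval f v = 0}"
    show "x \<in> Z \<union> Z'"
    proof (rule ccontr)
      assume "x \<notin> Z \<union> Z'"
      then obtain f v g w where fg: "f \<in> F" "v \<in> x" "mpoly_eval f v \<noteq> 0" "g \<in> F'" "w \<in> x" "mpoly_eval g w \<noteq> 0"
        using x unfolding F(2) F'(2) by blast
      then have "mpoly_eval f w \<noteq> 0" using F(1) homogeneous_nonvanishing[of x n v w] x by blast
      moreover have "mpoly_eval (f * g) w = 0" using x fg by blast
      ultimately show False using fg by (simp add: mpoly_eval_mult)
    qed
  qed
  ultimately show ?thesis unfolding zariski_closed_def by blast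
qed

lemma zariski_open_Int:
  assumes "zariski_open_in n C U" "zariski_open_in n C V" shows "zariski_open_in n C (U \<inter> V)"
proof -
  obtain Z Z' where "zariski_closed n Z" "U = C - Z" "zariski_closed n Z'" "V = C - Z'"
    using assms unfolding zariski_open_in_def by blast
  then have "zariski_closed n (Z \<union> Z')" "U \<inter> V = C - (Z \<union> Z')" using zariski_closed_Un by auto
  then show ?thesis unfolding zariski_open_in_def by blast
qed

lemma zariski_open_self: "zariski_open_in n C C"
  unfolding zariski_open_in_def using zariski_closed_empty by blast

lemma zariski_open_subset: "zariski_open_in n C U \<Longrightarrow> U \<subseteq> C"
  unfolding zariski_open_in_def by blast

lemma zariski_open_nonvanishing:
  assumes "C \<subseteq> proj_space n" "homogeneous n d f"
  shows "zariski_open_in n C {x \<in> C. \<forall>v\<in>x. mpoly_eval f v \<noteq> 0}"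
  unfolding zariski_open_in_def
proof (intro exI conjI)
  show "zariski_closed n {x \<in> proj_space n. \<forall>f\<in>{f}. \<forall>v\<in>x. mpoly_eval f v = 0}"
    unfolding zariski_closed_def using assms(2) by blast
  have "(\<forall>v\<in>x. mpoly_eval f v \<noteq> 0) \<longleftrightarrow> \<not> (\<forall>v\<in>x. mpoly_eval f v = 0)" if "x \<in> C" for x
  proof -
    have x: "x \<in> proj_space n" using that assms(1) by blast
    then obtain u where "u \<in> x" by (metis proj_pointE)
    then show ?thesis using homogeneous_nonvanishing[OF x _ _ assms(2)] by blast
  qed
  then show "{x \<in> C. \<forall>v\<in>x. mpoly_eval f v \<noteq> 0} = C - {x \<in> proj_space n. \<forall>f\<in>{f}. \<forall>v\<in>x. mpoly_eval f v = 0}"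
    using assms(1) by blast
qed

section \<open>Regular functions\<close>

lemma regular_on_restrict:
  assumes "regular_on n C U \<phi>" "zariski_open_in n C U'" "U' \<subseteq> U"
  shows "regular_on n C U' \<phi>"
  unfolding regular_on_def
proof
  fix x assume x: "x \<in> U'"
  then obtain V f g d where V: "zariski_open_in n C V" "x \<in> V" "V \<subseteq> U" "homogeneous n d f" "homogeneous n d g"
    "\<forall>y\<in>V. \<forall>v\<in>y. mpoly_eval g v \<noteq> 0 \<and> \<phi> y = mpoly_eval f v / mpoly_eval g v"
    using bspec[OF assms(1)[unfolded regular_on_def] subsetD[OF assms(3) x]] by blast
  then show "\<exists>V f g d. zariski_open_in n C V \<and> x \<in> V \<and> V \<subseteq> U' \<and> homogeneous n d f \<and> homogeneous n d g \<and>
       (\<forall>y\<in>V. \<forall>v\<in>y. mpoly_eval g v \<noteq> 0 \<and> \<phi> y = mpoly_eval f v / mpoly_eval g v)"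
    using x zariski_open_Int[OF V(1) assms(2)]
    by (intro exI[of _ "V \<inter> U'"] exI[of _ f] exI[of _ g] exI[of _ d]) auto
qed

text \<open>Common part of sums and products: on the intersection of two neighbourhoods the new
  function is a quotient with denominator \<open>g g'\<close> and a numerator of the matching degree
  \<open>d + e\<close>.\<close>

lemma regular_on_combine:
  fixes \<phi> \<psi> \<theta> :: "'k::field ppoint \<Rightarrow> 'k"
  assumes "regular_on n C U \<phi>" "regular_on n C U' \<psi>"
    and comb: "\<And>d e (f :: 'k mpoly) g f' g'. \<lbrakk>homogeneous n d f; homogeneous n d g; homogeneous n e f'; homogeneous n e g'\<rbrakk> \<Longrightarrow>
      \<exists>h. homogeneous n (d + e) h \<and>
        (\<forall>v y. mpoly_eval g v \<noteq> 0 \<longrightarrow> mpoly_eval g' v \<noteq> 0 \<longrightarrow> \<phi> y = mpoly_eval f v / mpoly_eval g v \<longrightarrow>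
           \<psi> y = mpoly_eval f' v / mpoly_eval g' v \<longrightarrow> \<theta> y = mpoly_eval h v / (mpoly_eval g v * mpoly_eval g' v))"
  shows "regular_on n C (U \<inter> U') \<theta>"
  unfolding regular_on_def
proof
  fix x assume x: "x \<in> U \<inter> U'"
  then obtain V f g d where V: "zariski_open_in n C V" "x \<in> V" "V \<subseteq> U" "homogeneous n d f" "homogeneous n d g"
    "\<forall>y\<in>V. \<forall>v\<in>y. mpoly_eval g v \<noteq> 0 \<and> \<phi> y = mpoly_eval f v / mpoly_eval g v"
    using assms(1) unfolding regular_on_def by (meson IntD1)
  obtain V' f' g' e where V': "zariski_open_in n C V'" "x \<in> V'" "V' \<subseteq> U'" "homogeneous n e f'" "homogeneous n e g'"
    "\<forall>y\<in>V'. \<forall>v\<in>y. mpoly_eval g' v \<noteq> 0 \<and> \<psi> y = mpoly_eval f' v / mpoly_eval g' v"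
    using x assms(2) unfolding regular_on_def by (meson IntD2)
  obtain h where h: "homogeneous n (d + e) h"
    "\<forall>v y. mpoly_eval g v \<noteq> 0 \<longrightarrow> mpoly_eval g' v \<noteq> 0 \<longrightarrow> \<phi> y = mpoly_eval f v / mpoly_eval g v \<longrightarrow>
           \<psi> y = mpoly_eval f' v / mpoly_eval g' v \<longrightarrow> \<theta> y = mpoly_eval h v / (mpoly_eval g v * mpoly_eval g' v)"
    using comb[OF V(4,5) V'(4,5)] by blast
  have "\<forall>y\<in>V \<inter> V'. \<forall>v\<in>y. mpoly_eval (g * g') v \<noteq> 0 \<and> \<theta> y = mpoly_eval h v / mpoly_eval (g * g') v"
  proof (intro ballI)
    fix y v assume yv: "y \<in> V \<inter> V'" "v \<in> y"
    then have "mpoly_eval g v \<noteq> 0" "mpoly_eval g' v \<noteq> 0" "\<phi> y = mpoly_eval f v / mpoly_eval g v"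
      "\<psi> y = mpoly_eval f' v / mpoly_eval g' v" using V(6) V'(6) by auto
    then show "mpoly_eval (g * g') v \<noteq> 0 \<and> \<theta> y = mpoly_eval h v / mpoly_eval (g * g') v"
      using h(2) by (simp add: mpoly_eval_mult)
  qed
  then show "\<exists>V f g d. zariski_open_in n C V \<and> x \<in> V \<and> V \<subseteq> U \<inter> U' \<and> homogeneous n d f \<and> homogeneous n d g \<and>
       (\<forall>y\<in>V. \<forall>v\<in>y. mpoly_eval g v \<noteq> 0 \<and> \<theta> y = mpoly_eval f v / mpoly_eval g v)"
    using V(1-3) V'(1-3) h(1) homogeneous_mult[OF V(5) V'(5)] zariski_open_Int[OF V(1) V'(1)]
    by (intro exI[of _ "V \<inter> V'"] exI[of _ h] exI[of _ "g * g'"] exI[of _ "d + e"]) auto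
qed

lemma regular_on_add:
  fixes \<phi> \<psi> :: "'k::field ppoint \<Rightarrow> 'k"
  assumes "regular_on n C U \<phi>" "regular_on n C U' \<psi>"
  shows "regular_on n C (U \<inter> U') (\<lambda>y. \<phi> y + \<psi> y)"
proof (rule regular_on_combine[OF assms])
  fix d e and f g f' g' :: "'k mpoly"
  assume h: "homogeneous n d f" "homogeneous n d g" "homogeneous n e f'" "homogeneous n e g'"
  have "homogeneous n (d + e) (f * g' + f' * g)"
    using homogeneous_mult[OF h(1,4)] homogeneous_mult[OF h(3,2)] by (intro homogeneous_add) (simp_all add: add.commute)
  then show "\<exists>h. homogeneous n (d + e) h \<and>
        (\<forall>v y. mpoly_eval g v \<noteq> 0 \<longrightarrow> mpoly_eval g' v \<noteq> 0 \<longrightarrow> \<phi> y = mpoly_eval f v / mpoly_eval g v \<longrightarrow>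
           \<psi> y = mpoly_eval f' v / mpoly_eval g' v \<longrightarrow> \<phi> y + \<psi> y = mpoly_eval h v / (mpoly_eval g v * mpoly_eval g' v))"
    by (intro exI[of _ "f * g' + f' * g"]) (simp add: mpoly_eval_add mpoly_eval_mult add_frac_eq)
qed

lemma regular_on_mult:
  fixes \<phi> \<psi> :: "'k::field ppoint \<Rightarrow> 'k"
  assumes "regular_on n C U \<phi>" "regular_on n C U' \<psi>"
  shows "regular_on n C (U \<inter> U') (\<lambda>y. \<phi> y * \<psi> y)"
proof (rule regular_on_combine[OF assms])
  fix d e and f g f' g' :: "'k mpoly"
  assume h: "homogeneous n d f" "homogeneous n d g" "homogeneous n e f'" "homogeneous n e g'"
  then show "\<exists>h. homogeneous n (d + e) h \<and>
        (\<forall>v y. mpoly_eval g v \<noteq> 0 \<longrightarrow> mpoly_eval g' v \<noteq> 0 \<longrightarrow> \<phi> y = mpoly_eval f v / mpoly_eval g v \<longrightarrow>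
           \<psi> y = mpoly_eval f' v / mpoly_eval g' v \<longrightarrow> \<phi> y * \<psi> y = mpoly_eval h v / (mpoly_eval g v * mpoly_eval g' v))"
    by (intro exI[of _ "f * f'"]) (simp add: mpoly_eval_mult homogeneous_mult)
qed

lemma regular_on_const: "regular_on n C C (\<lambda>_. a)"
  unfolding regular_on_def
proof
  fix x assume "x \<in> C"
  then show "\<exists>V f g d. zariski_open_in n C V \<and> x \<in> V \<and> V \<subseteq> C \<and> homogeneous n d f \<and> homogeneous n d g \<and>
       (\<forall>y\<in>V. \<forall>v\<in>y. mpoly_eval g v \<noteq> 0 \<and> a = mpoly_eval f v / mpoly_eval g v)"
    by (intro exI[of _ C] exI[of _ "Poly_Mapping.single 0 a"] exI[of _ 1] exI[of _ 0])
      (simp add: zariski_open_self homogeneous_const homogeneous_one mpoly_eval_const mpoly_eval_one)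
qed

text \<open>It is enough to know the value at one coordinate vector of each point, because a
  quotient of forms of equal degree is independent of the vector.\<close>

lemma regular_on_quotient:
  assumes "C \<subseteq> proj_space n" "homogeneous n d f" "homogeneous n d g"
    and "\<And>y. y \<in> C \<Longrightarrow> \<exists>v\<in>y. \<phi> y = mpoly_eval f v / mpoly_eval g v"
  shows "regular_on n C {y \<in> C. \<forall>v\<in>y. mpoly_eval g v \<noteq> 0} \<phi>"
  unfolding regular_on_def
proof
  let ?D = "{y \<in> C. \<forall>v\<in>y. mpoly_eval g v \<noteq> 0}"
  fix x assume x: "x \<in> ?D"
  have "\<phi> y = mpoly_eval f w / mpoly_eval g w" if yw: "y \<in> C" "w \<in> y" for y w
  proof -
    obtain v where "v \<in> y" "\<phi> y = mpoly_eval f v / mpoly_eval g v" using assms(4) yw(1) by blast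
    moreover have "y \<in> proj_space n" using yw(1) assms(1) by blast
    ultimately show ?thesis using homogeneous_quotient_eq[OF _ _ yw(2) assms(2,3)] by simp
  qed
  then show "\<exists>V f g d. zariski_open_in n C V \<and> x \<in> V \<and> V \<subseteq> ?D \<and> homogeneous n d f \<and> homogeneous n d g \<and>
       (\<forall>y\<in>V. \<forall>v\<in>y. mpoly_eval g v \<noteq> 0 \<and> \<phi> y = mpoly_eval f v / mpoly_eval g v)"
    using x assms zariski_open_nonvanishing[OF assms(1,3)]
    by (intro exI[of _ ?D] exI[of _ f] exI[of _ g] exI[of _ d]) auto
qed

section \<open>The local ring of a point\<close>

locale curve_point =
  fixes n :: nat and C :: "'k::field ppoint set" and x :: "'k ppoint"
  assumes C_proj: "C \<subseteq> proj_space n" and x_C: "x \<in> C"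
begin

abbreviation "LF \<equiv> local_functions n C x"
abbreviation "L \<equiv> local_ring n C x"
abbreviation "germ U \<phi> \<equiv> germ_rel n C x `` {(U, \<phi>)}"

lemma LF_iff: "(U, \<phi>) \<in> LF \<longleftrightarrow> zariski_open_in n C U \<and> x \<in> U \<and> regular_on n C U \<phi>"
  by (simp add: local_functions_def)

lemma germ_rel_iff: "((U, \<phi>), (V, \<psi>)) \<in> germ_rel n C x \<longleftrightarrow> (U, \<phi>) \<in> LF \<and> (V, \<psi>) \<in> LF \<and>
    (\<exists>W. zariski_open_in n C W \<and> x \<in> W \<and> W \<subseteq> U \<inter> V \<and> (\<forall>y\<in>W. \<phi> y = \<psi> y))"
  by (simp add: germ_rel_def)

lemma equiv_germ_rel: "equiv LF (germ_rel n C x)"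
proof (rule equivI)
  show "germ_rel n C x \<subseteq> LF \<times> LF" by (auto simp: germ_rel_def)
  show "refl_on LF (germ_rel n C x)"
    by (auto simp: refl_on_def germ_rel_iff LF_iff)
  show "sym (germ_rel n C x)"
    by (auto simp: sym_def germ_rel_iff)
  show "trans (germ_rel n C x)"
  proof (rule transI)
    fix a b c assume *: "(a, b) \<in> germ_rel n C x" "(b, c) \<in> germ_rel n C x"
    obtain U \<phi> V \<psi> T \<theta> where abc: "a = (U, \<phi>)" "b = (V, \<psi>)" "c = (T, \<theta>)" by (metis surj_pair)
    obtain W where W: "zariski_open_in n C W" "x \<in> W" "W \<subseteq> U \<inter> V" "\<forall>y\<in>W. \<phi> y = \<psi> y"
      using *(1) unfolding abc germ_rel_iff by blast
    obtain W' where W': "zariski_open_in n C W'" "x \<in> W'" "W' \<subseteq> V \<inter> T" "\<forall>y\<in>W'. \<psi> y = \<theta> y"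
      using *(2) unfolding abc germ_rel_iff by blast
    show "(a, c) \<in> germ_rel n C x"
      using * W W' zariski_open_Int[OF W(1) W'(1)] unfolding abc germ_rel_iff
      by (intro conjI exI[of _ "W \<inter> W'"]) auto
  qed
qed

lemma germ_eq_iff:
  assumes "(U, \<phi>) \<in> LF" "(V, \<psi>) \<in> LF"
  shows "germ U \<phi> = germ V \<psi> \<longleftrightarrow>
    (\<exists>W. zariski_open_in n C W \<and> x \<in> W \<and> W \<subseteq> U \<inter> V \<and> (\<forall>y\<in>W. \<phi> y = \<psi> y))"
  using eq_equiv_class_iff[OF equiv_germ_rel assms] assms by (simp add: germ_rel_iff)

lemma germ_self: "(U, \<phi>) \<in> LF \<Longrightarrow> (U, \<phi>) \<in> germ U \<phi>"
  using equiv_class_self[OF equiv_germ_rel] by auto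

lemma mem_germ: "(V, \<psi>) \<in> germ U \<phi> \<Longrightarrow> (V, \<psi>) \<in> LF \<and> germ V \<psi> = germ U \<phi>"
  using equiv_class_eq[OF equiv_germ_rel, of "(U, \<phi>)" "(V, \<psi>)"] by (auto simp: germ_rel_iff)

lemma carrier_L: "carrier L = (\<lambda>(U, \<phi>). germ U \<phi>) ` LF"
  by (auto simp: local_ring_def quotient_def)

lemma germ_carrier: "(U, \<phi>) \<in> LF \<Longrightarrow> germ U \<phi> \<in> carrier L"
  by (auto simp: carrier_L)

lemma LE: assumes "a \<in> carrier L" obtains U \<phi> where "(U, \<phi>) \<in> LF" "a = germ U \<phi>"
  using assms by (auto simp: carrier_L)

lemma LF_add: "(U, \<phi>) \<in> LF \<Longrightarrow> (V, \<psi>) \<in> LF \<Longrightarrow> (U \<inter> V, \<lambda>y. \<phi> y + \<psi> y) \<in> LF"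
  by (simp add: LF_iff zariski_open_Int regular_on_add)

lemma LF_mult: "(U, \<phi>) \<in> LF \<Longrightarrow> (V, \<psi>) \<in> LF \<Longrightarrow> (U \<inter> V, \<lambda>y. \<phi> y * \<psi> y) \<in> LF"
  by (simp add: LF_iff zariski_open_Int regular_on_mult)

lemma LF_const: "(C, \<lambda>_. a) \<in> LF"
  by (simp add: LF_iff zariski_open_self x_C regular_on_const)

lemma germ_cong_op:
  assumes "germ U \<phi> = germ U' \<phi>'" "germ V \<psi> = germ V' \<psi>'"
    and "(U, \<phi>) \<in> LF" "(U', \<phi>') \<in> LF" "(V, \<psi>) \<in> LF" "(V', \<psi>') \<in> LF"
    and "(U \<inter> V, \<lambda>y. f (\<phi> y) (\<psi> y)) \<in> LF" "(U' \<inter> V', \<lambda>y. f (\<phi>' y) (\<psi>' y)) \<in> LF"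
  shows "germ (U \<inter> V) (\<lambda>y. f (\<phi> y) (\<psi> y)) = germ (U' \<inter> V') (\<lambda>y. f (\<phi>' y) (\<psi>' y))"
proof -
  obtain W where W: "zariski_open_in n C W" "x \<in> W" "W \<subseteq> U \<inter> U'" "\<forall>y\<in>W. \<phi> y = \<phi>' y"
    using assms(1) germ_eq_iff[OF assms(3,4)] by blast
  obtain W' where W': "zariski_open_in n C W'" "x \<in> W'" "W' \<subseteq> V \<inter> V'" "\<forall>y\<in>W'. \<psi> y = \<psi>' y"
    using assms(2) germ_eq_iff[OF assms(5,6)] by blast
  show ?thesis
    unfolding germ_eq_iff[OF assms(7,8)]
    using W W' zariski_open_Int[OF W(1) W'(1)] by (intro exI[of _ "W \<inter> W'"]) auto
qed

text \<open>Sum and product of germs are defined as unions over representatives; this handles both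
  at once by reducing them to pointwise operations.\<close>

lemma germ_op:
  assumes "(U, \<phi>) \<in> LF" "(V, \<psi>) \<in> LF"
    and cl: "\<And>U V \<phi> \<psi>. (U, \<phi>) \<in> LF \<Longrightarrow> (V, \<psi>) \<in> LF \<Longrightarrow> (U \<inter> V, \<lambda>y. f (\<phi> y) (\<psi> y)) \<in> LF"
  shows "(\<Union>(U', \<phi>')\<in>germ U \<phi>. \<Union>(V', \<psi>')\<in>germ V \<psi>. germ (U' \<inter> V') (\<lambda>y. f (\<phi>' y) (\<psi>' y)))
    = germ (U \<inter> V) (\<lambda>y. f (\<phi> y) (\<psi> y))"
proof -
  have "germ (U' \<inter> V') (\<lambda>y. f (\<phi>' y) (\<psi>' y)) = germ (U \<inter> V) (\<lambda>y. f (\<phi> y) (\<psi> y))"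
    if "(U', \<phi>') \<in> germ U \<phi>" "(V', \<psi>') \<in> germ V \<psi>" for U' \<phi>' V' \<psi>'
    using mem_germ[OF that(1)] mem_germ[OF that(2)] assms by (intro germ_cong_op) auto
  then show ?thesis using germ_self[OF assms(1)] germ_self[OF assms(2)] by fastforce
qed

lemma L_add: "(U, \<phi>) \<in> LF \<Longrightarrow> (V, \<psi>) \<in> LF \<Longrightarrow> germ U \<phi> \<oplus>\<^bsub>L\<^esub> germ V \<psi> = germ (U \<inter> V) (\<lambda>y. \<phi> y + \<psi> y)"
  unfolding local_ring_def by (simp, rule germ_op, assumption+, rule LF_add)

lemma L_mult: "(U, \<phi>) \<in> LF \<Longrightarrow> (V, \<psi>) \<in> LF \<Longrightarrow> germ U \<phi> \<otimes>\<^bsub>L\<^esub> germ V \<psi> = germ (U \<inter> V) (\<lambda>y. \<phi> y * \<psi> y)"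
  unfolding local_ring_def by (simp, rule germ_op, assumption+, rule LF_mult)

lemma L_one: "\<one>\<^bsub>L\<^esub> = germ C (\<lambda>_. 1)"
  by (simp add: local_ring_def const_germ_def)

lemma L_zero: "\<zero>\<^bsub>L\<^esub> = germ C (\<lambda>_. 0)"
  by (simp add: local_ring_def const_germ_def)

lemma germ_eqI:
  assumes "(U, \<phi>) \<in> LF" "(V, \<psi>) \<in> LF" "\<And>y. y \<in> U \<inter> V \<Longrightarrow> \<phi> y = \<psi> y"
  shows "germ U \<phi> = germ V \<psi>"
  unfolding germ_eq_iff[OF assms(1,2)]
  using assms zariski_open_Int by (intro exI[of _ "U \<inter> V"]) (auto simp: LF_iff)

lemma cring_L: "cring L"
proof (rule cringI)
  show "abelian_group L"
  proof (rule abelian_groupI, goal_cases)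
    case (1 a b) then show ?case
      by (auto elim!: LE simp: L_add intro!: germ_carrier LF_add)
  next
    case 2 then show ?case by (simp add: L_zero germ_carrier LF_const)
  next
    case (3 a b c) then show ?case
      by (elim LE, hypsubst, simp only: L_add LF_add)
        (rule germ_eqI, (intro LF_add; assumption)+, simp add: add.assoc)
  next
    case (4 a b) then show ?case
      by (elim LE, hypsubst, simp only: L_add LF_add)
        (rule germ_eqI, (intro LF_add; assumption)+, simp add: add.commute)
  next
    case (5 a) then show ?case
      by (elim LE, hypsubst, simp only: L_add L_zero LF_const)
        (rule germ_eqI, (intro LF_add LF_const; assumption), assumption, simp)
  next
    case (6 a)
    then obtain U \<phi> where a: "(U, \<phi>) \<in> LF" "a = germ U \<phi>" by (rule LE)
    have U: "U \<subseteq> C" using a(1) zariski_open_subset by (auto simp: LF_iff)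
    then have "C \<inter> U = U" by blast
    then have m: "(U, \<lambda>y. (-1) * \<phi> y) \<in> LF" using LF_mult[OF LF_const[of "-1"] a(1)] by simp
    have "germ U (\<lambda>y. (-1) * \<phi> y) \<oplus>\<^bsub>L\<^esub> a = \<zero>\<^bsub>L\<^esub>"
      unfolding a(2) L_zero L_add[OF m a(1)] by (rule germ_eqI) (use LF_add[OF m a(1)] LF_const in auto)
    then show ?case using germ_carrier[OF m] by blast
  qed
  show "comm_monoid L"
  proof (rule comm_monoidI, goal_cases)
    case (1 a b) then show ?case
      by (auto elim!: LE simp: L_mult intro!: germ_carrier LF_mult)
  next
    case 2 then show ?case by (simp add: L_one germ_carrier LF_const)
  next
    case (3 a b c) then show ?case
      by (elim LE, hypsubst, simp only: L_mult LF_mult)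
        (rule germ_eqI, (intro LF_mult; assumption)+, simp add: mult.assoc)
  next
    case (4 a) then show ?case
      by (elim LE, hypsubst, simp only: L_mult L_one LF_const)
        (rule germ_eqI, (intro LF_mult LF_const; assumption), assumption, simp)
  next
    case (5 a b) then show ?case
      by (elim LE, hypsubst, simp only: L_mult LF_mult)
        (rule germ_eqI, (intro LF_mult; assumption)+, simp add: mult.commute)
  qed
  fix a b c assume "a \<in> carrier L" "b \<in> carrier L" "c \<in> carrier L"
  then show "(a \<oplus>\<^bsub>L\<^esub> b) \<otimes>\<^bsub>L\<^esub> c = a \<otimes>\<^bsub>L\<^esub> c \<oplus>\<^bsub>L\<^esub> b \<otimes>\<^bsub>L\<^esub> c"
    by (elim LE, hypsubst, simp only: L_mult L_add LF_mult LF_add)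
      (rule germ_eqI, (intro LF_mult LF_add; assumption)+, simp add: distrib_right)
qed

sublocale L: cring L by (rule cring_L)

definition "value a = (THE z. \<exists>U \<phi>. (U, \<phi>) \<in> LF \<and> a = germ U \<phi> \<and> z = \<phi> x)"

lemma value_germ [simp]: assumes "(U, \<phi>) \<in> LF" shows "value (germ U \<phi>) = \<phi> x"
  unfolding value_def
proof (rule the_equality)
  show "\<exists>V \<psi>. (V, \<psi>) \<in> LF \<and> germ U \<phi> = germ V \<psi> \<and> \<phi> x = \<psi> x" using assms by blast
  fix z assume "\<exists>V \<psi>. (V, \<psi>) \<in> LF \<and> germ U \<phi> = germ V \<psi> \<and> z = \<psi> x"
  then obtain V \<psi> where V: "(V, \<psi>) \<in> LF" "germ U \<phi> = germ V \<psi>" "z = \<psi> x" by blast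
  then show "z = \<phi> x" using germ_eq_iff[OF assms V(1)] by metis
qed

abbreviation "\<kappa> \<equiv> const_germ n C x"

lemma \<kappa>_germ: "\<kappa> a = germ C (\<lambda>_. a)" by (simp add: const_germ_def)
lemma \<kappa>_closed [simp]: "\<kappa> a \<in> carrier L" by (simp add: \<kappa>_germ germ_carrier LF_const)
lemma \<kappa>_add: "\<kappa> (a + b) = \<kappa> a \<oplus>\<^bsub>L\<^esub> \<kappa> b" by (simp add: \<kappa>_germ L_add LF_const)
lemma \<kappa>_mult: "\<kappa> (a * b) = \<kappa> a \<otimes>\<^bsub>L\<^esub> \<kappa> b" by (simp add: \<kappa>_germ L_mult LF_const)
lemma \<kappa>_one: "\<kappa> 1 = \<one>\<^bsub>L\<^esub>" by (simp add: \<kappa>_germ L_one)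
lemma \<kappa>_zero: "\<kappa> 0 = \<zero>\<^bsub>L\<^esub>" by (simp add: \<kappa>_germ L_zero)
lemma value_\<kappa> [simp]: "value (\<kappa> a) = a" by (simp add: \<kappa>_germ LF_const)

lemma value_add: "a \<in> carrier L \<Longrightarrow> b \<in> carrier L \<Longrightarrow> value (a \<oplus>\<^bsub>L\<^esub> b) = value a + value b"
  by (auto elim!: LE simp: L_add LF_add)
lemma value_mult: "a \<in> carrier L \<Longrightarrow> b \<in> carrier L \<Longrightarrow> value (a \<otimes>\<^bsub>L\<^esub> b) = value a * value b"
  by (auto elim!: LE simp: L_mult LF_mult)
lemma value_zero: "value \<zero>\<^bsub>L\<^esub> = 0" using value_\<kappa>[of 0] by (simp add: \<kappa>_zero)
lemma value_one: "value \<one>\<^bsub>L\<^esub> = 1" using value_\<kappa>[of 1] by (simp add: \<kappa>_one)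
lemma value_minus: "a \<in> carrier L \<Longrightarrow> value (\<ominus>\<^bsub>L\<^esub> a) = - value a"
  using value_add[of a "\<ominus>\<^bsub>L\<^esub> a"] by (simp add: L.r_neg value_zero add_eq_0_iff)
lemma value_diff: "a \<in> carrier L \<Longrightarrow> b \<in> carrier L \<Longrightarrow> value (a \<ominus>\<^bsub>L\<^esub> b) = value a - value b"
  by (simp add: a_minus_def value_add value_minus)

text \<open>A quotient \<open>f / g\<close> that does not vanish at the point has the inverse
  \<open>g / f\<close> on the open set where \<open>f\<close> does not vanish.\<close>

lemma unit_iff: assumes "a \<in> carrier L" shows "a \<in> Units L \<longleftrightarrow> value a \<noteq> 0"
proof
  assume u: "a \<in> Units L"
  then have "value a * value (inv\<^bsub>L\<^esub> a) = 1"
    using value_mult[of a "inv\<^bsub>L\<^esub> a"] by (simp add: value_one L.Units_closed)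
  then show "value a \<noteq> 0" by auto
next
  assume v: "value a \<noteq> 0"
  obtain U \<phi> where a: "(U, \<phi>) \<in> LF" "a = germ U \<phi>" using assms by (rule LE)
  obtain V f g d where V: "zariski_open_in n C V" "x \<in> V" "V \<subseteq> U" "homogeneous n d f" "homogeneous n d g"
    "\<forall>y\<in>V. \<forall>v\<in>y. mpoly_eval g v \<noteq> 0 \<and> \<phi> y = mpoly_eval f v / mpoly_eval g v"
    using a(1) unfolding LF_iff regular_on_def by blast
  let ?D = "V \<inter> {y \<in> C. \<forall>v\<in>y. mpoly_eval f v \<noteq> 0}"
  have D: "zariski_open_in n C ?D" by (rule zariski_open_Int[OF V(1) zariski_open_nonvanishing[OF C_proj V(4)]])
  have "\<phi> x \<noteq> 0" using v a by simp
  then have xD: "x \<in> ?D" using V(2,6) x_C by auto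
  have reg: "regular_on n C ?D (\<lambda>y. inverse (\<phi> y))"
    unfolding regular_on_def
  proof
    fix y assume "y \<in> ?D"
    then show "\<exists>W f g d. zariski_open_in n C W \<and> y \<in> W \<and> W \<subseteq> ?D \<and> homogeneous n d f \<and> homogeneous n d g \<and>
       (\<forall>y\<in>W. \<forall>v\<in>y. mpoly_eval g v \<noteq> 0 \<and> inverse (\<phi> y) = mpoly_eval f v / mpoly_eval g v)"
      using D V by (intro exI[of _ ?D] exI[of _ g] exI[of _ f] exI[of _ d]) auto
  qed
  have b: "(?D, \<lambda>y. inverse (\<phi> y)) \<in> LF" using D xD reg by (simp add: LF_iff)
  have nz: "\<phi> y \<noteq> 0" if "y \<in> ?D" for y
  proof -
    have "y \<in> proj_space n" using that C_proj by blast
    then obtain v where "v \<in> y" by (metis proj_pointE)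
    then show ?thesis using that V(6) by auto
  qed
  have 1: "a \<otimes>\<^bsub>L\<^esub> germ ?D (\<lambda>y. inverse (\<phi> y)) = \<one>\<^bsub>L\<^esub>"
    unfolding a(2) L_mult[OF a(1) b] L_one
    by (rule germ_eqI) (use LF_mult[OF a(1) b] LF_const nz in auto)
  show "a \<in> Units L"
    unfolding Units_def using 1 assms germ_carrier[OF b] L.m_comm[OF assms germ_carrier[OF b]] by auto
qed

lemma nonunits_L: "nonunits L = {a \<in> carrier L. value a = 0}"
  using unit_iff by (auto simp: nonunits_def)

text \<open>Germs are germs of functions with values in a field, so nilpotence can be refuted
  pointwise. It serves to show that no power of a uniformizer is zero.\<close>

lemma reduced: assumes "a \<in> carrier L" "a [^]\<^bsub>L\<^esub> (k::nat) = \<zero>\<^bsub>L\<^esub>" shows "a = \<zero>\<^bsub>L\<^esub>"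
proof -
  obtain U \<phi> where a: "(U, \<phi>) \<in> LF" "a = germ U \<phi>" using assms(1) by (rule LE)
  have p: "\<exists>V. (V, \<lambda>y. \<phi> y ^ m) \<in> LF \<and> a [^]\<^bsub>L\<^esub> m = germ V (\<lambda>y. \<phi> y ^ m)" for m
  proof (induction m)
    case 0 show ?case by (intro exI[of _ C]) (simp add: L_one LF_const)
  next
    case (Suc m)
    then obtain V where V: "(V, \<lambda>y. \<phi> y ^ m) \<in> LF" "a [^]\<^bsub>L\<^esub> m = germ V (\<lambda>y. \<phi> y ^ m)" by blast
    have "a [^]\<^bsub>L\<^esub> Suc m = germ (V \<inter> U) (\<lambda>y. \<phi> y ^ m * \<phi> y)"
      using L_mult[OF V(1) a(1)] unfolding V(2)[symmetric] a(2)[symmetric] by simp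
    then show ?case using LF_mult[OF V(1) a(1)] by (intro exI[of _ "V \<inter> U"]) (simp add: mult.commute)
  qed
  obtain V where V: "(V, \<lambda>y. \<phi> y ^ k) \<in> LF" "a [^]\<^bsub>L\<^esub> k = germ V (\<lambda>y. \<phi> y ^ k)" using p by blast
  then have "germ V (\<lambda>y. \<phi> y ^ k) = germ C (\<lambda>_. 0)" using assms(2) by (simp add: L_zero)
  then obtain W where W: "zariski_open_in n C W" "x \<in> W" "W \<subseteq> V \<inter> C" "\<forall>y\<in>W. \<phi> y ^ k = 0"
    using germ_eq_iff[OF V(1) LF_const] by blast
  have "zariski_open_in n C (W \<inter> U)" by (rule zariski_open_Int) (use W a in \<open>auto simp: LF_iff\<close>)
  then show ?thesis
    unfolding a(2) L_zero germ_eq_iff[OF a(1) LF_const]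
    using W a(1) by (intro exI[of _ "W \<inter> U"]) (auto simp: LF_iff)
qed

text \<open>The maximal ideal is generated by the functions \<open>X\<^sub>i / X\<^sub>0 - v\<^sub>i / v\<^sub>0\<close> on a chart around the
  point \<open>x = [v]\<close>: the quotients \<open>X\<^sub>i / X\<^sub>0\<close> and the constants generate, as a ring, functions that
  agree with their value at \<open>x\<close> modulo the ideal \<open>J\<close> of these differences, and every germ is a
  quotient of two such functions.\<close>

lemma finitely_generated:
  "\<exists>Z. finite Z \<and> Z \<subseteq> nonunits L \<and> (\<forall>J. ideal J L \<longrightarrow> Z \<subseteq> J \<longrightarrow> nonunits L \<subseteq> J)"
proof -
  have xP: "x \<in> proj_space n" using x_C C_proj by blast
  obtain v0 i0 where v0: "v0 \<in> x" "i0 \<le> n" "v0 i0 \<noteq> 0" using proj_pointE[OF xP] by metis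
  \<comment> \<open>A coordinate vector is fixed at each point; the quotients of forms of equal
    degree built from it do not depend on the choice.\<close>
  define rep where "rep y = (SOME v. v \<in> y)" for y :: "'k ppoint"
  have rep: "rep y \<in> y" if "y \<in> C" for y
  proof -
    have "y \<in> proj_space n" using that C_proj by blast
    then show ?thesis unfolding rep_def by (metis proj_pointE someI_ex)
  qed
  define D where "D = {y \<in> C. \<forall>v\<in>y. mpoly_eval (mvar i0) v \<noteq> 0}"
  have D: "zariski_open_in n C D"
    unfolding D_def by (rule zariski_open_nonvanishing[OF C_proj homogeneous_mvar[OF v0(2)]])
  have xD: "x \<in> D"
  proof -
    have "mpoly_eval (mvar i0) w \<noteq> 0" if "w \<in> x" for w
      by (rule homogeneous_nonvanishing[OF xP v0(1) that homogeneous_mvar[OF v0(2)]])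
        (use v0 in \<open>simp add: mpoly_eval_mvar\<close>)
    then show ?thesis using x_C by (simp add: D_def)
  qed
  define \<xi> where "\<xi> i y = rep y i / rep y i0" for i y
  have \<xi>LF: "(D, \<xi> i) \<in> LF" if "i \<le> n" for i
  proof -
    have "regular_on n C D (\<xi> i)"
      unfolding D_def
      by (rule regular_on_quotient[OF C_proj homogeneous_mvar[OF that] homogeneous_mvar[OF v0(2)]])
        (auto simp: \<xi>_def mpoly_eval_mvar rep intro!: bexI[OF _ rep])
    then show ?thesis using D xD by (simp add: LF_iff)
  qed
  define Z where "Z = (\<lambda>i. germ D (\<xi> i) \<ominus>\<^bsub>L\<^esub> \<kappa> (\<xi> i x)) ` {..n}"
  have fin: "finite Z" by (simp add: Z_def)
  have Zsub: "Z \<subseteq> nonunits L"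
    using \<xi>LF by (auto simp: Z_def nonunits_L germ_carrier value_diff)
  have "nonunits L \<subseteq> J" if J: "ideal J L" "Z \<subseteq> J" for J
  proof
    interpret J: ideal J L by fact
    define B where "B = {\<phi>. (D, \<phi>) \<in> LF \<and> germ D \<phi> \<ominus>\<^bsub>L\<^esub> \<kappa> (\<phi> x) \<in> J}"
    have DD: "D \<inter> D = D" by simp
    have DC: "D \<subseteq> C" by (auto simp: D_def)
    have constB: "(\<lambda>_. a) \<in> B" for a
    proof -
      have "(C \<inter> D, \<lambda>y. a * 1) \<in> LF" using D xD zariski_open_Int[OF zariski_open_self D]
        regular_on_restrict[OF regular_on_const zariski_open_Int[OF zariski_open_self D], of "a * 1"] x_C
        by (auto simp: LF_iff)
      then have LFD: "(D, \<lambda>_. a) \<in> LF" using DC by (simp add: Int_absorb1)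
      have "germ D (\<lambda>_. a) = \<kappa> a" unfolding \<kappa>_germ by (rule germ_eqI) (use LFD LF_const in auto)
      then show ?thesis using LFD by (simp add: B_def L.r_neg a_minus_def)
    qed
    have \<xi>B: "\<xi> i \<in> B" if "i \<le> n" for i
      using \<xi>LF[OF that] J(2) that by (auto simp: B_def Z_def)
    have multB: "(\<lambda>y. \<phi> y * \<psi> y) \<in> B" if "\<phi> \<in> B" "\<psi> \<in> B" for \<phi> \<psi>
    proof -
      have 1: "(D, \<phi>) \<in> LF" "(D, \<psi>) \<in> LF" using that by (auto simp: B_def)
      let ?a = "germ D \<phi>" and ?b = "germ D \<psi>"
      have ab: "?a \<in> carrier L" "?b \<in> carrier L" using 1 germ_carrier by auto
      have "germ D (\<lambda>y. \<phi> y * \<psi> y) = ?a \<otimes>\<^bsub>L\<^esub> ?b" using L_mult[OF 1] by simp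
      moreover have "?a \<otimes>\<^bsub>L\<^esub> ?b \<ominus>\<^bsub>L\<^esub> \<kappa> (\<phi> x * \<psi> x)
         = ?a \<otimes>\<^bsub>L\<^esub> (?b \<ominus>\<^bsub>L\<^esub> \<kappa> (\<psi> x)) \<oplus>\<^bsub>L\<^esub> \<kappa> (\<psi> x) \<otimes>\<^bsub>L\<^esub> (?a \<ominus>\<^bsub>L\<^esub> \<kappa> (\<phi> x))"
      proof -
        have "\<And>k l. k \<in> carrier L \<Longrightarrow> l \<in> carrier L \<Longrightarrow>
           ?a \<otimes>\<^bsub>L\<^esub> ?b \<ominus>\<^bsub>L\<^esub> k \<otimes>\<^bsub>L\<^esub> l = ?a \<otimes>\<^bsub>L\<^esub> (?b \<ominus>\<^bsub>L\<^esub> l) \<oplus>\<^bsub>L\<^esub> l \<otimes>\<^bsub>L\<^esub> (?a \<ominus>\<^bsub>L\<^esub> k)"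
          using ab by algebra
        then show ?thesis by (simp add: \<kappa>_mult)
      qed
      moreover have "?a \<otimes>\<^bsub>L\<^esub> (?b \<ominus>\<^bsub>L\<^esub> \<kappa> (\<psi> x)) \<oplus>\<^bsub>L\<^esub> \<kappa> (\<psi> x) \<otimes>\<^bsub>L\<^esub> (?a \<ominus>\<^bsub>L\<^esub> \<kappa> (\<phi> x)) \<in> J"
        using that ab by (intro J.a_closed J.I_l_closed) (auto simp: B_def)
      ultimately show ?thesis using LF_mult[OF 1] by (simp add: B_def)
    qed
    have addB: "(\<lambda>y. \<phi> y + \<psi> y) \<in> B" if "\<phi> \<in> B" "\<psi> \<in> B" for \<phi> \<psi>
    proof -
      have 1: "(D, \<phi>) \<in> LF" "(D, \<psi>) \<in> LF" using that by (auto simp: B_def)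
      let ?a = "germ D \<phi>" and ?b = "germ D \<psi>"
      have ab: "?a \<in> carrier L" "?b \<in> carrier L" using 1 germ_carrier by auto
      have "germ D (\<lambda>y. \<phi> y + \<psi> y) = ?a \<oplus>\<^bsub>L\<^esub> ?b" using L_add[OF 1] by simp
      moreover have "?a \<oplus>\<^bsub>L\<^esub> ?b \<ominus>\<^bsub>L\<^esub> \<kappa> (\<phi> x + \<psi> x)
         = (?a \<ominus>\<^bsub>L\<^esub> \<kappa> (\<phi> x)) \<oplus>\<^bsub>L\<^esub> (?b \<ominus>\<^bsub>L\<^esub> \<kappa> (\<psi> x))"
      proof -
        have "\<And>k l. k \<in> carrier L \<Longrightarrow> l \<in> carrier L \<Longrightarrow>
           ?a \<oplus>\<^bsub>L\<^esub> ?b \<ominus>\<^bsub>L\<^esub> (k \<oplus>\<^bsub>L\<^esub> l) = (?a \<ominus>\<^bsub>L\<^esub> k) \<oplus>\<^bsub>L\<^esub> (?b \<ominus>\<^bsub>L\<^esub> l)"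
          using ab by algebra
        then show ?thesis by (simp add: \<kappa>_add)
      qed
      moreover have "(?a \<ominus>\<^bsub>L\<^esub> \<kappa> (\<phi> x)) \<oplus>\<^bsub>L\<^esub> (?b \<ominus>\<^bsub>L\<^esub> \<kappa> (\<psi> x)) \<in> J"
        using that by (intro J.a_closed) (auto simp: B_def)
      ultimately show ?thesis using LF_add[OF 1] by (simp add: B_def)
    qed
    have powB: "(\<lambda>y. \<phi> y ^ k) \<in> B" if "\<phi> \<in> B" for \<phi> k
      by (induction k) (use constB multB that in auto)
    have prodB: "(\<lambda>y. \<Prod>i\<in>A. \<phi> i y) \<in> B" if "finite A" "\<And>i. i \<in> A \<Longrightarrow> \<phi> i \<in> B" for A :: "nat set" and \<phi>
      using that by (induction A rule: finite_induct) (use constB multB in auto)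
    have sumB: "(\<lambda>y. \<Sum>i\<in>A. \<phi> i y) \<in> B" if "finite A" "\<And>i. i \<in> A \<Longrightarrow> \<phi> i \<in> B" for A :: "(nat \<Rightarrow>\<^sub>0 nat) set" and \<phi>
      using that by (induction A rule: finite_induct) (use constB addB in auto)
    \<comment> \<open>Dehomogenization of \<open>f\<close> with respect to the coordinate
      \<open>i0\<close>, a polynomial in the functions \<open>\<xi> i\<close>.\<close>
    define q where "q f d y = mpoly_eval f (rep y) / rep y i0 ^ d" for f d y
    have qB: "q f d \<in> B" if f: "homogeneous n d f" for f d
    proof -
      have "(\<lambda>y. \<Sum>m\<in>Poly_Mapping.keys f. Poly_Mapping.lookup f m * (\<Prod>i\<in>Poly_Mapping.keys m. \<xi> i y ^ Poly_Mapping.lookup m i)) \<in> B"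
        using f by (intro sumB multB[OF constB] prodB powB \<xi>B) (auto simp: homogeneous_iff)
      moreover have "q f d = (\<lambda>y. \<Sum>m\<in>Poly_Mapping.keys f. Poly_Mapping.lookup f m * (\<Prod>i\<in>Poly_Mapping.keys m. \<xi> i y ^ Poly_Mapping.lookup m i))"
        unfolding q_def mpoly_eval_eq sum_divide_distrib
      proof (rule ext, rule sum.cong[OF refl])
        fix y m assume "m \<in> Poly_Mapping.keys f"
        then have d: "d = (\<Sum>i\<in>Poly_Mapping.keys m. Poly_Mapping.lookup m i)"
          using f by (simp add: homogeneous_iff monom_degree_def)
        show "Poly_Mapping.lookup f m * monom_eval m (rep y) / rep y i0 ^ d =
          Poly_Mapping.lookup f m * (\<Prod>i\<in>Poly_Mapping.keys m. \<xi> i y ^ Poly_Mapping.lookup m i)"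
          by (simp add: d monom_eval_def \<xi>_def power_divide prod_dividef power_sum)
      qed
      ultimately show ?thesis by simp
    qed
    fix a assume "a \<in> nonunits L"
    then have a: "a \<in> carrier L" "value a = 0" by (auto simp: nonunits_L)
    obtain U \<phi> where U: "(U, \<phi>) \<in> LF" "a = germ U \<phi>" using a(1) by (rule LE)
    obtain V f g d where V: "zariski_open_in n C V" "x \<in> V" "V \<subseteq> U" "homogeneous n d f" "homogeneous n d g"
      "\<forall>y\<in>V. \<forall>v\<in>y. mpoly_eval g v \<noteq> 0 \<and> \<phi> y = mpoly_eval f v / mpoly_eval g v"
      using U(1) unfolding LF_iff regular_on_def by blast
    have nz: "rep y i0 \<noteq> 0" if "y \<in> D" for y using that rep[of y] by (auto simp: D_def mpoly_eval_mvar)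
    have qf: "(D, q f d) \<in> LF" and qg: "(D, q g d) \<in> LF" using qB[OF V(4)] qB[OF V(5)] by (auto simp: B_def)
    have eq: "\<phi> y * q g d y = q f d y" if "y \<in> V \<inter> D" for y
      using that V(6) rep[of y] DC nz[of y] by (auto simp: q_def)
    have "a \<otimes>\<^bsub>L\<^esub> germ D (q g d) = germ D (q f d)"
      unfolding U(2) L_mult[OF U(1) qg] germ_eq_iff[OF LF_mult[OF U(1) qg] qf]
      using eq zariski_open_Int[OF V(1) D] V(2,3) xD by (intro exI[of _ "V \<inter> D"]) auto
    moreover have "germ D (q f d) \<in> J"
    proof -
      \<comment> \<open>Evaluated at \<open>x\<close>, where the given germ vanishes, the relation
        shows that the numerator has value 0 there; modulo \<open>J\<close> the numerator equals
        this value.\<close>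
      have "q f d x = \<phi> x * q g d x" using eq[of x] V(2) xD by simp
      also have "\<phi> x = 0" using a U by simp
      finally have "q f d x = 0" by simp
      then show ?thesis using qB[OF V(4)] qf by (simp add: B_def \<kappa>_zero a_minus_def germ_carrier)
    qed
    moreover have gu: "germ D (q g d) \<in> Units L"
      using V(2,6) rep[OF x_C] nz[OF xD] qg by (auto simp: unit_iff germ_carrier q_def)
    ultimately have "a \<otimes>\<^bsub>L\<^esub> germ D (q g d) \<otimes>\<^bsub>L\<^esub> inv\<^bsub>L\<^esub> germ D (q g d) \<in> J"
      using J.I_r_closed by simp
    then show "a \<in> J" using a gu L.Units_closed[OF gu] by (simp add: L.m_assoc)
  qed
  then show ?thesis using fin Zsub by blast
qed

end

section \<open>Uniformizers\<close>

text \<open>Nakayama's lemma: if the maximal ideal \<open>m\<close> is generated by \<open>Z\<close> and \<open>m = Rt + m\<^sup>2\<close>, then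
  \<open>m\<close> lies in the ideal generated by \<open>t\<close> and \<open>m z\<close>, \<open>z \<in> Z\<close>, and the generators in \<open>Z\<close> can be
  discarded one at a time.\<close>

lemma (in cring) nakayama_principal:
  assumes m: "ideal m R" and loc: "\<And>s. s \<in> m \<Longrightarrow> \<one> \<ominus> s \<in> Units R"
    and t: "t \<in> m" and Z: "finite Z" "Z \<subseteq> m"
    and sub: "m \<subseteq> Idl (insert t {s \<otimes> z |s z. s \<in> m \<and> z \<in> Z})"
  shows "m \<subseteq> PIdl t"
  using Z sub
proof (induction Z rule: finite_induct)
  case empty
  have "{s \<otimes> z |s z. s \<in> m \<and> z \<in> {}} = {}" by auto
  moreover have "t \<in> carrier R" using t ideal.Icarr[OF m] by blast
  ultimately show ?case using empty(2) cgenideal_eq_genideal[of t] by simp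
next
  case (insert z Z)
  interpret m: ideal m R by (rule m)
  let ?N = "\<lambda>Z. Idl (insert t {s \<otimes> z |s z. s \<in> m \<and> z \<in> Z})"
  have gen: "insert t {s \<otimes> z |s z. s \<in> m \<and> z \<in> Y} \<subseteq> carrier R" if "Y \<subseteq> m" for Y
    using t that by (auto dest: m.Icarr)
  have Zm: "Z \<subseteq> m" "z \<in> m" using insert by auto
  have zc: "z \<in> carrier R" using Zm by (auto dest: m.Icarr)
  interpret N: ideal "?N Z" R by (rule genideal_ideal) (rule gen[OF Zm(1)])
  \<comment> \<open>The ideal N + m z contains all generators of the larger ideal. So
    \<open>z\<close> itself has the form \<open>n + s z\<close> with \<open>s\<close> in
    \<open>m\<close>, and since \<open>1 - s\<close> is a unit, \<open>z\<close> already lies in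
    N.\<close>
  let ?K = "{n \<oplus> s \<otimes> z |n s. n \<in> ?N Z \<and> s \<in> m}"
  have K: "ideal ?K R"
  proof (rule idealI[OF ring_axioms])
    show "subgroup ?K (add_monoid R)"
    proof (rule add.subgroupI)
      show "?K \<subseteq> carrier R" using zc by (auto dest: m.Icarr N.Icarr)
      show "?K \<noteq> {}" using N.zero_closed m.zero_closed by blast
      fix a assume "a \<in> ?K"
      then obtain n s where ns: "a = n \<oplus> s \<otimes> z" "n \<in> ?N Z" "s \<in> m" by blast
      then have "\<ominus> a = (\<ominus> n) \<oplus> (\<ominus> s) \<otimes> z" using zc
        by (simp add: m.Icarr N.Icarr minus_add l_minus a_comm)
      then show "\<ominus> a \<in> ?K" using ns m.a_inv_closed N.a_inv_closed by blast
      fix b assume "b \<in> ?K"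
      then obtain n' s' where ns': "b = n' \<oplus> s' \<otimes> z" "n' \<in> ?N Z" "s' \<in> m" by blast
      have "a \<oplus> b = (n \<oplus> n') \<oplus> (s \<oplus> s') \<otimes> z"
        using ns ns' zc by (simp add: m.Icarr N.Icarr l_distr a_ac)
      then show "a \<oplus> b \<in> ?K" using ns ns' m.a_closed N.a_closed by blast
    qed
    fix a r assume "a \<in> ?K" and r: "r \<in> carrier R"
    then obtain n s where ns: "a = n \<oplus> s \<otimes> z" "n \<in> ?N Z" "s \<in> m" by blast
    have "r \<otimes> a = r \<otimes> n \<oplus> (r \<otimes> s) \<otimes> z"
      using ns zc r by (simp add: m.Icarr N.Icarr r_distr m_assoc)
    then show ra: "r \<otimes> a \<in> ?K" using ns r m.I_l_closed N.I_l_closed by blast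
    have "a \<otimes> r = r \<otimes> a" using ns zc r by (simp add: m.Icarr N.Icarr m_comm)
    then show "a \<otimes> r \<in> ?K" using ra by simp
  qed
  have gN: "insert t {s \<otimes> z |s z. s \<in> m \<and> z \<in> Z} \<subseteq> ?N Z" by (rule genideal_self) (rule gen[OF Zm(1)])
  have inK: "x \<in> ?K" if "x \<in> ?N Z" for x
  proof -
    have "x = x \<oplus> \<zero> \<otimes> z" using that zc by (simp add: N.Icarr)
    then show ?thesis using that m.zero_closed by blast
  qed
  have "?N (insert z Z) \<subseteq> ?K"
  proof (rule genideal_minimal[OF K], rule subsetI)
    fix x assume "x \<in> insert t {s \<otimes> z' |s z'. s \<in> m \<and> z' \<in> insert z Z}"
    then consider "x \<in> insert t {s \<otimes> z |s z. s \<in> m \<and> z \<in> Z}" | s where "s \<in> m" "x = s \<otimes> z" by blast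
    then show "x \<in> ?K"
    proof cases
      case 1 then show ?thesis using gN inK by blast
    next
      case (2 s)
      then have "x = \<zero> \<oplus> s \<otimes> z" using zc by (simp add: m.Icarr)
      then show ?thesis using 2 N.zero_closed by blast
    qed
  qed
  then have "z \<in> ?K" using Zm insert.prems by blast
  then obtain n s where ns: "z = n \<oplus> s \<otimes> z" "n \<in> ?N Z" "s \<in> m" by blast
  have c: "n \<in> carrier R" "s \<in> carrier R" using ns by (auto dest: m.Icarr N.Icarr)
  have u: "\<one> \<ominus> s \<in> Units R" using loc ns by blast
  have "(\<one> \<ominus> s) \<otimes> z = z \<ominus> s \<otimes> z" using c zc by algebra
  also have "\<dots> = (n \<oplus> s \<otimes> z) \<ominus> s \<otimes> z" using ns(1) by simp
  also have "\<dots> = n" using c zc by algebra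
  finally have e: "(\<one> \<ominus> s) \<otimes> z = n" .
  have "inv (\<one> \<ominus> s) \<otimes> ((\<one> \<ominus> s) \<otimes> z) = z"
    using u zc Units_closed[OF u] by (simp add: m_assoc[symmetric])
  then have "z = inv (\<one> \<ominus> s) \<otimes> n" using e by simp
  then have zN: "z \<in> ?N Z" using N.I_l_closed[OF ns(2) Units_inv_closed[OF u]] by simp
  have "?N (insert z Z) \<subseteq> ?N Z"
  proof (rule genideal_minimal[OF N.ideal_axioms], rule subsetI)
    fix x assume "x \<in> insert t {s \<otimes> z' |s z'. s \<in> m \<and> z' \<in> insert z Z}"
    then consider "x \<in> insert t {s \<otimes> z |s z. s \<in> m \<and> z \<in> Z}" | s where "s \<in> m" "x = s \<otimes> z" by blast
    then show "x \<in> ?N Z" using gN zN N.I_l_closed m.Icarr by cases blast+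
  qed
  then show ?case using insert.IH Zm insert.prems by blast
qed

context curve_point
begin

abbreviation "mx \<equiv> nonunits L"

lemma ideal_mx: "ideal mx L"
proof (rule idealI[OF L.ring_axioms])
  show "subgroup mx (add_monoid L)"
    by (rule L.add.subgroupI) (auto simp: nonunits_L value_add value_minus value_zero)
qed (auto simp: nonunits_L value_mult)

text \<open>A one-dimensional cotangent space gives m = k t + m^2, and Nakayama makes
  \<open>t\<close> a generator. A relation \<open>t^k = t^(k+1) s\<close> would force
  \<open>t^k = 0\<close>, as \<open>1 - t s\<close> is a unit; this is impossible because
  \<open>t\<close> is nonzero and the local ring is reduced.\<close>

lemma uniformizer_exists:
  assumes "cotangent_dim n C x 1"
  shows "\<exists>t\<in>carrier L. mx = PIdl\<^bsub>L\<^esub> t \<and> (\<forall>k. \<forall>s\<in>carrier L. t [^]\<^bsub>L\<^esub> (k::nat) \<noteq> t [^]\<^bsub>L\<^esub> Suc k \<otimes>\<^bsub>L\<^esub> s)"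
proof -
  interpret m: ideal mx L by (rule ideal_mx)
  obtain \<tau> where \<tau>: "\<forall>i<1. \<tau> i \<in> mx" "\<forall>f\<in>mx. \<exists>!a. a \<in> {..<1::nat} \<rightarrow>\<^sub>E UNIV \<and>
      f \<ominus>\<^bsub>L\<^esub> finsum L (\<lambda>i. \<kappa> (a i) \<otimes>\<^bsub>L\<^esub> \<tau> i) {..<1} \<in> ideal_power L mx 2"
    using assms unfolding cotangent_dim_def Let_def by blast
  define t where "t = \<tau> 0"
  have t: "t \<in> mx" "t \<in> carrier L" using \<tau>(1) by (auto simp: t_def dest: m.Icarr)
  have fs: "finsum L (\<lambda>i. \<kappa> (a i) \<otimes>\<^bsub>L\<^esub> \<tau> i) {..<1} = \<kappa> (a 0) \<otimes>\<^bsub>L\<^esub> t" for a :: "nat \<Rightarrow> 'k"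
    using t by (simp add: t_def lessThan_Suc)
  have ex: "\<exists>!a. a \<in> {..<1::nat} \<rightarrow>\<^sub>E UNIV \<and> f \<ominus>\<^bsub>L\<^esub> \<kappa> (a 0) \<otimes>\<^bsub>L\<^esub> t \<in> ideal_power L mx 2" if "f \<in> mx" for f
    using bspec[OF \<tau>(2) that] unfolding fs .
  obtain Z where Z: "finite Z" "Z \<subseteq> mx" "\<And>J. ideal J L \<Longrightarrow> Z \<subseteq> J \<Longrightarrow> mx \<subseteq> J"
    using finitely_generated by blast
  let ?G = "insert t {s \<otimes>\<^bsub>L\<^esub> z |s z. s \<in> mx \<and> z \<in> Z}"
  have G: "?G \<subseteq> carrier L" using t Z by (auto dest: m.Icarr)
  interpret N: ideal "Idl\<^bsub>L\<^esub> ?G" L by (rule L.genideal_ideal) (rule G)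
  have GN: "?G \<subseteq> Idl\<^bsub>L\<^esub> ?G" by (rule L.genideal_self) (rule G)
  \<comment> \<open>For fixed \<open>b\<close> the elements that \<open>b\<close> multiplies into
    the ideal form an ideal containing \<open>Z\<close>, hence contain the whole maximal
    ideal.\<close>
  have prod_in: "a \<otimes>\<^bsub>L\<^esub> b \<in> Idl\<^bsub>L\<^esub> ?G" if a: "a \<in> mx" and b: "b \<in> mx" for a b
  proof -
    let ?J = "{a \<in> carrier L. a \<otimes>\<^bsub>L\<^esub> b \<in> Idl\<^bsub>L\<^esub> ?G}"
    have bc: "b \<in> carrier L" using b by (rule m.Icarr)
    have "ideal ?J L"
    proof (rule idealI[OF L.ring_axioms])
      show "subgroup ?J (add_monoid L)"
        by (rule L.add.subgroupI)
          (use bc N.zero_closed in \<open>auto simp: L.l_minus L.l_distr intro!: exI[of _ "\<zero>\<^bsub>L\<^esub>"]\<close>)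
      fix a r assume ar: "a \<in> ?J" "r \<in> carrier L"
      then show "r \<otimes>\<^bsub>L\<^esub> a \<in> ?J" using bc N.I_l_closed by (simp add: L.m_assoc)
      then show "a \<otimes>\<^bsub>L\<^esub> r \<in> ?J" using ar by (simp add: L.m_comm)
    qed
    moreover have "Z \<subseteq> ?J"
    proof
      fix z assume z: "z \<in> Z"
      then have zc: "z \<in> carrier L" using Z(2) by (auto dest: m.Icarr)
      have "b \<otimes>\<^bsub>L\<^esub> z \<in> ?G" using z b by blast
      then have "b \<otimes>\<^bsub>L\<^esub> z \<in> Idl\<^bsub>L\<^esub> ?G" using GN by blast
      then show "z \<in> ?J" using zc bc by (simp add: L.m_comm)
    qed
    ultimately have "mx \<subseteq> ?J" by (rule Z(3))
    then show ?thesis using a by blast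
  qed
  \<comment> \<open>\<open>ideal_power\<close> starts from the whole ring, so its first power is the
    product of the maximal ideal with the ring.\<close>
  have m1: "w \<in> mx" if "w \<in> ideal_power L mx 1" for w
    using that[unfolded One_nat_def ideal_power.simps]
  proof (induction rule: ideal_prod.induct)
    case (prod i j) then show ?case by (simp add: m.I_r_closed)
  next
    case (sum s1 s2) then show ?case by (simp add: m.a_closed)
  qed
  have m2: "w \<in> Idl\<^bsub>L\<^esub> ?G" if "w \<in> ideal_power L mx 2" for w
    using that[unfolded numeral_2_eq_2 ideal_power.simps(2)[of L mx "Suc 0"]]
  proof (induction rule: ideal_prod.induct)
    case (prod i j) then show ?case using prod_in m1 by simp
  next
    case (sum s1 s2) then show ?case by (simp add: N.a_closed)
  qed
  have sub: "mx \<subseteq> Idl\<^bsub>L\<^esub> ?G"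
  proof
    fix f assume f: "f \<in> mx"
    have fc: "f \<in> carrier L" using f by (rule m.Icarr)
    obtain a :: "nat \<Rightarrow> 'k" where a: "f \<ominus>\<^bsub>L\<^esub> \<kappa> (a 0) \<otimes>\<^bsub>L\<^esub> t \<in> ideal_power L mx 2" using ex[OF f] by blast
    have "(f \<ominus>\<^bsub>L\<^esub> \<kappa> (a 0) \<otimes>\<^bsub>L\<^esub> t) \<oplus>\<^bsub>L\<^esub> \<kappa> (a 0) \<otimes>\<^bsub>L\<^esub> t \<in> Idl\<^bsub>L\<^esub> ?G"
      using m2[OF a] GN t by (intro N.a_closed N.I_l_closed) auto
    moreover have "(f \<ominus>\<^bsub>L\<^esub> \<kappa> (a 0) \<otimes>\<^bsub>L\<^esub> t) \<oplus>\<^bsub>L\<^esub> \<kappa> (a 0) \<otimes>\<^bsub>L\<^esub> t = f"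
      using fc t by (simp add: a_minus_def L.a_assoc L.l_neg)
    ultimately show "f \<in> Idl\<^bsub>L\<^esub> ?G" by simp
  qed
  have loc: "\<one>\<^bsub>L\<^esub> \<ominus>\<^bsub>L\<^esub> s \<in> Units L" if "s \<in> mx" for s
  proof -
    have s: "s \<in> carrier L" "value s = 0" using that unfolding nonunits_L by blast+
    have "value (\<one>\<^bsub>L\<^esub> \<ominus>\<^bsub>L\<^esub> s) = 1" using s by (simp only: value_diff L.one_closed value_one) simp
    then show ?thesis using s by (simp only: unit_iff L.minus_closed L.one_closed) simp
  qed
  have mP: "mx \<subseteq> PIdl\<^bsub>L\<^esub> t" by (rule L.nakayama_principal[OF ideal_mx loc t(1) Z(1,2) sub])
  have "PIdl\<^bsub>L\<^esub> t \<subseteq> mx" using t by (auto simp: cgenideal_def m.I_l_closed)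
  then have eq: "mx = PIdl\<^bsub>L\<^esub> t" using mP by blast
  \<comment> \<open>If \<open>t\<close> were zero, every constant would be a coordinate of the zero
    germ, against uniqueness of coordinates.\<close>
  have nz: "t \<noteq> \<zero>\<^bsub>L\<^esub>"
  proof
    assume "t = \<zero>\<^bsub>L\<^esub>"
    have z2: "\<zero>\<^bsub>L\<^esub> \<in> ideal_power L mx 2"
    proof -
      have "\<zero>\<^bsub>L\<^esub> \<otimes>\<^bsub>L\<^esub> \<zero>\<^bsub>L\<^esub> \<in> ideal_power L mx 1"
        unfolding One_nat_def ideal_power.simps by (rule ideal_prod.prod) (auto simp: m.zero_closed)
      then have "\<zero>\<^bsub>L\<^esub> \<otimes>\<^bsub>L\<^esub> \<zero>\<^bsub>L\<^esub> \<in> ideal_power L mx 2"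
        unfolding numeral_2_eq_2 ideal_power.simps(2)[of L mx "Suc 0"]
        by (intro ideal_prod.prod) (auto simp: m.zero_closed)
      then show ?thesis by simp
    qed
    have "\<zero>\<^bsub>L\<^esub> \<ominus>\<^bsub>L\<^esub> \<kappa> a \<otimes>\<^bsub>L\<^esub> t \<in> ideal_power L mx 2" for a
      using z2 \<open>t = \<zero>\<^bsub>L\<^esub>\<close> by (simp add: a_minus_def)
    then have "(\<lambda>i\<in>{..<1::nat}. 0::'k) = (\<lambda>i\<in>{..<1}. 1)"
      using ex[OF m.zero_closed] by (elim ex1E) (metis (no_types, lifting) UNIV_I restrict_PiE_iff)
    from fun_cong[OF this, of 0] show False by simp
  qed
  have "t [^]\<^bsub>L\<^esub> k \<noteq> t [^]\<^bsub>L\<^esub> Suc k \<otimes>\<^bsub>L\<^esub> s" if s: "s \<in> carrier L" for k :: nat and s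
  proof
    assume e: "t [^]\<^bsub>L\<^esub> k = t [^]\<^bsub>L\<^esub> Suc k \<otimes>\<^bsub>L\<^esub> s"
    have u: "\<one>\<^bsub>L\<^esub> \<ominus>\<^bsub>L\<^esub> t \<otimes>\<^bsub>L\<^esub> s \<in> Units L" using loc m.I_r_closed[OF t(1) s] by blast
    have tk: "t [^]\<^bsub>L\<^esub> k \<in> carrier L" using t by simp
    have "t [^]\<^bsub>L\<^esub> k \<otimes>\<^bsub>L\<^esub> (\<one>\<^bsub>L\<^esub> \<ominus>\<^bsub>L\<^esub> t \<otimes>\<^bsub>L\<^esub> s) = t [^]\<^bsub>L\<^esub> k \<ominus>\<^bsub>L\<^esub> (t [^]\<^bsub>L\<^esub> k \<otimes>\<^bsub>L\<^esub> t) \<otimes>\<^bsub>L\<^esub> s"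
      using tk t s by algebra
    also have "\<dots> = \<zero>\<^bsub>L\<^esub>" using e tk s t by (simp add: a_minus_def L.r_neg)
    finally have "(t [^]\<^bsub>L\<^esub> k \<otimes>\<^bsub>L\<^esub> (\<one>\<^bsub>L\<^esub> \<ominus>\<^bsub>L\<^esub> t \<otimes>\<^bsub>L\<^esub> s)) \<otimes>\<^bsub>L\<^esub> inv\<^bsub>L\<^esub> (\<one>\<^bsub>L\<^esub> \<ominus>\<^bsub>L\<^esub> t \<otimes>\<^bsub>L\<^esub> s) = \<zero>\<^bsub>L\<^esub>"
      using u by simp
    then have "t [^]\<^bsub>L\<^esub> k = \<zero>\<^bsub>L\<^esub>" using u tk L.Units_closed[OF u] by (simp add: L.m_assoc)
    then show False using reduced t nz by blast
  qed
  then show ?thesis using t eq by blast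
qed

end

section \<open>Completions isomorphic to power series rings\<close>

text \<open>A local ring with a field of representatives of its residue field and a generator
  \<open>t\<close> of the maximal ideal. \<open>expand\<close> yields coefficients of a power series
  in \<open>t\<close>; \<open>nonstable\<close> makes them unique.\<close>

locale coefficient_field = cring R for R :: "('a, 'b) ring_scheme" (structure) +
  fixes \<kappa> :: "'k::field \<Rightarrow> 'a" and t :: 'a
  assumes \<kappa>_closed [simp]: "\<kappa> a \<in> carrier R" and \<kappa>_one: "\<kappa> 1 = \<one>"
    and \<kappa>_add: "\<kappa> (a + b) = \<kappa> a \<oplus> \<kappa> b" and \<kappa>_mult: "\<kappa> (a * b) = \<kappa> a \<otimes> \<kappa> b"
    and t_closed [simp]: "t \<in> carrier R"
    and expand: "r \<in> carrier R \<Longrightarrow> \<exists>a. \<exists>s\<in>carrier R. r = \<kappa> a \<oplus> t \<otimes> s"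
    and unit: "a \<noteq> 0 \<Longrightarrow> s \<in> carrier R \<Longrightarrow> \<kappa> a \<oplus> t \<otimes> s \<in> Units R"
    and nonstable: "s \<in> carrier R \<Longrightarrow> t [^] (k::nat) \<noteq> t [^] Suc k \<otimes> s"
begin

lemma \<kappa>_zero: "\<kappa> 0 = \<zero>"
  using \<kappa>_add[of 0 0] by (simp add: add.r_cancel_one')

lemma \<kappa>_diff: "\<kappa> (a - b) = \<kappa> a \<ominus> \<kappa> b"
proof -
  have "\<kappa> (a - b) \<oplus> \<kappa> b = \<kappa> a" by (simp flip: \<kappa>_add)
  then show ?thesis by (metis \<kappa>_closed a_minus_def add.inv_solve_right)
qed

text \<open>That multiples of \<open>t\<close> are not units is the case \<open>k = 0\<close> of
  \<open>nonstable\<close>.\<close>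

lemma nonunits_eq: "nonunits R = {t \<otimes> s |s. s \<in> carrier R}"
proof (intro equalityI subsetI)
  fix r assume r: "r \<in> nonunits R"
  then have rc: "r \<in> carrier R" by (simp add: nonunits_def)
  obtain a s where s: "s \<in> carrier R" "r = \<kappa> a \<oplus> t \<otimes> s" using expand[OF rc] by blast
  then have "a = 0" using unit r by (auto simp: nonunits_def)
  then show "r \<in> {t \<otimes> s |s. s \<in> carrier R}" using s by (auto simp: \<kappa>_zero)
next
  fix r assume "r \<in> {t \<otimes> s |s. s \<in> carrier R}"
  then obtain s where s: "s \<in> carrier R" "r = t \<otimes> s" by blast
  have "r \<notin> Units R"
  proof
    assume u: "r \<in> Units R"
    have "t [^] (0::nat) = t [^] Suc 0 \<otimes> (s \<otimes> inv r)" using u s by (simp add: m_assoc[symmetric])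
    moreover have "s \<otimes> inv r \<in> carrier R" using s u by simp
    ultimately show False using nonstable[of "s \<otimes> inv r" 0] by blast
  qed
  then show "r \<in> nonunits R" using s by (simp add: nonunits_def)
qed

lemma ideal_power_eq: "ideal_power R (nonunits R) n = {t [^] n \<otimes> s |s. s \<in> carrier R}"
proof (induction n)
  case 0 then show ?case by (force simp: image_def)
next
  case (Suc n)
  show ?case
  proof (intro equalityI subsetI)
    fix r assume "r \<in> ideal_power R (nonunits R) (Suc n)"
    then show "r \<in> {t [^] Suc n \<otimes> s |s. s \<in> carrier R}"
      unfolding ideal_power.simps
    proof (induction rule: ideal_prod.induct)
      case (prod i j)
      obtain s s' where s: "s \<in> carrier R" "i = t \<otimes> s" "s' \<in> carrier R" "j = t [^] n \<otimes> s'"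
        using prod Suc nonunits_eq by auto
      then have "i \<otimes> j = t [^] Suc n \<otimes> (s \<otimes> s')" by (simp add: m_ac)
      then show ?case using s by blast
    next
      case (sum i j)
      then obtain s s' where s: "s \<in> carrier R" "i = t [^] Suc n \<otimes> s" "s' \<in> carrier R" "j = t [^] Suc n \<otimes> s'"
        by blast
      then have "i \<oplus> j = t [^] Suc n \<otimes> (s \<oplus> s')" by (simp add: r_distr)
      then show ?case using s by blast
    qed
  next
    fix r assume "r \<in> {t [^] Suc n \<otimes> s |s. s \<in> carrier R}"
    then obtain s where s: "s \<in> carrier R" "r = t [^] Suc n \<otimes> s" by blast
    have "t = t \<otimes> \<one>" by simp
    then have "t \<in> nonunits R" unfolding nonunits_eq by blast
    moreover have "t [^] n \<otimes> s \<in> ideal_power R (nonunits R) n" using Suc s by blast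
    ultimately have "t \<otimes> (t [^] n \<otimes> s) \<in> ideal_power R (nonunits R) (Suc n)"
      unfolding ideal_power.simps by (rule ideal_prod.prod)
    moreover have "t \<otimes> (t [^] n \<otimes> s) = r" using s by (simp add: m_ac)
    ultimately show "r \<in> ideal_power R (nonunits R) (Suc n)" by simp
  qed
qed

abbreviation "In n \<equiv> ideal_power R (nonunits R) n"

lemma ideal_In: "ideal (In n) R"
proof -
  have "In n = PIdl (t [^] n)" unfolding ideal_power_eq cgenideal_def using m_comm[of "t [^] n"] by force
  then show ?thesis by (simp add: cgenideal_ideal)
qed

text \<open>\<open>approx n r f\<close> says that \<open>r\<close> is congruent to \<open>f(t)\<close> modulo \<open>t\<^sup>n\<close>.\<close>

primrec approx :: "nat \<Rightarrow> 'a \<Rightarrow> 'k fps \<Rightarrow> bool" where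
  "approx 0 r f \<longleftrightarrow> r \<in> carrier R"
| "approx (Suc n) r f \<longleftrightarrow> (\<exists>s. r = \<kappa> (fps_nth f 0) \<oplus> t \<otimes> s \<and> approx n s (fps_shift 1 f))"

lemma approx_closed: "approx n r f \<Longrightarrow> r \<in> carrier R"
  by (induction n arbitrary: r f) auto

lemma approx_mono: "approx (Suc n) r f \<Longrightarrow> approx n r f"
proof (induction n arbitrary: r f)
  case 0 then show ?case using approx_closed by (auto intro: approx_closed)
next
  case (Suc n)
  then obtain s where "r = \<kappa> (fps_nth f 0) \<oplus> t \<otimes> s" "approx (Suc n) s (fps_shift 1 f)"
    unfolding approx.simps(2)[of "Suc n"] by blast
  then show ?case using Suc.IH unfolding approx.simps(2)[of n] by blast
qed

lemma approx_ex_left: "\<exists>r. approx n r f"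
proof (induction n arbitrary: f)
  case 0 then show ?case by auto
next
  case (Suc n) then show ?case by (metis approx.simps(2))
qed

lemma fps_decompose: "f = fps_const (fps_nth f 0) + fps_X * fps_shift 1 f" for f :: "'k fps"
  by (rule fps_ext) (auto simp: fps_X_mult_nth)

lemma shift_X: "fps_shift 1 (fps_const a + fps_X * g) = g" for g :: "'k fps"
  by (rule fps_ext) (simp add: fps_X_mult_nth)

lemma approx_ex_right: "r \<in> carrier R \<Longrightarrow> \<exists>f. approx n r f"
proof (induction n arbitrary: r)
  case 0 then show ?case by auto
next
  case (Suc n)
  obtain a s where s: "s \<in> carrier R" "r = \<kappa> a \<oplus> t \<otimes> s" using expand[OF Suc.prems] by blast
  obtain g where "approx n s g" using Suc.IH[OF s(1)] by blast
  then show ?case using s by (intro exI[of _ "fps_const a + fps_X * g"]) (auto simp: shift_X simp del: One_nat_def)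
qed

lemma approx_add: "approx n r f \<Longrightarrow> approx n r' g \<Longrightarrow> approx n (r \<oplus> r') (f + g)"
proof (induction n arbitrary: r r' f g)
  case 0 then show ?case by simp
next
  case (Suc n)
  then obtain s s' where s: "r = \<kappa> (fps_nth f 0) \<oplus> t \<otimes> s" "approx n s (fps_shift 1 f)"
    "r' = \<kappa> (fps_nth g 0) \<oplus> t \<otimes> s'" "approx n s' (fps_shift 1 g)" by auto
  note c = approx_closed[OF s(2)] approx_closed[OF s(4)]
  have "r \<oplus> r' = \<kappa> (fps_nth (f + g) 0) \<oplus> t \<otimes> (s \<oplus> s')"
    using c by (simp add: s \<kappa>_add r_distr a_ac)
  moreover have "approx n (s \<oplus> s') (fps_shift 1 (f + g))" using Suc.IH[OF s(2,4)] by (simp add: fps_shift_add)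
  ultimately show ?case by auto
qed

lemma approx_scale: "approx n r f \<Longrightarrow> approx n (\<kappa> a \<otimes> r) (fps_const a * f)"
proof (induction n arbitrary: r f)
  case 0 then show ?case by simp
next
  case (Suc n)
  then obtain s where s: "r = \<kappa> (fps_nth f 0) \<oplus> t \<otimes> s" "approx n s (fps_shift 1 f)" by auto
  note c = approx_closed[OF s(2)]
  have "\<kappa> a \<otimes> r = \<kappa> (fps_nth (fps_const a * f) 0) \<oplus> t \<otimes> (\<kappa> a \<otimes> s)"
    using c by (simp add: s \<kappa>_mult r_distr m_ac)
  moreover have "fps_shift 1 (fps_const a * f) = fps_const a * fps_shift 1 f" by (rule fps_ext) simp
  ultimately show ?case using Suc.IH[OF s(2)] by auto
qed

lemma approx_t: "approx n r f \<Longrightarrow> approx (Suc n) (t \<otimes> r) (fps_X * f)"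
  using approx_closed[of n r f] shift_X[of 0 f] by (auto simp: \<kappa>_zero intro!: exI[of _ r])

lemma approx_const: "approx n (\<kappa> a) (fps_const a)"
proof (cases n)
  case 0 then show ?thesis by simp
next
  case (Suc m)
  have "approx m \<zero> (0::'k fps)"
    by (induction m) (auto simp: \<kappa>_zero intro!: exI[of _ \<zero>])
  then show ?thesis using Suc by (auto simp: fps_shift_fps_const intro!: exI[of _ \<zero>])
qed

lemma approx_mult: "approx n r f \<Longrightarrow> approx n r' g \<Longrightarrow> approx n (r \<otimes> r') (f * g)"
proof (induction n arbitrary: r r' f g)
  case 0 then show ?case by simp
next
  case (Suc n)
  then obtain s s' where s: "r = \<kappa> (fps_nth f 0) \<oplus> t \<otimes> s" "approx n s (fps_shift 1 f)"
    "r' = \<kappa> (fps_nth g 0) \<oplus> t \<otimes> s'" "approx n s' (fps_shift 1 g)" by auto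
  note c = approx_closed[OF s(2)] approx_closed[OF s(4)]
  let ?a = "fps_nth f 0" and ?b = "fps_nth g 0"
  \<comment> \<open>The part of the product that is divisible by \<open>t\<close>, arranged so that
    the induction hypothesis approximates each of its summands to order \<open>n\<close>.\<close>
  let ?s = "\<kappa> ?a \<otimes> s' \<oplus> (\<kappa> ?b \<otimes> s \<oplus> t \<otimes> (s \<otimes> s'))"
  let ?h = "fps_const ?a * fps_shift 1 g + (fps_const ?b * fps_shift 1 f + fps_X * (fps_shift 1 f * fps_shift 1 g))"
  have "approx n ?s ?h"
    by (intro approx_add approx_scale s approx_mono[OF approx_t] Suc.IH)
  moreover have "r \<otimes> r' = \<kappa> (?a * ?b) \<oplus> t \<otimes> ?s"
  proof -
    have "\<And>k l. k \<in> carrier R \<Longrightarrow> l \<in> carrier R \<Longrightarrow> (k \<oplus> t \<otimes> s) \<otimes> (l \<oplus> t \<otimes> s') =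
       k \<otimes> l \<oplus> t \<otimes> (k \<otimes> s' \<oplus> (l \<otimes> s \<oplus> t \<otimes> (s \<otimes> s')))"
      using c t_closed by algebra
    then show ?thesis by (simp add: s \<kappa>_mult)
  qed
  moreover have "f * g = fps_const (?a * ?b) + fps_X * ?h"
  proof -
    have "f * g = (fps_const ?a + fps_X * fps_shift 1 f) * (fps_const ?b + fps_X * fps_shift 1 g)"
      using fps_decompose[of f] fps_decompose[of g] by simp
    also have "\<dots> = fps_const ?a * fps_const ?b + fps_X * ?h" by (simp only: algebra_simps)
    finally show ?thesis by simp
  qed
  ultimately show ?case
    by (auto simp: shift_X simp del: One_nat_def intro!: exI[of _ ?s])
qed

text \<open>If the constant terms differed, \<open>r \<ominus> r'\<close> would be a unit and
  \<open>t^k\<close> would be a multiple of \<open>t^(k+1)\<close>, against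
  \<open>nonstable\<close>. The prefactor \<open>t^k\<close> is carried through the induction
  because \<open>t\<close> is not known to be cancellable.\<close>

lemma approx_unique:
  assumes "approx n r f" "approx n r' g" "w \<in> carrier R" "t [^] k \<otimes> (r \<ominus> r') = t [^] (k + n) \<otimes> w" "i < n"
  shows "fps_nth f i = fps_nth g i"
  using assms
proof (induction n arbitrary: r r' f g k i)
  case 0 then show ?case by simp
next
  case (Suc n)
  obtain s s' where s: "r = \<kappa> (fps_nth f 0) \<oplus> t \<otimes> s" "approx n s (fps_shift 1 f)"
    "r' = \<kappa> (fps_nth g 0) \<oplus> t \<otimes> s'" "approx n s' (fps_shift 1 g)" using Suc.prems(1,2) by auto
  note c = approx_closed[OF s(2)] approx_closed[OF s(4)]
  have tk: "t [^] k \<in> carrier R" by simp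
  have rr: "r \<ominus> r' = \<kappa> (fps_nth f 0 - fps_nth g 0) \<oplus> t \<otimes> (s \<ominus> s')"
  proof -
    have "\<And>k l. k \<in> carrier R \<Longrightarrow> l \<in> carrier R \<Longrightarrow>
      (k \<oplus> t \<otimes> s) \<ominus> (l \<oplus> t \<otimes> s') = (k \<ominus> l) \<oplus> t \<otimes> (s \<ominus> s')" using c t_closed by algebra
    then show ?thesis by (simp add: s \<kappa>_diff)
  qed
  have eq0: "fps_nth f 0 = fps_nth g 0"
  proof (rule ccontr)
    assume "fps_nth f 0 \<noteq> fps_nth g 0"
    then have u: "r \<ominus> r' \<in> Units R" unfolding rr using c by (intro unit) auto
    have "t [^] k = (t [^] k \<otimes> (r \<ominus> r')) \<otimes> inv (r \<ominus> r')"
      using u Units_closed[OF u] by (simp add: m_assoc)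
    also have "\<dots> = t [^] Suc k \<otimes> (t [^] n \<otimes> w \<otimes> inv (r \<ominus> r'))"
      unfolding Suc.prems(4) using u Suc.prems(3)
      by (simp add: nat_pow_mult[symmetric] m_assoc m_lcomm)
    finally show False using nonstable[of "t [^] n \<otimes> w \<otimes> inv (r \<ominus> r')" k] u Suc.prems(3) by simp
  qed
  have "t [^] Suc k \<otimes> (s \<ominus> s') = t [^] k \<otimes> (r \<ominus> r')"
    unfolding rr using c by (simp add: eq0 \<kappa>_zero m_assoc)
  also have "\<dots> = t [^] (Suc k + n) \<otimes> w" using Suc.prems(4) by simp
  finally have "i' < n \<Longrightarrow> fps_nth (fps_shift 1 f) i' = fps_nth (fps_shift 1 g) i'" for i'
    using Suc.IH[OF s(2,4) Suc.prems(3)] by blast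
  from this[of "i - 1"] show ?case using eq0 Suc.prems(5) by (cases i) auto
qed

lemma approx_unique': "approx n r f \<Longrightarrow> approx n r g \<Longrightarrow> i < n \<Longrightarrow> fps_nth f i = fps_nth g i"
  using approx_unique[of n r f r g \<zero> 0 i] approx_closed[of n r f] by (simp add: a_minus_def r_neg)

lemma approx_cong: "approx n r f \<Longrightarrow> (\<And>i. i < n \<Longrightarrow> fps_nth f i = fps_nth g i) \<Longrightarrow> approx n r g"
proof (induction n arbitrary: r f g)
  case 0 then show ?case by simp
next
  case (Suc n)
  obtain s where s: "r = \<kappa> (fps_nth f 0) \<oplus> t \<otimes> s" "approx n s (fps_shift 1 f)" using Suc.prems(1) by auto
  have "approx n s (fps_shift 1 g)" by (rule Suc.IH[OF s(2)]) (use Suc.prems(2) in simp)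
  then show ?case using s Suc.prems(2)[of 0] by auto
qed

lemma approx_shift: "approx n r f \<Longrightarrow> w \<in> carrier R \<Longrightarrow> approx n (t [^] n \<otimes> w \<oplus> r) f"
proof (induction n arbitrary: r f)
  case 0 then show ?case by simp
next
  case (Suc n)
  obtain s where s: "r = \<kappa> (fps_nth f 0) \<oplus> t \<otimes> s" "approx n s (fps_shift 1 f)" using Suc.prems(1) by auto
  note c = approx_closed[OF s(2)]
  have "t [^] Suc n \<otimes> w \<oplus> r = \<kappa> (fps_nth f 0) \<oplus> t \<otimes> (t [^] n \<otimes> w \<oplus> s)"
    using c Suc.prems(2) by (simp add: s(1) r_distr m_ac a_ac)
  then show ?case using Suc.IH[OF s(2) Suc.prems(2)] by auto
qed

text \<open>With \<open>approx_shift\<close> this shows that the elements approximated by one series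
  form a single coset of the \<open>n\<close>-th power of the maximal ideal.\<close>

lemma approx_diff: "approx n r f \<Longrightarrow> approx n r' f \<Longrightarrow> \<exists>w\<in>carrier R. r' = t [^] n \<otimes> w \<oplus> r"
proof (induction n arbitrary: r r' f)
  case 0
  then have "r' = t [^] (0::nat) \<otimes> (r' \<ominus> r) \<oplus> r" by (simp add: a_minus_def a_assoc l_neg)
  then show ?case using 0 by auto
next
  case (Suc n)
  obtain s s' where s: "r = \<kappa> (fps_nth f 0) \<oplus> t \<otimes> s" "approx n s (fps_shift 1 f)"
    "r' = \<kappa> (fps_nth f 0) \<oplus> t \<otimes> s'" "approx n s' (fps_shift 1 f)" using Suc.prems by auto
  note c = approx_closed[OF s(2)]
  obtain w where w: "w \<in> carrier R" "s' = t [^] n \<otimes> w \<oplus> s" using Suc.IH[OF s(2,4)] by blast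
  have "r' = t [^] Suc n \<otimes> w \<oplus> r" using c w by (simp add: s w(2) r_distr m_ac a_ac)
  then show ?case using w by blast
qed

text \<open>Entry \<open>n\<close> is the coset of \<open>f(t)\<close> modulo \<open>t^n\<close>,
  presented as the set of all elements approximated by \<open>f\<close> to order
  \<open>n\<close>.\<close>

definition "\<theta> f = (\<lambda>n. {r. approx n r f})"

lemma \<theta>_coset: assumes "approx n r f" shows "\<theta> f n = In n +> r"
proof -
  have "{r'. approx n r' f} = {t [^] n \<otimes> w \<oplus> r |w. w \<in> carrier R}"
    using approx_diff[OF assms] approx_shift[OF assms] by auto
  then show ?thesis unfolding \<theta>_def ideal_power_eq a_r_coset_def r_coset_def by auto
qed

abbreviation "A \<equiv> completion R (nonunits R)"

lemma A_simps:
  "carrier A = {a. (\<forall>n. a n \<in> carrier (R Quot In n)) \<and> (\<forall>n. a (Suc n) \<subseteq> a n)}"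
  "a \<otimes>\<^bsub>A\<^esub> b = (\<lambda>n. a n \<otimes>\<^bsub>R Quot In n\<^esub> b n)" "a \<oplus>\<^bsub>A\<^esub> b = (\<lambda>n. a n \<oplus>\<^bsub>R Quot In n\<^esub> b n)"
  "\<one>\<^bsub>A\<^esub> = (\<lambda>n. \<one>\<^bsub>R Quot In n\<^esub>)" "\<zero>\<^bsub>A\<^esub> = (\<lambda>n. \<zero>\<^bsub>R Quot In n\<^esub>)"
  by (auto simp: completion_def prod_ring_def Let_def PiE_iff)

lemma \<theta>_carrier: "\<theta> f \<in> carrier A"
proof -
  have "\<theta> f n \<in> carrier (R Quot In n)" for n
  proof -
    obtain r where r: "approx n r f" using approx_ex_left by blast
    then show ?thesis using approx_closed[OF r] by (auto simp: \<theta>_coset FactRing_def A_RCOSETS_def RCOSETS_def a_r_coset_def)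
  qed
  moreover have "\<theta> f (Suc n) \<subseteq> \<theta> f n" for n using approx_mono by (auto simp: \<theta>_def)
  ultimately show ?thesis by (simp add: A_simps)
qed

text \<open>Injective because an approximated element determines the initial coefficients;
  surjective because the coefficients found for the entries of a compatible sequence become
  stationary.\<close>

lemma \<theta>_bij: "bij_betw \<theta> UNIV (carrier A)"
proof (rule bij_betw_imageI)
  show "inj \<theta>"
  proof (rule injI, rule fps_ext)
    fix f g i assume e: "\<theta> f = \<theta> g"
    obtain r where r: "approx (Suc i) r f" using approx_ex_left by blast
    then have "approx (Suc i) r g" using fun_cong[OF e, of "Suc i"] unfolding \<theta>_def by blast
    then show "fps_nth f i = fps_nth g i" using r approx_unique'[of "Suc i" r f g i] by simp
  qed
  have "a \<in> range \<theta>" if a: "a \<in> carrier A" for a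
  proof -
    have "\<exists>r\<in>carrier R. a n = In n +> r" for n
      using a by (auto simp: A_simps FactRing_def A_RCOSETS_def RCOSETS_def a_r_coset_def)
    then obtain r where r: "\<And>n. r n \<in> carrier R" "\<And>n. a n = In n +> r n" by metis
    have "\<exists>f. approx n (r n) f" for n by (rule approx_ex_right[OF r(1)])
    then obtain F where F: "\<And>n. approx n (r n) (F n)" by metis
    have an: "a n = \<theta> (F n) n" for n using \<theta>_coset[OF F] r(2) by simp
    have step: "fps_nth (F (Suc n)) i = fps_nth (F n) i" if "i < n" for n i
    proof -
      have "r (Suc n) \<in> a (Suc n)" unfolding an \<theta>_def mem_Collect_eq by (rule F)
      then have "r (Suc n) \<in> a n" using a by (auto simp: A_simps)
      then have "approx n (r (Suc n)) (F n)" using an by (simp add: \<theta>_def)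
      moreover have "approx n (r (Suc n)) (F (Suc n))" using F[of "Suc n"] by (rule approx_mono)
      ultimately show ?thesis using approx_unique' that by metis
    qed
    have stab: "fps_nth (F n) i = fps_nth (F (Suc i)) i" if "i < n" for n i
      using that
    proof (induction n)
      case (Suc n) then show ?case using step by (cases "i = n") auto
    qed simp
    \<comment> \<open>Coefficient \<open>i\<close> is read off at stage \<open>i + 1\<close>, the
      first stage whose approximation determines it.\<close>
    define f where "f = Abs_fps (\<lambda>i. fps_nth (F (Suc i)) i)"
    have "a n = \<theta> f n" for n
    proof -
      have "approx n (r n) f" by (rule approx_cong[OF F]) (unfold f_def fps_nth_Abs_fps, rule stab)
      from \<theta>_coset[OF this] show ?thesis using r(2) by simp
    qed
    then show ?thesis by blast
  qed
  then show "range \<theta> = carrier A" using \<theta>_carrier by blast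
qed

lemma \<theta>_mult: "\<theta> (f * g) = \<theta> f \<otimes>\<^bsub>A\<^esub> \<theta> g"
proof
  fix n
  obtain r s where rs: "approx n r f" "approx n s g" using approx_ex_left by metis
  then show "\<theta> (f * g) n = (\<theta> f \<otimes>\<^bsub>A\<^esub> \<theta> g) n"
    using \<theta>_coset[OF approx_mult[OF rs]] \<theta>_coset[OF rs(1)] \<theta>_coset[OF rs(2)]
      ideal.rcoset_mult_add[OF ideal_In approx_closed[OF rs(1)] approx_closed[OF rs(2)]]
    by (simp add: A_simps FactRing_def)
qed

lemma \<theta>_add: "\<theta> (f + g) = \<theta> f \<oplus>\<^bsub>A\<^esub> \<theta> g"
proof
  fix n
  obtain r s where rs: "approx n r f" "approx n s g" using approx_ex_left by metis
  interpret I: ideal "In n" R by (rule ideal_In)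
  show "\<theta> (f + g) n = (\<theta> f \<oplus>\<^bsub>A\<^esub> \<theta> g) n"
    using \<theta>_coset[OF approx_add[OF rs]] \<theta>_coset[OF rs(1)] \<theta>_coset[OF rs(2)]
      I.a_rcos_sum[OF approx_closed[OF rs(1)] approx_closed[OF rs(2)]]
    by (simp add: A_simps FactRing_def)
qed

lemma \<theta>_const: "\<theta> (fps_const a) = (\<lambda>n. In n +> \<kappa> a)"
  by (rule ext, rule \<theta>_coset, rule approx_const)

lemma \<theta>_one: "\<theta> 1 = \<one>\<^bsub>A\<^esub>"
  using \<theta>_const[of 1] by (simp add: A_simps FactRing_def \<kappa>_one)

lemma \<theta>_zero: "\<theta> 0 = \<zero>\<^bsub>A\<^esub>"
proof -
  have "In n +> \<zero> = In n" for n
    using a_coset_add_zero[OF additive_subgroup.a_subset[OF ideal.axioms(1)[OF ideal_In]]] .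
  then show ?thesis using \<theta>_const[of 0] by (simp add: A_simps FactRing_def \<kappa>_zero)
qed

end

section \<open>Rings isomorphic to power series rings and their fraction fields\<close>

locale power_series_ring =
  fixes A :: "('a, 'b) ring_scheme" (structure) and \<theta> :: "'k::field fps \<Rightarrow> 'a"
  assumes \<theta>_bij: "bij_betw \<theta> UNIV (carrier A)"
    and \<theta>_mult: "\<theta> (f * g) = \<theta> f \<otimes> \<theta> g" and \<theta>_add: "\<theta> (f + g) = \<theta> f \<oplus> \<theta> g"
    and \<theta>_one: "\<theta> 1 = \<one>" and \<theta>_zero: "\<theta> 0 = \<zero>"
begin

lemma carrier_A: "carrier A = range \<theta>"
  using \<theta>_bij by (simp add: bij_betw_def)

lemma \<theta>_eq [simp]: "\<theta> f = \<theta> g \<longleftrightarrow> f = g"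
  using \<theta>_bij by (auto simp: bij_betw_def inj_eq)

lemma \<theta>_eq_zero: "\<theta> f = \<zero> \<longleftrightarrow> f = 0"
  by (metis \<theta>_zero \<theta>_eq)

lemma \<theta>_Units: "\<theta> f \<in> Units A \<longleftrightarrow> fps_nth f 0 \<noteq> 0"
proof
  assume "\<theta> f \<in> Units A"
  then obtain g where "\<theta> f \<otimes> \<theta> g = \<one>" unfolding Units_def carrier_A by blast
  then have "f * g = 1" by (metis \<theta>_mult \<theta>_one \<theta>_eq)
  then have "fps_nth f 0 * fps_nth g 0 = 1" by (metis fps_mult_nth_0 fps_one_nth)
  then show "fps_nth f 0 \<noteq> 0" by auto
next
  assume "fps_nth f 0 \<noteq> 0"
  then have "inverse f * f = 1" by (rule inverse_mult_eq_1)
  then have "\<theta> (inverse f) \<otimes> \<theta> f = \<one>" "\<theta> f \<otimes> \<theta> (inverse f) = \<one>"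
    by (simp_all add: \<theta>_mult[symmetric] \<theta>_one mult.commute)
  then show "\<theta> f \<in> Units A" unfolding Units_def carrier_A by blast
qed

lemma nonunits_A: "nonunits A = \<theta> ` {f. fps_nth f 0 = 0}"
  unfolding nonunits_def carrier_A using \<theta>_Units by auto

text \<open>The maximal ideal consists of the series without constant term, so its powers are given
  by vanishing initial coefficients; this identifies \<open>dvr_order\<close> with
  \<open>subdegree\<close>.\<close>

lemma ideal_power_A: "ideal_power A (nonunits A) n = \<theta> ` {f. \<forall>i<n. fps_nth f i = 0}"
proof (induction n)
  case 0 then show ?case by (simp add: carrier_A)
next
  case (Suc n)
  show ?case
  proof (intro equalityI subsetI)
    fix r assume "r \<in> ideal_power A (nonunits A) (Suc n)"
    then show "r \<in> \<theta> ` {f. \<forall>i<Suc n. fps_nth f i = 0}"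
      unfolding ideal_power.simps
    proof (induction rule: ideal_prod.induct)
      case (prod i j)
      obtain f g where fg: "i = \<theta> f" "fps_nth f 0 = 0" "j = \<theta> g" "\<forall>i<n. fps_nth g i = 0"
        using prod unfolding Suc unfolding nonunits_A by blast
      have "fps_nth (f * g) m = 0" if m: "m < Suc n" for m
      proof -
        have "fps_nth f l * fps_nth g (m - l) = 0" if "l \<le> m" for l
        proof (cases "l = 0")
          case False then have "m - l < n" using m that by linarith
          then show ?thesis using fg(4) by simp
        qed (simp add: fg)
        then show ?thesis unfolding fps_mult_nth by (intro sum.neutral) simp
      qed
      then show ?case using fg \<theta>_mult[of f g] by (intro image_eqI[of _ _ "f * g"]) auto
    next
      case (sum i j)
      then obtain f g where "i = \<theta> f" "\<forall>i<Suc n. fps_nth f i = 0" "j = \<theta> g" "\<forall>i<Suc n. fps_nth g i = 0"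
        by blast
      then show ?case using \<theta>_add[of f g] by (intro image_eqI[of _ _ "f + g"]) auto
    qed
  next
    fix r assume "r \<in> \<theta> ` {f. \<forall>i<Suc n. fps_nth f i = 0}"
    then obtain f where f: "r = \<theta> f" "\<forall>i<Suc n. fps_nth f i = 0" by blast
    have "f = fps_X * fps_shift 1 f"
      by (rule fps_ext) (use f(2) in \<open>auto simp: fps_X_mult_nth\<close>)
    then have r: "r = \<theta> fps_X \<otimes> \<theta> (fps_shift 1 f)" using f(1) by (metis \<theta>_mult)
    have "\<theta> fps_X \<in> nonunits A" unfolding nonunits_A by (intro imageI) simp
    moreover have "\<theta> (fps_shift 1 f) \<in> ideal_power A (nonunits A) n"
      unfolding Suc by (intro imageI) (use f(2) in simp)
    ultimately show "r \<in> ideal_power A (nonunits A) (Suc n)"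
      unfolding r ideal_power.simps by (rule ideal_prod.prod)
  qed
qed

lemma dvr_order_\<theta>: assumes "f \<noteq> 0" shows "dvr_order A (\<theta> f) = subdegree f"
proof -
  have iff: "\<theta> f \<in> ideal_power A (nonunits A) n \<longleftrightarrow> n \<le> subdegree f" for n
  proof
    assume "\<theta> f \<in> ideal_power A (nonunits A) n"
    then have "\<forall>i<n. fps_nth f i = 0" unfolding ideal_power_A by auto
    then show "n \<le> subdegree f" using assms by (metis not_le nth_subdegree_nonzero)
  next
    assume "n \<le> subdegree f"
    then show "\<theta> f \<in> ideal_power A (nonunits A) n"
      unfolding ideal_power_A by (intro imageI) (auto intro: nth_less_subdegree_zero)
  qed
  show ?thesis unfolding dvr_order_def iff by (rule Greatest_equality) auto
qed

text \<open>An element of the fraction field is an equivalence class of pairs; the class belonging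
  to a Laurent series consists of all pairs of power series with that quotient.\<close>

definition \<Lambda> :: "'k fls \<Rightarrow> ('a \<times> 'a) set" where
  "\<Lambda> z = {(\<theta> f, \<theta> g) |f g. g \<noteq> 0 \<and> fps_to_fls f = z * fps_to_fls g}"

lemma fraction_\<theta>: assumes "g \<noteq> 0" shows "fraction A (\<theta> f) (\<theta> g) = \<Lambda> (fps_to_fls f / fps_to_fls g)"
proof -
  have e: "f * g' = f' * g \<longleftrightarrow> fps_to_fls f' = (fps_to_fls f / fps_to_fls g) * fps_to_fls g'" for f' g'
  proof -
    have "fps_to_fls f' = (fps_to_fls f / fps_to_fls g) * fps_to_fls g' \<longleftrightarrow>
        fps_to_fls f * fps_to_fls g' = fps_to_fls f' * fps_to_fls g"
      using assms by (auto simp: field_simps)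
    also have "\<dots> \<longleftrightarrow> f * g' = f' * g" by (simp only: fls_times_fps_to_fls[symmetric] fps_to_fls_eq_iff)
    finally show ?thesis ..
  qed
  have "fraction A (\<theta> f) (\<theta> g) = {(\<theta> f', \<theta> g') |f' g'. g' \<noteq> 0 \<and> f * g' = f' * g}"
    unfolding fraction_def frac_rel_def carrier_A using assms
    by (auto simp: \<theta>_eq_zero \<theta>_mult[symmetric])
  then show ?thesis unfolding \<Lambda>_def e .
qed

lemma fls_quotient: obtains f g where "g \<noteq> 0" "(z :: 'k fls) = fps_to_fls f / fps_to_fls g"
proof -
  \<comment> \<open>The order of the pole, or 0 if there is none; multiplication by
    \<open>X^k\<close> makes \<open>z\<close> a power series.\<close>
  define k where "k = nat (- fls_subdegree z)"
  have "z = 0 \<or> 0 \<le> fls_subdegree (z * fls_X ^ k)" by (cases "z = 0") (simp_all add: k_def)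
  then have "fps_to_fls (fls_regpart (z * fls_X ^ k)) = z * fls_X ^ k" by auto
  moreover have "fps_to_fls (fps_X ^ k) = (fls_X ^ k :: 'k fls)" by (simp add: fps_to_fls_power)
  moreover have "z = (z * fls_X ^ k) / fls_X ^ k" by (rule nonzero_mult_div_cancel_right[symmetric]) simp
  ultimately have "z = fps_to_fls (fls_regpart (z * fls_X ^ k)) / fps_to_fls (fps_X ^ k)" by (simp only:)
  then show ?thesis by (rule that[rotated]) simp
qed

lemma \<Lambda>_ex: "\<exists>f g. (\<theta> f, \<theta> g) \<in> \<Lambda> z \<and> g \<noteq> 0 \<and> fps_to_fls f = z * fps_to_fls g"
proof -
  obtain f g where "g \<noteq> 0" "z = fps_to_fls f / fps_to_fls g" by (rule fls_quotient)
  then show ?thesis unfolding \<Lambda>_def by (intro exI[of _ f] exI[of _ g]) auto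
qed

lemma \<Lambda>_eq [simp]: "\<Lambda> z = \<Lambda> w \<longleftrightarrow> z = w"
proof
  assume e: "\<Lambda> z = \<Lambda> w"
  obtain f g where fg: "(\<theta> f, \<theta> g) \<in> \<Lambda> z" "g \<noteq> 0" "fps_to_fls f = z * fps_to_fls g" using \<Lambda>_ex by blast
  then have "(\<theta> f, \<theta> g) \<in> \<Lambda> w" using e by simp
  then have "fps_to_fls f = w * fps_to_fls g" unfolding \<Lambda>_def by auto
  then show "z = w" using fg by simp
qed simp

lemma carrier_frac_field: "carrier (frac_field A) = range \<Lambda>"
proof (intro equalityI subsetI)
  fix y assume "y \<in> carrier (frac_field A)"
  then obtain a b where ab: "a \<in> carrier A" "b \<in> carrier A" "b \<noteq> \<zero>" "y = fraction A a b"
    unfolding frac_field_def quotient_def fraction_def by auto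
  obtain f g where "a = \<theta> f" "b = \<theta> g" using ab unfolding carrier_A by blast
  then have "g \<noteq> 0" "y = fraction A (\<theta> f) (\<theta> g)" using ab by (simp_all add: \<theta>_eq_zero)
  then show "y \<in> range \<Lambda>" by (simp add: fraction_\<theta>)
next
  fix y assume "y \<in> range \<Lambda>"
  then obtain z where y: "y = \<Lambda> z" by blast
  obtain f g where fg: "g \<noteq> 0" "z = fps_to_fls f / fps_to_fls g" by (rule fls_quotient)
  then have "y = fraction A (\<theta> f) (\<theta> g)" by (simp add: fraction_\<theta> y)
  moreover have "(\<theta> f, \<theta> g) \<in> carrier A \<times> (carrier A - {\<zero>})" using fg(1) by (simp add: carrier_A \<theta>_eq_zero)
  ultimately show "y \<in> carrier (frac_field A)" by (simp add: frac_field_def fraction_def quotientI)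
qed

lemma \<Lambda>_closed [simp]: "\<Lambda> z \<in> carrier (frac_field A)"
  by (simp add: carrier_frac_field)

lemma \<Lambda>_Union:
  fixes h :: "'a \<Rightarrow> 'a \<Rightarrow> 'a \<Rightarrow> 'a \<Rightarrow> 'c set"
  assumes "\<And>f g f' g'. g \<noteq> 0 \<Longrightarrow> g' \<noteq> 0 \<Longrightarrow> fps_to_fls f = z * fps_to_fls g \<Longrightarrow>
    fps_to_fls f' = w * fps_to_fls g' \<Longrightarrow> h (\<theta> f) (\<theta> g) (\<theta> f') (\<theta> g') = Y"
  shows "(\<Union>(a, b)\<in>\<Lambda> z. \<Union>(c, d)\<in>\<Lambda> w. h a b c d) = Y"
proof -
  have all: "h a b c d = Y" if "(a, b) \<in> \<Lambda> z" "(c, d) \<in> \<Lambda> w" for a b c d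
    using that assms unfolding \<Lambda>_def by blast
  obtain a b where 1: "(a, b) \<in> \<Lambda> z" using \<Lambda>_ex by blast
  obtain c d where 2: "(c, d) \<in> \<Lambda> w" using \<Lambda>_ex by blast
  show ?thesis
  proof (intro equalityI subsetI)
    fix y assume "y \<in> (\<Union>(a, b)\<in>\<Lambda> z. \<Union>(c, d)\<in>\<Lambda> w. h a b c d)"
    then show "y \<in> Y" using all by blast
  next
    fix y assume "y \<in> Y"
    then have "y \<in> h a b c d" using all[OF 1 2] by simp
    then show "y \<in> (\<Union>(a, b)\<in>\<Lambda> z. \<Union>(c, d)\<in>\<Lambda> w. h a b c d)" using 1 2 by blast
  qed
qed

lemma \<Lambda>_mult: "\<Lambda> (z * w) = \<Lambda> z \<otimes>\<^bsub>frac_field A\<^esub> \<Lambda> w"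
proof -
  have "(\<Union>(a, b)\<in>\<Lambda> z. \<Union>(c, d)\<in>\<Lambda> w. fraction A (a \<otimes> c) (b \<otimes> d)) = \<Lambda> (z * w)"
    by (rule \<Lambda>_Union) (simp add: \<theta>_mult[symmetric] fraction_\<theta> fls_times_fps_to_fls)
  then show ?thesis by (simp add: frac_field_def)
qed

lemma \<Lambda>_add: "\<Lambda> (z + w) = \<Lambda> z \<oplus>\<^bsub>frac_field A\<^esub> \<Lambda> w"
proof -
  have "(\<Union>(a, b)\<in>\<Lambda> z. \<Union>(c, d)\<in>\<Lambda> w. fraction A (a \<otimes> d \<oplus> c \<otimes> b) (b \<otimes> d)) = \<Lambda> (z + w)"
    by (rule \<Lambda>_Union)
      (simp add: \<theta>_mult[symmetric] \<theta>_add[symmetric] fraction_\<theta> fls_times_fps_to_fls fps_to_fls_plus field_simps)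
  then show ?thesis by (simp add: frac_field_def)
qed

lemma fraction_\<theta>_one: "fraction A (\<theta> f) \<one> = \<Lambda> (fps_to_fls f)"
  using fraction_\<theta>[of 1 f] by (simp add: \<theta>_one)

lemma \<Lambda>_one: "\<Lambda> 1 = \<one>\<^bsub>frac_field A\<^esub>"
  using fraction_\<theta>_one[of 1] by (simp add: frac_field_def \<theta>_one)

lemma \<Lambda>_zero: "\<Lambda> 0 = \<zero>\<^bsub>frac_field A\<^esub>"
  using fraction_\<theta>_one[of 0] by (simp add: frac_field_def \<theta>_zero)

lemma integers_\<Lambda>: "\<Lambda> z \<in> (\<lambda>a. fraction A a \<one>) ` carrier A \<longleftrightarrow> 0 \<le> fls_subdegree z"
proof -
  have "\<Lambda> z \<in> (\<lambda>a. fraction A a \<one>) ` carrier A \<longleftrightarrow> z \<in> range fps_to_fls"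
    unfolding carrier_A by (auto simp: fraction_\<theta>_one image_iff)
  also have "\<dots> \<longleftrightarrow> 0 \<le> fls_subdegree z"
  proof
    assume "0 \<le> fls_subdegree z"
    then have "z = fps_to_fls (fls_regpart z)" by simp
    then show "z \<in> range fps_to_fls" by (rule range_eqI)
  qed (auto simp: fls_subdegree_fls_to_fps)
  finally show ?thesis .
qed

text \<open>Order is additive on products of Laurent series, so every representation as a fraction
  gives the same difference of orders.\<close>

lemma frac_val_\<Lambda>: assumes "z \<noteq> 0" shows "frac_val A (\<Lambda> z) = fls_subdegree z"
  unfolding frac_val_def
proof (rule the_equality)
  have sub: "int (dvr_order A (\<theta> f)) - int (dvr_order A (\<theta> g)) = fls_subdegree z"
    if "f \<noteq> 0" "g \<noteq> 0" "\<Lambda> z = fraction A (\<theta> f) (\<theta> g)" for f g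
  proof -
    have "z = fps_to_fls f / fps_to_fls g" using that by (simp add: fraction_\<theta>)
    then have "fps_to_fls f = z * fps_to_fls g" using that by simp
    then have "fls_subdegree (fps_to_fls f) = fls_subdegree z + fls_subdegree (fps_to_fls g)"
      using that assms by (simp add: fls_subdegree_mult)
    then show ?thesis using that by (simp add: dvr_order_\<theta> fls_subdegree_fls_to_fps)
  qed
  obtain f g where fg: "g \<noteq> 0" "z = fps_to_fls f / fps_to_fls g" by (rule fls_quotient)
  then have f: "f \<noteq> 0" using assms by auto
  have e: "\<Lambda> z = fraction A (\<theta> f) (\<theta> g)" using fg by (simp add: fraction_\<theta>)
  have c: "\<theta> f \<in> carrier A - {\<zero>}" "\<theta> g \<in> carrier A - {\<zero>}"
    using f fg by (auto simp: carrier_A \<theta>_eq_zero)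
  show "\<exists>a\<in>carrier A - {\<zero>}. \<exists>b\<in>carrier A - {\<zero>}. \<Lambda> z = fraction A a b \<and>
      fls_subdegree z = int (dvr_order A a) - int (dvr_order A b)"
    by (rule bexI[OF _ c(1)], rule bexI[OF _ c(2)], rule conjI[OF e sub[OF f fg(1) e, symmetric]])
  fix v assume "\<exists>a\<in>carrier A - {\<zero>}. \<exists>b\<in>carrier A - {\<zero>}. \<Lambda> z = fraction A a b \<and>
      v = int (dvr_order A a) - int (dvr_order A b)"
  then obtain a b where ab: "a \<in> carrier A" "a \<noteq> \<zero>" "b \<in> carrier A" "b \<noteq> \<zero>" "\<Lambda> z = fraction A a b"
    "v = int (dvr_order A a) - int (dvr_order A b)" by blast
  obtain f' g' where fg': "a = \<theta> f'" "b = \<theta> g'" using ab unfolding carrier_A by blast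
  show "v = fls_subdegree z" using sub[of f' g'] ab fg' by (simp add: \<theta>_eq_zero)
qed

end

section \<open>Roots of power series\<close>

text \<open>For \<open>n > 0\<close>, changing coefficient \<open>n\<close> of \<open>g\<close> by
  \<open>c\<close> enters coefficient \<open>n\<close> of a power only linearly, with the derivative
  of \<open>x^m\<close> at the constant term as factor.\<close>

lemma fps_nth_power_perturb:
  fixes g h :: "'k::comm_ring_1 fps"
  assumes n: "n > 0" and h: "\<And>i. fps_nth h i = fps_nth g i + (if i = n then c else 0)"
  shows "fps_nth (h ^ m) n = fps_nth (g ^ m) n + of_nat m * fps_nth g 0 ^ (m - 1) * c"
proof (induction m)
  case 0 then show ?case by simp
next
  case (Suc m)
  let ?a = "fps_nth g 0"
  have low: "\<forall>i<n. fps_nth (h ^ m) i = fps_nth (g ^ m) i"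
    by (induction m) (auto simp: fps_mult_nth h)
  have h0: "fps_nth h 0 = ?a" using h[of 0] n by simp
  have "(\<Sum>i=1..n. fps_nth h i * fps_nth (h ^ m) (n - i)) =
      (\<Sum>i=1..n. fps_nth g i * fps_nth (g ^ m) (n - i) + (if i = n then c * ?a ^ m else 0))"
  proof (rule sum.cong[OF refl])
    fix i assume i: "i \<in> {1..n}"
    then have "fps_nth (h ^ m) (n - i) = fps_nth (g ^ m) (n - i)" using low n by simp
    then show "fps_nth h i * fps_nth (h ^ m) (n - i) =
        fps_nth g i * fps_nth (g ^ m) (n - i) + (if i = n then c * ?a ^ m else 0)"
      using i h[of i] by (simp add: fps_nth_power_0 distrib_right)
  qed
  also have "\<dots> = (\<Sum>i=1..n. fps_nth g i * fps_nth (g ^ m) (n - i)) + c * ?a ^ m"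
    using n by (simp add: sum.distrib)
  finally have "fps_nth (h ^ Suc m) n = ?a * fps_nth (h ^ m) n +
      ((\<Sum>i=1..n. fps_nth g i * fps_nth (g ^ m) (n - i)) + c * ?a ^ m)"
    by (simp add: fps_mult_nth sum.atLeast_Suc_atMost h0)
  moreover have "fps_nth (g ^ Suc m) n = ?a * fps_nth (g ^ m) n + (\<Sum>i=1..n. fps_nth g i * fps_nth (g ^ m) (n - i))"
    by (simp add: fps_mult_nth sum.atLeast_Suc_atMost)
  moreover have "?a * (of_nat m * ?a ^ (m - 1) * c) + c * ?a ^ m = of_nat (Suc m) * ?a ^ m * c"
    by (cases m) (simp_all add: algebra_simps)
  ultimately show ?case using Suc by (simp add: algebra_simps)
qed

text \<open>As in Hensel's lemma: start from a root \<open>a\<close> of the constant term and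
  correct one coefficient at a time. Each correction solves a linear equation whose leading factor
  \<open>p a^(p - 1)\<close> is nonzero.\<close>

lemma fps_has_root:
  fixes f :: "'k::alg_closed_field fps"
  assumes p: "of_nat p \<noteq> (0::'k)" and f: "fps_nth f 0 \<noteq> 0"
  shows "\<exists>g. g ^ p = f"
proof -
  have p0: "p > 0" using p by (cases p) auto
  obtain a where a: "a ^ p = fps_nth f 0" using nth_root_exists[OF p0] by blast
  have a0: "a \<noteq> 0" using a f p0 by (auto simp: power_0_left)
  have pert: "fps_nth (g + fps_const c * fps_X ^ n) i = fps_nth g i + (if i = n then c else 0)"
    for g :: "'k fps" and c n i by simp
  have step: "\<exists>c. fps_nth ((g + fps_const c * fps_X ^ n) ^ p) n = fps_nth f n"
    if g: "fps_nth g 0 = a" and n: "n > 0" for g n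
  proof -
    let ?c = "(fps_nth f n - fps_nth (g ^ p) n) / (of_nat p * a ^ (p - 1))"
    have "of_nat p * a ^ (p - 1) \<noteq> 0" using p a0 by simp
    then have "of_nat p * fps_nth g 0 ^ (p - 1) * ?c = fps_nth f n - fps_nth (g ^ p) n" by (simp add: g)
    then have "fps_nth ((g + fps_const ?c * fps_X ^ n) ^ p) n = fps_nth f n"
      unfolding fps_nth_power_perturb[OF n pert] by simp
    then show ?thesis by blast
  qed
  define nxt where "nxt g n = g + fps_const (SOME c. fps_nth ((g + fps_const c * fps_X ^ n) ^ p) n = fps_nth f n) * fps_X ^ n"
    for g :: "'k fps" and n
  define G where "G = rec_nat (fps_const a) (\<lambda>n g. nxt g (Suc n))"
  have G: "G 0 = fps_const a" "G (Suc n) = nxt (G n) (Suc n)" for n by (simp_all add: G_def)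
  have Gst: "fps_nth (G (Suc n)) i = fps_nth (G n) i" if "i \<le> n" for n i
    using that by (simp only: G(2) nxt_def pert) simp
  have Geq: "fps_nth (G n) i = fps_nth (G i) i" if "i \<le> n" for n i
    using that
  proof (induction n rule: dec_induct)
    case (step m) then show ?case using Gst[of i m] by simp
  qed simp
  have G0: "fps_nth (G n) 0 = a" for n using Geq[of 0 n] by (simp add: G(1))
  have Gp: "fps_nth (G n ^ p) n = fps_nth f n" for n
  proof (cases n)
    case 0 then show ?thesis by (simp add: fps_nth_power_0 G0 a)
  next
    case (Suc m)
    show ?thesis unfolding Suc G(2) nxt_def by (rule someI_ex) (rule step[OF G0], simp)
  qed
  \<comment> \<open>Corrections at later stages leave earlier coefficients alone, so the diagonal is
    the limit of the sequence.\<close>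
  define g where "g = Abs_fps (\<lambda>i. fps_nth (G i) i)"
  have "fps_nth (g ^ p) n = fps_nth f n" for n
  proof -
    have g: "fps_nth g i = fps_nth (G n) i" if "i \<le> n" for i using that by (simp add: g_def Geq[OF that])
    have "\<forall>i\<le>n. fps_nth (g ^ m) i = fps_nth (G n ^ m) i" for m
      by (induction m) (auto simp: fps_mult_nth g)
    then show ?thesis using Gp[of n] by simp
  qed
  then show ?thesis by (intro exI[of _ g] fps_ext)
qed

text \<open>The series is a power of the variable times a power series with nonzero constant term;
  the exponent is a multiple of \<open>p\<close>, and the second factor has a root by
  \<open>fps_has_root\<close>.\<close>

lemma fls_has_root:
  fixes z :: "'k::alg_closed_field fls"
  assumes p: "of_nat p \<noteq> (0::'k)" and z: "z \<noteq> 0" "int p dvd fls_subdegree z"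
  shows "\<exists>w. w ^ p = z \<and> w \<noteq> 0"
proof -
  have p0: "p > 0" using p by (cases p) auto
  let ?f = "fls_base_factor_to_fps z"
  have "fps_nth ?f 0 \<noteq> 0" using z by simp
  then obtain g where g: "g ^ p = ?f" using fps_has_root[OF p] by blast
  obtain k where k: "fls_subdegree z = int p * k" using z(2) by blast
  let ?w = "fps_to_fls g * fls_X_intpow k"
  have "?w ^ p = fps_to_fls ?f * fls_X_intpow (int p * k)"
    by (simp add: power_mult_distrib fps_to_fls_power[symmetric] g fls_X_intpow_power mult.commute)
  also have "\<dots> = z" using fls_base_factor_X_power_decompose(1)[of z] by (simp only: fps_to_fls_base_factor_to_fps k)
  finally have "?w ^ p = z" .
  then show ?thesis using z(1) p0 by (intro exI[of _ ?w]) (auto simp: power_0_left)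
qed

section \<open>The completed local rings of a curve\<close>

text \<open>Chains can be truncated, so their lengths form an initial segment. Uniqueness identifies
  the dimension hidden in \<open>nonsingular_at\<close> with 1.\<close>

lemma has_dim_unique: assumes "has_dim n C d" "has_dim n C e" shows "d = e"
proof -
  have mono: "irreducible_chain n C j" if "irreducible_chain n C i" "j \<le> i" for i j
  proof -
    obtain Z :: "nat \<Rightarrow> 'a ppoint set" where Z: "\<forall>l\<le>i. zariski_closed n (Z l) \<and> irreducible_set n (Z l) \<and> Z l \<subseteq> C"
      "\<forall>l<i. Z l \<subset> Z (Suc l)" using \<open>irreducible_chain n C i\<close> unfolding irreducible_chain_def by blast
    have "\<forall>l\<le>j. zariski_closed n (Z l) \<and> irreducible_set n (Z l) \<and> Z l \<subseteq> C" "\<forall>l<j. Z l \<subset> Z (Suc l)"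
      using Z \<open>j \<le> i\<close> by (meson order_trans less_le_trans)+
    then show ?thesis unfolding irreducible_chain_def by blast
  qed
  show ?thesis using assms mono unfolding has_dim_def by (metis Suc_leI nat_neq_iff)
qed

lemma (in curve_point) coefficient_field_ex:
  assumes "cotangent_dim n C x 1"
  shows "\<exists>t. coefficient_field L \<kappa> t"
proof -
  obtain t where t: "t \<in> carrier L" and eq: "mx = PIdl\<^bsub>L\<^esub> t"
    and ns: "\<forall>k. \<forall>s\<in>carrier L. t [^]\<^bsub>L\<^esub> (k::nat) \<noteq> t [^]\<^bsub>L\<^esub> Suc k \<otimes>\<^bsub>L\<^esub> s"
    using uniformizer_exists[OF assms] by blast
  have t0: "value t = 0"
  proof -
    have "t = \<one>\<^bsub>L\<^esub> \<otimes>\<^bsub>L\<^esub> t" using t by simp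
    then have "t \<in> PIdl\<^bsub>L\<^esub> t" unfolding cgenideal_def using L.one_closed by blast
    then have "t \<in> mx" using eq by simp
    then show ?thesis unfolding nonunits_L by simp
  qed
  have "coefficient_field L \<kappa> t"
  proof (unfold_locales)
    show "\<kappa> a \<in> carrier L" for a by (rule \<kappa>_closed)
    show "\<kappa> 1 = \<one>\<^bsub>L\<^esub>" by (rule \<kappa>_one)
    show "\<kappa> (a + b) = \<kappa> a \<oplus>\<^bsub>L\<^esub> \<kappa> b" for a b by (rule \<kappa>_add)
    show "\<kappa> (a * b) = \<kappa> a \<otimes>\<^bsub>L\<^esub> \<kappa> b" for a b by (rule \<kappa>_mult)
    show "t \<in> carrier L" by (rule t)
    show "\<exists>a. \<exists>s\<in>carrier L. r = \<kappa> a \<oplus>\<^bsub>L\<^esub> t \<otimes>\<^bsub>L\<^esub> s" if r: "r \<in> carrier L" for r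
    proof -
      have "value (r \<ominus>\<^bsub>L\<^esub> \<kappa> (value r)) = 0" using r by (simp add: value_diff value_\<kappa>)
      then have "r \<ominus>\<^bsub>L\<^esub> \<kappa> (value r) \<in> PIdl\<^bsub>L\<^esub> t" using r unfolding eq[symmetric] nonunits_L by simp
      then obtain s where s: "s \<in> carrier L" "r \<ominus>\<^bsub>L\<^esub> \<kappa> (value r) = s \<otimes>\<^bsub>L\<^esub> t" unfolding cgenideal_def by blast
      have "r = \<kappa> (value r) \<oplus>\<^bsub>L\<^esub> (r \<ominus>\<^bsub>L\<^esub> \<kappa> (value r))"
        using r by (simp add: a_minus_def L.a_lcomm[of _ r] L.r_neg)
      also have "\<dots> = \<kappa> (value r) \<oplus>\<^bsub>L\<^esub> t \<otimes>\<^bsub>L\<^esub> s" unfolding s(2) using s(1) t by (simp add: L.m_comm)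
      finally show ?thesis using s(1) by blast
    qed
    show "\<kappa> a \<oplus>\<^bsub>L\<^esub> t \<otimes>\<^bsub>L\<^esub> s \<in> Units L" if "a \<noteq> 0" "s \<in> carrier L" for a s
      using that t t0 by (simp add: unit_iff value_add value_mult value_\<kappa>)
    show "t [^]\<^bsub>L\<^esub> k \<noteq> t [^]\<^bsub>L\<^esub> Suc k \<otimes>\<^bsub>L\<^esub> s" if "s \<in> carrier L" for s and k :: nat
      using ns that by blast
  qed
  then show ?thesis by blast
qed

lemma smooth_curve_power_series:
  assumes "smooth_projective_curve n C" "x \<in> C"
  shows "\<exists>\<theta>. power_series_ring (A_at n C x) \<theta> \<and> (\<forall>a. \<theta> (fps_const a) =
    (\<lambda>i. ideal_power (local_ring n C x) (nonunits (local_ring n C x)) i +>\<^bsub>local_ring n C x\<^esub> const_germ n C x a))"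
proof -
  have "C \<subseteq> proj_space n" using assms(1) unfolding smooth_projective_curve_def zariski_closed_def by auto
  then interpret curve_point n C x by unfold_locales (use assms(2) in auto)
  have "cotangent_dim n C x 1"
    using assms has_dim_unique unfolding smooth_projective_curve_def nonsingular_at_def by metis
  then obtain t where "coefficient_field L \<kappa> t" using coefficient_field_ex by blast
  then interpret cf: coefficient_field L \<kappa> t .
  have "power_series_ring (A_at n C x) cf.\<theta>"
    unfolding A_at_def by unfold_locales (rule cf.\<theta>_bij cf.\<theta>_mult cf.\<theta>_add cf.\<theta>_one cf.\<theta>_zero)+
  then show ?thesis using cf.\<theta>_const by blast
qed

section \<open>Rings of adeles\<close>

text \<open>The two rings of adeles differ only in the sets of places at which an element may fail to be
  integral: the finite sets for the full ring, the subsets of \<open>S\<close> for the ring attached to \<open>S\<close>.\<close>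

locale adeles =
  fixes n :: nat and C :: "'k::field ppoint set" and \<theta> :: "'k ppoint \<Rightarrow> 'k fps \<Rightarrow> 'k local_elt"
    and \<F> :: "'k ppoint set set"
  assumes power_series: "x \<in> C \<Longrightarrow> power_series_ring (A_at n C x) (\<theta> x)"
    and \<theta>_const: "x \<in> C \<Longrightarrow> \<theta> x (fps_const a) =
      (\<lambda>i. ideal_power (local_ring n C x) (nonunits (local_ring n C x)) i +>\<^bsub>local_ring n C x\<^esub> const_germ n C x a)"
    and C_nonempty: "C \<noteq> {}"
    and \<F>_empty: "{} \<in> \<F>" and \<F>_subset: "\<lbrakk>D \<in> \<F>; E \<subseteq> D\<rbrakk> \<Longrightarrow> E \<in> \<F>"
    and \<F>_union: "\<lbrakk>D \<in> \<F>; E \<in> \<F>\<rbrakk> \<Longrightarrow> D \<union> E \<in> \<F>"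
begin

definition "\<Phi> z = (\<lambda>x\<in>C. power_series_ring.\<Lambda> (\<theta> x) (z x))"

definition bad :: "('k ppoint \<Rightarrow> 'k fls) \<Rightarrow> 'k ppoint set" where
  "bad z = {x \<in> C. fls_subdegree (z x) < 0}"

definition "B = (prod_ring C (K_at n C))
  \<lparr>carrier := {\<alpha> \<in> carrier (prod_ring C (K_at n C)). {x \<in> C. \<alpha> x \<notin> integers_at n C x} \<in> \<F>}\<rparr>"

lemma \<Phi>_eq: "\<Phi> z = \<Phi> w \<longleftrightarrow> (\<forall>x\<in>C. z x = w x)"
proof
  assume e: "\<Phi> z = \<Phi> w"
  show "\<forall>x\<in>C. z x = w x"
  proof
    fix x assume x: "x \<in> C"
    interpret power_series_ring "A_at n C x" "\<theta> x" using x by (rule power_series)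
    show "z x = w x" using fun_cong[OF e, of x] x by (simp add: \<Phi>_def)
  qed
qed (auto simp: \<Phi>_def intro!: restrict_ext)

lemma integral_\<Phi>: "x \<in> C \<Longrightarrow> \<Phi> z x \<in> integers_at n C x \<longleftrightarrow> 0 \<le> fls_subdegree (z x)"
proof -
  assume x: "x \<in> C"
  interpret power_series_ring "A_at n C x" "\<theta> x" using x by (rule power_series)
  show ?thesis using integers_\<Lambda>[of "z x"] x by (simp add: \<Phi>_def integers_at_def)
qed

lemma val_\<Phi>: "x \<in> C \<Longrightarrow> z x \<noteq> 0 \<Longrightarrow> val_at n C x (\<Phi> z x) = fls_subdegree (z x)"
proof -
  assume x: "x \<in> C" and z: "z x \<noteq> 0"
  interpret power_series_ring "A_at n C x" "\<theta> x" using x by (rule power_series)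
  show ?thesis using frac_val_\<Lambda>[OF z] x by (simp add: \<Phi>_def val_at_def)
qed

lemma carrier_prod: "carrier (prod_ring C (K_at n C)) = range \<Phi>"
proof (intro equalityI subsetI)
  fix \<alpha> assume a: "\<alpha> \<in> carrier (prod_ring C (K_at n C))"
  have "\<exists>z. \<alpha> x = power_series_ring.\<Lambda> (\<theta> x) z" if x: "x \<in> C" for x
  proof -
    interpret power_series_ring "A_at n C x" "\<theta> x" using x by (rule power_series)
    have "\<alpha> x \<in> carrier (K_at n C x)" using a x by (auto simp: prod_ring_def)
    then show ?thesis unfolding K_at_def carrier_frac_field by blast
  qed
  then obtain z where z: "\<And>x. x \<in> C \<Longrightarrow> \<alpha> x = power_series_ring.\<Lambda> (\<theta> x) (z x)" by metis
  have "\<alpha> = \<Phi> z"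
  proof
    fix x show "\<alpha> x = \<Phi> z x" using z a by (cases "x \<in> C") (auto simp: \<Phi>_def prod_ring_def PiE_def extensional_def)
  qed
  then show "\<alpha> \<in> range \<Phi>" by blast
next
  fix \<alpha> assume "\<alpha> \<in> range \<Phi>"
  then obtain z where z: "\<alpha> = \<Phi> z" by blast
  have "power_series_ring.\<Lambda> (\<theta> x) (z x) \<in> carrier (K_at n C x)" if x: "x \<in> C" for x
  proof -
    interpret power_series_ring "A_at n C x" "\<theta> x" using x by (rule power_series)
    show ?thesis unfolding K_at_def by simp
  qed
  then show "\<alpha> \<in> carrier (prod_ring C (K_at n C))" by (simp add: z \<Phi>_def prod_ring_def)
qed

lemma bad_\<Phi>: "{x \<in> C. \<Phi> z x \<notin> integers_at n C x} = bad z"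
  using integral_\<Phi>[of _ z] by (auto simp: bad_def)

lemma carrier_B: "carrier B = \<Phi> ` {z. bad z \<in> \<F>}"
  unfolding B_def carrier_prod using bad_\<Phi> by auto

lemma \<Phi>_closed: "\<Phi> z \<in> carrier B \<longleftrightarrow> bad z \<in> \<F>"
  unfolding B_def carrier_prod by (simp add: bad_\<Phi>)

lemma \<Phi>_mult: "\<Phi> z \<otimes>\<^bsub>B\<^esub> \<Phi> w = \<Phi> (\<lambda>x. z x * w x)"
proof -
  have "power_series_ring.\<Lambda> (\<theta> x) (z x) \<otimes>\<^bsub>K_at n C x\<^esub> power_series_ring.\<Lambda> (\<theta> x) (w x) =
      power_series_ring.\<Lambda> (\<theta> x) (z x * w x)" if x: "x \<in> C" for x
  proof -
    interpret power_series_ring "A_at n C x" "\<theta> x" using x by (rule power_series)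
    show ?thesis unfolding K_at_def by (rule \<Lambda>_mult[symmetric])
  qed
  then show ?thesis by (auto simp: B_def prod_ring_def \<Phi>_def intro!: restrict_ext)
qed

lemma \<Phi>_add: "\<Phi> z \<oplus>\<^bsub>B\<^esub> \<Phi> w = \<Phi> (\<lambda>x. z x + w x)"
proof -
  have "power_series_ring.\<Lambda> (\<theta> x) (z x) \<oplus>\<^bsub>K_at n C x\<^esub> power_series_ring.\<Lambda> (\<theta> x) (w x) =
      power_series_ring.\<Lambda> (\<theta> x) (z x + w x)" if x: "x \<in> C" for x
  proof -
    interpret power_series_ring "A_at n C x" "\<theta> x" using x by (rule power_series)
    show ?thesis unfolding K_at_def by (rule \<Lambda>_add[symmetric])
  qed
  then show ?thesis by (auto simp: B_def prod_ring_def \<Phi>_def intro!: restrict_ext)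
qed

lemma \<Phi>_one: "\<one>\<^bsub>B\<^esub> = \<Phi> (\<lambda>x. 1)"
proof -
  have "\<one>\<^bsub>K_at n C x\<^esub> = power_series_ring.\<Lambda> (\<theta> x) 1" if x: "x \<in> C" for x
  proof -
    interpret power_series_ring "A_at n C x" "\<theta> x" using x by (rule power_series)
    show ?thesis unfolding K_at_def by (rule \<Lambda>_one[symmetric])
  qed
  then show ?thesis by (auto simp: B_def prod_ring_def \<Phi>_def intro!: restrict_ext)
qed

lemma \<Phi>_zero: "\<zero>\<^bsub>B\<^esub> = \<Phi> (\<lambda>x. 0)"
proof -
  have "\<zero>\<^bsub>K_at n C x\<^esub> = power_series_ring.\<Lambda> (\<theta> x) 0" if x: "x \<in> C" for x
  proof -
    interpret power_series_ring "A_at n C x" "\<theta> x" using x by (rule power_series)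
    show ?thesis unfolding K_at_def by (rule \<Lambda>_zero[symmetric])
  qed
  then show ?thesis by (auto simp: B_def prod_ring_def \<Phi>_def intro!: restrict_ext)
qed

lemma adele_const_\<Phi>: "adele_const n C a = \<Phi> (\<lambda>x. fls_const a)"
proof -
  have "fraction (A_at n C x) (\<lambda>i. ideal_power (local_ring n C x) (nonunits (local_ring n C x)) i
       +>\<^bsub>local_ring n C x\<^esub> const_germ n C x a) \<one>\<^bsub>A_at n C x\<^esub> = power_series_ring.\<Lambda> (\<theta> x) (fls_const a)"
    if x: "x \<in> C" for x
  proof -
    interpret power_series_ring "A_at n C x" "\<theta> x" using x by (rule power_series)
    show ?thesis unfolding \<theta>_const[OF x, symmetric] using fraction_\<theta>_one[of "fps_const a"] by simp
  qed
  then show ?thesis by (auto simp: adele_const_def \<Phi>_def Let_def intro!: restrict_ext)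
qed

lemma bad_const: "(\<And>x. x \<in> C \<Longrightarrow> fls_subdegree (z x) = 0) \<Longrightarrow> bad z \<in> \<F>"
  using \<F>_empty by (simp add: bad_def cong: conj_cong)

lemma bad_mult: assumes "bad z \<in> \<F>" "bad w \<in> \<F>" shows "bad (\<lambda>x. z x * w x) \<in> \<F>"
proof -
  have "0 \<le> fls_subdegree (z x * w x)" if "0 \<le> fls_subdegree (z x)" "0 \<le> fls_subdegree (w x)" for x
    using that by (cases "z x = 0 \<or> w x = 0") auto
  then have "bad (\<lambda>x. z x * w x) \<subseteq> bad z \<union> bad w" unfolding bad_def by (auto simp: not_le[symmetric])
  then show ?thesis using \<F>_subset \<F>_union assms by blast
qed

lemma bad_add: assumes "bad z \<in> \<F>" "bad w \<in> \<F>" shows "bad (\<lambda>x. z x + w x) \<in> \<F>"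
proof -
  have "0 \<le> fls_subdegree (z x + w x)" if "0 \<le> fls_subdegree (z x)" "0 \<le> fls_subdegree (w x)" for x
  proof (cases "z x + w x = 0")
    case False then show ?thesis using fls_plus_subdegree[of "z x" "w x"] that by linarith
  qed simp
  then have "bad (\<lambda>x. z x + w x) \<subseteq> bad z \<union> bad w" unfolding bad_def by (auto simp: not_le[symmetric])
  then show ?thesis using \<F>_subset \<F>_union assms by blast
qed

lemma bad_0_1: "bad (\<lambda>x. 0) \<in> \<F>" "bad (\<lambda>x. 1) \<in> \<F>"
  by (rule bad_const, simp)+

lemma cring_B: "cring B"
proof (rule cringI)
  show "abelian_group B"
  proof (rule abelian_groupI)
    fix \<alpha> assume "\<alpha> \<in> carrier B"
    then obtain z where z: "\<alpha> = \<Phi> z" "bad z \<in> \<F>" unfolding carrier_B by blast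
    have "bad (\<lambda>x. - z x) \<in> \<F>" using z(2) by (simp add: bad_def)
    then show "\<exists>\<beta>\<in>carrier B. \<beta> \<oplus>\<^bsub>B\<^esub> \<alpha> = \<zero>\<^bsub>B\<^esub>"
      by (intro bexI[of _ "\<Phi> (\<lambda>x. - z x)"]) (simp_all add: z(1) \<Phi>_add \<Phi>_zero \<Phi>_closed)
  qed (auto simp: carrier_B \<Phi>_add \<Phi>_zero \<Phi>_eq add_ac bad_0_1 intro!: imageI bad_add)
  show "comm_monoid B"
    by (rule comm_monoidI) (auto simp: carrier_B \<Phi>_mult \<Phi>_one \<Phi>_eq mult_ac bad_0_1 intro!: imageI bad_mult)
  show "(\<alpha> \<oplus>\<^bsub>B\<^esub> \<beta>) \<otimes>\<^bsub>B\<^esub> \<gamma> = \<alpha> \<otimes>\<^bsub>B\<^esub> \<gamma> \<oplus>\<^bsub>B\<^esub> \<beta> \<otimes>\<^bsub>B\<^esub> \<gamma>"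
    if "\<alpha> \<in> carrier B" "\<beta> \<in> carrier B" "\<gamma> \<in> carrier B" for \<alpha> \<beta> \<gamma>
    using that by (auto simp: carrier_B \<Phi>_mult \<Phi>_add \<Phi>_eq distrib_right)
qed

sublocale B: cring B by (rule cring_B)

lemma B_nontrivial: "\<one>\<^bsub>B\<^esub> \<noteq> \<zero>\<^bsub>B\<^esub>"
  using C_nonempty by (auto simp: \<Phi>_one \<Phi>_zero \<Phi>_eq)

lemma adele_const_hom:
  "adele_const n C a \<in> carrier B" "adele_const n C 1 = \<one>\<^bsub>B\<^esub>"
  "adele_const n C (a + b) = adele_const n C a \<oplus>\<^bsub>B\<^esub> adele_const n C b"
  "adele_const n C (a * b) = adele_const n C a \<otimes>\<^bsub>B\<^esub> adele_const n C b"
  by (auto simp: adele_const_\<Phi> \<Phi>_closed \<Phi>_one \<Phi>_add \<Phi>_mult \<Phi>_eq fls_plus_const intro!: bad_const)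

lemma \<Phi>_pow: "\<Phi> z [^]\<^bsub>B\<^esub> (m::nat) = \<Phi> (\<lambda>x. z x ^ m)"
  by (induction m) (auto simp: \<Phi>_one \<Phi>_mult \<Phi>_eq mult.commute)

text \<open>A Laurent series and its inverse have opposite orders, so both are integral exactly
  where the order is 0.\<close>

lemma \<Phi>_Units: "\<Phi> z \<in> Units B \<longleftrightarrow> (\<forall>x\<in>C. z x \<noteq> 0) \<and> {x \<in> C. fls_subdegree (z x) \<noteq> 0} \<in> \<F>"
proof
  assume u: "\<Phi> z \<in> Units B"
  then obtain w where w: "inv\<^bsub>B\<^esub> \<Phi> z = \<Phi> w" "bad w \<in> \<F>"
    using B.Units_inv_closed[OF u] unfolding carrier_B by blast
  have "\<Phi> z \<otimes>\<^bsub>B\<^esub> \<Phi> w = \<one>\<^bsub>B\<^esub>" using u w(1) by (metis B.Units_r_inv)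
  then have one: "z x * w x = 1" if "x \<in> C" for x using that by (simp add: \<Phi>_mult \<Phi>_one \<Phi>_eq)
  then have nz: "z x \<noteq> 0" "w x \<noteq> 0" if "x \<in> C" for x using that by fastforce+
  have "fls_subdegree (z x) + fls_subdegree (w x) = 0" if "x \<in> C" for x
    using fls_subdegree_mult[OF nz[OF that]] one[OF that] by simp
  then have "{x \<in> C. fls_subdegree (z x) \<noteq> 0} \<subseteq> bad z \<union> bad w" unfolding bad_def by fastforce
  moreover have "bad z \<in> \<F>" using B.Units_closed[OF u] by (simp add: \<Phi>_closed)
  ultimately show "(\<forall>x\<in>C. z x \<noteq> 0) \<and> {x \<in> C. fls_subdegree (z x) \<noteq> 0} \<in> \<F>"
    using nz w(2) \<F>_subset \<F>_union by blast
next
  assume z: "(\<forall>x\<in>C. z x \<noteq> 0) \<and> {x \<in> C. fls_subdegree (z x) \<noteq> 0} \<in> \<F>"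
  have i: "fls_subdegree (inverse (z x)) = - fls_subdegree (z x)" if x: "x \<in> C" for x
  proof -
    have "z x * inverse (z x) = 1" using z x by simp
    then have "fls_subdegree (z x * inverse (z x)) = 0" by simp
    then show ?thesis using z x by (subst (asm) fls_subdegree_mult) auto
  qed
  have "bad z \<subseteq> {x \<in> C. fls_subdegree (z x) \<noteq> 0}" by (auto simp: bad_def)
  moreover have "bad (\<lambda>x. inverse (z x)) \<subseteq> {x \<in> C. fls_subdegree (z x) \<noteq> 0}" using i by (auto simp: bad_def)
  ultimately have c: "\<Phi> z \<in> carrier B" "\<Phi> (\<lambda>x. inverse (z x)) \<in> carrier B"
    using z \<F>_subset by (auto simp: \<Phi>_closed)
  have "\<Phi> (\<lambda>x. inverse (z x)) \<otimes>\<^bsub>B\<^esub> \<Phi> z = \<one>\<^bsub>B\<^esub>" using z by (simp add: \<Phi>_mult \<Phi>_one \<Phi>_eq)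
  then show "\<Phi> z \<in> Units B" using c B.m_comm[OF c] unfolding Units_def by auto
qed

lemma Units_B: assumes "\<alpha> \<in> Units B"
  obtains z where "\<alpha> = \<Phi> z" "\<forall>x\<in>C. z x \<noteq> 0" "{x \<in> C. fls_subdegree (z x) \<noteq> 0} \<in> \<F>"
proof -
  obtain z where "\<alpha> = \<Phi> z" using B.Units_closed[OF assms] unfolding carrier_B by blast
  then show ?thesis using assms \<Phi>_Units that by blast
qed

lemma \<Phi>_finsum: "(\<And>i. i < m \<Longrightarrow> bad (z i) \<in> \<F>) \<Longrightarrow>
    finsum B (\<lambda>i. \<Phi> (z i)) {..<m::nat} = \<Phi> (\<lambda>x. \<Sum>i<m. z i x) \<and> bad (\<lambda>x. \<Sum>i<m. z i x) \<in> \<F>"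
proof (induction m)
  case 0 then show ?case by (simp add: \<Phi>_zero bad_const)
next
  case (Suc m)
  then have IH: "finsum B (\<lambda>i. \<Phi> (z i)) {..<m} = \<Phi> (\<lambda>x. \<Sum>i<m. z i x)" "bad (\<lambda>x. \<Sum>i<m. z i x) \<in> \<F>" by auto
  have "finsum B (\<lambda>i. \<Phi> (z i)) {..<Suc m} = \<Phi> (z m) \<oplus>\<^bsub>B\<^esub> finsum B (\<lambda>i. \<Phi> (z i)) {..<m}"
    unfolding lessThan_Suc using Suc.prems by (intro B.finsum_insert) (auto simp: \<Phi>_closed)
  then show ?case using IH Suc.prems[of m] bad_add[of "\<lambda>x. \<Sum>i<m. z i x" "z m"]
    by (simp add: \<Phi>_add add.commute)
qed

text \<open>At each place one picks a summand that is nonzero, and an integral unit if all summands are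
  integral there.\<close>

lemma partition_of_unity_B:
  assumes a: "a \<in> {..<m::nat} \<rightarrow> carrier B" and one: "finsum B a {..<m} = \<one>\<^bsub>B\<^esub>"
  shows "\<exists>e d. e \<in> {..<m} \<rightarrow> carrier B \<and> d \<in> {..<m} \<rightarrow> carrier B \<and> finsum B e {..<m} = \<one>\<^bsub>B\<^esub> \<and>
    (\<forall>i<m. a i \<otimes>\<^bsub>B\<^esub> d i = e i \<and> e i \<otimes>\<^bsub>B\<^esub> e i = e i) \<and> (\<forall>i<m. \<forall>j<m. i \<noteq> j \<longrightarrow> e i \<otimes>\<^bsub>B\<^esub> e j = \<zero>\<^bsub>B\<^esub>)"
proof -
  have "\<exists>z. a i = \<Phi> z \<and> bad z \<in> \<F>" if "i < m" for i using a that unfolding carrier_B by blast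
  then obtain z where z: "\<And>i. i < m \<Longrightarrow> a i = \<Phi> (z i)" "\<And>i. i < m \<Longrightarrow> bad (z i) \<in> \<F>" by metis
  have "finsum B a {..<m} = finsum B (\<lambda>i. \<Phi> (z i)) {..<m}"
    by (rule B.finsum_cong') (auto simp: z \<Phi>_closed)
  then have sum1: "(\<Sum>i<m. z i x) = 1" if "x \<in> C" for x
    using \<Phi>_finsum[of m z] z(2) one that by (simp add: \<Phi>_one \<Phi>_eq)
  have ex: "\<exists>k<m. z k x \<noteq> 0 \<and> ((\<forall>i<m. 0 \<le> fls_subdegree (z i x)) \<longrightarrow> fls_subdegree (z k x) = 0)" if x: "x \<in> C" for x
  proof (cases "\<forall>i<m. 0 \<le> fls_subdegree (z i x)")
    case True
    \<comment> \<open>If all summands are integral, their constant coefficients add up to 1; one of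
      these is nonzero, and that summand has order 0.\<close>
    have nth: "fls_nth (\<Sum>i\<in>I. z i x) 0 = (\<Sum>i\<in>I. fls_nth (z i x) 0)" if "finite I" for I
      using that by (induction I rule: finite_induct) auto
    have "(\<Sum>i<m. fls_nth (z i x) 0) = 1" using nth[of "{..<m}"] sum1[OF x] by simp
    moreover have "(\<Sum>i<m. fls_nth (z i x) 0) = 0" if "\<And>k. k < m \<Longrightarrow> fls_nth (z k x) 0 = 0"
      using that by (intro sum.neutral) simp
    ultimately obtain k where k: "k < m" "fls_nth (z k x) 0 \<noteq> 0" using zero_neq_one[where 'a = 'k] by metis
    then have "fls_subdegree (z k x) \<le> 0" by (intro fls_subdegree_leI)
    then show ?thesis using k True by (intro exI[of _ k]) force
  next
    case False
    have "(\<Sum>i<m. z i x) = 0" if "\<And>k. k < m \<Longrightarrow> z k x = 0" using that by (intro sum.neutral) simp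
    then have "\<exists>k<m. z k x \<noteq> 0" using sum1[OF x] zero_neq_one[where 'a = "'k fls"] by metis
    then show ?thesis using False by blast
  qed
  have "\<forall>x\<in>C. \<exists>k. k < m \<and> z k x \<noteq> 0 \<and> ((\<forall>i<m. 0 \<le> fls_subdegree (z i x)) \<longrightarrow> fls_subdegree (z k x) = 0)"
    using ex by blast
  from bchoice[OF this] obtain K where K': "\<forall>x\<in>C. K x < m \<and> z (K x) x \<noteq> 0 \<and>
    ((\<forall>i<m. 0 \<le> fls_subdegree (z i x)) \<longrightarrow> fls_subdegree (z (K x) x) = 0)" by blast
  have K: "K x < m" "z (K x) x \<noteq> 0"
    "\<forall>i<m. 0 \<le> fls_subdegree (z i x) \<Longrightarrow> fls_subdegree (z (K x) x) = 0" if "x \<in> C" for x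
    using bspec[OF K' that] by blast+
  define e where "e i = \<Phi> (\<lambda>x. if i = K x then 1 else 0)" for i
  define d where "d i = \<Phi> (\<lambda>x. if i = K x then inverse (z i x) else 0)" for i
  have be: "bad (\<lambda>x. if i = K x then 1 else 0) \<in> \<F>" for i by (rule bad_const) simp
  have bU: "(\<Union>i<l. bad (z i)) \<in> \<F>" if "l \<le> m" for l
    using that by (induction l) (auto simp: \<F>_empty lessThan_Suc intro!: \<F>_union z(2))
  \<comment> \<open>Where all summands are integral the chosen one has order 0, so its inverse is
    integral too. Poles of the inverse occur only at poles of the summands, a finite union of
    admissible sets.\<close>
  have bd: "bad (\<lambda>x. if i = K x then inverse (z i x) else 0) \<in> \<F>" for i
  proof (rule \<F>_subset[OF bU[OF order_refl]], rule subsetI)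
    fix x assume "x \<in> bad (\<lambda>x. if i = K x then inverse (z i x) else 0)"
    then have x: "x \<in> C" "i = K x" "fls_subdegree (inverse (z i x)) < 0" unfolding bad_def by (auto split: if_splits)
    have "z i x * inverse (z i x) = 1" using K(2) x by simp
    then have "fls_subdegree (z i x * inverse (z i x)) = 0" by simp
    then have "fls_subdegree (z i x) \<noteq> 0" using K(2) x by (subst (asm) fls_subdegree_mult) auto
    then have "\<not> (\<forall>i<m. 0 \<le> fls_subdegree (z i x))" using K(3) x by blast
    then obtain l where "l < m" "fls_subdegree (z l x) < 0" by (meson not_le)
    then have "l \<in> {..<m}" "x \<in> bad (z l)" using x(1) by (simp_all add: bad_def)
    then show "x \<in> (\<Union>i<m. bad (z i))" by blast
  qed
  have "finsum B e {..<m} = \<one>\<^bsub>B\<^esub>"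
  proof -
    have "finsum B e {..<m} = \<Phi> (\<lambda>x. \<Sum>i<m. if i = K x then 1 else 0)"
      unfolding e_def using \<Phi>_finsum[of m "\<lambda>i x. if i = K x then 1 else 0"] be by blast
    also have "\<dots> = \<one>\<^bsub>B\<^esub>" by (simp add: \<Phi>_one \<Phi>_eq K)
    finally show ?thesis .
  qed
  moreover have "a i \<otimes>\<^bsub>B\<^esub> d i = e i" if "i < m" for i
    unfolding z(1)[OF that] d_def e_def \<Phi>_mult \<Phi>_eq using K(2) by auto
  moreover have "e i \<otimes>\<^bsub>B\<^esub> e i = e i" for i unfolding e_def \<Phi>_mult \<Phi>_eq by auto
  moreover have "e i \<otimes>\<^bsub>B\<^esub> e j = \<zero>\<^bsub>B\<^esub>" if "i \<noteq> j" for i j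
    unfolding e_def \<Phi>_mult \<Phi>_zero \<Phi>_eq using that by auto
  moreover have "e i \<in> carrier B" "d i \<in> carrier B" for i unfolding e_def d_def \<Phi>_closed by (rule be bd)+
  ultimately show ?thesis by (intro exI[of _ e] exI[of _ d] conjI) auto
qed

end

lemma (in adeles) adele_ring_B: assumes "\<F> = {S. finite S}" shows "adele_ring n C = B"
  unfolding B_def unfolding assms adele_ring_def by simp

lemma (in adeles) adele_ring_at_B: assumes "\<F> = Pow S" shows "adele_ring_at n C S = B"
proof -
  have "{x \<in> C. \<alpha> x \<notin> integers_at n C x} \<in> Pow S \<longleftrightarrow> (\<forall>x\<in>C - S. \<alpha> x \<in> integers_at n C x)" for \<alpha> by auto
  then show ?thesis unfolding B_def unfolding assms adele_ring_at_def by simp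
qed

section \<open>Harrison groups of adele rings\<close>

lemma fls_subdegree_power: "(z :: 'k::field fls) \<noteq> 0 \<Longrightarrow> fls_subdegree (z ^ m) = int m * fls_subdegree z"
  by (induction m) (simp_all add: algebra_simps)

locale adele_kummer = adeles n C \<theta> \<F> + prime_character G p \<chi>
  for n and C :: "'k::alg_closed_field ppoint set" and \<theta> \<F> and G :: "'g monoid" and p and \<chi> :: "'g \<Rightarrow> 'k"
begin

sublocale KR: kummer_ring G p \<chi> B "adele_const n C"
  by (intro kummer_ring.intro kummer_base.intro kummer_base_axioms.intro kummer_ring_axioms.intro
      prime_character_axioms cring_B B_nontrivial adele_const_hom partition_of_unity_B)

text \<open>At each point a root exists as soon as the order is divisible by \<open>p\<close>. The
  local roots form a unit of the adele ring because the root has order 0 wherever \<open>z\<close>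
  and \<open>w\<close> both do.\<close>

lemma power_iff:
  assumes z: "\<Phi> z \<in> Units B" and w: "\<Phi> w \<in> Units B"
  shows "(\<exists>r\<in>Units B. \<Phi> z = r [^]\<^bsub>B\<^esub> p \<otimes>\<^bsub>B\<^esub> \<Phi> w) \<longleftrightarrow>
    (\<forall>x\<in>C. int p dvd fls_subdegree (z x) - fls_subdegree (w x))"
proof
  assume "\<exists>r\<in>Units B. \<Phi> z = r [^]\<^bsub>B\<^esub> p \<otimes>\<^bsub>B\<^esub> \<Phi> w"
  then obtain r where r: "r \<in> Units B" "\<Phi> z = r [^]\<^bsub>B\<^esub> p \<otimes>\<^bsub>B\<^esub> \<Phi> w" by blast
  obtain y where y: "r = \<Phi> y" "\<forall>x\<in>C. y x \<noteq> 0" using r(1) by (rule Units_B)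
  show "\<forall>x\<in>C. int p dvd fls_subdegree (z x) - fls_subdegree (w x)"
  proof
    fix x assume x: "x \<in> C"
    have "w x \<noteq> 0" using w x by (simp add: \<Phi>_Units)
    moreover have "z x = y x ^ p * w x" using r(2) x unfolding y(1) \<Phi>_pow \<Phi>_mult \<Phi>_eq by blast
    ultimately show "int p dvd fls_subdegree (z x) - fls_subdegree (w x)"
      using y(2) x by (simp add: fls_subdegree_power)
  qed
next
  assume d: "\<forall>x\<in>C. int p dvd fls_subdegree (z x) - fls_subdegree (w x)"
  have "\<exists>v. v ^ p * w x = z x \<and> v \<noteq> 0 \<and> int p * fls_subdegree v = fls_subdegree (z x) - fls_subdegree (w x)"
    if x: "x \<in> C" for x
  proof -
    have nz: "z x \<noteq> 0" "w x \<noteq> 0" using z w x by (simp_all add: \<Phi>_Units)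
    have "fls_subdegree (z x / w x) + fls_subdegree (w x) = fls_subdegree (z x)"
      using nz fls_subdegree_mult[of "z x / w x" "w x"] by simp
    then have s: "fls_subdegree (z x / w x) = fls_subdegree (z x) - fls_subdegree (w x)" by simp
    then obtain v where v: "v ^ p = z x / w x" "v \<noteq> 0"
      using fls_has_root[OF of_nat_p, of "z x / w x"] nz bspec[OF d x] by auto
    have "v ^ p * w x = z x" using v nz by simp
    moreover have "int p * fls_subdegree v = fls_subdegree (z x) - fls_subdegree (w x)"
      using fls_subdegree_power[OF v(2), of p] v(1) s by simp
    ultimately show ?thesis using v(2) by blast
  qed
  then have "\<forall>x\<in>C. \<exists>v. v ^ p * w x = z x \<and> v \<noteq> 0 \<and> int p * fls_subdegree v = fls_subdegree (z x) - fls_subdegree (w x)"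
    by blast
  from bchoice[OF this] obtain y where y: "\<forall>x\<in>C. y x ^ p * w x = z x \<and> y x \<noteq> 0 \<and>
    int p * fls_subdegree (y x) = fls_subdegree (z x) - fls_subdegree (w x)" by blast
  have "\<Phi> y \<in> Units B"
    unfolding \<Phi>_Units
  proof (intro conjI ballI)
    have "fls_subdegree (y x) = 0" if "x \<in> C" "fls_subdegree (z x) = 0" "fls_subdegree (w x) = 0" for x
      using bspec[OF y that(1)] that p_pos by simp
    then have "{x \<in> C. fls_subdegree (y x) \<noteq> 0} \<subseteq> {x \<in> C. fls_subdegree (z x) \<noteq> 0} \<union> {x \<in> C. fls_subdegree (w x) \<noteq> 0}"
      by blast
    then show "{x \<in> C. fls_subdegree (y x) \<noteq> 0} \<in> \<F>"
      using z w \<F>_subset \<F>_union unfolding \<Phi>_Units by blast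
  qed (use y in blast)
  moreover have "\<Phi> z = \<Phi> y [^]\<^bsub>B\<^esub> p \<otimes>\<^bsub>B\<^esub> \<Phi> w" unfolding \<Phi>_pow \<Phi>_mult \<Phi>_eq using y by simp
  ultimately show "\<exists>r\<in>Units B. \<Phi> z = r [^]\<^bsub>B\<^esub> p \<otimes>\<^bsub>B\<^esub> \<Phi> w" by blast
qed

definition U :: "('k ppoint \<Rightarrow> 'k fls) set" where
  "U = {z. (\<forall>x\<in>C. z x \<noteq> 0) \<and> {x \<in> C. fls_subdegree (z x) \<noteq> 0} \<in> \<F>}"

definition "kcl z = KR.kummer_class (\<Phi> z)"

abbreviation "HG \<equiv> harrison_group p G B (adele_const n C)"

lemma U_iff: "z \<in> U \<longleftrightarrow> \<Phi> z \<in> Units B"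
  by (simp add: U_def \<Phi>_Units)

lemma U_mult: "z \<in> U \<Longrightarrow> w \<in> U \<Longrightarrow> (\<lambda>x. z x * w x) \<in> U"
  unfolding U_iff using B.Units_m_closed[of "\<Phi> z" "\<Phi> w"] by (simp add: \<Phi>_mult)

lemma U_one: "(\<lambda>x. 1) \<in> U"
  unfolding U_iff \<Phi>_one[symmetric] by simp

lemma kcl_eq_iff: "z \<in> U \<Longrightarrow> w \<in> U \<Longrightarrow>
    kcl z = kcl w \<longleftrightarrow> (\<forall>x\<in>C. int p dvd fls_subdegree (z x) - fls_subdegree (w x))"
  unfolding U_iff kcl_def by (simp add: KR.kummer_class_eq_iff power_iff)

lemma carrier_HG: "carrier HG = kcl ` U"
proof -
  have "Units B = \<Phi> ` U"
  proof (intro equalityI subsetI)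
    fix \<alpha> assume a: "\<alpha> \<in> Units B"
    then obtain z where "\<alpha> = \<Phi> z" by (rule Units_B)
    then show "\<alpha> \<in> \<Phi> ` U" using a U_iff by blast
  qed (auto simp: U_iff)
  then show ?thesis unfolding KR.carrier_hgroup kcl_def by (simp add: image_image)
qed

lemma HG_mult: "z \<in> U \<Longrightarrow> w \<in> U \<Longrightarrow> kcl z \<otimes>\<^bsub>HG\<^esub> kcl w = kcl (\<lambda>x. z x * w x)"
  unfolding U_iff kcl_def by (simp add: KR.hgroup_mult \<Phi>_mult)

lemma HG_one: "\<one>\<^bsub>HG\<^esub> = kcl (\<lambda>x. 1)"
  by (simp add: KR.hgroup_one kcl_def \<Phi>_one)

lemma kcl_kummer: "z \<in> U \<Longrightarrow> gext_class B G (kummer_extension p B (adele_const n C) \<chi> (\<Phi> z)) = kcl z"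
  unfolding U_iff kcl_def by (rule KR.gext_class_kummer_extension)

text \<open>An inclusion of adele rings keeps the family of Laurent series, so on classes it keeps
  the representative.\<close>

lemma harrison_map_kcl:
  assumes "adele_kummer n C \<theta> \<F>' G p \<chi>" and sub: "\<F> \<subseteq> \<F>'" and z: "z \<in> U"
  shows "harrison_map G B (adeles.B n C \<F>') (\<lambda>\<alpha>. \<alpha>) (kcl z) = adele_kummer.kcl n C \<theta> \<F>' G p \<chi> z"
proof -
  interpret F': adele_kummer n C \<theta> \<F>' G p \<chi> by (rule assms(1))
  have "(\<lambda>\<alpha>. \<alpha>) \<in> ring_hom B F'.B"
    by (rule ring_hom_memI) (use sub in \<open>auto simp: carrier_B F'.\<Phi>_closed \<Phi>_mult F'.\<Phi>_mult \<Phi>_add F'.\<Phi>_add \<Phi>_one F'.\<Phi>_one\<close>)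
  then show ?thesis
    unfolding kcl_def F'.kcl_def using z unfolding U_iff
    by (intro KR.harrison_map_kummer F'.KR.kummer_ring_axioms) auto
qed

end

section \<open>The ramification filtration and its direct limits\<close>

locale curve_adeles = prime_character G p \<chi>
  for G :: "'g monoid" and p and \<chi> :: "'g \<Rightarrow> 'k::alg_closed_field" +
  fixes n and C :: "'k ppoint set" and \<theta>
  assumes power_series: "x \<in> C \<Longrightarrow> power_series_ring (A_at n C x) (\<theta> x)"
    and \<theta>_const: "x \<in> C \<Longrightarrow> \<theta> x (fps_const a) =
      (\<lambda>i. ideal_power (local_ring n C x) (nonunits (local_ring n C x)) i +>\<^bsub>local_ring n C x\<^esub> const_germ n C x a)"
    and C_nonempty: "C \<noteq> {}"
begin

lemma adele_kummerI:
  assumes "{} \<in> \<F>" "\<And>D E. D \<in> \<F> \<Longrightarrow> E \<subseteq> D \<Longrightarrow> E \<in> \<F>" "\<And>D E. D \<in> \<F> \<Longrightarrow> E \<in> \<F> \<Longrightarrow> D \<union> E \<in> \<F>"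
  shows "adele_kummer n C \<theta> \<F> G p \<chi>"
  by (intro adele_kummer.intro adeles.intro prime_character_axioms) (use assms power_series \<theta>_const C_nonempty in auto)

sublocale A: adele_kummer n C \<theta> "{S. finite S}" G p \<chi>
  by (rule adele_kummerI) (auto dest: finite_subset)

sublocale Q: adele_kummer n C \<theta> "Pow S" G p \<chi> for S
  by (rule adele_kummerI) auto

abbreviation "I \<equiv> {S. finite S \<and> S \<subseteq> C}"
abbreviation "H \<equiv> adele_harrison p G n C"
abbreviation "F \<equiv> ram_within p G \<chi> n C"
abbreviation "HS \<equiv> adele_harrison_at p G n C"
abbreviation "tr \<equiv> (\<lambda>S S'. harrison_map G (adele_ring_at n C S) (adele_ring_at n C S') (\<lambda>\<alpha>. \<alpha>))"
abbreviation "bc \<equiv> (\<lambda>S. harrison_map G (adele_ring_at n C S) (adele_ring n C) (\<lambda>\<alpha>. \<alpha>))"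
abbreviation "HF \<equiv> (\<lambda>S. H\<lparr>carrier := F S\<rparr>)"
abbreviation "incl \<equiv> (\<lambda>(S :: 'k ppoint set) (S' :: 'k ppoint set) (B :: ('k adele, 'g, 'k adele list) gext set). B)"

lemma H_eq: "H = A.HG"
  by (simp add: adele_harrison_def A.adele_ring_B)

lemma HS_eq: "HS S = Q.HG S"
  by (simp add: adele_harrison_at_def Q.adele_ring_at_B)

lemma Q_U_subset: "finite S \<Longrightarrow> Q.U S \<subseteq> A.U"
  unfolding Q.U_def A.U_def by (auto dest: finite_subset)

lemma Q_U_mono: "S \<subseteq> S' \<Longrightarrow> Q.U S \<subseteq> Q.U S'"
  unfolding Q.U_def by auto

lemma tr_kcl: assumes "S \<subseteq> S'" "z \<in> Q.U S" shows "tr S S' (Q.kcl S z) = Q.kcl S' z"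
  using Q.harrison_map_kcl[OF Q.adele_kummer_axioms _ assms(2), of S'] assms(1)
  by (simp add: Q.adele_ring_at_B Pow_mono)

lemma bc_kcl: assumes "finite S" "z \<in> Q.U S" shows "bc S (Q.kcl S z) = A.kcl z"
proof -
  have "Pow S \<subseteq> {S. finite S}" using assms(1) by (auto dest: finite_subset)
  from Q.harrison_map_kcl[OF A.adele_kummer_axioms this assms(2)] show ?thesis
    by (simp add: Q.adele_ring_at_B A.adele_ring_B)
qed

text \<open>The criterion for equal classes compares orders at the points of \<open>C\<close> and is
  the same for both rings; this is the injectivity of the map to the full adele ring.\<close>

lemma kcl_eq_iff': assumes "finite S" "z \<in> Q.U S" "w \<in> Q.U S"
  shows "Q.kcl S z = Q.kcl S w \<longleftrightarrow> A.kcl z = A.kcl w"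
proof -
  have "z \<in> A.U" "w \<in> A.U" using assms Q_U_subset by blast+
  then show ?thesis using assms by (simp add: Q.kcl_eq_iff A.kcl_eq_iff)
qed

text \<open>The parameter selected in \<open>ram\<close> need not be \<open>z\<close>, but it
  defines the same class, so its orders agree with those of \<open>z\<close> modulo
  \<open>p\<close>.\<close>

lemma ram_kcl: assumes z: "z \<in> A.U" shows "ram p G \<chi> n C (A.kcl z) = {x \<in> C. \<not> int p dvd fls_subdegree (z x)}"
proof -
  define P where "P t \<longleftrightarrow> t \<in> Units A.B \<and> A.kcl z = gext_class A.B G (kummer_extension p A.B (adele_const n C) \<chi> t)" for t
  have ram: "ram p G \<chi> n C (A.kcl z) = {x \<in> C. \<not> int p dvd val_at n C x ((SOME t. P t) x)}"
    unfolding ram_def Let_def A.adele_ring_B[OF refl] P_def ..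
  have "P (A.\<Phi> z)" unfolding P_def using z A.kcl_kummer[OF z] A.U_iff by simp
  from someI[of P, OF this] have P: "P (SOME t. P t)" .
  then have "(SOME t. P t) \<in> Units A.B" unfolding P_def by (rule conjunct1)
  then obtain w where w: "(SOME t. P t) = A.\<Phi> w" by (rule A.Units_B)
  have Pw: "P (A.\<Phi> w)" using P unfolding w .
  have wU: "w \<in> A.U" using Pw unfolding P_def A.U_iff by (rule conjunct1)
  have "A.kcl z = A.kcl w" using Pw unfolding P_def A.kcl_kummer[OF wU] by (rule conjunct2)
  then have d: "\<forall>x\<in>C. int p dvd fls_subdegree (z x) - fls_subdegree (w x)" using z wU by (simp add: A.kcl_eq_iff)
  have "int p dvd val_at n C x (A.\<Phi> w x) \<longleftrightarrow> int p dvd fls_subdegree (z x)" if x: "x \<in> C" for x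
  proof -
    have "w x \<noteq> 0" using wU x by (simp add: A.U_def)
    then have "val_at n C x (A.\<Phi> w x) = fls_subdegree (w x)" using x by (intro A.val_\<Phi>)
    then show ?thesis using dvd_add_right_iff[OF bspec[OF d x], of "fls_subdegree (w x)"] by simp
  qed
  then show ?thesis unfolding ram w by blast
qed

lemma F_eq: "F S = A.kcl ` {z \<in> A.U. \<forall>x\<in>C - S. int p dvd fls_subdegree (z x)}"
proof (intro equalityI subsetI)
  fix B assume "B \<in> F S"
  then have B: "B \<in> carrier A.HG" "ram p G \<chi> n C B \<subseteq> S" by (simp_all add: ram_within_def H_eq)
  obtain z where z: "z \<in> A.U" "B = A.kcl z" using B(1) unfolding A.carrier_HG by blast
  have "\<forall>x\<in>C - S. int p dvd fls_subdegree (z x)" using B(2) unfolding z(2) ram_kcl[OF z(1)] by blast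
  then show "B \<in> A.kcl ` {z \<in> A.U. \<forall>x\<in>C - S. int p dvd fls_subdegree (z x)}" using z by blast
next
  fix B assume "B \<in> A.kcl ` {z \<in> A.U. \<forall>x\<in>C - S. int p dvd fls_subdegree (z x)}"
  then obtain z where z: "z \<in> A.U" "\<forall>x\<in>C - S. int p dvd fls_subdegree (z x)" "B = A.kcl z" by blast
  then have "ram p G \<chi> n C B \<subseteq> S" using ram_kcl[OF z(1)] by auto
  moreover have "B \<in> carrier A.HG" unfolding A.carrier_HG using z by blast
  ultimately show "B \<in> F S" by (simp add: ram_within_def H_eq)
qed

text \<open>Powers of the uniformizers at the points of \<open>S\<close> and 1 elsewhere: the
  standard representatives of classes with ramification in \<open>S\<close>.\<close>

definition monom_at :: "'k ppoint set \<Rightarrow> ('k ppoint \<Rightarrow> int) \<Rightarrow> 'k ppoint \<Rightarrow> 'k fls" where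
  "monom_at S e = (\<lambda>x. if x \<in> S then fls_X_intpow (e x) else 1)"

lemma monom_at_U: "monom_at S e \<in> Q.U S"
  unfolding Q.U_def monom_at_def by auto

lemma subdegree_monom_at: "fls_subdegree (monom_at S e x) = (if x \<in> S then e x else 0)"
  by (simp add: monom_at_def)

text \<open>The exponents are the orders reduced modulo \<open>p\<close>. Outside \<open>S\<close>
  the orders are multiples of \<open>p\<close>, so the value 1 represents the same class
  there.\<close>

lemma F_monom_at: assumes "finite S" "B \<in> F S"
  shows "\<exists>e \<in> S \<rightarrow>\<^sub>E {..<p}. B = A.kcl (monom_at S (\<lambda>x. int (e x)))"
proof -
  obtain z where z: "z \<in> A.U" "\<forall>x\<in>C - S. int p dvd fls_subdegree (z x)" "B = A.kcl z"
    using assms(2) unfolding F_eq by blast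
  let ?e = "\<lambda>x\<in>S. nat (fls_subdegree (z x) mod int p)"
  have e: "?e \<in> S \<rightarrow>\<^sub>E {..<p}" using p_pos by (auto simp: nat_less_iff)
  have "monom_at S (\<lambda>x. int (?e x)) \<in> A.U" using monom_at_U Q_U_subset[OF assms(1)] by blast
  moreover have "int p dvd fls_subdegree (z x) - fls_subdegree (monom_at S (\<lambda>x. int (?e x)) x)" if "x \<in> C" for x
    using z(2) that p_pos by (cases "x \<in> S") (auto simp: subdegree_monom_at)
  ultimately have "A.kcl z = A.kcl (monom_at S (\<lambda>x. int (?e x)))" using z(1) by (simp add: A.kcl_eq_iff del: restrict_apply)
  then show ?thesis using e z(3) by blast
qed

text \<open>Divisibility of the orders by \<open>p\<close> outside \<open>S\<close> can be improved
  to order 0 by changing the representative, which then is a unit of the smaller ring.\<close>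

lemma F_Q: assumes "finite S" shows "F S = A.kcl ` Q.U S"
proof (intro equalityI subsetI)
  fix B assume "B \<in> F S"
  then show "B \<in> A.kcl ` Q.U S" using F_monom_at[OF assms] monom_at_U by blast
next
  fix B assume "B \<in> A.kcl ` Q.U S"
  then obtain z where z: "z \<in> Q.U S" "B = A.kcl z" by blast
  have "fls_subdegree (z x) = 0" if "x \<in> C - S" for x using z(1) that unfolding Q.U_def by blast
  moreover have "z \<in> A.U" using z(1) Q_U_subset[OF assms] by blast
  ultimately show "B \<in> F S" unfolding F_eq z(2) by (intro imageI) simp
qed

text \<open>There are \<open>p\<close> choices of exponent at each point of \<open>S\<close>.
  Different exponents below \<open>p\<close> are incongruent, and each point of \<open>S\<close>
  lies on the curve, so the classes detect them.\<close>

lemma card_F: assumes S: "finite S" "S \<subseteq> C" shows "card (F S) = p ^ card S"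
proof -
  let ?h = "\<lambda>e. A.kcl (monom_at S (\<lambda>x. int (e x)))"
  have mU: "monom_at S e \<in> A.U" for e using monom_at_U Q_U_subset[OF S(1)] by blast
  have "bij_betw ?h (S \<rightarrow>\<^sub>E {..<p}) (F S)"
  proof (rule bij_betw_imageI)
    show "inj_on ?h (S \<rightarrow>\<^sub>E {..<p})"
    proof (rule inj_onI)
      fix e e' assume e: "e \<in> S \<rightarrow>\<^sub>E {..<p}" "e' \<in> S \<rightarrow>\<^sub>E {..<p}" and eq: "?h e = ?h e'"
      show "e = e'"
      proof (rule PiE_ext[OF e])
        fix x assume x: "x \<in> S"
        then have "x \<in> C" using S(2) by blast
        from bspec[OF eq[unfolded A.kcl_eq_iff[OF mU mU]] this] have "int p dvd int (e x) - int (e' x)"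
          using x by (simp add: subdegree_monom_at)
        then have "int (e x) mod int p = int (e' x) mod int p" by (simp add: mod_eq_dvd_iff)
        moreover have "e x < p" "e' x < p" using e x by auto
        ultimately show "e x = e' x" by simp
      qed
    qed
    show "?h ` (S \<rightarrow>\<^sub>E {..<p}) = F S"
    proof (intro equalityI subsetI)
      fix B assume "B \<in> F S" then show "B \<in> ?h ` (S \<rightarrow>\<^sub>E {..<p})" using F_monom_at[OF S(1)] by blast
    next
      fix B assume "B \<in> ?h ` (S \<rightarrow>\<^sub>E {..<p})"
      then show "B \<in> F S" unfolding F_Q[OF S(1)] using monom_at_U by blast
    qed
  qed
  then have "card (F S) = card (S \<rightarrow>\<^sub>E {..<p})" by (simp add: bij_betw_same_card)
  also have "\<dots> = p ^ card S" using S(1) by (simp add: card_PiE)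
  finally show ?thesis .
qed

lemma comm_group_H: "comm_group H"
  unfolding H_eq by (rule A.KR.comm_group_hgroup)

text \<open>Orders add under multiplication and change sign under inversion, so divisibility by
  \<open>p\<close> outside \<open>S\<close> is preserved.\<close>

lemma subgroup_F: "subgroup (F S) H"
proof -
  interpret H: comm_group A.HG by (rule A.KR.comm_group_hgroup)
  let ?V = "{z \<in> A.U. \<forall>x\<in>C - S. int p dvd fls_subdegree (z x)}"
  show ?thesis
    unfolding H_eq
  proof (rule H.subgroupI)
    show "F S \<subseteq> carrier A.HG" unfolding F_eq A.carrier_HG by blast
    show "F S \<noteq> {}" unfolding F_eq using A.U_one by auto
    fix a assume "a \<in> F S"
    then obtain z where z: "z \<in> A.U" "\<forall>x\<in>C - S. int p dvd fls_subdegree (z x)" "a = A.kcl z"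
      unfolding F_eq by blast
    have nz: "z x \<noteq> 0" if "x \<in> C" for x using z(1) that by (simp add: A.U_def)
    have inv: "fls_subdegree (inverse (z x)) = - fls_subdegree (z x)" for x by (rule fls_inverse_subdegree)
    have "(\<lambda>x. inverse (z x)) \<in> ?V" using z unfolding A.U_def by (auto simp: inv)
    then have b: "A.kcl (\<lambda>x. inverse (z x)) \<in> F S" "(\<lambda>x. inverse (z x)) \<in> A.U" unfolding F_eq by blast+
    have one: "(\<lambda>x. inverse (z x) * z x) \<in> A.U" using A.U_mult[OF b(2) z(1)] .
    have "A.kcl (\<lambda>x. inverse (z x)) \<otimes>\<^bsub>A.HG\<^esub> a = A.kcl (\<lambda>x. inverse (z x) * z x)"
      unfolding z(3) by (rule A.HG_mult[OF b(2) z(1)])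
    also have "\<dots> = \<one>\<^bsub>A.HG\<^esub>" unfolding A.HG_one using one A.U_one nz by (simp add: A.kcl_eq_iff)
    finally have "inv\<^bsub>A.HG\<^esub> a = A.kcl (\<lambda>x. inverse (z x))"
      using b z by (intro H.inv_equality) (auto simp: A.carrier_HG)
    then show "inv\<^bsub>A.HG\<^esub> a \<in> F S" using b by simp
    fix a' assume "a' \<in> F S"
    then obtain w where w: "w \<in> A.U" "\<forall>x\<in>C - S. int p dvd fls_subdegree (w x)" "a' = A.kcl w"
      unfolding F_eq by blast
    have "w x \<noteq> 0" if "x \<in> C" for x using w(1) that by (simp add: A.U_def)
    then have "(\<lambda>x. z x * w x) \<in> ?V" using A.U_mult[OF z(1) w(1)] z(2) w(2) nz by simp
    then show "a \<otimes>\<^bsub>A.HG\<^esub> a' \<in> F S" unfolding F_eq z(3) w(3) A.HG_mult[OF z(1) w(1)] by blast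
  qed
qed

lemma F_mono: "S \<subseteq> S' \<Longrightarrow> F S \<subseteq> F S'"
  unfolding ram_within_def by blast

lemma system_HS: "direct_system I HS tr"
  unfolding direct_system_def
proof (intro conjI ballI impI)
  show "comm_group (HS S)" for S unfolding HS_eq by (rule Q.KR.comm_group_hgroup)
  show "tr S S' \<in> hom (HS S) (HS S')" if "S \<subseteq> S'" for S S'
  proof (rule homI)
    fix a assume "a \<in> carrier (HS S)"
    then obtain z where z: "z \<in> Q.U S" "a = Q.kcl S z" unfolding HS_eq Q.carrier_HG by blast
    then show "tr S S' a \<in> carrier (HS S')"
      unfolding z(2) tr_kcl[OF that z(1)] HS_eq Q.carrier_HG using Q_U_mono[OF that] by blast
    fix b assume "b \<in> carrier (HS S)"
    then obtain w where w: "w \<in> Q.U S" "b = Q.kcl S w" unfolding HS_eq Q.carrier_HG by blast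
    have "z \<in> Q.U S'" "w \<in> Q.U S'" using z w Q_U_mono[OF that] by blast+
    then show "tr S S' (a \<otimes>\<^bsub>HS S\<^esub> b) = tr S S' a \<otimes>\<^bsub>HS S'\<^esub> tr S S' b"
      unfolding z(2) w(2) HS_eq Q.HG_mult[OF z(1) w(1)] tr_kcl[OF that z(1)] tr_kcl[OF that w(1)]
        tr_kcl[OF that Q.U_mult[OF z(1) w(1)]] by (simp add: Q.HG_mult)
  qed
  show "tr S S a = a" if "a \<in> carrier (HS S)" for S a
  proof -
    obtain z where z: "z \<in> Q.U S" "a = Q.kcl S z" using \<open>a \<in> carrier (HS S)\<close> unfolding HS_eq Q.carrier_HG by blast
    show ?thesis unfolding z(2) by (rule tr_kcl[OF subset_refl z(1)])
  qed
  show "tr S' S'' (tr S S' a) = tr S S'' a"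
    if sub: "S \<subseteq> S' \<and> S' \<subseteq> S''" and a: "a \<in> carrier (HS S)" for S S' S'' a
  proof -
    obtain z where z: "z \<in> Q.U S" "a = Q.kcl S z" using a unfolding HS_eq Q.carrier_HG by blast
    have s: "S \<subseteq> S'" "S' \<subseteq> S''" "S \<subseteq> S''" using sub by auto
    have z': "z \<in> Q.U S'" using z(1) Q_U_mono[OF s(1)] by blast
    show ?thesis unfolding z(2) tr_kcl[OF s(1) z(1)] tr_kcl[OF s(2) z'] tr_kcl[OF s(3) z(1)] ..
  qed
qed

lemma directed_I: "S \<in> I \<Longrightarrow> S' \<in> I \<Longrightarrow> \<exists>S''\<in>I. S \<subseteq> S'' \<and> S' \<subseteq> S''"
  by (rule bexI[of _ "S \<union> S'"]) auto

sublocale D1: directed_system I HS tr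
  by (rule directed_system.intro[OF system_HS directed_I])

lemma system_HF: "direct_system I HF incl"
  unfolding direct_system_def
proof (intro conjI ballI impI)
  interpret H: comm_group H by (rule comm_group_H)
  show "comm_group (HF S)" for S
  proof -
    have "group (HF S)" by (rule subgroup.subgroup_is_group[OF subgroup_F H.group_axioms])
    then show ?thesis
      by (rule group.group_comm_groupI) (auto intro!: H.m_comm dest: subgroup.mem_carrier[OF subgroup_F])
  qed
  show "incl S S' \<in> hom (HF S) (HF S')" if "S \<subseteq> S'" for S S'
    by (rule homI) (use F_mono[OF that] in auto)
qed auto

sublocale D2: directed_system I HF incl
  by (rule directed_system.intro[OF system_HF directed_I])

lemma bc_tr: assumes "S \<in> I" "S' \<in> I" "S \<subseteq> S'" "a \<in> carrier (HS S)" shows "bc S' (tr S S' a) = bc S a"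
proof -
  obtain z where z: "z \<in> Q.U S" "a = Q.kcl S z" using assms(4) unfolding HS_eq Q.carrier_HG by blast
  have fin: "finite S" "finite S'" using assms by auto
  have z': "z \<in> Q.U S'" using z(1) Q_U_mono[OF assms(3)] by blast
  show ?thesis unfolding z(2) tr_kcl[OF assms(3) z(1)] bc_kcl[OF fin(1) z(1)] bc_kcl[OF fin(2) z'] ..
qed

lemma bc_image: assumes "S \<in> I" shows "bc S ` carrier (HS S) = F S"
proof -
  have fin: "finite S" using assms by simp
  show ?thesis unfolding HS_eq Q.carrier_HG F_Q[OF fin] image_image
    by (rule image_cong[OF refl]) (rule bc_kcl[OF fin])
qed

lemma bc_mult: assumes "S \<in> I" "a \<in> carrier (HS S)" "b \<in> carrier (HS S)"
  shows "bc S (a \<otimes>\<^bsub>HS S\<^esub> b) = bc S a \<otimes>\<^bsub>H\<^esub> bc S b"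
proof -
  have fin: "finite S" using assms by simp
  obtain z where z: "z \<in> Q.U S" "a = Q.kcl S z" using assms(2) unfolding HS_eq Q.carrier_HG by blast
  obtain w where w: "w \<in> Q.U S" "b = Q.kcl S w" using assms(3) unfolding HS_eq Q.carrier_HG by blast
  have U: "z \<in> A.U" "w \<in> A.U" using z w Q_U_subset[OF fin] by blast+
  show ?thesis unfolding z(2) w(2) HS_eq H_eq Q.HG_mult[OF z(1) w(1)] bc_kcl[OF fin z(1)] bc_kcl[OF fin w(1)]
      bc_kcl[OF fin Q.U_mult[OF z(1) w(1)]] A.HG_mult[OF U] ..
qed

lemma bc_inj: assumes "S \<in> I" shows "inj_on (bc S) (carrier (HS S))"
proof (rule inj_onI)
  have fin: "finite S" using assms by simp
  fix a b assume "a \<in> carrier (HS S)" "b \<in> carrier (HS S)" and e: "bc S a = bc S b"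
  then obtain z w where z: "z \<in> Q.U S" "a = Q.kcl S z" and w: "w \<in> Q.U S" "b = Q.kcl S w"
    unfolding HS_eq Q.carrier_HG by blast
  have "A.kcl z = A.kcl w" using e unfolding z(2) w(2) bc_kcl[OF fin z(1)] bc_kcl[OF fin w(1)] .
  then show "a = b" unfolding z(2) w(2) kcl_eq_iff'[OF fin z(1) w(1)] .
qed

lemma F_carrier: "F S \<subseteq> carrier H"
  unfolding ram_within_def by blast

lemma F_cover: assumes "B \<in> carrier H" shows "\<exists>S\<in>I. B \<in> F S"
proof -
  obtain z where z: "z \<in> A.U" "B = A.kcl z" using assms unfolding H_eq A.carrier_HG by blast
  let ?S = "{x \<in> C. fls_subdegree (z x) \<noteq> 0}"
  have "?S \<in> I" using z(1) unfolding A.U_def by auto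
  moreover have "B \<in> F ?S" unfolding F_eq z(2) using z(1) by (intro imageI) auto
  ultimately show ?thesis by blast
qed

lemma bc_F: assumes "S \<in> I" "a \<in> carrier (HS S)" shows "bc S a \<in> carrier (HF S)"
  using imageI[OF assms(2), of "bc S"] unfolding bc_image[OF assms(1)] by simp

text \<open>Each level embeds into the full group with image \<open>F S\<close>, and every class
  lies in some \<open>F S\<close>, since a unit adele has nonzero order at finitely many points
  only.\<close>

lemma iso_L1_H: "dlim_desc bc \<in> iso D1.L H"
proof (rule D1.desc_iso)
  show "bc S \<in> hom (HS S) H" if "S \<in> I" for S
  proof (rule homI)
    fix a b assume a: "a \<in> carrier (HS S)" and b: "b \<in> carrier (HS S)"
    show "bc S a \<in> carrier H" using bc_F[OF that a] F_carrier[of S] by auto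
    show "bc S (a \<otimes>\<^bsub>HS S\<^esub> b) = bc S a \<otimes>\<^bsub>H\<^esub> bc S b" by (rule bc_mult[OF that a b])
  qed
  show "\<exists>S\<in>I. \<exists>a\<in>carrier (HS S). B = bc S a" if B: "B \<in> carrier H" for B
  proof -
    obtain S where "S \<in> I" "B \<in> F S" using F_cover[OF B] by blast
    then have "B \<in> bc S ` carrier (HS S)" using bc_image[OF \<open>S \<in> I\<close>] by simp
    then show ?thesis using \<open>S \<in> I\<close> by blast
  qed
qed (rule bc_tr bc_inj; assumption)+

lemma iso_L2_H: "dlim_desc (\<lambda>S B. B) \<in> iso D2.L H"
proof (rule D2.desc_iso)
  show "(\<lambda>B. B) \<in> hom (HF S) H" for S
    by (rule homI) (use F_carrier in auto)
  show "\<exists>S\<in>I. \<exists>a\<in>carrier (HF S). B = a" if "B \<in> carrier H" for B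
    using F_cover[OF that] by simp
qed (auto simp: inj_on_def)

text \<open>Each level of the first system is carried bijectively onto the corresponding level of
  the second, so the criterion \<open>desc_iso\<close> applies directly and gives the explicit map
  of the statement.\<close>

lemma iso_L1_L2: "dlim_desc (\<lambda>S B. D2.cl S (bc S B)) \<in> iso D1.L D2.L"
proof (rule D1.desc_iso)
  fix S S' a assume S: "S \<in> I" "S' \<in> I" "S \<subseteq> S'" "a \<in> carrier (HS S)"
  have b: "bc S a \<in> carrier (HF S)" using S by (intro bc_F)
  then have b': "bc S a \<in> carrier (HF S')" using F_mono[OF S(3)] by auto
  show "D2.cl S' (bc S' (tr S S' a)) = D2.cl S (bc S a)"
    unfolding bc_tr[OF S] D2.cl_eq_iff[OF S(2) b' S(1) b] D2.rel_iff using S b b' by blast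
next
  fix S assume S: "S \<in> I"
  show "(\<lambda>B. D2.cl S (bc S B)) \<in> hom (HS S) D2.L"
  proof (rule homI)
    fix a b assume ab: "a \<in> carrier (HS S)" "b \<in> carrier (HS S)"
    have "D2.cl S (bc S a) \<otimes>\<^bsub>D2.L\<^esub> D2.cl S (bc S b) = D2.cl S (bc S a \<otimes>\<^bsub>HF S\<^esub> bc S b)"
      using S ab by (intro D2.mult_cl bc_F) auto
    then show "D2.cl S (bc S (a \<otimes>\<^bsub>HS S\<^esub> b)) = D2.cl S (bc S a) \<otimes>\<^bsub>D2.L\<^esub> D2.cl S (bc S b)"
      using bc_mult[OF S ab] by simp
  qed (intro D2.cl_closed bc_F S)
  show "inj_on (\<lambda>B. D2.cl S (bc S B)) (carrier (HS S))"
  proof (rule inj_onI)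
    fix a b assume ab: "a \<in> carrier (HS S)" "b \<in> carrier (HS S)" and e: "D2.cl S (bc S a) = D2.cl S (bc S b)"
    have "bc S a = bc S b"
      using e unfolding D2.cl_eq_iff[OF S bc_F[OF S ab(1)] S bc_F[OF S ab(2)]] D2.rel_iff by blast
    then show "a = b" by (rule inj_onD[OF bc_inj[OF S] _ ab])
  qed
next
  fix y assume "y \<in> carrier D2.L"
  then obtain S b where S: "S \<in> I" "b \<in> carrier (HF S)" "y = D2.cl S b" unfolding D2.carrier_L by blast
  then have "b \<in> bc S ` carrier (HS S)" using bc_image[OF S(1)] by simp
  then show "\<exists>S\<in>I. \<exists>a\<in>carrier (HS S). y = D2.cl S (bc S a)" using S by blast
qed

end

theorem corollary3p18:
  fixes C :: "'k::alg_closed_field ppoint set" and n p :: nat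
    and G :: "'g monoid" and \<chi> :: "'g \<Rightarrow> 'k"
  assumes "Factorial_Ring.prime p" and "CHAR('k) \<noteq> p"
    and "smooth_projective_curve n C"
    and "group G" and "cyclic_group G" and "Coset.order G = p"
    and "\<chi> \<in> characters p G" and "\<exists>g\<in>carrier G. \<chi> g \<noteq> 1"
  shows
    "let I = {S. finite S \<and> S \<subseteq> C};
         H = adele_harrison p G n C;
         F = ram_within p G \<chi> n C;
         HS = adele_harrison_at p G n C;
         tr = (\<lambda>S S'. harrison_map G (adele_ring_at n C S) (adele_ring_at n C S') (\<lambda>\<alpha>. \<alpha>));
         bc = (\<lambda>S. harrison_map G (adele_ring_at n C S) (adele_ring n C) (\<lambda>\<alpha>. \<alpha>));
         HF = (\<lambda>S. H\<lparr>carrier := F S\<rparr>);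
         incl = (\<lambda>S S' B. B);
         L1 = direct_limit I HS tr;
         L2 = direct_limit I HF incl
     in comm_group H \<and>
        (\<forall>S\<in>I. subgroup (F S) H) \<and>
        (\<forall>S\<in>I. \<forall>S'\<in>I. S \<subseteq> S' \<longrightarrow> F S \<subseteq> F S') \<and>
        direct_system I HS tr \<and>
        direct_system I HF incl \<and>
        dlim_desc bc \<in> iso L1 H \<and>
        dlim_desc (\<lambda>S B. dlim_rel I HF incl `` {(S, bc S B)}) \<in> iso L1 L2 \<and>
        dlim_desc (\<lambda>S B. B) \<in> iso L2 H \<and>
        (\<forall>S\<in>I. card (F S) = p ^ card S)"
proof -
  have "\<forall>x\<in>C. \<exists>\<theta>. power_series_ring (A_at n C x) \<theta> \<and> (\<forall>a. \<theta> (fps_const a) =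
    (\<lambda>i. ideal_power (local_ring n C x) (nonunits (local_ring n C x)) i +>\<^bsub>local_ring n C x\<^esub> const_germ n C x a))"
    using smooth_curve_power_series[OF assms(3)] by blast
  \<comment> \<open>One isomorphism with a power series ring is fixed at every point; all adele
    rings are then described through the same choice.\<close>
  from bchoice[OF this] obtain \<theta> where \<theta>: "\<forall>x\<in>C. power_series_ring (A_at n C x) (\<theta> x) \<and> (\<forall>a. \<theta> x (fps_const a) =
    (\<lambda>i. ideal_power (local_ring n C x) (nonunits (local_ring n C x)) i +>\<^bsub>local_ring n C x\<^esub> const_germ n C x a))"
    by blast
  interpret curve_adeles G p \<chi> n C \<theta>
  proof (intro curve_adeles.intro curve_adeles_axioms.intro prime_character.intro assms)
    show "C \<noteq> {}" using assms(3) unfolding smooth_projective_curve_def irreducible_set_def by blast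
  qed (use \<theta> in blast)+
  show ?thesis
    unfolding Let_def
    using comm_group_H subgroup_F F_mono system_HS system_HF iso_L1_H iso_L1_L2[unfolded D2.cl_def] iso_L2_H card_F
    by simp
qed

end
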